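(* Let $V$ be a finite set, let $f: 2^V\rightarrow \mathbb{Z}_{\ge 0}$ be an integer-valued normalized supermodular function and let $\rho$ be a rational number. Then there exists a normalized non-decreasing submodular function $h:2^V\rightarrow\mathbb{R}_{\geq 0}$ such that (1) if $\rho$ is an integer, then $h$ is integer-valued; (2) for every $F\subseteq V$, we have $\lambda^*_{f|_{V-F}} \leq \rho$ if and only if $h(F)\ge h(V)$; (3) $h(\{v\}) \leq \max\{0, f(v\,|\,V - v) - \rho\}$ for all $v \in V$; and (4) evaluation queries for the function $h$ (given $S\subseteq V$, return $h(S)$) can be answered in polynomial time by making a polynomial number of evaluation queries to the function $f$.
   Context: For a finite set $V$, a set function $f:2^V\to\mathbb{R}$ is submodular if $f(A)+f(B)\ge f(A\cap B)+f(A\cup B)$ for all $A,B\subseteq V$; supermodular if $-f$ is submodular; non-decreasing if $f(A)\le f(B)$ whenever $A\subseteq B\subseteq V$; normalized if $f(\emptyset)=0$. The marginal of $v\in V$ with respect to $S\subseteq V$ is $f(v\,|\,S):=f(S\cup\{v\})-f(S)$, and $V-v:=V\setminus\{v\}$. For $F\subseteq V$, $f|_{V-F}$ is the restriction of $f$ to subsets of $V\setminus F$. The density of a set function $f$ on ground set $V$ is $\lambda^*_f:=\max\{f(S)/|S| : \emptyset\ne S\subseteq V\}$; for an empty ground set the condition $\lambda^*_f\le\rho$ is considered to hold. An evaluation oracle for $f$ takes $S\subseteq V$ and returns $f(S)$. *)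

theory Defs
  imports Complex_Main "HOL-Library.Log_Nat" "HOL-Computational_Algebra.Polynomial"
begin

section \<open>Set functions\<close>

text \<open>
  A set function on a finite ground set V is a HOL function on sets of which only the values
  on subsets of V matter. Restricting it to V - F therefore just means replacing the ground
  set by V - F. ``Non-decreasing'' is the library's \<^term>\<open>mono_on (Pow V) f\<close>.
\<close>

definition submodular_on :: "'a set \<Rightarrow> ('a set \<Rightarrow> 'b::ordered_ab_group_add) \<Rightarrow> bool" where
  "submodular_on V f \<longleftrightarrow> (\<forall>A B. A \<subseteq> V \<longrightarrow> B \<subseteq> V \<longrightarrow> f A + f B \<ge> f (A \<inter> B) + f (A \<union> B))"

definition supermodular_on :: "'a set \<Rightarrow> ('a set \<Rightarrow> 'b::ordered_ab_group_add) \<Rightarrow> bool" where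
  "supermodular_on V f \<longleftrightarrow> submodular_on V (\<lambda>S. - f S)"

definition normalized :: "('a set \<Rightarrow> 'b::zero) \<Rightarrow> bool" where
  "normalized f \<longleftrightarrow> f {} = 0"

definition marginal :: "('a set \<Rightarrow> 'b::ab_group_add) \<Rightarrow> 'a \<Rightarrow> 'a set \<Rightarrow> 'b" where
  "marginal f v S = f (S \<union> {v}) - f S"

definition density :: "'a set \<Rightarrow> ('a set \<Rightarrow> real) \<Rightarrow> real" where
  "density V f = Max {f S / real (card S) | S. S \<noteq> {} \<and> S \<subseteq> V}"

definition density_le :: "'a set \<Rightarrow> ('a set \<Rightarrow> real) \<Rightarrow> real \<Rightarrow> bool" where
  "density_le V f r \<longleftrightarrow> V = {} \<or> density V f \<le> r"


section \<open>A machine model with an evaluation oracle\<close>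

text \<open>
  Programs of a random access machine with structured control flow, whose memory consists of
  named integer arrays (only finitely many names occur in a program). Time is measured by the
  logarithmic cost criterion: every operation is charged the bit lengths of its operands, of
  the addresses it uses and of the integers it reads or writes. Up to polynomials this is Turing
  machine time. The oracle is only accessible through the command Query.
\<close>

type_synonym vname = string
type_synonym state = "vname \<Rightarrow> int \<Rightarrow> int"

datatype aexp =
    Const int
  | Read vname aexp
  | Add aexp aexp
  | Sub aexp aexp
  | Mul aexp aexp
  | Div aexp aexp

datatype bexp =
    Less aexp aexp
  | Neg bexp
  | Conj bexp bexp

datatype com =
    Skip
  | Write vname aexp aexp
  | Seq com com
  | Cond bexp com com
  | While bexp com
  | Query vname vname

text \<open>Number of bits of an integer, including one for the sign.\<close>

definition bits :: "int \<Rightarrow> nat" where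
  "bits i = 1 + floorlog 2 (nat \<bar>i\<bar>)"

primrec aval :: "aexp \<Rightarrow> state \<Rightarrow> int" where
  "aval (Const k) s = k"
| "aval (Read x a) s = s x (aval a s)"
| "aval (Add a b) s = aval a s + aval b s"
| "aval (Sub a b) s = aval a s - aval b s"
| "aval (Mul a b) s = aval a s * aval b s"
| "aval (Div a b) s = aval a s div aval b s"

primrec acost :: "aexp \<Rightarrow> state \<Rightarrow> nat" where
  "acost (Const k) s = bits k"
| "acost (Read x a) s = acost a s + bits (aval a s) + bits (s x (aval a s))"
| "acost (Add a b) s = acost a s + acost b s + bits (aval a s) + bits (aval b s)"
| "acost (Sub a b) s = acost a s + acost b s + bits (aval a s) + bits (aval b s)"
| "acost (Mul a b) s = acost a s + acost b s + bits (aval a s) + bits (aval b s)"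
| "acost (Div a b) s = acost a s + acost b s + bits (aval a s) + bits (aval b s)"

primrec bval :: "bexp \<Rightarrow> state \<Rightarrow> bool" where
  "bval (Less a b) s \<longleftrightarrow> aval a s < aval b s"
| "bval (Neg b) s \<longleftrightarrow> \<not> bval b s"
| "bval (Conj b c) s \<longleftrightarrow> bval b s \<and> bval c s"

primrec bcost :: "bexp \<Rightarrow> state \<Rightarrow> nat" where
  "bcost (Less a b) s = acost a s + acost b s + bits (aval a s) + bits (aval b s)"
| "bcost (Neg b) s = bcost b s + 1"
| "bcost (Conj b c) s = bcost b s + bcost c s + 1"

text \<open>
  \<open>exec n orc c s t k s'\<close>: started in \<open>s\<close>, program \<open>c\<close> halts in \<open>s'\<close> after time \<open>t\<close> and
  \<open>k\<close> oracle queries. The oracle \<open>orc\<close> is defined on subsets of {0..<n}; \<open>Query x y\<close> passes it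
  the set whose characteristic vector is stored in the first n cells of array \<open>y\<close> and stores
  the answer in cell 0 of array \<open>x\<close>, at a cost accounting for reading the n entries and writing
  the answer.
\<close>

definition decode_set :: "nat \<Rightarrow> (int \<Rightarrow> int) \<Rightarrow> nat set" where
  "decode_set n a = {i. i < n \<and> a (int i) \<noteq> 0}"

inductive exec :: "nat \<Rightarrow> (nat set \<Rightarrow> int) \<Rightarrow> com \<Rightarrow> state \<Rightarrow> nat \<Rightarrow> nat \<Rightarrow> state \<Rightarrow> bool"
  for n :: nat and orc :: "nat set \<Rightarrow> int" where
  Skip: "exec n orc Skip s 1 0 s"
| Write: "exec n orc (Write x a b) s
      (acost a s + acost b s + bits (aval a s) + bits (aval b s)) 0
      (s(x := (s x)(aval a s := aval b s)))"
| Seq: "exec n orc c1 s1 t1 k1 s2 \<Longrightarrow> exec n orc c2 s2 t2 k2 s3 \<Longrightarrow>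
      exec n orc (Seq c1 c2) s1 (t1 + t2) (k1 + k2) s3"
| CondTrue: "bval b s \<Longrightarrow> exec n orc c1 s t k s' \<Longrightarrow>
      exec n orc (Cond b c1 c2) s (bcost b s + t) k s'"
| CondFalse: "\<not> bval b s \<Longrightarrow> exec n orc c2 s t k s' \<Longrightarrow>
      exec n orc (Cond b c1 c2) s (bcost b s + t) k s'"
| WhileFalse: "\<not> bval b s \<Longrightarrow> exec n orc (While b c) s (bcost b s) 0 s"
| WhileTrue: "bval b s1 \<Longrightarrow> exec n orc c s1 t1 k1 s2 \<Longrightarrow>
      exec n orc (While b c) s2 t2 k2 s3 \<Longrightarrow>
      exec n orc (While b c) s1 (bcost b s1 + t1 + t2) (k1 + k2) s3"
| Query: "exec n orc (Query x y) s (1 + n + bits (orc (decode_set n (s y)))) 1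
      (s(x := (s x)(0 := orc (decode_set n (s y)))))"


section \<open>Answering evaluation queries in polynomial time\<close>

text \<open>
  The ground set is presented to the machine by an enumeration \<open>xs\<close>: element \<open>xs ! i\<close> is
  represented by its index i. The input consists of \<open>|V|\<close>, numerator and denominator of \<open>\<rho>\<close>,
  and the characteristic vector of the set \<open>S\<close> at which \<open>h\<close> is to be evaluated.
\<close>

definition input_state :: "'a list \<Rightarrow> rat \<Rightarrow> 'a set \<Rightarrow> state" where
  "input_state xs \<rho> S = (\<lambda>x i.
     if x = ''n'' \<and> i = 0 then int (length xs)
     else if x = ''rho_num'' \<and> i = 0 then fst (quotient_of \<rho>)
     else if x = ''rho_den'' \<and> i = 0 then snd (quotient_of \<rho>)
     else if x = ''S'' \<and> 0 \<le> i \<and> i < int (length xs) \<and> xs ! nat i \<in> S then 1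
     else 0)"

definition eval_oracle :: "('a set \<Rightarrow> int) \<Rightarrow> 'a list \<Rightarrow> nat set \<Rightarrow> int" where
  "eval_oracle f xs I = f ((\<lambda>i. xs ! i) ` I)"

text \<open>The values of \<open>h\<close> are returned exactly, as a fraction of integers.\<close>

definition outputs :: "state \<Rightarrow> real \<Rightarrow> bool" where
  "outputs s r \<longleftrightarrow> s ''out_den'' 0 > 0 \<and> r = of_int (s ''out_num'' 0) / of_int (s ''out_den'' 0)"

text \<open>As usual in the oracle model, the bit lengths of the oracle's answers count as input.\<close>

definition input_size :: "'a set \<Rightarrow> ('a set \<Rightarrow> int) \<Rightarrow> rat \<Rightarrow> nat" where
  "input_size V f \<rho> = card V + bits (fst (quotient_of \<rho>)) + bits (snd (quotient_of \<rho>))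
     + Max ((\<lambda>S. bits (f S)) ` Pow V)"

text \<open>
  Program \<open>c\<close> answers the evaluation queries for \<open>h\<close> using evaluation queries for \<open>f\<close>: the number
  of queries is bounded by the polynomial \<open>q\<close> in \<open>|V|\<close>, the time by the polynomial \<open>p\<close> in the
  input size. For this to mean ``polynomial'', \<open>c\<close>, \<open>p\<close> and \<open>q\<close> must not depend on the instance
  V, f, \<open>\<rho>\<close>.
\<close>

definition answers_evaluation_queries ::
    "com \<Rightarrow> nat poly \<Rightarrow> nat poly \<Rightarrow> 'a set \<Rightarrow> ('a set \<Rightarrow> int) \<Rightarrow> rat \<Rightarrow> ('a set \<Rightarrow> real) \<Rightarrow> bool" where
  "answers_evaluation_queries c p q V f \<rho> h \<longleftrightarrow>
     (\<forall>xs S. distinct xs \<longrightarrow> set xs = V \<longrightarrow> S \<subseteq> V \<longrightarrow>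
        (\<exists>t k s. exec (length xs) (eval_oracle f xs) c (input_state xs \<rho> S) t k s \<and>
           outputs s (h S) \<and>
           t \<le> poly p (input_size V f \<rho>) \<and>
           k \<le> poly q (card V)))"

end

theory Submission
  imports Defs "Jordan_Normal_Form.Determinant"
begin

text \<open>For \<open>T \<subseteq> V\<close> let \<open>m(T)\<close> be the maximum of \<open>f(X) - \<rho> \<bar>X\<bar>\<close> over \<open>X \<subseteq> T\<close>, so that the density of
  \<open>f\<close> on \<open>T\<close> is at most \<open>\<rho>\<close> iff \<open>m(T) = 0\<close>. The function \<open>m\<close> is non-decreasing and supermodular,
  hence \<open>h(S) = m(V) - m(V - S)\<close> has the properties (1) to (3).

  Evaluating \<open>h\<close> amounts to two submodular minimizations, done by a push-relabel variant of
  Schrijver's algorithm: a vector \<open>x\<close> of the base polytope is kept as a combination of greedy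
  vectors of linear orders, together with labels \<open>d\<close> that increase by at most one along every
  order and vanish where \<open>x\<close> is positive. As long as some \<open>t\<close> has \<open>x(t) < 0\<close> and \<open>d(t) < m\<close>, one of
  largest label is either relabelled or raised by an exchange that moves elements of its label
  forward in an order with the largest value of \<open>\<Sum>p. p * d(\<pi>(p))\<close>. A lexicographic measure
  bounds the number of such steps polynomially, and in the end a level set of \<open>d\<close> is a minimizer.

  The orders with positive coefficient are kept inside a basis of integer columns by simplex pivots
  (the initial unit vectors play the role of slack columns). The inverse is stored as adjugate and
  determinant, whose entries are minors, and coefficients are scaled to be integral, so that
  all numbers have polynomially many bits.\<close>

section \<open>Cost bounds for commands\<close>

text \<open>The number of queries has to be polynomial in the size of the ground set alone, while
  the time may depend on bit lengths. Hence the number of rounds is controlled by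
  \<open>progress\<close>, which looks at signs, labels and orders but never at magnitudes. The
  obstacle is the size of the numbers: coefficients that are recombined in every round could double
  their bit length each time. Since only the signs of \<open>x\<close> matter, a common positive
  factor is harmless, so scaling replaces every division except the exact one in a pivot. The new
  coefficients are linear in the old ones, with factors that come from a single order and from
  minors of the current basis; as the size of these factors does not depend on the history,
  exponents of \<open>U\<close> add up over the rounds instead of multiplying.\<close>

lemma abs_less_pow_floorlog: "nat \<bar>a\<bar> < 2 ^ floorlog 2 (nat \<bar>a\<bar>)"
  using floorlog_le_iff[of 2 "nat \<bar>a\<bar>" "floorlog 2 (nat \<bar>a\<bar>)"] by simp

lemma bits_leI: "\<bar>a\<bar> < 2 ^ k \<Longrightarrow> bits a \<le> Suc k"
  using floorlog_le_iff[of 2 "nat \<bar>a\<bar>" k] by (simp add: bits_def nat_less_iff)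

lemma abs_less_pow_bits: "\<bar>a\<bar> < 2 ^ (bits a - 1)"
  using abs_less_pow_floorlog[of a] by (simp add: bits_def nat_less_iff)

lemma bits_pos: "bits a > 0"
  by (simp add: bits_def)

lemma bits_mono: "\<bar>a\<bar> \<le> \<bar>b\<bar> \<Longrightarrow> bits a \<le> bits b"
  by (simp add: bits_def floorlog_mono)

lemma bits_add: "bits (a + b) \<le> bits a + bits b"
proof -
  let ?a = "bits a - 1" and ?b = "bits b - 1"
  have "(2::int) ^ ?a + 2 ^ ?b \<le> 2 ^ (?a + ?b) + 2 ^ (?a + ?b)"
    by (intro add_mono power_increasing) auto
  then have "\<bar>a + b\<bar> < 2 ^ Suc (?a + ?b)"
    using abs_less_pow_bits[of a] abs_less_pow_bits[of b] abs_triangle_ineq[of a b]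
    unfolding power_Suc by linarith
  from bits_leI[OF this] show ?thesis using bits_pos[of a] bits_pos[of b] by simp
qed

lemma bits_uminus [simp]: "bits (- a) = bits a"
  by (simp add: bits_def)

lemma bits_diff: "bits (a - b) \<le> bits a + bits b"
  using bits_add[of a "- b"] by simp

lemma bits_mult: "bits (a * b) \<le> bits a + bits b"
proof -
  let ?a = "bits a - 1" and ?b = "bits b - 1"
  have "\<bar>a * b\<bar> < 2 ^ (?a + ?b)"
    unfolding abs_mult power_add
    using abs_less_pow_bits[of a] abs_less_pow_bits[of b] by (intro mult_strict_mono') auto
  from bits_leI[OF this] show ?thesis using bits_pos[of a] bits_pos[of b] by simp
qed

text \<open>\<open>div\<close> rounds towards minus infinity, so a negative quotient could move away
  from zero; it does not pass \<open>a\<close>, because \<open>a * b <= a\<close> for negative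
  \<open>a\<close> and \<open>b >= 1\<close>. Division by zero yields \<open>0\<close>.\<close>

lemma abs_div_le: "\<bar>a div b\<bar> \<le> \<bar>a :: int\<bar>"
proof (cases "b = 0")
  case False
  have "\<bar>a div b\<bar> \<le> \<bar>a\<bar>" if "b > 0" for a b :: int
  proof (cases "a \<ge> 0")
    case True
    have "nat a div nat b \<le> nat a" by (rule div_le_dividend)
    with True that show ?thesis by (simp add: pos_imp_zdiv_nonneg_iff nat_div_distrib[symmetric])
  next
    case False
    then have "a * b \<le> a" using that by (simp add: mult_le_cancel_left2)
    then have "a \<le> a div b" using that by (metis less_eq_int_code(1) nonzero_mult_div_cancel_right zdiv_mono1 order_less_imp_not_eq2)
    moreover have "a div b < 0" using False that by (simp add: div_neg_pos_less0)
    ultimately show ?thesis by simp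
  qed
  from this[of b a] this[of "-b" "-a"] False show ?thesis by (cases "b > 0") auto
qed simp

lemma bits_div: "bits (a div b) \<le> bits a"
  by (intro bits_mono abs_div_le)

text \<open>These bounds depend on the program text and on \<open>B\<close> only, not on the state.
  A read counts \<open>B\<close> whatever its address is, so nested reads do not compound.\<close>

primrec ebits :: "nat \<Rightarrow> aexp \<Rightarrow> nat" where
  "ebits B (Const k) = bits k"
| "ebits B (Read x a) = B"
| "ebits B (Add a b) = ebits B a + ebits B b"
| "ebits B (Sub a b) = ebits B a + ebits B b"
| "ebits B (Mul a b) = ebits B a + ebits B b"
| "ebits B (Div a b) = ebits B a + ebits B b"

primrec etime :: "nat \<Rightarrow> aexp \<Rightarrow> nat" where
  "etime B (Const k) = bits k"
| "etime B (Read x a) = etime B a + ebits B a + B"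
| "etime B (Add a b) = etime B a + etime B b + ebits B a + ebits B b"
| "etime B (Sub a b) = etime B a + etime B b + ebits B a + ebits B b"
| "etime B (Mul a b) = etime B a + etime B b + ebits B a + ebits B b"
| "etime B (Div a b) = etime B a + etime B b + ebits B a + ebits B b"

primrec btime :: "nat \<Rightarrow> bexp \<Rightarrow> nat" where
  "btime B (Less a b) = etime B a + etime B b + ebits B a + ebits B b"
| "btime B (Neg b) = btime B b + 1"
| "btime B (Conj b c) = btime B b + btime B c + 1"

text \<open>Every loop is assumed to make at most \<open>H\<close> iterations, every cell to have at most \<open>B\<close> bits.\<close>

primrec ctime :: "nat \<Rightarrow> nat \<Rightarrow> com \<Rightarrow> nat" where
  "ctime B H Skip = 1"
| "ctime B H (Write x a b) = etime B a + etime B b + ebits B a + ebits B b"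
| "ctime B H (Seq c1 c2) = ctime B H c1 + ctime B H c2"
| "ctime B H (Cond b c1 c2) = btime B b + ctime B H c1 + ctime B H c2"
| "ctime B H (While b c) = (H + 1) * (btime B b + ctime B H c)"
| "ctime B H (Query x y) = 1 + H + B"

primrec cqueries :: "nat \<Rightarrow> com \<Rightarrow> nat" where
  "cqueries H Skip = 0"
| "cqueries H (Write x a b) = 0"
| "cqueries H (Seq c1 c2) = cqueries H c1 + cqueries H c2"
| "cqueries H (Cond b c1 c2) = cqueries H c1 + cqueries H c2"
| "cqueries H (While b c) = (H + 1) * cqueries H c"
| "cqueries H (Query x y) = 1"

primrec wvars :: "com \<Rightarrow> vname set" where
  "wvars Skip = {}"
| "wvars (Write x a b) = {x}"
| "wvars (Seq c1 c2) = wvars c1 \<union> wvars c2"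
| "wvars (Cond b c1 c2) = wvars c1 \<union> wvars c2"
| "wvars (While b c) = wvars c"
| "wvars (Query x y) = {x}"

primrec avars :: "aexp \<Rightarrow> vname set" where
  "avars (Const k) = {}"
| "avars (Read x a) = insert x (avars a)"
| "avars (Add a b) = avars a \<union> avars b"
| "avars (Sub a b) = avars a \<union> avars b"
| "avars (Mul a b) = avars a \<union> avars b"
| "avars (Div a b) = avars a \<union> avars b"

lemma aval_cong: "(\<And>x. x \<in> avars a \<Longrightarrow> s x = s' x) \<Longrightarrow> aval a s = aval a s'"
  by (induction a) auto

lemma linear_bound_add:
  fixes f g :: "nat \<Rightarrow> nat"
  assumes "\<exists>C. \<forall>B. f B \<le> C * (B + 1)" and "\<exists>C. \<forall>B. g B \<le> C * (B + 1)"
  shows "\<exists>C. \<forall>B. f B + g B \<le> C * (B + 1)"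
proof -
  from assms obtain C D where "\<And>B. f B \<le> C * (B + 1)" "\<And>B. g B \<le> D * (B + 1)" by blast
  then have "f B + g B \<le> (C + D) * (B + 1)" for B unfolding distrib_right by (rule add_mono)
  then show ?thesis by blast
qed

lemma ebits_linear: "\<exists>C. \<forall>B. ebits B a \<le> C * (B + 1)"
proof (induction a)
  case (Const k)
  show ?case by (rule exI[of _ "bits k"]) auto
next
  case (Read x a)
  show ?case by (rule exI[of _ 1]) auto
qed (simp only: ebits.simps, erule (1) linear_bound_add)+

lemma etime_linear: "\<exists>C. \<forall>B. etime B a \<le> C * (B + 1)"
proof -
  have *: "\<exists>C. \<forall>B. etime B a + etime B b + ebits B a + ebits B b \<le> C * (B + 1)"
    if "\<exists>C. \<forall>B. etime B a \<le> C * (B + 1)" "\<exists>C. \<forall>B. etime B b \<le> C * (B + 1)" for a b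
    using that by (intro linear_bound_add ebits_linear)
  show ?thesis
  proof (induction a)
    case (Const k)
    show ?case by (rule exI[of _ "bits k"]) auto
  next
    case (Read x a)
    have "\<exists>C. \<forall>B::nat. B \<le> C * (B + 1)" by (rule exI[of _ 1]) simp
    with Read show ?case unfolding etime.simps by (intro linear_bound_add ebits_linear)
  qed (simp only: etime.simps, erule (1) *)+
qed

lemma btime_linear: "\<exists>C. \<forall>B. btime B b \<le> C * (B + 1)"
proof (induction b)
  case (Less a b)
  show ?case unfolding btime.simps by (intro linear_bound_add etime_linear ebits_linear)
next
  case (Neg b)
  have "\<exists>C. \<forall>B::nat. 1 \<le> C * (B + 1)" by (rule exI[of _ 1]) simp
  with Neg show ?case unfolding btime.simps by (intro linear_bound_add)
next
  case (Conj b c)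
  have "\<exists>C. \<forall>B::nat. 1 \<le> C * (B + 1)" by (rule exI[of _ 1]) simp
  with Conj show ?case unfolding btime.simps by (intro linear_bound_add)
qed

text \<open>Linear in the cell width because an expression has fixed size, and polynomial in the
  trip count with one more factor \<open>H + 1\<close> for each enclosing loop. Adding the exponents
  in a sequence is generous, but it avoids a maximum.\<close>

lemma ctime_poly: "\<exists>C D. \<forall>B H. ctime B H c \<le> C * (B + 1) * (H + 1) ^ D"
proof (induction c)
  case Skip
  show ?case by (rule exI[of _ 1]) (auto intro!: exI[of _ 0])
next
  case (Write x a b)
  have "\<exists>C. \<forall>B. etime B a + etime B b + ebits B a + ebits B b \<le> C * (B + 1)"
    by (intro linear_bound_add etime_linear ebits_linear)
  then obtain C where "\<And>B. etime B a + etime B b + ebits B a + ebits B b \<le> C * (B + 1)" by blast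
  then show ?case unfolding ctime.simps by (intro exI[of _ C] exI[of _ 0]) simp
next
  case (Seq c1 c2)
  then obtain C1 D1 C2 D2 where *:
    "\<And>B H. ctime B H c1 \<le> C1 * (B + 1) * (H + 1) ^ D1"
    "\<And>B H. ctime B H c2 \<le> C2 * (B + 1) * (H + 1) ^ D2"
    by blast
  have "ctime B H (Seq c1 c2) \<le> (C1 + C2) * (B + 1) * (H + 1) ^ (D1 + D2)" for B H
  proof -
    have "C1 * (B + 1) * (H + 1) ^ D1 \<le> C1 * (B + 1) * (H + 1) ^ (D1 + D2)"
      "C2 * (B + 1) * (H + 1) ^ D2 \<le> C2 * (B + 1) * (H + 1) ^ (D1 + D2)"
      by (auto intro!: mult_left_mono power_increasing simp del: mult_Suc_right)
    with *(1)[of B H] *(2)[of B H] show ?thesis by (simp only: ctime.simps distrib_right)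
  qed
  then show ?case by blast
next
  case (Cond b c1 c2)
  from this btime_linear[of b] obtain C1 D1 C2 D2 C3 where *:
    "\<And>B H. ctime B H c1 \<le> C1 * (B + 1) * (H + 1) ^ D1"
    "\<And>B H. ctime B H c2 \<le> C2 * (B + 1) * (H + 1) ^ D2"
    "\<And>B. btime B b \<le> C3 * (B + 1)"
    by blast
  have "ctime B H (Cond b c1 c2) \<le> (C3 + C1 + C2) * (B + 1) * (H + 1) ^ (D1 + D2)" for B H
  proof -
    have "C1 * (B + 1) * (H + 1) ^ D1 \<le> C1 * (B + 1) * (H + 1) ^ (D1 + D2)"
      "C2 * (B + 1) * (H + 1) ^ D2 \<le> C2 * (B + 1) * (H + 1) ^ (D1 + D2)"
      by (auto intro!: mult_left_mono power_increasing simp del: mult_Suc_right)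
    moreover have "C3 * (B + 1) * 1 \<le> C3 * (B + 1) * (H + 1) ^ (D1 + D2)"
      by (intro mult_left_mono) auto
    ultimately show ?thesis using *(1)[of B H] *(2)[of B H] *(3)[of B]
      unfolding ctime.simps distrib_right mult_1_right by linarith
  qed
  then show ?case by blast
next
  case (While b c)
  from this btime_linear[of b] obtain C1 D1 C3 where *:
    "\<And>B H. ctime B H c \<le> C1 * (B + 1) * (H + 1) ^ D1"
    "\<And>B. btime B b \<le> C3 * (B + 1)"
    by blast
  have "ctime B H (While b c) \<le> (C3 + C1) * (B + 1) * (H + 1) ^ Suc D1" for B H
  proof -
    have "C3 * (B + 1) * 1 \<le> C3 * (B + 1) * (H + 1) ^ D1"
      by (intro mult_left_mono) auto
    then have "btime B b + ctime B H c \<le> (C3 + C1) * (B + 1) * (H + 1) ^ D1"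
      using *(1)[of B H] *(2)[of B] unfolding distrib_right mult_1_right by linarith
    from mult_left_mono[OF this, of "H + 1"]
    have "ctime B H (While b c) \<le> (H + 1) * ((C3 + C1) * (B + 1) * (H + 1) ^ D1)"
      by (simp only: ctime.simps)
    then show ?thesis by (simp only: power_Suc mult_ac)
  qed
  then show ?case by blast
next
  case (Query x y)
  show ?case by (rule exI[of _ 1], rule exI[of _ 1]) auto
qed

text \<open>No cell width appears here: the query count depends on the trip count alone, which is
  why it can be polynomial in the size of the ground set.\<close>

lemma cqueries_poly: "\<exists>C D. \<forall>H. cqueries H c \<le> C * (H + 1) ^ D"
proof (induction c)
  case (Seq c1 c2)
  then obtain C1 D1 C2 D2 where *:
    "\<And>H. cqueries H c1 \<le> C1 * (H + 1) ^ D1" "\<And>H. cqueries H c2 \<le> C2 * (H + 1) ^ D2"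
    by blast
  have "cqueries H (Seq c1 c2) \<le> (C1 + C2) * (H + 1) ^ (D1 + D2)" for H
  proof -
    have "C1 * (H + 1) ^ D1 \<le> C1 * (H + 1) ^ (D1 + D2)" "C2 * (H + 1) ^ D2 \<le> C2 * (H + 1) ^ (D1 + D2)"
      by (auto intro!: mult_left_mono power_increasing simp del: mult_Suc_right)
    with *(1)[of H] *(2)[of H] show ?thesis by (simp only: cqueries.simps distrib_right)
  qed
  then show ?case by blast
next
  case (Cond b c1 c2)
  then obtain C1 D1 C2 D2 where *:
    "\<And>H. cqueries H c1 \<le> C1 * (H + 1) ^ D1" "\<And>H. cqueries H c2 \<le> C2 * (H + 1) ^ D2"
    by blast
  have "cqueries H (Cond b c1 c2) \<le> (C1 + C2) * (H + 1) ^ (D1 + D2)" for H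
  proof -
    have "C1 * (H + 1) ^ D1 \<le> C1 * (H + 1) ^ (D1 + D2)" "C2 * (H + 1) ^ D2 \<le> C2 * (H + 1) ^ (D1 + D2)"
      by (auto intro!: mult_left_mono power_increasing simp del: mult_Suc_right)
    with *(1)[of H] *(2)[of H] show ?thesis by (simp only: cqueries.simps distrib_right)
  qed
  then show ?case by blast
next
  case (While b c)
  then obtain C D where *: "\<And>H. cqueries H c \<le> C * (H + 1) ^ D" by blast
  have "cqueries H (While b c) \<le> C * (H + 1) ^ Suc D" for H
    using mult_left_mono[OF *[of H], of "H + 1"] by (simp add: mult_ac)
  then show ?case by blast
next
  case (Query x y)
  show ?case by (rule exI[of _ 1], rule exI[of _ 0]) auto
qed auto

lemma exec_frame: "exec n orc c s t k s' \<Longrightarrow> x \<notin> wvars c \<Longrightarrow> s' x = s x"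
  by (induction rule: exec.induct) auto

abbreviation Var :: "vname \<Rightarrow> aexp" where "Var x \<equiv> Read x (Const 0)"

text \<open>The bound \<open>hi\<close> is evaluated anew before every round; \<open>wp_For\<close>
  therefore asks that the body write none of its variables.\<close>

definition For :: "vname \<Rightarrow> aexp \<Rightarrow> com \<Rightarrow> com" where
  "For v hi c = Seq (Write v (Const 0) (Const 0))
     (While (Less (Var v) hi) (Seq c (Write v (Const 0) (Add (Var v) (Const 1)))))"

lemma wvars_For [simp]: "wvars (For v hi c) = insert v (wvars c)"
  by (auto simp: For_def)

section \<open>Executions with bounded cells\<close>

text \<open>\<open>Z\<close> bounds values, \<open>B\<close> the corresponding bit lengths and
  \<open>H\<close> the trip counts. Values are easier to estimate than bit lengths, so the
  correctness proofs speak of \<open>Z\<close>. The condition \<open>n \<le> H\<close> pays for the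
  vector that a query reads.\<close>

locale machine =
  fixes n :: nat and orc :: "nat set \<Rightarrow> int" and Z :: int and B H :: nat
  assumes bits_le_B: "\<And>i. \<bar>i\<bar> \<le> Z \<Longrightarrow> bits i \<le> B"
    and n_le_H: "n \<le> H" and Z_pos: "1 \<le> Z"
begin

definition bounded_st :: "state \<Rightarrow> bool" where
  "bounded_st s \<longleftrightarrow> (\<forall>x i. \<bar>s x i\<bar> \<le> Z)"

text \<open>Termination, the two resource bounds and the boundedness of the cells travel inside the
  predicate, so that postconditions mention values only. What remains to be shown about a program is
  that each written value is at most \<open>Z\<close> in absolute value and each trip count at most
  \<open>H\<close>.\<close>

definition wp :: "com \<Rightarrow> (state \<Rightarrow> bool) \<Rightarrow> state \<Rightarrow> bool" where
  "wp c Q s \<longleftrightarrow> (bounded_st s \<longrightarrow> (\<exists>t k s'. exec n orc c s t k s' \<and> t \<le> ctime B H c \<and>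
     k \<le> cqueries H c \<and> bounded_st s' \<and> Q s'))"

lemma bounded_bits: "bounded_st s \<Longrightarrow> bits (s x i) \<le> B"
  using bits_le_B by (simp add: bounded_st_def)

lemma bits_aval: "bounded_st s \<Longrightarrow> bits (aval a s) \<le> ebits B a"
proof (induction a)
  case (Add a b)
  then show ?case using bits_add[of "aval a s" "aval b s"] by simp
next
  case (Sub a b)
  then show ?case using bits_diff[of "aval a s" "aval b s"] by simp
next
  case (Mul a b)
  then show ?case using bits_mult[of "aval a s" "aval b s"] by simp
next
  case (Div a b)
  then show ?case using bits_div[of "aval a s" "aval b s"] by simp
qed (simp_all add: bounded_bits)

lemma acost_le: "bounded_st s \<Longrightarrow> acost a s \<le> etime B a"
  by (induction a) (simp_all add: add_mono bits_aval bounded_bits)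

lemma bcost_le: "bounded_st s \<Longrightarrow> bcost b s \<le> btime B b"
  by (induction b) (simp_all add: add_mono bits_aval acost_le)

lemma bounded_upd: "bounded_st s \<Longrightarrow> \<bar>v\<bar> \<le> Z \<Longrightarrow> bounded_st (s(x := (s x)(i := v)))"
  by (simp add: bounded_st_def)

lemma wp_weaken: "wp c Q s \<Longrightarrow> (\<And>s'. Q s' \<Longrightarrow> Q' s') \<Longrightarrow> wp c Q' s"
  unfolding wp_def by meson

lemma wp_frame: "wp c (\<lambda>s'. (\<forall>x. x \<notin> wvars c \<longrightarrow> s' x = s x) \<longrightarrow> Q s') s \<Longrightarrow> wp c Q s"
  unfolding wp_def using exec_frame by meson

lemma wp_Skip: "Q s \<Longrightarrow> wp Skip Q s"
  unfolding wp_def using exec.Skip[of n orc s] by fastforce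

text \<open>The induction over a loop needs bounds that shrink with the number of remaining rounds,
  which the fixed bounds of \<open>wp\<close> cannot express.\<close>

definition goes :: "nat \<Rightarrow> nat \<Rightarrow> com \<Rightarrow> (state \<Rightarrow> bool) \<Rightarrow> state \<Rightarrow> bool" where
  "goes T K c Q s \<longleftrightarrow> (\<exists>t k s'. exec n orc c s t k s' \<and> t \<le> T \<and> k \<le> K \<and> bounded_st s' \<and> Q s')"

lemma goesI: "exec n orc c s t k s' \<Longrightarrow> t \<le> T \<Longrightarrow> k \<le> K \<Longrightarrow> bounded_st s' \<Longrightarrow> Q s' \<Longrightarrow> goes T K c Q s"
  by (auto simp: goes_def)

lemma goesE:
  assumes "goes T K c Q s"
  obtains t k s' where "exec n orc c s t k s'" "t \<le> T" "k \<le> K" "bounded_st s'" "Q s'"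
  using assms by (auto simp: goes_def)

lemma wp_goes: "wp c Q s \<longleftrightarrow> (bounded_st s \<longrightarrow> goes (ctime B H c) (cqueries H c) c Q s)"
  by (simp add: wp_def goes_def)

lemma wp_Write:
  assumes "\<bar>aval b s\<bar> \<le> Z" and "Q (s(x := (s x)(aval a s := aval b s)))"
  shows "wp (Write x a b) Q s"
  unfolding wp_goes
proof
  assume b: "bounded_st s"
  show "goes (ctime B H (Write x a b)) (cqueries H (Write x a b)) (Write x a b) Q s"
  proof (rule goesI[OF exec.Write])
    show "acost a s + acost b s + bits (aval a s) + bits (aval b s) \<le> ctime B H (Write x a b)"
      unfolding ctime.simps by (intro add_mono acost_le bits_aval b)
  qed (use assms bounded_upd[OF b assms(1)] in auto)
qed

lemma wp_Seq: "wp c1 (wp c2 Q) s \<Longrightarrow> wp (Seq c1 c2) Q s"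
  unfolding wp_goes[of "Seq c1 c2"]
proof
  assume wp: "wp c1 (wp c2 Q) s" and b: "bounded_st s"
  from wp b obtain t k s' where 1: "exec n orc c1 s t k s'" "t \<le> ctime B H c1" "k \<le> cqueries H c1"
    "bounded_st s'" "wp c2 Q s'" by (auto simp: wp_goes[of c1] elim: goesE)
  then obtain t' k' s'' where 2: "exec n orc c2 s' t' k' s''" "t' \<le> ctime B H c2" "k' \<le> cqueries H c2"
    "bounded_st s''" "Q s''" by (auto simp: wp_goes elim: goesE)
  show "goes (ctime B H (Seq c1 c2)) (cqueries H (Seq c1 c2)) (Seq c1 c2) Q s"
    by (rule goesI[OF exec.Seq[OF 1(1) 2(1)]]) (use 1 2 in auto)
qed

lemma wp_Cond:
  assumes "bval b s \<Longrightarrow> wp c1 Q s" and "\<not> bval b s \<Longrightarrow> wp c2 Q s"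
  shows "wp (Cond b c1 c2) Q s"
  unfolding wp_goes
proof
  assume b: "bounded_st s"
  note bc = bcost_le[OF b, of b]
  show "goes (ctime B H (Cond b c1 c2)) (cqueries H (Cond b c1 c2)) (Cond b c1 c2) Q s"
  proof (cases "bval b s")
    case True
    with assms(1) b obtain t k s' where 1: "exec n orc c1 s t k s'" "t \<le> ctime B H c1"
      "k \<le> cqueries H c1" "bounded_st s'" "Q s'" by (auto simp: wp_goes elim: goesE)
    show ?thesis by (rule goesI[OF exec.CondTrue[OF True 1(1)]]) (use 1 bc in auto)
  next
    case False
    with assms(2) b obtain t k s' where 1: "exec n orc c2 s t k s'" "t \<le> ctime B H c2"
      "k \<le> cqueries H c2" "bounded_st s'" "Q s'" by (auto simp: wp_goes elim: goesE)
    show ?thesis by (rule goesI[OF exec.CondFalse[OF False 1(1)]]) (use 1 bc in auto)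
  qed
qed

lemma wp_Query:
  assumes "\<bar>orc (decode_set n (s y))\<bar> \<le> Z" and "Q (s(x := (s x)(0 := orc (decode_set n (s y)))))"
  shows "wp (Query x y) Q s"
  unfolding wp_goes
proof
  assume b: "bounded_st s"
  show "goes (ctime B H (Query x y)) (cqueries H (Query x y)) (Query x y) Q s"
    by (rule goesI[OF exec.Query])
      (use assms bounded_upd[OF b assms(1)] bits_le_B[OF assms(1)] n_le_H in auto)
qed

text \<open>The number \<open>N\<close> of rounds is exact and the invariant is indexed by the
  round, which gives termination and the time bound at once.\<close>

lemma wp_While:
  assumes step: "\<And>k s. k < N \<Longrightarrow> J k s \<Longrightarrow> bval b s \<and> wp c (J (Suc k)) s"
    and final: "\<And>s. J N s \<Longrightarrow> \<not> bval b s \<and> Q s" and "J 0 s" and "N \<le> H"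
  shows "wp (While b c) Q s"
proof -
  \<comment> \<open>\<open>l\<close> is the number of rounds still to come; the trailing term pays
    for the last, failing test.\<close>
  let ?T = "\<lambda>l. l * (btime B b + ctime B H c) + btime B b"
  have *: "goes (?T l) (l * cqueries H c) (While b c) Q s" if "l \<le> N" "J (N - l) s" "bounded_st s" for l s
    using that
  proof (induction l arbitrary: s)
    case 0
    then have "J N s" by simp
    then have nb: "\<not> bval b s" "Q s" using final by auto
    show ?case
      by (rule goesI[OF exec.WhileFalse[OF nb(1)]]) (use bcost_le[of s b] nb 0 in auto)
  next
    case (Suc l)
    then have b: "bval b s" "wp c (J (Suc (N - Suc l))) s" using step[of "N - Suc l" s] by auto
    moreover have "Suc (N - Suc l) = N - l" using Suc.prems by simp
    ultimately have "wp c (J (N - l)) s" by simp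
    with Suc.prems obtain t q s' where 1: "exec n orc c s t q s'" "t \<le> ctime B H c"
      "q \<le> cqueries H c" "bounded_st s'" "J (N - l) s'" by (auto simp: wp_goes elim: goesE)
    have "goes (?T l) (l * cqueries H c) (While b c) Q s'"
      by (rule Suc.IH) (use 1 Suc.prems in auto)
    then obtain t' q' s'' where 2: "exec n orc (While b c) s' t' q' s''"
      "t' \<le> ?T l" "q' \<le> l * cqueries H c" "bounded_st s''" "Q s''" by (rule goesE)
    show ?case
      by (rule goesI[OF exec.WhileTrue[OF b(1) 1(1) 2(1)]])
        (use 1(2,3) 2 bcost_le[OF Suc.prems(3), of b] in auto)
  qed
  have "N * (btime B b + ctime B H c) \<le> H * (btime B b + ctime B H c)"
    "N * cqueries H c \<le> H * cqueries H c"
    using assms(4) by (simp_all add: mult_right_mono)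
  then have le: "?T N \<le> ctime B H (While b c)" "N * cqueries H c \<le> cqueries H (While b c)"
    unfolding ctime.simps cqueries.simps distrib_right[of H 1] mult_1 by linarith+
  show ?thesis unfolding wp_goes
  proof
    assume "bounded_st s"
    then have "goes (?T N) (N * cqueries H c) (While b c) Q s" by (intro *) (use assms(3) in auto)
    then obtain t q s' where 1: "exec n orc (While b c) s t q s'"
      "t \<le> ?T N" "q \<le> N * cqueries H c" "bounded_st s'" "Q s'" by (rule goesE)
    show "goes (ctime B H (While b c)) (cqueries H (While b c)) (While b c) Q s"
      by (rule goesI[OF 1(1)]) (use 1 le in auto)
  qed
qed

text \<open>The invariant is read in the state after the counter has been advanced, and everything
  outside the variables of the body is passed on automatically, so that \<open>I\<close> has to
  describe only what the body changes.\<close>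

lemma wp_For:
  assumes v: "v \<notin> wvars c" "v \<notin> avars hi" "avars hi \<inter> wvars c = {}"
    and N: "aval hi s0 = int N" "N \<le> H" "int N \<le> Z"
    and 0: "I 0 (s0(v := (s0 v)(0 := 0)))"
    and step: "\<And>k s. k < N \<Longrightarrow> I k s \<Longrightarrow> s v 0 = int k \<Longrightarrow>
      (\<And>x. x \<notin> insert v (wvars c) \<Longrightarrow> s x = s0 x) \<Longrightarrow>
      wp c (\<lambda>s'. I (Suc k) (s'(v := (s' v)(0 := int k + 1)))) s"
    and post: "\<And>s. I N s \<Longrightarrow> s v 0 = int N \<Longrightarrow>
      (\<And>x. x \<notin> insert v (wvars c) \<Longrightarrow> s x = s0 x) \<Longrightarrow> Q s"
  shows "wp (For v hi c) Q s0"
proof -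
  define J where "J k s \<longleftrightarrow> I k s \<and> s v 0 = int k \<and> (\<forall>x. x \<notin> insert v (wvars c) \<longrightarrow> s x = s0 x)" for k s
  have hi: "aval hi s = int N" if "J k s" for k s
  proof -
    have "aval hi s = aval hi s0" by (rule aval_cong) (use that v in \<open>auto simp: J_def\<close>)
    then show ?thesis using N(1) by simp
  qed
  show ?thesis unfolding For_def
  proof (rule wp_Seq, rule wp_Write)
    show "wp (While (Less (Var v) hi) (Seq c (Write v (Const 0) (Add (Var v) (Const 1))))) Q
      (s0(v := (s0 v)(aval (Const 0) s0 := aval (Const 0) s0)))"
    proof (rule wp_While[of N J])
      fix k s assume k: "k < N" and J: "J k s"
      have "wp c (\<lambda>s'. I (Suc k) (s'(v := (s' v)(0 := int k + 1)))) s"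
        by (rule step) (use k J in \<open>auto simp: J_def\<close>)
      then have "wp c (\<lambda>s'. (\<forall>x. x \<notin> wvars c \<longrightarrow> s' x = s x) \<longrightarrow>
          wp (Write v (Const 0) (Add (Var v) (Const 1))) (J (Suc k)) s') s"
      proof (rule wp_weaken, intro impI)
        fix s' assume I: "I (Suc k) (s'(v := (s' v)(0 := int k + 1)))"
          and f: "\<forall>x. x \<notin> wvars c \<longrightarrow> s' x = s x"
        then have [simp]: "s' v = s v" using v(1) by auto
        show "wp (Write v (Const 0) (Add (Var v) (Const 1))) (J (Suc k)) s'"
          using I f J k N(3) by (intro wp_Write) (auto simp: J_def)
      qed
      then have "wp c (wp (Write v (Const 0) (Add (Var v) (Const 1))) (J (Suc k))) s"
        by (rule wp_frame)
      then have "wp (Seq c (Write v (Const 0) (Add (Var v) (Const 1)))) (J (Suc k)) s"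
        by (rule wp_Seq)
      then show "bval (Less (Var v) hi) s \<and> wp (Seq c (Write v (Const 0) (Add (Var v) (Const 1)))) (J (Suc k)) s"
        using hi[OF J] J k by (auto simp: J_def)
    next
      fix s assume "J N s"
      then show "\<not> bval (Less (Var v) hi) s \<and> Q s" using hi[of N s] post[of s] by (auto simp: J_def)
    next
      show "J 0 (s0(v := (s0 v)(aval (Const 0) s0 := aval (Const 0) s0)))" using 0 by (simp add: J_def)
    qed (rule N)
  qed (use Z_pos in simp)
qed

end

section \<open>Pivoting in integer bases\<close>

definition column_matrix :: "nat \<Rightarrow> (nat \<Rightarrow> nat \<Rightarrow> int) \<Rightarrow> int mat" where
  "column_matrix m B = mat m m (\<lambda>(v, j). B j v)"

text \<open>The sign \<open>e\<close> makes the denominator \<open>D\<close> of the inverse \<open>N / D\<close> positive.\<close>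

definition basis_adjugate :: "nat \<Rightarrow> (nat \<Rightarrow> nat \<Rightarrow> int) \<Rightarrow> (nat \<Rightarrow> nat \<Rightarrow> int) \<Rightarrow> int \<Rightarrow> bool" where
  "basis_adjugate m B N D \<longleftrightarrow> D > 0 \<and> (\<exists>e \<in> {1, -1}. D = e * det (column_matrix m B) \<and>
     (\<forall>r<m. \<forall>c<m. N r c = e * adj_mat (column_matrix m B) $$ (r, c)))"

lemma column_matrix_carrier [simp]: "column_matrix m B \<in> carrier_mat m m"
  by (simp add: column_matrix_def)

lemma column_matrix_index [simp]: "v < m \<Longrightarrow> j < m \<Longrightarrow> column_matrix m B $$ (v, j) = B j v"
  by (simp add: column_matrix_def)

lemma column_matrix_dim [simp]: "dim_row (column_matrix m B) = m" "dim_col (column_matrix m B) = m"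
  by (simp_all add: column_matrix_def)

lemma basis_adjugateE:
  assumes "basis_adjugate m B N D"
  obtains e where "e = 1 \<or> e = -1" "D = e * det (column_matrix m B)" "D > 0"
     "\<And>r c. r < m \<Longrightarrow> c < m \<Longrightarrow> N r c = e * adj_mat (column_matrix m B) $$ (r, c)"
  using assms unfolding basis_adjugate_def by blast

lemma adj_mult_sum:
  assumes "r < m" "j < m"
  shows "(\<Sum>c<m. adj_mat (column_matrix m B) $$ (r, c) * B j c) = (if r = j then det (column_matrix m B) else 0)"
proof -
  have "(\<Sum>c<m. adj_mat (column_matrix m B) $$ (r, c) * B j c)
      = (adj_mat (column_matrix m B) * column_matrix m B) $$ (r, j)"
    using assms carrier_matD[OF adj_mat(1)[OF column_matrix_carrier[of m B]]]
      carrier_matD[OF column_matrix_carrier[of m B]]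
    by (simp add: scalar_prod_def lessThan_atLeast0)
  then show ?thesis using assms by (simp add: adj_mat(3)[OF column_matrix_carrier])
qed

lemma mult_adj_sum:
  assumes "v < m" "c < m"
  shows "(\<Sum>j<m. B j v * adj_mat (column_matrix m B) $$ (j, c)) = (if v = c then det (column_matrix m B) else 0)"
proof -
  have "(\<Sum>j<m. B j v * adj_mat (column_matrix m B) $$ (j, c))
      = (column_matrix m B * adj_mat (column_matrix m B)) $$ (v, c)"
    using assms carrier_matD[OF adj_mat(1)[OF column_matrix_carrier[of m B]]]
      carrier_matD[OF column_matrix_carrier[of m B]]
    by (simp add: scalar_prod_def lessThan_atLeast0)
  then show ?thesis using assms by (simp add: adj_mat(2)[OF column_matrix_carrier])
qed

lemma basis_adjugate_mult:
  assumes "basis_adjugate m B N D" "r < m" "j < m"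
  shows "(\<Sum>c<m. N r c * B j c) = (if r = j then D else 0)"
proof -
  from assms(1) obtain e where e: "D = e * det (column_matrix m B)"
     "\<And>r c. r < m \<Longrightarrow> c < m \<Longrightarrow> N r c = e * adj_mat (column_matrix m B) $$ (r, c)"
    by (rule basis_adjugateE) blast
  have "(\<Sum>c<m. N r c * B j c) = e * (\<Sum>c<m. adj_mat (column_matrix m B) $$ (r, c) * B j c)"
    using assms by (auto simp: e(2) sum_distrib_left mult.assoc intro!: sum.cong)
  then show ?thesis using assms by (simp add: adj_mult_sum e(1))
qed

lemma basis_adjugate_mult':
  assumes "basis_adjugate m B N D" "v < m" "c < m"
  shows "(\<Sum>j<m. B j v * N j c) = (if v = c then D else 0)"
proof -
  from assms(1) obtain e where e: "D = e * det (column_matrix m B)"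
     "\<And>r c. r < m \<Longrightarrow> c < m \<Longrightarrow> N r c = e * adj_mat (column_matrix m B) $$ (r, c)"
    by (rule basis_adjugateE) blast
  have "(\<Sum>j<m. B j v * N j c) = e * (\<Sum>j<m. B j v * adj_mat (column_matrix m B) $$ (j, c))"
    using assms by (auto simp: e(2) sum_distrib_left mult_ac intro!: sum.cong)
  then show ?thesis using assms by (simp add: mult_adj_sum e(1))
qed

text \<open>Cramer's rule: as the basis matrix times \<open>N\<close> is \<open>D\<close> times the
  identity, the integers \<open>N w\<close> are the coordinates of \<open>w\<close> in the basis
  over the common denominator \<open>D\<close>.\<close>

lemma basis_adjugate_expand:
  assumes "basis_adjugate m B N D" "v < m"
  shows "(\<Sum>j<m. (\<Sum>c<m. N j c * w c) * B j v) = D * w v"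
proof -
  have "(\<Sum>j<m. (\<Sum>c<m. N j c * w c) * B j v) = (\<Sum>j<m. \<Sum>c<m. B j v * N j c * w c)"
    by (simp add: sum_distrib_left sum_distrib_right mult_ac)
  also have "\<dots> = (\<Sum>c<m. (\<Sum>j<m. B j v * N j c) * w c)"
    by (subst sum.swap) (simp add: sum_distrib_right)
  also have "\<dots> = (\<Sum>c<m. if v = c then D * w c else 0)"
    by (intro sum.cong) (simp_all add: basis_adjugate_mult'[OF assms])
  also have "\<dots> = D * w v" using assms(2) by simp
  finally show ?thesis .
qed

lemma basis_adjugate_unit:
  "basis_adjugate m (\<lambda>j v. if j = v then 1 else 0) (\<lambda>r c. if r = c then 1 else 0) 1"
proof -
  have 1: "column_matrix m (\<lambda>j v. if j = v then 1 else 0) = 1\<^sub>m m"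
    by (auto simp: column_matrix_def)
  have "adj_mat (1\<^sub>m m :: int mat) \<in> carrier_mat m m" "1\<^sub>m m * adj_mat (1\<^sub>m m) = (1::int) \<cdot>\<^sub>m 1\<^sub>m m"
    using adj_mat(1,2)[of "1\<^sub>m m :: int mat" m] by auto
  then have "adj_mat (1\<^sub>m m) = (1\<^sub>m m :: int mat)" by auto
  then show ?thesis by (auto simp: basis_adjugate_def 1)
qed

text \<open>The Leibniz formula is a sum of \<open>m!\<close> products of \<open>m\<close> entries.
  Hadamard's inequality would be sharper, but the bit length is polynomial either way.\<close>

lemma abs_det_le:
  fixes A :: "int mat"
  assumes A: "A \<in> carrier_mat m m" and U: "\<And>i j. i < m \<Longrightarrow> j < m \<Longrightarrow> \<bar>A $$ (i, j)\<bar> \<le> U"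
  shows "\<bar>det A\<bar> \<le> fact m * U ^ m"
proof -
  have "\<bar>det A\<bar> \<le> (\<Sum>p | p permutes {0..<m}. \<bar>signof p * (\<Prod>i = 0..<m. A $$ (i, p i))\<bar>)"
    unfolding det_def'[OF A] by (rule sum_abs)
  also have "\<dots> \<le> (\<Sum>p | p permutes {0..<m}. U ^ m)"
  proof (rule sum_mono)
    fix p assume "p \<in> {p. p permutes {0..<m}}"
    then have p: "p i < m" if "i < m" for i using that permutes_in_image[of p "{0..<m}" i] by simp
    have "\<bar>\<Prod>i = 0..<m. A $$ (i, p i)\<bar> \<le> (\<Prod>i = 0..<m. U)"
      unfolding abs_prod by (rule prod_mono) (use U p in auto)
    then show "\<bar>signof p * (\<Prod>i = 0..<m. A $$ (i, p i))\<bar> \<le> U ^ m"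
      by (simp add: abs_mult sign_def)
  qed
  also have "\<dots> = fact m * U ^ m" by (simp add: card_permutations[OF refl])
  finally show ?thesis .
qed

text \<open>Only the entries of the current columns enter, not the pivots that led to them. This
  keeps the sizes from growing with the number of rounds.\<close>

lemma basis_adjugate_bound:
  assumes "basis_adjugate m B N D" and U: "\<And>j v. j < m \<Longrightarrow> v < m \<Longrightarrow> \<bar>B j v\<bar> \<le> U" and "U \<ge> 1"
  shows "D \<le> fact m * U ^ m" and "r < m \<Longrightarrow> c < m \<Longrightarrow> \<bar>N r c\<bar> \<le> fact m * U ^ m"
proof -
  let ?A = "column_matrix m B"
  from assms(1) obtain e where e: "e = 1 \<or> e = -1" "D = e * det ?A" "D > 0"
     "\<And>r c. r < m \<Longrightarrow> c < m \<Longrightarrow> N r c = e * adj_mat ?A $$ (r, c)"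
    by (rule basis_adjugateE) blast
  have "\<bar>det ?A\<bar> \<le> fact m * U ^ m" by (rule abs_det_le) (use U in auto)
  with e show "D \<le> fact m * U ^ m" by auto
  assume rc: "r < m" "c < m"
  have "\<bar>det (mat_delete ?A c r)\<bar> \<le> fact (m - 1) * U ^ (m - 1)"
    by (rule abs_det_le) (use U rc in \<open>auto simp: mat_delete_def\<close>)
  also have "\<dots> \<le> fact m * U ^ m"
    using \<open>U \<ge> 1\<close> by (intro mult_mono power_increasing fact_mono) auto
  finally show "\<bar>N r c\<bar> \<le> fact m * U ^ m"
    using rc e(1,4) by (auto simp: adj_mat_def cofactor_def abs_mult power_abs)
qed

text \<open>Fraction-free pivoting in the manner of Bareiss and Edmonds. The elimination formula
  yields \<open>D\<close> times the adjugate of the new basis up to sign, so the division by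
  \<open>D\<close> is exact; the new determinant is \<open>Y p\<close> up to sign, and
  \<open>sgn (Y p)\<close> restores a positive denominator.\<close>

lemma basis_adjugate_replace:
  fixes w :: "nat \<Rightarrow> int"
  assumes ba: "basis_adjugate m B N D" and p: "p < m"
    and Y: "\<And>r. r < m \<Longrightarrow> Y r = (\<Sum>c<m. N r c * w c)" and Yp: "Y p \<noteq> 0"
    and B': "\<And>j v. j < m \<Longrightarrow> v < m \<Longrightarrow> B' j v = (if j = p then w v else B j v)"
    and N': "\<And>r c. r < m \<Longrightarrow> c < m \<Longrightarrow> N' r c =
      (if r = p then sgn (Y p) * N p c else sgn (Y p) * ((Y p * N r c - Y r * N p c) div D))"
  shows "basis_adjugate m B' N' \<bar>Y p\<bar>"
proof -
  let ?A = "column_matrix m B" and ?A' = "column_matrix m B'"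
  from ba obtain e where e: "e = 1 \<or> e = -1" "D = e * det ?A" "D > 0"
     "\<And>r c. r < m \<Longrightarrow> c < m \<Longrightarrow> N r c = e * adj_mat ?A $$ (r, c)"
    by (rule basis_adjugateE) blast
  \<comment> \<open>The new rows before the division and without the sign; row \<open>p\<close>
    carries the factor \<open>D\<close> so that all rows are treated alike.\<close>
  define R where "R r c = (if r = p then D * N p c else Y p * N r c - Y r * N p c)" for r c
  have detA': "det ?A' * e = Y p"
  proof -
    \<comment> \<open>The two matrices differ only in column \<open>p\<close>, so their cofactors
      along it coincide, and the Laplace expansion reproduces row \<open>p\<close> of
      \<open>N\<close> applied to \<open>w\<close>.\<close>
    have "mat_delete ?A' c p = mat_delete ?A c p" if "c < m" for c
      using that p by (intro eq_matI) (auto simp: mat_delete_def B')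
    then have cof: "cofactor ?A' c p = adj_mat ?A $$ (p, c)" if "c < m" for c
      using that p by (simp add: cofactor_def adj_mat_def)
    have "det ?A' = (\<Sum>c<m. ?A' $$ (c, p) * cofactor ?A' c p)"
      by (rule laplace_expansion_column[OF column_matrix_carrier p])
    also have "\<dots> = (\<Sum>c<m. e * (N p c * w c))"
      by (intro sum.cong) (use e p cof B' in auto)
    also have "\<dots> = e * Y p" using p by (simp add: Y sum_distrib_left)
    finally show ?thesis using e(1) by auto
  qed
  have NB: "(\<Sum>c<m. N r c * B' j c) = (if j = p then Y r else if r = j then D else 0)"
    if "r < m" "j < m" for r j
    using that basis_adjugate_mult[OF ba that] by (auto simp: B' Y intro!: sum.cong)
  have RB: "(\<Sum>c<m. R r c * B' j c) = (if r = j then D * Y p else 0)" if "r < m" "j < m" for r j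
  proof (cases "r = p")
    case True
    have "(\<Sum>c<m. R r c * B' j c) = D * (\<Sum>c<m. N p c * B' j c)"
      unfolding R_def using True by (simp add: sum_distrib_left mult.assoc)
    then show ?thesis using NB[of p j] that p True by auto
  next
    case False
    have "(\<Sum>c<m. R r c * B' j c) = Y p * (\<Sum>c<m. N r c * B' j c) - Y r * (\<Sum>c<m. N p c * B' j c)"
      unfolding R_def using False
      by (simp add: sum_distrib_left sum_subtractf[symmetric] algebra_simps)
    then show ?thesis using NB[of p j] NB[of r j] that p False by auto
  qed
  \<comment> \<open>Multiply \<open>R B' = D (Y p) I\<close> from the right by the adjugate of the
    new matrix and cancel its determinant, which is \<open>Y p\<close> up to sign.\<close>
  have R: "R r c = D * (e * adj_mat ?A' $$ (r, c))" if rc: "r < m" "c < m" for r c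
  proof -
    have "(\<Sum>k<m. (\<Sum>i<m. R r i * B' k i) * adj_mat ?A' $$ (k, c))
        = (\<Sum>i<m. R r i * (\<Sum>k<m. B' k i * adj_mat ?A' $$ (k, c)))"
      unfolding sum_distrib_left sum_distrib_right by (subst sum.swap) (simp add: mult_ac)
    also have "\<dots> = (\<Sum>i<m. if i = c then R r i * det ?A' else 0)"
      by (intro sum.cong) (use rc in \<open>auto simp: mult_adj_sum\<close>)
    also have "\<dots> = R r c * det ?A'" using rc by simp
    finally have "R r c * det ?A' = (\<Sum>k<m. (\<Sum>i<m. R r i * B' k i) * adj_mat ?A' $$ (k, c))" ..
    also have "\<dots> = (\<Sum>k<m. if k = r then D * Y p * adj_mat ?A' $$ (k, c) else 0)"
      by (intro sum.cong) (use rc in \<open>auto simp: RB\<close>)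
    also have "\<dots> = D * Y p * adj_mat ?A' $$ (r, c)" using rc by simp
    finally show ?thesis using Yp e(1) by (auto simp flip: detA')
  qed
  have N'': "N' r c = sgn (Y p) * e * adj_mat ?A' $$ (r, c)" if "r < m" "c < m" for r c
  proof -
    have "N' r c = sgn (Y p) * (R r c div D)"
      using that e(3) N' by (simp add: R_def)
    also have "R r c div D = e * adj_mat ?A' $$ (r, c)" using R[OF that] e(3) by simp
    finally show ?thesis by (simp add: mult.assoc)
  qed
  have "sgn (Y p) * e \<in> {1, -1}" using Yp e(1) by (auto simp: sgn_if)
  moreover have "\<bar>Y p\<bar> = sgn (Y p) * e * det ?A'" unfolding detA'[symmetric] abs_sgn
    by (simp add: mult_ac)
  ultimately show ?thesis using Yp N'' unfolding basis_adjugate_def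
    by (intro conjI bexI[of _ "sgn (Y p) * e"] allI impI) auto
qed

text \<open>Spreading an amount of \<open>w\<close> over the basis changes \<open>lam\<close> in
  direction \<open>Y / D\<close>, until column \<open>p\<close> is the first to block, at the amount
  \<open>lam p * D / |Y p|\<close>; the remainder of \<open>\<theta>\<close> enters in its place.
  Everything is multiplied by \<open>|Y p|\<close> to stay integral. An idle column with
  \<open>Y p > 0\<close> blocks at once: its ratio is zero, so \<open>w\<close> takes its place with
  full weight and the other coefficients are merely scaled.\<close>

lemma insert_pivot:
  fixes lam :: "nat \<Rightarrow> int" and w :: "nat \<Rightarrow> int"
  assumes ba: "basis_adjugate m B N D" and lam: "\<And>j. j < m \<Longrightarrow> lam j \<ge> 0"
    and Y: "\<And>r. r < m \<Longrightarrow> Y r = (\<Sum>c<m. N r c * w c)"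
    and p: "p < m" "Y p < 0 \<or> Y p > 0 \<and> lam p = 0"
    and min: "\<And>r. r < m \<Longrightarrow> Y r < 0 \<or> Y r > 0 \<and> lam r = 0 \<Longrightarrow> lam p * \<bar>Y r\<bar> \<le> lam r * \<bar>Y p\<bar>"
    and lt: "lam p * D < \<theta> * \<bar>Y p\<bar>"
    and B': "\<And>j v. j < m \<Longrightarrow> v < m \<Longrightarrow> B' j v = (if j = p then w v else B j v)"
    and lam': "\<And>j. j < m \<Longrightarrow> lam' j = (if j = p then \<theta> * \<bar>Y p\<bar> - lam p * D else lam j * \<bar>Y p\<bar> + lam p * Y j)"
  shows "j < m \<Longrightarrow> lam' j \<ge> 0"
    and "j < m \<Longrightarrow> j \<noteq> p \<Longrightarrow> lam j = 0 \<Longrightarrow> lam' j = 0"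
    and "v < m \<Longrightarrow> (\<Sum>j<m. lam' j * B' j v) = \<bar>Y p\<bar> * ((\<Sum>j<m. lam j * B j v) + \<theta> * w v)"
proof -
  assume j: "j < m"
  show "lam' j \<ge> 0"
  proof (cases "j = p \<or> Y j \<ge> 0")
    case True
    then show ?thesis using lam' lt lam j p(1) by auto
  next
    case False
    with min[of j] j have "lam p * \<bar>Y j\<bar> \<le> lam j * \<bar>Y p\<bar>" by auto
    with False show ?thesis using lam' j by auto
  qed
next
  assume j: "j < m" "j \<noteq> p" "lam j = 0"
  show "lam' j = 0"
  proof (cases "Y j = 0")
    case False
    with min[of j] j have "lam p * \<bar>Y j\<bar> \<le> 0" by (auto simp: linorder_neq_iff)
    with False lam[of p] p(1) have "lam p = 0" by (simp add: mult_le_0_iff)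
    then show ?thesis using lam'[OF j(1)] j by simp
  qed (use lam'[OF j(1)] j in simp)
next
  assume v: "v < m"
  \<comment> \<open>Either \<open>Y p < 0\<close>, or both sides vanish because
    \<open>lam p = 0\<close>.\<close>
  have Ypg: "- (lam p * Y p) = \<bar>Y p\<bar> * lam p" using p(2) by auto
  have ex: "D * w v = (\<Sum>j<m. Y j * B j v)"
    using basis_adjugate_expand[OF ba v, of w] by (simp add: Y)
  have split: "(\<Sum>j<m. f j) = f p + (\<Sum>j\<in>{..<m} - {p}. f j)" for f :: "nat \<Rightarrow> int"
    using p(1) by (simp add: sum.remove)
  have "(\<Sum>j<m. lam' j * B' j v) = (\<theta> * \<bar>Y p\<bar> - lam p * D) * w v +
     (\<Sum>j\<in>{..<m} - {p}. (lam j * \<bar>Y p\<bar> + lam p * Y j) * B j v)"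
    unfolding split using p(1) v by (auto simp: lam' B' intro!: sum.cong)
  also have "(\<Sum>j\<in>{..<m} - {p}. (lam j * \<bar>Y p\<bar> + lam p * Y j) * B j v) =
      \<bar>Y p\<bar> * (\<Sum>j\<in>{..<m} - {p}. lam j * B j v) + lam p * (\<Sum>j\<in>{..<m} - {p}. Y j * B j v)"
    by (simp add: sum_distrib_left sum.distrib[symmetric] algebra_simps)
  also have "(\<Sum>j\<in>{..<m} - {p}. Y j * B j v) = D * w v - Y p * B p v"
    unfolding ex split by simp
  also have "(\<theta> * \<bar>Y p\<bar> - lam p * D) * w v +
      (\<bar>Y p\<bar> * (\<Sum>j\<in>{..<m} - {p}. lam j * B j v) + lam p * (D * w v - Y p * B p v)) =
      \<bar>Y p\<bar> * (\<theta> * w v + (\<Sum>j\<in>{..<m} - {p}. lam j * B j v)) + - (lam p * Y p) * B p v"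
    by (simp add: algebra_simps)
  also have "\<dots> = \<bar>Y p\<bar> * ((\<Sum>j<m. lam j * B j v) + \<theta> * w v)"
    unfolding Ypg split by (simp add: algebra_simps)
  finally show "(\<Sum>j<m. lam' j * B' j v) = \<bar>Y p\<bar> * ((\<Sum>j<m. lam j * B j v) + \<theta> * w v)" .
qed

text \<open>The case in which no column blocks before all of \<open>\<theta>\<close> is spread over
  the basis; the basis stays, and the scaling factor is \<open>D\<close>.\<close>

lemma insert_absorb_vector:
  fixes lam :: "nat \<Rightarrow> int" and w :: "nat \<Rightarrow> int"
  assumes ba: "basis_adjugate m B N D" and lam: "\<And>j. j < m \<Longrightarrow> lam j \<ge> 0"
    and Y: "\<And>r. r < m \<Longrightarrow> Y r = (\<Sum>c<m. N r c * w c)" and "\<theta> > 0"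
    and min: "\<And>r. r < m \<Longrightarrow> Y r < 0 \<or> Y r > 0 \<and> lam r = 0 \<Longrightarrow> \<theta> * \<bar>Y r\<bar> \<le> lam r * D"
    and lam': "\<And>j. j < m \<Longrightarrow> lam' j = D * lam j + \<theta> * Y j"
  shows "j < m \<Longrightarrow> lam' j \<ge> 0"
    and "j < m \<Longrightarrow> lam j = 0 \<Longrightarrow> lam' j = 0"
    and "v < m \<Longrightarrow> (\<Sum>j<m. lam' j * B j v) = D * ((\<Sum>j<m. lam j * B j v) + \<theta> * w v)"
proof -
  have D: "D > 0" using ba by (simp add: basis_adjugate_def)
  assume j: "j < m"
  show "lam' j \<ge> 0"
  proof (cases "Y j \<ge> 0")
    case True
    then show ?thesis using lam'[OF j] lam[OF j] D \<open>\<theta> > 0\<close> by simp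
  next
    case False
    with min[OF j] show ?thesis using lam'[OF j] by (auto simp: mult.commute)
  qed
next
  assume j: "j < m" "lam j = 0"
  show "lam' j = 0"
  proof (cases "Y j = 0")
    case False
    with min[OF j(1)] j(2) have "\<theta> * \<bar>Y j\<bar> \<le> 0" by (auto simp: linorder_neq_iff)
    with False \<open>\<theta> > 0\<close> show ?thesis by (simp add: mult_le_0_iff)
  qed (use lam'[OF j(1)] j(2) in simp)
next
  assume v: "v < m"
  have ex: "D * w v = (\<Sum>j<m. Y j * B j v)"
    using basis_adjugate_expand[OF ba v, of w] by (simp add: Y)
  have "(\<Sum>j<m. lam' j * B j v) = D * (\<Sum>j<m. lam j * B j v) + \<theta> * (\<Sum>j<m. Y j * B j v)"
    by (simp add: lam' sum_distrib_left sum.distrib[symmetric] algebra_simps)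
  then show "(\<Sum>j<m. lam' j * B j v) = D * ((\<Sum>j<m. lam j * B j v) + \<theta> * w v)"
    unfolding ex[symmetric] by (simp add: algebra_simps)
qed

section \<open>Greedy vectors and exchanges\<close>

definition ordering_on :: "nat \<Rightarrow> (nat \<Rightarrow> nat) \<Rightarrow> bool" where
  "ordering_on m \<pi> \<longleftrightarrow> bij_betw \<pi> {..<m} {..<m}"

definition greedy :: "(nat set \<Rightarrow> int) \<Rightarrow> nat \<Rightarrow> (nat \<Rightarrow> nat) \<Rightarrow> nat \<Rightarrow> int" where
  "greedy F m \<pi> v = (let p = inv_into {..<m} \<pi> v in F (\<pi> ` {..<Suc p}) - F (\<pi> ` {..<p}))"

definition move_to :: "(nat \<Rightarrow> nat) \<Rightarrow> nat \<Rightarrow> nat \<Rightarrow> nat \<Rightarrow> nat" where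
  "move_to \<pi> p j q = (if q = p then \<pi> j else if p < q \<and> q \<le> j then \<pi> (q - 1) else \<pi> q)"

lemma ordering_on_less: "ordering_on m \<pi> \<Longrightarrow> p < m \<Longrightarrow> \<pi> p < m"
  by (auto simp: ordering_on_def bij_betw_def)

lemma ordering_on_inj: "ordering_on m \<pi> \<Longrightarrow> p < m \<Longrightarrow> q < m \<Longrightarrow> \<pi> p = \<pi> q \<longleftrightarrow> p = q"
  by (auto simp: ordering_on_def bij_betw_def inj_on_def)

lemma ordering_on_surj: "ordering_on m \<pi> \<Longrightarrow> v < m \<Longrightarrow> \<exists>p<m. v = \<pi> p"
  unfolding ordering_on_def bij_betw_def by blast

lemma greedy_at:
  "ordering_on m \<pi> \<Longrightarrow> p < m \<Longrightarrow> greedy F m \<pi> (\<pi> p) = F (\<pi> ` {..<Suc p}) - F (\<pi> ` {..<p})"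
  by (simp add: greedy_def ordering_on_def bij_betw_def inv_into_f_f)

lemma move_to_image_le: "q \<le> p \<Longrightarrow> move_to \<pi> p j ` {..<q} = \<pi> ` {..<q}"
  by (rule image_cong) (auto simp: move_to_def)

lemma move_to_image_between:
  assumes "p \<le> q" "q \<le> j"
  shows "move_to \<pi> p j ` {..<Suc q} = insert (\<pi> j) (\<pi> ` {..<q})"
  using assms
proof (induction q rule: dec_induct)
  case base
  have "move_to \<pi> p j ` {..<p} = \<pi> ` {..<p}" by (rule move_to_image_le) simp
  moreover have "move_to \<pi> p j p = \<pi> j" by (simp add: move_to_def)
  ultimately show ?case by (simp add: lessThan_Suc)
next
  case (step q)
  then have "move_to \<pi> p j (Suc q) = \<pi> q" by (simp add: move_to_def)
  then show ?case using step by (simp add: lessThan_Suc insert_commute)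
qed

lemma move_to_image_ge:
  assumes "p \<le> j" "j < q"
  shows "move_to \<pi> p j ` {..<q} = \<pi> ` {..<q}"
proof -
  have "j + 1 \<le> q" using assms by simp
  then show ?thesis
  proof (induction q rule: dec_induct)
    case base
    show ?case using move_to_image_between[of p j j \<pi>] assms by (simp add: lessThan_Suc)
  next
    case (step q)
    then have "move_to \<pi> p j q = \<pi> q" using assms by (simp add: move_to_def)
    then show ?case using step by (simp add: lessThan_Suc)
  qed
qed

lemma ordering_on_move_to:
  assumes "ordering_on m \<pi>" "p \<le> j" "j < m"
  shows "ordering_on m (move_to \<pi> p j)"
proof -
  have "move_to \<pi> p j ` {..<m} = {..<m}"
    using assms by (simp add: move_to_image_ge ordering_on_def bij_betw_def)
  then show ?thesis unfolding ordering_on_def bij_betw_def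
    by (simp add: eq_card_imp_inj_on)
qed

section \<open>Submodular functions, the base polytope and its greedy vectors\<close>

locale submodular_fun =
  fixes m :: nat and F :: "nat set \<Rightarrow> int"
  assumes sub: "\<And>A B. A \<subseteq> {..<m} \<Longrightarrow> B \<subseteq> {..<m} \<Longrightarrow> F (A \<inter> B) + F (A \<union> B) \<le> F A + F B"
    and F_empty: "F {} = 0"
begin

lemma image_sub: "ordering_on m \<pi> \<Longrightarrow> q \<le> m \<Longrightarrow> \<pi> ` {..<q} \<subseteq> {..<m}"
  by (auto intro: ordering_on_less)

lemma decreasing_marginals:
  assumes "A \<subseteq> B" "B \<subseteq> {..<m}" "v < m" "v \<notin> B"
  shows "F (insert v B) - F B \<le> F (insert v A) - F A"
proof -
  have "insert v A \<inter> B = A" "insert v A \<union> B = insert v B" using assms by auto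
  with sub[of "insert v A" B] assms show ?thesis by fastforce
qed

text \<open>Greedy vectors lie in the base polytope (Edmonds). Along the order, an element of
  \<open>X\<close> has at least as large a marginal after the part of the prefix inside
  \<open>X\<close> as after the whole prefix.\<close>

lemma greedy_sum_le_prefix:
  assumes \<pi>: "ordering_on m \<pi>" and X: "X \<subseteq> {..<m}" and "p \<le> m"
  shows "(\<Sum>v\<in>X \<inter> \<pi> ` {..<p}. greedy F m \<pi> v) \<le> F (X \<inter> \<pi> ` {..<p})"
  using \<open>p \<le> m\<close>
proof (induction p)
  case 0
  then show ?case by (simp add: F_empty)
next
  case (Suc p)
  have notin: "\<pi> p \<notin> \<pi> ` {..<p}" using ordering_on_inj[OF \<pi>] Suc.prems by fastforce
  show ?case
  proof (cases "\<pi> p \<in> X")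
    case True
    then have eq: "X \<inter> \<pi> ` {..<Suc p} = insert (\<pi> p) (X \<inter> \<pi> ` {..<p})"
      by (auto simp: lessThan_Suc)
    have "F (insert (\<pi> p) (\<pi> ` {..<p})) - F (\<pi> ` {..<p})
        \<le> F (insert (\<pi> p) (X \<inter> \<pi> ` {..<p})) - F (X \<inter> \<pi> ` {..<p})"
      by (rule decreasing_marginals) (use Suc.prems notin image_sub[OF \<pi>] ordering_on_less[OF \<pi>] in auto)
    then show ?thesis using Suc notin
      unfolding eq by (simp add: greedy_at[OF \<pi>] lessThan_Suc)
  next
    case False
    then have "X \<inter> \<pi> ` {..<Suc p} = X \<inter> \<pi> ` {..<p}" by (auto simp: lessThan_Suc)
    then show ?thesis using Suc by simp
  qed
qed

lemma greedy_sum_le: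
  assumes \<pi>: "ordering_on m \<pi>" and X: "X \<subseteq> {..<m}"
  shows "(\<Sum>v\<in>X. greedy F m \<pi> v) \<le> F X"
proof -
  have "X \<inter> \<pi> ` {..<m} = X" using \<pi> X by (auto simp: ordering_on_def bij_betw_def)
  then show ?thesis using greedy_sum_le_prefix[OF assms, of m] by simp
qed

text \<open>Telescoping: the polytope constraints belonging to prefixes are tight.\<close>

lemma greedy_sum_prefix:
  assumes \<pi>: "ordering_on m \<pi>" and "p \<le> m"
  shows "(\<Sum>v\<in>\<pi> ` {..<p}. greedy F m \<pi> v) = F (\<pi> ` {..<p})"
  using \<open>p \<le> m\<close>
proof (induction p)
  case 0
  then show ?case by (simp add: F_empty)
next
  case (Suc p)
  have "\<pi> p \<notin> \<pi> ` {..<p}" using ordering_on_inj[OF \<pi>] Suc.prems by fastforce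
  then show ?case using Suc by (simp add: greedy_at[OF \<pi>] lessThan_Suc)
qed

lemma greedy_sum: "ordering_on m \<pi> \<Longrightarrow> (\<Sum>v<m. greedy F m \<pi> v) = F {..<m}"
  using greedy_sum_prefix[of \<pi> m] by (simp add: ordering_on_def bij_betw_def)

text \<open>The moved element has fewer predecessors afterwards; conversely, each overtaken element
  acquires \<open>\<pi> j\<close> as a predecessor and loses.\<close>

lemma greedy_move_to_moved:
  assumes \<pi>: "ordering_on m \<pi>" and pj: "p \<le> j" "j < m"
  shows "greedy F m \<pi> (\<pi> j) \<le> greedy F m (move_to \<pi> p j) (\<pi> j)"
proof -
  let ?\<pi> = "move_to \<pi> p j"
  have "\<pi> j = ?\<pi> p" by (simp add: move_to_def)
  then have "greedy F m ?\<pi> (\<pi> j) = F (?\<pi> ` {..<Suc p}) - F (?\<pi> ` {..<p})"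
    using greedy_at[OF ordering_on_move_to[OF assms], of p] pj by simp
  also have "\<dots> = F (insert (\<pi> j) (\<pi> ` {..<p})) - F (\<pi> ` {..<p})"
    using pj by (simp add: move_to_image_le move_to_image_between)
  also have "\<dots> \<ge> F (insert (\<pi> j) (\<pi> ` {..<j})) - F (\<pi> ` {..<j})"
    by (rule decreasing_marginals)
      (use pj image_sub[OF \<pi>] ordering_on_less[OF \<pi>] ordering_on_inj[OF \<pi>] in fastforce)+
  finally show ?thesis using pj by (simp add: greedy_at[OF \<pi>] lessThan_Suc)
qed

lemma greedy_move_to_between:
  assumes \<pi>: "ordering_on m \<pi>" and pj: "p \<le> q" "q < j" "j < m"
  shows "greedy F m (move_to \<pi> p j) (\<pi> q) \<le> greedy F m \<pi> (\<pi> q)"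
proof -
  let ?\<pi> = "move_to \<pi> p j"
  have "\<pi> q = ?\<pi> (Suc q)" using pj by (simp add: move_to_def)
  then have "greedy F m ?\<pi> (\<pi> q) = F (?\<pi> ` {..<Suc (Suc q)}) - F (?\<pi> ` {..<Suc q})"
    using greedy_at[OF ordering_on_move_to[OF \<pi>], of p j "Suc q"] pj by simp
  also have "\<dots> = F (insert (\<pi> q) (insert (\<pi> j) (\<pi> ` {..<q}))) - F (insert (\<pi> j) (\<pi> ` {..<q}))"
    using pj move_to_image_between[of p q j \<pi>] move_to_image_between[of p "Suc q" j \<pi>]
    by (simp add: lessThan_Suc insert_commute)
  also have "\<dots> \<le> F (insert (\<pi> q) (\<pi> ` {..<q})) - F (\<pi> ` {..<q})"
    by (rule decreasing_marginals)
      (use pj image_sub[OF \<pi>] ordering_on_less[OF \<pi>] ordering_on_inj[OF \<pi>] in fastforce)+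
  finally show ?thesis using pj by (simp add: greedy_at[OF \<pi>] lessThan_Suc)
qed

lemma greedy_move_to_outside:
  assumes \<pi>: "ordering_on m \<pi>" and pj: "p \<le> j" "j < m" and q: "q < p \<or> j < q" "q < m"
  shows "greedy F m (move_to \<pi> p j) (\<pi> q) = greedy F m \<pi> (\<pi> q)"
proof -
  let ?\<pi> = "move_to \<pi> p j"
  have 1: "\<pi> q = ?\<pi> q" using pj q by (auto simp: move_to_def)
  have "greedy F m ?\<pi> (\<pi> q) = F (?\<pi> ` {..<Suc q}) - F (?\<pi> ` {..<q})"
    unfolding 1 using greedy_at[OF ordering_on_move_to[OF \<pi> pj]] q by simp
  moreover have "?\<pi> ` {..<Suc q} = \<pi> ` {..<Suc q}" "?\<pi> ` {..<q} = \<pi> ` {..<q}"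
    using q pj by (cases "q < p"; simp add: move_to_image_le move_to_image_ge)+
  ultimately show ?thesis using q by (simp add: greedy_at[OF \<pi>])
qed

text \<open>As a vector it is nonnegative at the moved element, nonpositive at the overtaken ones
  and zero elsewhere, with sum zero. For fixed \<open>p\<close> these vectors form a triangular
  system in \<open>j\<close>, which can be solved from the back with nonnegative
  multipliers.\<close>

definition swap_gain :: "(nat \<Rightarrow> nat) \<Rightarrow> nat \<Rightarrow> nat \<Rightarrow> nat \<Rightarrow> int" where
  "swap_gain \<pi> p j v = greedy F m (move_to \<pi> p j) v - greedy F m \<pi> v"

lemma swap_gain_sum:
  "ordering_on m \<pi> \<Longrightarrow> p \<le> j \<Longrightarrow> j < m \<Longrightarrow> (\<Sum>v<m. swap_gain \<pi> p j v) = 0"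
  by (simp add: swap_gain_def sum_subtractf greedy_sum ordering_on_move_to)

text \<open>The multipliers \<open>kap\<close> are found by back substitution in the triangular system that
  expresses a multiple of \<open>e_t - e_s\<close> by the vectors \<open>swap_gain \<pi> s j\<close>; \<open>r\<close> is the current
  right hand side, already correct at the positions \<open>\<ge> j0\<close>.\<close>

definition exchange :: "(nat \<Rightarrow> nat) \<Rightarrow> nat \<Rightarrow> nat \<Rightarrow> nat \<Rightarrow> (nat \<Rightarrow> int) \<Rightarrow> (nat \<Rightarrow> int) \<Rightarrow> bool" where
  "exchange \<pi> s t j0 kap r \<longleftrightarrow>
     (\<forall>v<m. r v = (\<Sum>j<m. kap j * swap_gain \<pi> s j v)) \<and>
     (\<forall>j<m. kap j \<ge> 0) \<and> (\<forall>j<m. j < j0 \<or> t < j \<longrightarrow> kap j = 0) \<and> (\<Sum>j<m. kap j) > 0 \<and>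
     (\<forall>p. j0 \<le> p \<and> p < t \<longrightarrow> r (\<pi> p) = 0) \<and> r (\<pi> t) \<ge> 0"

lemma swap_gain_moved: "ordering_on m \<pi> \<Longrightarrow> s \<le> j \<Longrightarrow> j < m \<Longrightarrow> swap_gain \<pi> s j (\<pi> j) \<ge> 0"
  using greedy_move_to_moved by (simp add: swap_gain_def)

lemma swap_gain_between:
  "ordering_on m \<pi> \<Longrightarrow> s \<le> q \<Longrightarrow> q < j \<Longrightarrow> j < m \<Longrightarrow> swap_gain \<pi> s j (\<pi> q) \<le> 0"
  using greedy_move_to_between by (simp add: swap_gain_def)

lemma swap_gain_outside:
  "ordering_on m \<pi> \<Longrightarrow> s \<le> j \<Longrightarrow> j < m \<Longrightarrow> q < s \<or> j < q \<Longrightarrow> q < m \<Longrightarrow> swap_gain \<pi> s j (\<pi> q) = 0"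
  using greedy_move_to_outside by (simp add: swap_gain_def)

text \<open>The moved element is the only place where the vector can be positive, and the entries
  sum to zero.\<close>

lemma swap_gain_eq_0:
  assumes \<pi>: "ordering_on m \<pi>" and j: "s \<le> j" "j < m" and 0: "swap_gain \<pi> s j (\<pi> j) = 0" and v: "v < m"
  shows "swap_gain \<pi> s j v = 0"
proof -
  have nonpos: "swap_gain \<pi> s j v \<le> 0" if "v < m" for v
  proof -
    obtain q where q: "q < m" "v = \<pi> q" using ordering_on_surj[OF \<pi> \<open>v < m\<close>] by blast
    consider "q = j" | "s \<le> q" "q < j" | "q < s \<or> j < q" by linarith
    then show ?thesis using q 0 swap_gain_between[OF \<pi>] swap_gain_outside[OF \<pi>] j by cases auto
  qed
  have "(\<Sum>v<m. - swap_gain \<pi> s j v) = 0" using swap_gain_sum[OF \<pi> j] by (simp add: sum_negf)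
  then have "\<forall>v\<in>{..<m}. - swap_gain \<pi> s j v = 0"
    using nonpos by (subst (asm) sum_nonneg_eq_0_iff) auto
  then show ?thesis using v by auto
qed

text \<open>If the pivot vanishes, moving \<open>\<pi> j\<close> does not change the greedy vector
  at all. The system then collapses to that single column and the exchange has amount zero:
  \<open>x\<close> keeps its direction, but an order is replaced by one of smaller disorder.\<close>

lemma exchange_single:
  assumes \<pi>: "ordering_on m \<pi>" and j: "s < j" "j \<le> t" "t < m"
    and 0: "j = t \<or> swap_gain \<pi> s j (\<pi> j) = 0"
    and r: "\<And>v. v < m \<Longrightarrow> r v = swap_gain \<pi> s j v"
    and kap: "\<And>i. i < m \<Longrightarrow> kap i = (if i = j then 1 else 0)"
  shows "exchange \<pi> s t j kap r"
proof -
  have pm: "\<pi> p < m" if "p < m" for p using ordering_on_less[OF \<pi> that] .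
  have sum: "(\<Sum>i<m. kap i * g i) = g j" for g
  proof -
    have "(\<Sum>i<m. kap i * g i) = (\<Sum>i<m. if i = j then g i else 0)"
      by (intro sum.cong) (auto simp: kap)
    then show ?thesis using j by simp
  qed
  have "r (\<pi> p) = 0" if "j \<le> p" "p < t" for p
    using that j 0 swap_gain_eq_0[OF \<pi> _ _ _ pm[of p], of s j] r[OF pm[of p]] by auto
  moreover have "r (\<pi> t) \<ge> 0"
  proof (cases "j = t")
    case True
    then show ?thesis using swap_gain_moved[OF \<pi>, of s j] j r[OF pm[of t]] by simp
  next
    case False
    then show ?thesis using 0 swap_gain_eq_0[OF \<pi> _ _ _ pm[of t], of s j] r[OF pm[of t]] j by simp
  qed
  ultimately show ?thesis
    unfolding exchange_def using r sum[of "\<lambda>_. 1"] sum j by (auto simp: kap)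
qed

text \<open>\<open>kap\<close> is supported behind \<open>j\<close>, and the columns there are
  nonpositive at \<open>\<pi> j\<close>; hence \<open>r (\<pi> j) \<le> 0\<close>, the multiplier
  \<open>- r (\<pi> j)\<close> is nonnegative, and scaling by the positive pivot avoids a
  division.\<close>

lemma exchange_step:
  assumes \<pi>: "ordering_on m \<pi>" and j: "s < j" "j < t" "t < m"
    and ex: "exchange \<pi> s t (Suc j) kap r"
    and pos: "swap_gain \<pi> s j (\<pi> j) \<noteq> 0"
    and r': "\<And>v. v < m \<Longrightarrow> r' v = swap_gain \<pi> s j (\<pi> j) * r v + (- r (\<pi> j)) * swap_gain \<pi> s j v"
    and kap': "\<And>i. i < m \<Longrightarrow> kap' i = swap_gain \<pi> s j (\<pi> j) * kap i + (if i = j then - r (\<pi> j) else 0)"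
  shows "exchange \<pi> s t j kap' r'"
proof -
  let ?a = "swap_gain \<pi> s j (\<pi> j)"
  have pm: "\<pi> p < m" if "p < m" for p using ordering_on_less[OF \<pi> that] .
  have a: "?a > 0" using swap_gain_moved[OF \<pi>, of s j] pos j by simp
  note ex = ex[unfolded exchange_def]
  have rj: "r (\<pi> j) \<le> 0"
  proof -
    have "kap i * swap_gain \<pi> s i (\<pi> j) \<le> 0" if "i < m" for i
      using ex that swap_gain_between[OF \<pi>, of s j i] j
      by (cases "i \<le> j") (auto simp: mult_nonneg_nonpos)
    then have "(\<Sum>i<m. kap i * swap_gain \<pi> s i (\<pi> j)) \<le> 0" by (intro sum_nonpos) simp
    then show ?thesis using ex pm[of j] j by simp
  qed
  have sum: "(\<Sum>i<m. kap' i * g i) = ?a * (\<Sum>i<m. kap i * g i) + (- r (\<pi> j)) * g j" for g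
  proof -
    have "(\<Sum>i<m. kap' i * g i) = (\<Sum>i<m. ?a * (kap i * g i) + (if i = j then (- r (\<pi> j)) * g i else 0))"
      by (intro sum.cong) (auto simp: kap' algebra_simps)
    then show ?thesis using j by (simp add: sum.distrib sum_distrib_left)
  qed
  \<comment> \<open>The new column vanishes behind \<open>j\<close>, so the zeros already achieved
    persist.\<close>
  have out: "r (\<pi> p) = 0 \<and> swap_gain \<pi> s j (\<pi> p) = 0" if "j < p" "p < t" for p
    using ex that swap_gain_outside[OF \<pi>, of s j p] j by auto
  show ?thesis unfolding exchange_def
  proof (intro conjI allI impI)
    fix v assume "v < m" then show "r' v = (\<Sum>j<m. kap' j * swap_gain \<pi> s j v)"
      using ex by (simp add: r' sum)
  next
    fix i assume "i < m" then show "kap' i \<ge> 0" using ex a rj by (simp add: kap')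
  next
    fix i assume "i < m" "i < j \<or> t < i" then show "kap' i = 0" using ex j by (auto simp: kap')
  next
    have "?a * (\<Sum>j<m. kap j) > 0" using ex a by simp
    then show "0 < (\<Sum>j<m. kap' j)" using sum[of "\<lambda>_. 1"] rj by simp
  next
    fix p assume p: "j \<le> p \<and> p < t"
    show "r' (\<pi> p) = 0"
    proof (cases "p = j")
      case True
      then show ?thesis using r'[OF pm[of j]] j by simp
    next
      case False
      then show ?thesis using r'[OF pm[of p]] out[of p] p j by simp
    qed
  next
    show "0 \<le> r' (\<pi> t)"
      using r'[OF pm[of t]] swap_gain_outside[OF \<pi>, of s j t] ex a j by simp
  qed
qed

text \<open>After the last step the right hand side can be nonzero at the positions \<open>s\<close>
  and \<open>t\<close> only, and its entries sum to zero. Replacing the order by the weighted moved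
  orders thus transfers the amount \<open>r (\<pi> t)\<close> from \<open>\<pi> s\<close> to
  \<open>\<pi> t\<close>.\<close>

lemma exchange_final:
  assumes \<pi>: "ordering_on m \<pi>" and st: "s < t" "t < m" and ex: "exchange \<pi> s t (Suc s) kap r" and v: "v < m"
  shows "(\<Sum>j<m. kap j * greedy F m (move_to \<pi> s j) v) =
    (\<Sum>j<m. kap j) * greedy F m \<pi> v + (if v = \<pi> t then r (\<pi> t) else if v = \<pi> s then - r (\<pi> t) else 0)"
proof -
  have pm: "\<pi> p < m" if "p < m" for p using ordering_on_less[OF \<pi> that] .
  note ex = ex[unfolded exchange_def]
  have kap0: "j \<le> s \<or> t < j \<Longrightarrow> j < m \<Longrightarrow> kap j = 0" for j using ex by auto
  have outside: "r (\<pi> p) = 0" if "p < m" "p \<noteq> s" "p \<noteq> t" for p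
  proof (cases "s < p \<and> p < t")
    case False
    with that have p: "p < s \<or> t < p" by auto
    have "kap j * swap_gain \<pi> s j (\<pi> p) = 0" if "j < m" for j
    proof (cases "j \<le> s \<or> t < j")
      case False
      then have "swap_gain \<pi> s j (\<pi> p) = 0"
        by (intro swap_gain_outside[OF \<pi>]) (use that p \<open>p < m\<close> in auto)
      then show ?thesis by simp
    qed (use kap0 that in auto)
    then have "(\<Sum>j<m. kap j * swap_gain \<pi> s j (\<pi> p)) = 0" by (intro sum.neutral) simp
    then show ?thesis using ex pm[OF that(1)] by simp
  qed (use ex in auto)
  have "(\<Sum>v<m. r v) = (\<Sum>v<m. \<Sum>j<m. kap j * swap_gain \<pi> s j v)" using ex by simp
  also have "\<dots> = (\<Sum>j<m. kap j * (\<Sum>v<m. swap_gain \<pi> s j v))"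
    by (subst sum.swap) (simp add: sum_distrib_left)
  also have "\<dots> = 0"
  proof (intro sum.neutral ballI)
    fix j assume "j \<in> {..<m}"
    then show "kap j * (\<Sum>v<m. swap_gain \<pi> s j v) = 0"
      using kap0[of j] swap_gain_sum[OF \<pi>, of s j] by (cases "j \<le> s") auto
  qed
  finally have "(\<Sum>v<m. r v) = 0" .
  moreover have "(\<Sum>v<m. r v) = (\<Sum>p<m. r (\<pi> p))"
    using \<pi> unfolding ordering_on_def by (rule sum.reindex_bij_betw[symmetric])
  moreover have "(\<Sum>p<m. r (\<pi> p)) = (\<Sum>p\<in>{s, t}. r (\<pi> p))"
    by (rule sum.mono_neutral_right) (use st outside in auto)
  ultimately have rs: "r (\<pi> s) = - r (\<pi> t)" using st by simp
  have "r v = (if v = \<pi> t then r (\<pi> t) else if v = \<pi> s then - r (\<pi> t) else 0)"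
    using ordering_on_surj[OF \<pi> v] outside rs by auto
  moreover have "r v = (\<Sum>j<m. kap j * greedy F m (move_to \<pi> s j) v) - (\<Sum>j<m. kap j) * greedy F m \<pi> v"
    using ex v by (simp add: swap_gain_def right_diff_distrib sum_subtractf sum_distrib_right)
  ultimately show ?thesis by linarith
qed

end

lemma ordering_on_cong: "(\<And>p. p < m \<Longrightarrow> \<pi> p = \<pi>' p) \<Longrightarrow> ordering_on m \<pi> \<longleftrightarrow> ordering_on m \<pi>'"
  unfolding ordering_on_def by (intro bij_betw_cong) simp

lemma greedy_cong:
  assumes \<pi>: "ordering_on m \<pi>" and eq: "\<And>p. p < m \<Longrightarrow> \<pi> p = \<pi>' p" and v: "v < m"
  shows "greedy F m \<pi> v = greedy F m \<pi>' v"
proof -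
  have \<pi>': "ordering_on m \<pi>'" using \<pi> eq ordering_on_cong by blast
  obtain p where p: "p < m" "v = \<pi> p" using ordering_on_surj[OF \<pi> v] by blast
  have "\<pi> ` {..<Suc p} = \<pi>' ` {..<Suc p}" "\<pi> ` {..<p} = \<pi>' ` {..<p}"
    using p eq by (auto intro!: image_cong)
  then show ?thesis using greedy_at[OF \<pi> p(1), of F] greedy_at[OF \<pi>' p(1), of F] p eq by simp
qed

text \<open>Mixed radix notation: with the lower digit below the radix, lexicographic comparison
  becomes comparison of numbers.\<close>

lemma lex_less_mult_add:
  fixes a b :: nat
  assumes "a < a' \<or> a = a' \<and> b < b'" "b < R"
  shows "a * R + b < a' * R + b'"
  using assms(1)
proof
  assume "a < a'"
  then have "Suc a * R \<le> a' * R" by (intro mult_right_mono) auto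
  then show ?thesis using assms(2) by simp
qed auto

section \<open>Labels and progress\<close>

text \<open>Elements of label \<open>m\<close> are retired; the gap argument of
  \<open>minimum_level_set\<close> copes with their negative values.\<close>

definition candidates :: "nat \<Rightarrow> (nat \<Rightarrow> int) \<Rightarrow> (nat \<Rightarrow> nat) \<Rightarrow> nat set" where
  "candidates m x d = {v. v < m \<and> x v < 0 \<and> d v < m}"

text \<open>Ties between equal labels go to the larger index, which makes the choice unique and lets
  \<open>key\<close> encode it in one number.\<close>

definition selected :: "nat \<Rightarrow> (nat \<Rightarrow> int) \<Rightarrow> (nat \<Rightarrow> nat) \<Rightarrow> nat \<Rightarrow> bool" where
  "selected m x d t \<longleftrightarrow> t \<in> candidates m x d \<and>
     (\<forall>v \<in> candidates m x d. d v < d t \<or> d v = d t \<and> v \<le> t)"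

text \<open>Such a pair is an admissible arc of push-relabel: \<open>t\<close> can be raised at the
  expense of an element one label lower.\<close>

definition out_of_place :: "nat \<Rightarrow> (nat \<Rightarrow> nat) \<Rightarrow> nat \<Rightarrow> (nat \<Rightarrow> nat) \<Rightarrow> bool" where
  "out_of_place m d t \<pi> \<longleftrightarrow> (\<exists>p q. p < q \<and> q < m \<and> \<pi> q = t \<and> d (\<pi> p) + 1 = d t)"

text \<open>Large labels late in the order make the sum large; an order created by an exchange has a
  value one smaller than the order it comes from.\<close>

definition disorder :: "nat \<Rightarrow> (nat \<Rightarrow> nat) \<Rightarrow> (nat \<Rightarrow> nat) \<Rightarrow> nat" where
  "disorder m d \<pi> = (\<Sum>p<m. p * d (\<pi> p))"

definition bad_orders :: "nat \<Rightarrow> (nat \<Rightarrow> nat) \<Rightarrow> nat \<Rightarrow> (nat \<Rightarrow> nat \<Rightarrow> nat) \<Rightarrow> (nat \<Rightarrow> int) \<Rightarrow> nat set" where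
  "bad_orders m d t ord lam = {j. j < m \<and> lam j > 0 \<and> out_of_place m d t (ord j)}"

definition max_disorder where
  "max_disorder m d t ord lam = Max (insert 0 ((\<lambda>j. Suc (disorder m d (ord j))) ` bad_orders m d t ord lam))"

definition worst_orders where
  "worst_orders m d t ord lam =
     {j \<in> bad_orders m d t ord lam. Suc (disorder m d (ord j)) = max_disorder m d t ord lam}"

definition key where
  "key m x d = Max ((\<lambda>v. d v * m + v) ` candidates m x d)"

text \<open>The lexicographic order of the label deficit, the selected element \<open>t\<close>, the largest disorder of
  an order in which \<open>t\<close> can be exchanged, and the number of orders attaining it. The offset in
  \<open>max_disorder\<close> makes the absence of such orders smaller than disorder \<open>0\<close>.\<close>

definition progress :: "nat \<Rightarrow> (nat \<Rightarrow> int) \<Rightarrow> (nat \<Rightarrow> nat) \<Rightarrow> (nat \<Rightarrow> nat \<Rightarrow> nat) \<Rightarrow> (nat \<Rightarrow> int) \<Rightarrow> nat" where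
  "progress m x d ord lam = (if candidates m x d = {} then 0 else
     let t = key m x d mod m in
     (((\<Sum>v<m. m - d v) * (m * m + 1) + Suc (key m x d)) * (m ^ 3 + 2) + max_disorder m d t ord lam)
       * (m + 1) + card (worst_orders m d t ord lam))"

lemma finite_candidates [simp]: "finite (candidates m x d)"
  by (simp add: candidates_def)

lemma finite_bad_orders [simp]: "finite (bad_orders m d t ord lam)"
  by (simp add: bad_orders_def)

lemma mult_add_less: "a < m \<Longrightarrow> b < m \<Longrightarrow> a * m + b < m * (m :: nat)"
  using lex_less_mult_add[of a m b 0 m] by simp

lemma key_less: "candidates m x d \<noteq> {} \<Longrightarrow> key m x d < m * m"
  unfolding key_def by (subst Max_less_iff) (auto simp: candidates_def intro: mult_add_less)

lemma key_le_iff: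
  "candidates m x d \<noteq> {} \<Longrightarrow> key m x d \<le> k \<longleftrightarrow> (\<forall>v \<in> candidates m x d. d v * m + v \<le> k)"
  unfolding key_def by (subst Max_le_iff) auto

lemma selected_key:
  assumes "selected m x d t"
  shows "key m x d = d t * m + t" "key m x d mod m = t"
proof -
  have t: "t \<in> candidates m x d" using assms by (simp add: selected_def)
  show "key m x d = d t * m + t" unfolding key_def
  proof (rule Max_eqI)
    fix y assume "y \<in> (\<lambda>v. d v * m + v) ` candidates m x d"
    then obtain v where v: "v \<in> candidates m x d" "y = d v * m + v" by blast
    then have "d v < d t \<or> d v = d t \<and> v < Suc t" using assms by (auto simp: selected_def)
    then have "d v * m + v < d t * m + Suc t"
      by (rule lex_less_mult_add) (use v in \<open>simp add: candidates_def\<close>)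
    then show "y \<le> d t * m + t" using v by simp
  qed (use t in auto)
  then show "key m x d mod m = t" using t by (simp add: candidates_def)
qed

lemma max_disorder_le_iff:
  "max_disorder m d t ord lam \<le> k \<longleftrightarrow> (\<forall>j \<in> bad_orders m d t ord lam. Suc (disorder m d (ord j)) \<le> k)"
  unfolding max_disorder_def by (subst Max_le_iff) auto

lemma disorder_le:
  assumes "ordering_on m \<pi>" and "\<And>v. v < m \<Longrightarrow> d v \<le> m"
  shows "disorder m d \<pi> \<le> m ^ 3"
proof -
  have "disorder m d \<pi> \<le> (\<Sum>p<m. m * m)" unfolding disorder_def
    by (intro sum_mono mult_mono) (use assms ordering_on_less in auto)
  then show ?thesis by (simp add: power3_eq_cube)
qed

lemma disorder_cong: "(\<And>p. p < m \<Longrightarrow> \<pi> p = \<pi>' p) \<Longrightarrow> disorder m d \<pi> = disorder m d \<pi>'"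
  unfolding disorder_def by (intro sum.cong) auto

lemma out_of_place_cong: "(\<And>p. p < m \<Longrightarrow> \<pi> p = \<pi>' p) \<Longrightarrow> out_of_place m d t \<pi> \<Longrightarrow> out_of_place m d t \<pi>'"
  unfolding out_of_place_def by (metis less_trans)

context submodular_fun begin

text \<open>The weights are not normalized: \<open>x\<close> is their sum times a point of the base
  polytope. This leaves the signs unchanged and needs no fractions.\<close>

definition combination :: "(nat \<Rightarrow> nat \<Rightarrow> nat) \<Rightarrow> (nat \<Rightarrow> int) \<Rightarrow> (nat \<Rightarrow> nat \<Rightarrow> int) \<Rightarrow> (nat \<Rightarrow> int) \<Rightarrow> bool" where
  "combination ord lam B x \<longleftrightarrow> (\<forall>j<m. lam j \<ge> 0) \<and>
     (\<forall>j<m. lam j > 0 \<longrightarrow> ordering_on m (ord j) \<and> (\<forall>v<m. B j v = greedy F m (ord j) v)) \<and>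
     (\<forall>v<m. x v = (\<Sum>j<m. lam j * B j v)) \<and> (\<Sum>j<m. lam j) > 0"

text \<open>Valid distance labels as in push-relabel: the elements with \<open>x > 0\<close>, which
  can give something away, are the targets at distance zero.\<close>

definition labelling :: "(nat \<Rightarrow> nat) \<Rightarrow> (nat \<Rightarrow> nat \<Rightarrow> nat) \<Rightarrow> (nat \<Rightarrow> int) \<Rightarrow> (nat \<Rightarrow> int) \<Rightarrow> bool" where
  "labelling d ord lam x \<longleftrightarrow> (\<forall>v<m. d v \<le> m \<and> (x v > 0 \<longrightarrow> d v = 0)) \<and>
     (\<forall>j<m. lam j > 0 \<longrightarrow> (\<forall>p q. p < q \<longrightarrow> q < m \<longrightarrow> d (ord j q) \<le> d (ord j p) + 1))"

lemma max_disorder_less: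
  assumes "combination ord lam B x" "labelling d ord lam x"
  shows "max_disorder m d t ord lam < m ^ 3 + 2"
proof -
  have "max_disorder m d t ord lam \<le> m ^ 3 + 1"
    unfolding max_disorder_le_iff
    using assms disorder_le[of m _ d] by (auto simp: bad_orders_def combination_def labelling_def)
  then show ?thesis by simp
qed

lemma card_worst_orders: "card (worst_orders m d t ord lam) < m + 1"
proof -
  have "worst_orders m d t ord lam \<subseteq> {..<m}" by (auto simp: worst_orders_def bad_orders_def)
  then have "card (worst_orders m d t ord lam) \<le> card {..<m}" by (intro card_mono) auto
  then show ?thesis by simp
qed

text \<open>The measure is a number with digits in mixed radix, so one strict lexicographic drop
  suffices. The lower digits may be compared for one and the same \<open>t\<close>, because
  \<open>t\<close> is the remainder of \<open>key\<close> modulo \<open>m\<close> and they matter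
  only if the keys agree.\<close>

lemma progress_less:
  assumes "combination ord' lam' B' x'" "labelling d' ord' lam' x'" and "selected m x d t"
    and "candidates m x' d' \<noteq> {} \<Longrightarrow>
      (\<Sum>v<m. m - d' v) < (\<Sum>v<m. m - d v) \<or> (\<Sum>v<m. m - d' v) = (\<Sum>v<m. m - d v) \<and>
      (key m x' d' < key m x d \<or> key m x' d' = key m x d \<and>
      (max_disorder m d' t ord' lam' < max_disorder m d t ord lam \<or>
       max_disorder m d' t ord' lam' = max_disorder m d t ord lam \<and>
       card (worst_orders m d' t ord' lam') < card (worst_orders m d t ord lam)))"
  shows "progress m x' d' ord' lam' < progress m x d ord lam"
proof (cases "candidates m x' d' = {}")
  case True
  then show ?thesis using assms(3) by (auto simp: progress_def selected_def Let_def)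
next
  case False
  have ne: "candidates m x d \<noteq> {}" using assms(3) by (auto simp: selected_def)
  have t: "key m x d mod m = t" using selected_key[OF assms(3)] by simp
  let ?t' = "key m x' d' mod m"
  let ?S = "\<lambda>d. \<Sum>v<m. m - d v"
  have P: "progress m x d ord lam = ((?S d * (m * m + 1) + Suc (key m x d)) * (m ^ 3 + 2)
       + max_disorder m d t ord lam) * (m + 1) + card (worst_orders m d t ord lam)"
    using ne by (simp add: progress_def t)
  have P': "progress m x' d' ord' lam' = ((?S d' * (m * m + 1) + Suc (key m x' d')) * (m ^ 3 + 2)
       + max_disorder m d' ?t' ord' lam') * (m + 1) + card (worst_orders m d' ?t' ord' lam')"
    using False by (simp add: progress_def Let_def)
  have k: "Suc (key m x' d') < m * m + 1" using key_less[OF False] by simp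
  show ?thesis unfolding P P'
  proof (intro lex_less_mult_add[OF _ card_worst_orders])
    consider (1) "?S d' < ?S d \<or> ?S d' = ?S d \<and> key m x' d' < key m x d"
      | (2) "?S d' = ?S d" "key m x' d' = key m x d"
        "max_disorder m d' t ord' lam' < max_disorder m d t ord lam \<or>
       max_disorder m d' t ord' lam' = max_disorder m d t ord lam \<and>
       card (worst_orders m d' t ord' lam') < card (worst_orders m d t ord lam)"
      using assms(4)[OF False] by blast
    then show "(?S d' * (m * m + 1) + Suc (key m x' d')) * (m ^ 3 + 2) + max_disorder m d' ?t' ord' lam'
        < (?S d * (m * m + 1) + Suc (key m x d)) * (m ^ 3 + 2) + max_disorder m d t ord lam \<or>
      (?S d' * (m * m + 1) + Suc (key m x' d')) * (m ^ 3 + 2) + max_disorder m d' ?t' ord' lam'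
        = (?S d * (m * m + 1) + Suc (key m x d)) * (m ^ 3 + 2) + max_disorder m d t ord lam \<and>
      card (worst_orders m d' ?t' ord' lam') < card (worst_orders m d t ord lam)"
    proof cases
      case 1
      then have "?S d' * (m * m + 1) + Suc (key m x' d') < ?S d * (m * m + 1) + Suc (key m x d)"
        by (intro lex_less_mult_add k) auto
      then show ?thesis
        by (intro disjI1 lex_less_mult_add[OF disjI1 max_disorder_less[OF assms(1,2)]])
    next
      case 2
      then have "?t' = t" using t by simp
      with 2 show ?thesis by auto
    qed
  qed
qed

text \<open>The exponent 8 is 2 + 2 + 3 + 1: the label deficit and the key range over about
  \<open>m ^ 2\<close> values each, the disorder over about \<open>m ^ 3\<close>, the number of
  worst orders over \<open>m + 1\<close>.\<close>

lemma progress_bound: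
  assumes "combination ord lam B x" "labelling d ord lam x" "m > 0"
  shows "progress m x d ord lam \<le> (m + 1) ^ 8"
proof (cases "candidates m x d = {}")
  case False
  let ?S = "\<Sum>v<m. m - d v"
  have "?S \<le> (\<Sum>v<m. m)" by (intro sum_mono) auto
  then have S: "?S < m * m + 1" by simp
  have 1: "?S * (m * m + 1) + Suc (key m x d) < (m * m + 1) * (m * m + 1) + 0"
    by (rule lex_less_mult_add) (use S key_less[OF False] in auto)
  have 2: "(?S * (m * m + 1) + Suc (key m x d)) * (m ^ 3 + 2) + max_disorder m d t ord lam
      < ((m * m + 1) * (m * m + 1) + 0) * (m ^ 3 + 2) + 0" for t
    by (rule lex_less_mult_add) (use 1 max_disorder_less[OF assms(1,2)] in auto)
  have "progress m x d ord lam < (((m * m + 1) * (m * m + 1) + 0) * (m ^ 3 + 2) + 0) * (m + 1) + 0"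
    unfolding progress_def Let_def using False
    by (simp only: if_False) (rule lex_less_mult_add[OF disjI1[OF 2] card_worst_orders])
  also have "\<dots> = ((m * m + 1) * (m * m + 1)) * (m ^ 3 + 2) * (m + 1)" by simp
  also have "\<dots> \<le> ((m + 1) ^ 2 * (m + 1) ^ 2) * (m + 1) ^ 3 * (m + 1)"
  proof (intro mult_mono)
    show "m ^ 3 + 2 \<le> (m + 1) ^ 3" using \<open>m > 0\<close> by (simp add: power3_eq_cube algebra_simps)
  qed (simp_all add: power2_eq_square)
  also have "\<dots> = (m + 1) ^ 8"
  proof -
    have "a ^ 2 * a ^ 2 * a ^ 3 * a = a ^ 8" for a :: nat by (simp add: eval_nat_numeral)
    then show ?thesis .
  qed
  finally show ?thesis by simp
qed (simp add: progress_def)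

text \<open>Every element before \<open>t\<close> has label at least \<open>d t - 1\<close> by
  validity, and none has exactly that label, so raising \<open>t\<close> by one keeps the slope
  bound. Being negative, \<open>t\<close> may carry a positive label.\<close>

lemma labelling_relabel:
  assumes lab: "labelling d ord lam x" and com: "combination ord lam B x"
    and t: "selected m x d t" and none: "bad_orders m d t ord lam = {}"
  shows "labelling (d(t := d t + 1)) ord lam x"
    and "progress m x (d(t := d t + 1)) ord lam < progress m x d ord lam"
proof -
  have tm: "t < m" "x t < 0" "d t < m" using t by (auto simp: selected_def candidates_def)
  show lab': "labelling (d(t := d t + 1)) ord lam x"
    unfolding labelling_def
  proof (intro conjI allI impI)
    fix j p q assume j: "j < m" "lam j > 0" and pq: "p < q" "q < m"
    have ord: "ordering_on m (ord j)" using com j by (auto simp: combination_def)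
    have le: "d (ord j q) \<le> d (ord j p) + 1" using lab j pq by (auto simp: labelling_def)
    have "ord j p \<noteq> ord j q" using ordering_on_inj[OF ord, of p q] pq by simp
    moreover have "d (ord j p) + 1 \<noteq> d t" if "ord j q = t"
      using none j pq that by (auto simp: bad_orders_def out_of_place_def)
    ultimately show "(d(t := d t + 1)) (ord j q) \<le> (d(t := d t + 1)) (ord j p) + 1"
      using le by auto
  qed (use lab tm in \<open>auto simp: labelling_def\<close>)
  have "(\<Sum>v<m. m - (d(t := d t + 1)) v) < (\<Sum>v<m. m - d v)"
    by (rule sum_strict_mono_ex1) (use tm in auto)
  then show "progress m x (d(t := d t + 1)) ord lam < progress m x d ord lam"
    by (intro progress_less[OF com lab' t]) auto
qed

text \<open>An order is improved by moving an element with the label of \<open>t\<close> before the last earlier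
  element with the preceding label: among positions \<open>s\<close> to \<open>q\<close>, only the labels at \<open>s\<close> and
  \<open>s + 1\<close> get exchanged.\<close>

lemma move_to_labels:
  fixes d :: "nat \<Rightarrow> nat"
  assumes "s < p" "p \<le> q" and l: "\<And>i. s < i \<Longrightarrow> i \<le> q \<Longrightarrow> d (\<pi> i) = l" and "d (\<pi> s) + 1 = l"
  shows "d (move_to \<pi> s p i) = (if i = s then l else if i = s + 1 then l - 1 else d (\<pi> i))"
proof -
  consider "i = s" | "i = s + 1" | "s + 1 < i" "i \<le> p" | "i < s \<or> p < i" by linarith
  then show ?thesis
  proof cases
    case 1
    then show ?thesis using l[of p] assms(1,2) by (simp add: move_to_def)
  next
    case 2
    then show ?thesis using assms(1,4) by (simp add: move_to_def)
  next
    case 3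
    then have "move_to \<pi> s p i = \<pi> (i - 1)" by (simp add: move_to_def)
    moreover have "d (\<pi> (i - 1)) = l" "d (\<pi> i) = l" by (rule l; use 3 assms(2) in simp)+
    ultimately show ?thesis using 3 by simp
  next
    case 4
    then have "i \<noteq> s + 1" "i \<noteq> s" using assms(1) by auto
    then show ?thesis using 4 by (auto simp: move_to_def)
  qed
qed

text \<open>Only the labels at \<open>s\<close> and \<open>s + 1\<close> are interchanged, from
  \<open>l - 1, l\<close> to \<open>l, l - 1\<close>; weighting by the position turns this into a
  drop of exactly one.\<close>

lemma disorder_move_to:
  assumes "s < p" "p \<le> q" "q < m" and l: "\<And>i. s < i \<Longrightarrow> i \<le> q \<Longrightarrow> d (\<pi> i) = l" and s: "d (\<pi> s) + 1 = l"
  shows "Suc (disorder m d (move_to \<pi> s p)) = disorder m d \<pi>"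
proof -
  let ?\<pi> = "move_to \<pi> s p"
  have split: "(\<Sum>i<m. f i) = f s + f (s + 1) + (\<Sum>i\<in>{..<m} - {s, s + 1}. f i)" for f :: "nat \<Rightarrow> nat"
  proof -
    have "{..<m} = insert s (insert (s + 1) ({..<m} - {s, s + 1}))" using assms by auto
    then have "(\<Sum>i<m. f i) = (\<Sum>i\<in>insert s (insert (s + 1) ({..<m} - {s, s + 1})). f i)" by simp
    also have "\<dots> = f s + f (s + 1) + (\<Sum>i\<in>{..<m} - {s, s + 1}. f i)"
      by (subst sum.insert; simp)+
    finally show ?thesis .
  qed
  have l1: "d (\<pi> (s + 1)) = l" using assms by (intro l) auto
  have eq: "d (move_to \<pi> s p i) = (if i = s then l else if i = s + 1 then l - 1 else d (\<pi> i))" for i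
    by (rule move_to_labels[where q = q]) (use assms in auto)
  have "(\<Sum>i\<in>{..<m} - {s, s + 1}. i * d (?\<pi> i)) = (\<Sum>i\<in>{..<m} - {s, s + 1}. i * d (\<pi> i))"
    by (intro sum.cong) (simp_all add: eq)
  then have "disorder m d ?\<pi> = s * l + (s + 1) * (l - 1) + (\<Sum>i\<in>{..<m} - {s, s + 1}. i * d (\<pi> i))"
    unfolding disorder_def split[of "\<lambda>i. i * d (?\<pi> i)"] by (simp add: eq)
  moreover have "disorder m d \<pi> = s * (l - 1) + (s + 1) * l + (\<Sum>i\<in>{..<m} - {s, s + 1}. i * d (\<pi> i))"
    unfolding disorder_def split[of "\<lambda>i. i * d (\<pi> i)"] l1 using s by auto
  moreover have "Suc (s * l + (s + 1) * (l - 1)) = s * (l - 1) + (s + 1) * l"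
    using s by (cases l) auto
  ultimately show ?thesis by simp
qed

text \<open>Two kinds of comparison are new: label \<open>l\<close> at \<open>s\<close> with earlier
  elements, which already preceded \<open>l\<close> at \<open>s + 1\<close>, and label
  \<open>l - 1\<close> at \<open>s + 1\<close> with later elements, which already followed
  \<open>l - 1\<close> at \<open>s\<close>.\<close>

lemma arcs_move_to:
  fixes d :: "nat \<Rightarrow> nat"
  assumes "s < p" "p \<le> q" "q < m" and l: "\<And>i. s < i \<Longrightarrow> i \<le> q \<Longrightarrow> d (\<pi> i) = l" and s: "d (\<pi> s) + 1 = l"
    and arcs: "\<And>i j. i < j \<Longrightarrow> j < m \<Longrightarrow> d (\<pi> j) \<le> d (\<pi> i) + 1" and ij: "i < j" "j < m"
  shows "d (move_to \<pi> s p j) \<le> d (move_to \<pi> s p i) + 1"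
proof -
  have eq: "d (move_to \<pi> s p i) = (if i = s then l else if i = s + 1 then l - 1 else d (\<pi> i))" for i
    by (rule move_to_labels[where q = q]) (use assms in auto)
  have l1: "d (\<pi> (s + 1)) = l" using assms by (intro l) auto
  have as: "s < j \<Longrightarrow> d (\<pi> j) \<le> l" using arcs[of s j] s ij by simp
  have b1: "i < s \<Longrightarrow> l \<le> d (\<pi> i) + 1" using arcs[of i "s + 1"] assms(1-3) l1 by simp
  have b2: "i < s \<Longrightarrow> l \<le> d (\<pi> i) + 2" using arcs[of i s] s assms(1-3) by linarith
  have "i < s + 1 \<Longrightarrow> i \<noteq> s \<Longrightarrow> i < s" by simp
  with as b1 b2 arcs[OF ij] show ?thesis unfolding eq using ij s by auto
qed

text \<open>Stated for arbitrary data so that the scalings \<open>c0\<close>, \<open>c1\<close>,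
  \<open>g\<close> of the program and its replacement of columns fit in. The only element that can
  become a candidate is \<open>ord i s\<close>, whose label is smaller than that of
  \<open>t\<close>, so the key does not rise. If \<open>t\<close> reaches zero, the key drops;
  otherwise the order \<open>i\<close> has lost its weight, and the orders that come in have smaller
  disorder.\<close>

lemma exchange_progress:
  fixes lam1 x1 x' :: "nat \<Rightarrow> int"
  assumes com: "combination ord lam B x" and lab: "labelling d ord lam x" and t: "selected m x d t"
    and i: "i \<in> bad_orders m d t ord lam"
    and imax: "\<And>j. j \<in> bad_orders m d t ord lam \<Longrightarrow> disorder m d (ord j) \<le> disorder m d (ord i)"
    and sq: "s < q" "q < m" "ord i q = t" "d (ord i s) + 1 = d t"
    and last: "\<And>p. s < p \<Longrightarrow> p < q \<Longrightarrow> d (ord i p) + 1 \<noteq> d t"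
    and c: "c0 > 0" "c1 \<ge> 0" "\<delta> \<ge> 0"
    and x1: "\<And>v. v < m \<Longrightarrow> x1 v = c0 * x v + c1 * (if v = t then \<delta> else if v = ord i s then - \<delta> else 0)"
    and x1t: "x1 t \<le> 0" and full: "lam1 i = 0 \<or> x1 t = 0"
    and lam1: "\<And>j. j < m \<Longrightarrow> lam1 j > 0 \<Longrightarrow> lam j > 0"
    and g: "g > 0" "\<And>v. v < m \<Longrightarrow> x' v = g * x1 v"
    and lam': "\<And>j. j < m \<Longrightarrow> lam' j \<ge> 0" "\<And>v. v < m \<Longrightarrow> x' v = (\<Sum>j<m. lam' j * B' j v)"
       "(\<Sum>j<m. lam' j) > 0"
    and ord': "\<And>j. j < m \<Longrightarrow> lam' j > 0 \<Longrightarrow>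
       lam1 j > 0 \<and> (\<forall>p<m. ord' j p = ord j p) \<and> (\<forall>v<m. B' j v = B j v) \<or>
       (\<exists>p. s < p \<and> p \<le> q \<and> (\<forall>r<m. ord' j r = move_to (ord i) s p r) \<and>
          (\<forall>v<m. B' j v = greedy F m (move_to (ord i) s p) v))"
  shows "combination ord' lam' B' x'" and "labelling d ord' lam' x'"
    and "progress m x' d ord' lam' < progress m x d ord lam"
proof -
  have im: "i < m" "lam i > 0" using i by (auto simp: bad_orders_def)
  have tm: "t < m" "x t < 0" "d t < m" using t by (auto simp: selected_def candidates_def)
  have \<pi>: "ordering_on m (ord i)" using com im by (simp add: combination_def)
  have arcs: "d (ord j q) \<le> d (ord j p) + 1" if "j < m" "lam j > 0" "p < q" "q < m" for j p q
    using lab that by (simp add: labelling_def)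
  \<comment> \<open>Between \<open>s\<close> and \<open>q\<close> validity leaves only the labels
    \<open>d t - 1\<close> and \<open>d t\<close>, and \<open>s\<close> is the last position
    carrying the former.\<close>
  have l: "d (ord i p) = d t" if "s < p" "p \<le> q" for p
  proof (cases "p = q")
    case False
    then have "d t \<le> d (ord i p) + 1" "d (ord i p) \<le> d (ord i s) + 1"
      using arcs[OF im, of p q] arcs[OF im, of s p] that sq by auto
    then show ?thesis using last[of p] that False sq by simp
  qed (use sq in simp)
  show com': "combination ord' lam' B' x'"
    unfolding combination_def
  proof (intro conjI allI impI)
    fix j assume j: "j < m" "lam' j > 0"
    consider "lam1 j > 0" "\<forall>p<m. ord' j p = ord j p" "\<forall>v<m. B' j v = B j v"
      | p where "s < p" "p \<le> q" "\<forall>r<m. ord' j r = move_to (ord i) s p r"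
        "\<forall>v<m. B' j v = greedy F m (move_to (ord i) s p) v" using ord'[OF j] by blast
    then have "ordering_on m (ord' j) \<and> (\<forall>v<m. B' j v = greedy F m (ord' j) v)"
    proof cases
      case 1
      then have "ordering_on m (ord j)" "\<forall>v<m. B j v = greedy F m (ord j) v"
        using com j lam1 by (auto simp: combination_def)
      then show ?thesis using 1 ordering_on_cong[of m "ord' j" "ord j"] greedy_cong[of m "ord j" "ord' j"]
        by simp
    next
      case 2
      have "ordering_on m (move_to (ord i) s p)" by (rule ordering_on_move_to[OF \<pi>]) (use 2 sq in auto)
      then show ?thesis using 2 ordering_on_cong[of m "ord' j" "move_to (ord i) s p"]
          greedy_cong[of m "move_to (ord i) s p" "ord' j"] by simp
    qed
    then show "ordering_on m (ord' j)" "\<And>v. v < m \<Longrightarrow> B' j v = greedy F m (ord' j) v" by auto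
  qed (use lam' in auto)
  \<comment> \<open>Only \<open>t\<close> is raised, and it stays nonpositive; so no element becomes
    positive that was not so before.\<close>
  have x1_pos: "x v > 0" if "v < m" "x' v > 0" for v
  proof -
    have "x1 v > 0" using that g by (simp add: zero_less_mult_iff)
    then have "v \<noteq> t" using x1t by auto
    moreover have "c1 * - \<delta> \<le> 0" using c by simp
    ultimately have "c0 * x v > 0" using x1[OF that(1)] \<open>x1 v > 0\<close> by (auto split: if_splits)
    then show ?thesis using c by (simp add: zero_less_mult_iff)
  qed
  show lab': "labelling d ord' lam' x'"
    unfolding labelling_def
  proof (intro conjI allI impI)
    fix v assume "v < m"
    then show "d v \<le> m" using lab by (simp add: labelling_def)
  next
    fix v assume "v < m" "x' v > 0"
    then show "d v = 0" using lab x1_pos[of v] by (simp add: labelling_def)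
  next
    fix j p r assume j: "j < m" "lam' j > 0" and pr: "p < r" "r < m"
    consider "lam1 j > 0" "\<forall>p<m. ord' j p = ord j p"
      | p where "s < p" "p \<le> q" "\<forall>r<m. ord' j r = move_to (ord i) s p r" using ord'[OF j] by blast
    then show "d (ord' j r) \<le> d (ord' j p) + 1"
    proof cases
      case 1
      then show ?thesis using arcs[OF j(1) lam1[OF j(1)] pr] pr by simp
    next
      case (2 p')
      then show ?thesis using arcs_move_to[of s p' q d "ord i" "d t" p r] l sq arcs[OF im] pr by simp
    qed
  qed
  have cand': "v \<in> candidates m x d" if "v \<in> candidates m x' d" "v \<noteq> ord i s" for v
  proof -
    have v: "v < m" "x' v < 0" "d v < m" using that by (auto simp: candidates_def)
    have "x v < 0"
    proof (cases "v = t")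
      case False
      have "x1 v < 0" using v g by (simp add: mult_less_0_iff)
      then have "c0 * x v < 0" using x1[OF v(1)] False that(2) by simp
      then show ?thesis using c by (simp add: mult_less_0_iff)
    qed (use tm in simp)
    then show ?thesis using v by (simp add: candidates_def)
  qed
  have sm: "ord i s < m" using ordering_on_less[OF \<pi>] sq by simp
  have key_s: "d (ord i s) * m + ord i s < d t * m + t"
    by (rule lex_less_mult_add) (use sq sm in auto)
  have kt: "key m x d = d t * m + t" using selected_key[OF t] by simp
  have sel_le: "d v * m + v \<le> key m x d" if "v \<in> candidates m x d" for v
    using key_le_iff[of m x d "key m x d"] that by auto
  have sel_less: "d v * m + v < key m x d" if "v \<in> candidates m x d" "v \<noteq> t" for v
  proof -
    have "d v < d t \<or> d v = d t \<and> v < t" using t that by (auto simp: selected_def)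
    then show ?thesis unfolding kt by (rule lex_less_mult_add) (use that in \<open>simp add: candidates_def\<close>)
  qed
  show "progress m x' d ord' lam' < progress m x d ord lam"
  proof (rule progress_less[OF com' lab' t])
    assume ne: "candidates m x' d \<noteq> {}"
    have le: "key m x' d \<le> key m x d"
      unfolding key_le_iff[OF ne]
    proof
      fix v assume "v \<in> candidates m x' d"
      then show "d v * m + v \<le> key m x d"
        using sel_le[OF cand', of v] key_s kt by (cases "v = ord i s") simp_all
    qed
    have tc: "t \<in> candidates m x' d" if eq: "key m x' d = key m x d"
    proof (rule ccontr)
      assume "t \<notin> candidates m x' d"
      then have "\<forall>v \<in> candidates m x' d. d v * m + v \<le> key m x d - 1"

      proof (intro ballI)
        fix v assume "v \<in> candidates m x' d"
        then have "d v * m + v < key m x d"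
          using sel_less[OF cand', of v] key_s kt \<open>t \<notin> candidates m x' d\<close>
          by (cases "v = ord i s"; cases "v = t") simp_all
        then show "d v * m + v \<le> key m x d - 1" by simp
      qed
      then have "key m x' d \<le> key m x d - 1" using key_le_iff[OF ne] by blast
      then show False using eq key_s kt by simp
    qed
    show "(\<Sum>v<m. m - d v) < (\<Sum>v<m. m - d v) \<or> (\<Sum>v<m. m - d v) = (\<Sum>v<m. m - d v) \<and>
      (key m x' d < key m x d \<or> key m x' d = key m x d \<and>
      (max_disorder m d t ord' lam' < max_disorder m d t ord lam \<or>
       max_disorder m d t ord' lam' = max_disorder m d t ord lam \<and>
       card (worst_orders m d t ord' lam') < card (worst_orders m d t ord lam)))"
    proof (cases "key m x' d = key m x d")
      case True
      then have "x' t < 0" using tc by (simp add: candidates_def)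
      then have "x1 t < 0" using g(1) g(2)[OF tm(1)] by (simp add: mult_less_0_iff)
      \<comment> \<open>\<open>t\<close> is still negative, so the step was limited by the weight of
        the order \<open>i\<close>.\<close>
      then have l1i: "lam1 i = 0" using full by simp
      have md: "max_disorder m d t ord lam = Suc (disorder m d (ord i))"
        unfolding max_disorder_def
      proof (rule Max_eqI)
        fix y assume "y \<in> insert 0 ((\<lambda>j. Suc (disorder m d (ord j))) ` bad_orders m d t ord lam)"
        then show "y \<le> Suc (disorder m d (ord i))" using imax by blast
      qed (use i in simp_all)
      have bad': "Suc (disorder m d (ord' j)) < Suc (disorder m d (ord i)) \<or>
          j \<in> bad_orders m d t ord lam - {i} \<and> disorder m d (ord' j) = disorder m d (ord j)"
        if "j \<in> bad_orders m d t ord' lam'" for j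
      proof -
        have j: "j < m" "lam' j > 0" "out_of_place m d t (ord' j)" using that by (auto simp: bad_orders_def)
        consider "lam1 j > 0" "\<forall>p<m. ord' j p = ord j p"
          | p where "s < p" "p \<le> q" "\<forall>r<m. ord' j r = move_to (ord i) s p r" using ord'[OF j(1,2)] by blast
        then show ?thesis
        proof cases
          case 1
          have "j \<noteq> i" using l1i 1(1) by auto
          moreover have "lam j > 0" by (rule lam1[OF j(1) 1(1)])
          moreover have "out_of_place m d t (ord j)" by (rule out_of_place_cong[OF _ j(3)]) (use 1 in simp)
          moreover have "disorder m d (ord' j) = disorder m d (ord j)" by (rule disorder_cong) (use 1 in simp)
          ultimately show ?thesis using j by (simp add: bad_orders_def)
        next
          case 2
          have "disorder m d (ord' j) = disorder m d (move_to (ord i) s p)" by (rule disorder_cong) (use 2 in simp)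
          moreover have "Suc (disorder m d (move_to (ord i) s p)) = disorder m d (ord i)"
            by (rule disorder_move_to[where q = q and l = "d t"]) (fact 2 sq l)+
          ultimately show ?thesis by simp
        qed
      qed
      have le: "max_disorder m d t ord' lam' \<le> max_disorder m d t ord lam"
        unfolding max_disorder_le_iff md
      proof
        fix j assume "j \<in> bad_orders m d t ord' lam'"
        from bad'[OF this] show "Suc (disorder m d (ord' j)) \<le> Suc (disorder m d (ord i))"
        proof
          assume "j \<in> bad_orders m d t ord lam - {i} \<and> disorder m d (ord' j) = disorder m d (ord j)"
          then show ?thesis using imax[of j] by simp
        qed simp
      qed
      have "card (worst_orders m d t ord' lam') < card (worst_orders m d t ord lam)"
        if eq: "max_disorder m d t ord' lam' = max_disorder m d t ord lam"
      proof (rule psubset_card_mono)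
        have "worst_orders m d t ord' lam' \<subseteq> worst_orders m d t ord lam - {i}"
        proof
          fix j assume "j \<in> worst_orders m d t ord' lam'"
          then have j: "j \<in> bad_orders m d t ord' lam'" "disorder m d (ord' j) = disorder m d (ord i)"
            by (auto simp: worst_orders_def eq md)
          from bad'[OF j(1)] j(2) show "j \<in> worst_orders m d t ord lam - {i}"
            by (auto simp: worst_orders_def md)
        qed
        moreover have "i \<in> worst_orders m d t ord lam" using i md by (simp add: worst_orders_def)
        ultimately show "worst_orders m d t ord' lam' \<subset> worst_orders m d t ord lam" by blast
      qed (simp add: worst_orders_def)
      then show ?thesis using True le by auto
    qed (use le in simp)
  qed
qed

lemma minimum_level_set:
  assumes com: "combination ord lam B x" and lab: "labelling d ord lam x"
    and none: "candidates m x d = {}"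
  shows "\<exists>l\<le>m. \<forall>X \<subseteq> {..<m}. F {v. v < m \<and> l < d v} \<le> F X"
proof -
  have "\<not> {..m} \<subseteq> d ` {..<m}"
  proof
    assume "{..m} \<subseteq> d ` {..<m}"
    then have "card {..m} \<le> card (d ` {..<m})" by (intro card_mono) auto
    also have "\<dots> \<le> m" using card_image_le[of "{..<m}" d] by simp
    finally show False by simp
  qed
  then obtain l where l: "l \<le> m" "\<And>v. v < m \<Longrightarrow> d v \<noteq> l" by auto
  define W where "W = {v. v < m \<and> l < d v}"
  have FW: "(\<Sum>v\<in>W. B j v) = F W" if j: "j < m" "lam j > 0" for j
  proof -
    have \<pi>: "ordering_on m (ord j)" and B: "\<And>v. v < m \<Longrightarrow> B j v = greedy F m (ord j) v"
      using com j by (auto simp: combination_def)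
    \<comment> \<open>The length of the longest prefix inside \<open>W\<close>; the alternative
      \<open>p = m\<close> covers the case that all elements belong to \<open>W\<close>.\<close>
    define k where "k = (LEAST p. p = m \<or> ord j p \<notin> W)"
    have k: "k = m \<or> ord j k \<notin> W" unfolding k_def by (rule LeastI[of _ m]) simp
    have km: "k \<le> m" unfolding k_def by (rule Least_le) simp
    have below: "ord j p \<in> W" if "p < k" for p using not_less_Least[of p] that unfolding k_def by blast
    have above: "ord j p \<notin> W" if "k \<le> p" "p < m" for p
    proof (cases "p = k")
      case False
      have "ord j k < m" "ord j k \<notin> W" using k that ordering_on_less[OF \<pi>] False by auto
      \<comment> \<open>Label \<open>l\<close> does not occur, so being outside \<open>W\<close>
        means being strictly below \<open>l\<close>, and a rise by one cannot cross the gap.\<close>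
      then have "d (ord j k) < l" using l(2)[of "ord j k"] by (simp add: W_def)
      moreover have "d (ord j p) \<le> d (ord j k) + 1" using lab j that False by (simp add: labelling_def)
      ultimately show ?thesis by (simp add: W_def)
    qed (use k that in auto)
    have "W = ord j ` {..<k}"
    proof
      show "W \<subseteq> ord j ` {..<k}"
      proof
        fix v assume "v \<in> W"
        then obtain p where p: "p < m" "v = ord j p"
          using ordering_on_surj[OF \<pi>, of v] by (auto simp: W_def)
        then have "p < k" using above[of p] \<open>v \<in> W\<close> by (cases "p < k") auto
        then show "v \<in> ord j ` {..<k}" using p by simp
      qed
    qed (use below in auto)
    moreover have "(\<Sum>v\<in>W. B j v) = (\<Sum>v\<in>W. greedy F m (ord j) v)"
      by (intro sum.cong) (auto simp: W_def B)
    ultimately show ?thesis using greedy_sum_prefix[OF \<pi> km] by simp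
  qed
  have xsum: "(\<Sum>v\<in>X. x v) = (\<Sum>j<m. lam j * (\<Sum>v\<in>X. B j v))" if "X \<subseteq> {..<m}" for X
  proof -
    have "(\<Sum>v\<in>X. x v) = (\<Sum>v\<in>X. \<Sum>j<m. lam j * B j v)"
      using com that by (intro sum.cong) (auto simp: combination_def)
    then show ?thesis by (subst (asm) sum.swap) (simp add: sum_distrib_left)
  qed
  have "F W \<le> F X" if X: "X \<subseteq> {..<m}" for X
  proof -
    have lam0: "lam j = 0" if "j < m" "\<not> lam j > 0" for j
    proof -
      have "lam j \<ge> 0" using com that(1) by (simp add: combination_def)
      then show ?thesis using that(2) by simp
    qed
    have "(\<Sum>j<m. lam j) * F W = (\<Sum>j<m. lam j * (\<Sum>v\<in>W. B j v))"
      unfolding sum_distrib_right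
    proof (intro sum.cong refl)
      fix j assume "j \<in> {..<m}"
      then show "lam j * F W = lam j * (\<Sum>v\<in>W. B j v)" using FW[of j] lam0[of j] by (cases "lam j > 0") simp_all
    qed
    also have "\<dots> = (\<Sum>v\<in>W. x v)" by (rule xsum[symmetric]) (auto simp: W_def)
    also have "\<dots> \<le> (\<Sum>v\<in>W. if v \<in> X then x v else 0)"
    proof (rule sum_mono)
      fix v assume "v \<in> W"
      then have "v < m" "d v \<noteq> 0" by (auto simp: W_def)
      then have "\<not> x v > 0" using lab by (auto simp: labelling_def)
      then show "x v \<le> (if v \<in> X then x v else 0)" by simp
    qed
    also have "\<dots> = (\<Sum>v\<in>X \<inter> W. x v)"
    proof -
      have "finite W" by (simp add: W_def)
      then show ?thesis using sum.inter_restrict[of W x X] by (simp add: Int_commute)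
    qed
    also have "\<dots> \<le> (\<Sum>v\<in>X. x v)"
    proof (rule sum_mono2)
      fix v assume v: "v \<in> X - X \<inter> W"
      then have "v < m" "d v < l" using X l(2)[of v] by (auto simp: W_def)
      then have "v < m" "d v < m" using l(1) by linarith+
      then have "v \<notin> candidates m x d" using none by simp
      then show "0 \<le> x v" using \<open>v < m\<close> \<open>d v < m\<close> by (simp add: candidates_def)
    qed (use finite_subset[OF X] in auto)
    also have "\<dots> = (\<Sum>j<m. lam j * (\<Sum>v\<in>X. B j v))" by (rule xsum[OF X])
    also have "\<dots> \<le> (\<Sum>j<m. lam j * F X)"
    proof (rule sum_mono)
      fix j assume j: "j \<in> {..<m}"
      show "lam j * (\<Sum>v\<in>X. B j v) \<le> lam j * F X"
      proof (cases "lam j > 0")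
        case True
        then have \<pi>: "ordering_on m (ord j)" and "(\<Sum>v\<in>X. B j v) = (\<Sum>v\<in>X. greedy F m (ord j) v)"
          using com j X by (auto simp: combination_def intro!: sum.cong)
        then show ?thesis using greedy_sum_le[OF \<pi> X] True by simp
      next
        case False
        then have "lam j = 0" using lam0[of j] j by simp
        then show ?thesis by simp
      qed
    qed
    also have "\<dots> = (\<Sum>j<m. lam j) * F X" by (simp add: sum_distrib_right)
    finally show ?thesis using com by (simp add: combination_def)
  qed
  then show ?thesis using l(1) unfolding W_def by blast
qed

end

text \<open>A dummy element of marginal value one makes the coordinate of \<open>x\<close> at \<open>z\<close> the total weight.\<close>

locale submodular_dummy = submodular_fun +
  fixes z :: nat
  assumes z: "z < m" and F_dummy: "\<And>A. A \<subseteq> {..<m} \<Longrightarrow> z \<notin> A \<Longrightarrow> F (insert z A) = F A + 1"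
begin

lemma greedy_dummy:
  assumes \<pi>: "ordering_on m \<pi>"
  shows "greedy F m \<pi> z = 1"
proof -
  obtain p where p: "p < m" "z = \<pi> p" using ordering_on_surj[OF \<pi> z] by blast
  have "F (insert z (\<pi> ` {..<p})) = F (\<pi> ` {..<p}) + 1"
  proof (rule F_dummy)
    show "\<pi> ` {..<p} \<subseteq> {..<m}" using image_sub[OF \<pi>, of p] p by simp
    show "z \<notin> \<pi> ` {..<p}"
    proof
      assume "z \<in> \<pi> ` {..<p}"
      then obtain q where "q < p" "\<pi> p = \<pi> q" using p by auto
      then show False using ordering_on_inj[OF \<pi>, of p q] p by simp
    qed
  qed
  then show ?thesis using p greedy_at[OF \<pi> p(1), of F] by (simp add: lessThan_Suc)
qed

lemma total_weight:
  assumes "\<And>j. j < m \<Longrightarrow> lam j \<ge> 0" and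
    "\<And>j. j < m \<Longrightarrow> lam j > 0 \<Longrightarrow> ordering_on m (ord j) \<and> (\<forall>v<m. B j v = greedy F m (ord j) v)"
  shows "(\<Sum>j<m. lam j * B j z) = (\<Sum>j<m. lam j)"
proof (intro sum.cong refl)
  fix j assume j: "j \<in> {..<m}"
  show "lam j * B j z = lam j"
  proof (cases "lam j > 0")
    case True
    then show ?thesis using assms(2)[of j] greedy_dummy[of "ord j"] j z by simp
  qed (use assms(1)[of j] j in simp)
qed

end

section \<open>The program\<close>

abbreviation Assign :: "vname \<Rightarrow> aexp \<Rightarrow> com" where
  "Assign x e \<equiv> Write x (Const 0) e"

abbreviation Then :: "com \<Rightarrow> com \<Rightarrow> com" (infixr ";;" 55) where
  "c ;; c' \<equiv> Seq c c'"

abbreviation cell :: "vname \<Rightarrow> aexp \<Rightarrow> aexp" where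
  "cell j a \<equiv> Add (Mul (Var j) (Var ''m'')) a"

definition Equal :: "aexp \<Rightarrow> aexp \<Rightarrow> bexp" where
  "Equal a b = Conj (Neg (Less a b)) (Neg (Less b a))"

lemma bval_Equal [simp]: "bval (Equal a b) s \<longleftrightarrow> aval a s = aval b s"
  by (auto simp: Equal_def)

text \<open>\<open>cur\<close> is the function to be minimized, \<open>rho_num\<close> times the
  cardinality minus \<open>rho_den\<close> times \<open>f\<close>, plus the dummy term. The mask is
  kept inside \<open>T\<close>, so minimizing over subsets of \<open>T\<close> needs no change of
  the ground set.\<close>

definition eval_prefix :: com where "eval_prefix =
  Query ''ans'' ''mask'' ;;
  Assign ''cur'' (Add (Sub (Mul (Var ''rho_num'') (Var ''cnt'')) (Mul (Var ''rho_den'') (Var ''ans''))) (Var ''dummy''))"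

text \<open>Cell \<open>n\<close> of \<open>T\<close> is zero, so the dummy enters neither the mask
  nor the count; it is recorded in \<open>dummy\<close> alone.\<close>

definition greedy_com :: com where "greedy_com =
  For ''a'' (Var ''m'') (Write ''mask'' (Var ''a'') (Const 0)) ;;
  Assign ''prev'' (Const 0) ;; Assign ''cnt'' (Const 0) ;; Assign ''dummy'' (Const 0) ;;
  For ''a'' (Var ''m'') (
    Assign ''u'' (Read ''co'' (Var ''a'')) ;;
    Write ''mask'' (Var ''u'') (Read ''T'' (Var ''u'')) ;;
    Assign ''cnt'' (Add (Var ''cnt'') (Read ''T'' (Var ''u''))) ;;
    Cond (Less (Var ''u'') (Var ''n'')) Skip (Assign ''dummy'' (Const 1)) ;;
    eval_prefix ;;
    Write ''w'' (Var ''u'') (Sub (Var ''cur'') (Var ''prev'')) ;;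
    Assign ''prev'' (Var ''cur''))"

definition moved_com :: com where "moved_com =
  For ''a'' (Var ''m'') (
    Cond (Equal (Var ''a'') (Var ''s'')) (Write ''co'' (Var ''a'') (Read ''oo'' (Var ''j'')))
      (Cond (Conj (Less (Var ''s'') (Var ''a'')) (Neg (Less (Var ''j'') (Var ''a''))))
        (Write ''co'' (Var ''a'') (Read ''oo'' (Sub (Var ''a'') (Const 1))))
        (Write ''co'' (Var ''a'') (Read ''oo'' (Var ''a''))))) ;;
  greedy_com"

text \<open>The test lets equal labels through, so the last index wins, as in
  \<open>selected\<close>.\<close>

definition select_element :: com where "select_element =
  Assign ''t'' (Const (-1)) ;; Assign ''kt'' (Const (-1)) ;;
  For ''a'' (Var ''m'') (
    Cond (Conj (Less (Read ''x'' (Var ''a'')) (Const 0))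
           (Conj (Less (Read ''d'' (Var ''a'')) (Var ''m'')) (Neg (Less (Read ''d'' (Var ''a'')) (Var ''kt'')))))
      (Assign ''t'' (Var ''a'') ;; Assign ''kt'' (Read ''d'' (Var ''a''))) Skip)"

text \<open>\<open>seen\<close> restricts the search to positions before \<open>t\<close>; the
  disorder and the presence of an admissible arc are found in one pass.\<close>

definition select_order :: com where "select_order =
  Assign ''b'' (Const (-1)) ;; Assign ''phib'' (Const (-1)) ;;
  For ''c'' (Var ''m'') (Cond (Less (Const 0) (Read ''lam'' (Var ''c''))) (
    Assign ''phi'' (Const 0) ;; Assign ''bad'' (Const 0) ;; Assign ''seen'' (Const 0) ;;
    For ''a'' (Var ''m'') (
      Assign ''u'' (Read ''ord'' (cell ''c'' (Var ''a''))) ;;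
      Assign ''phi'' (Add (Var ''phi'') (Mul (Var ''a'') (Read ''d'' (Var ''u'')))) ;;
      Cond (Equal (Var ''u'') (Var ''t'')) (Assign ''seen'' (Const 1))
        (Cond (Conj (Less (Var ''seen'') (Const 1))
           (Equal (Add (Read ''d'' (Var ''u'')) (Const 1)) (Read ''d'' (Var ''t''))))
          (Assign ''bad'' (Const 1)) Skip)) ;;
    Cond (Conj (Less (Const 0) (Var ''bad'')) (Less (Var ''phib'') (Var ''phi'')))
      (Assign ''b'' (Var ''c'') ;; Assign ''phib'' (Var ''phi'')) Skip) Skip)"

definition locate :: com where "locate =
  For ''a'' (Var ''m'') (Write ''oo'' (Var ''a'') (Read ''ord'' (cell ''b'' (Var ''a'')))) ;;
  For ''a'' (Var ''m'') (Write ''bb'' (Var ''a'') (Read ''B'' (cell ''b'' (Var ''a'')))) ;;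
  Assign ''seen'' (Const 0) ;;
  For ''a'' (Var ''m'') (
    Assign ''u'' (Read ''oo'' (Var ''a'')) ;;
    Cond (Equal (Var ''u'') (Var ''t'')) (Assign ''seen'' (Const 1) ;; Assign ''q'' (Var ''a''))
      (Cond (Conj (Less (Var ''seen'') (Const 1))
           (Equal (Add (Read ''d'' (Var ''u'')) (Const 1)) (Read ''d'' (Var ''t''))))
        (Assign ''s'' (Var ''a'')) Skip))"

text \<open>One step of the back substitution for \<open>exchange\<close>. In the first round, and when the pivot \<open>al\<close>
  vanishes, the system restarts with the current column alone.\<close>

definition exchange_update :: com where "exchange_update =
  Assign ''u'' (Read ''oo'' (Var ''j'')) ;;
  Assign ''al'' (Sub (Read ''w'' (Var ''u'')) (Read ''bb'' (Var ''u''))) ;;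
  Assign ''be'' (Sub (Const 0) (Read ''r'' (Var ''u''))) ;;
  Cond (Conj (Less (Const 0) (Var ''al'')) (Less (Const 0) (Var ''c''))) Skip
    (Assign ''al'' (Const 0) ;; Assign ''be'' (Const 1)) ;;
  For ''a'' (Var ''m'') (Write ''kap'' (Var ''a'') (Mul (Var ''al'') (Read ''kap'' (Var ''a'')))) ;;
  Write ''kap'' (Var ''j'') (Add (Read ''kap'' (Var ''j'')) (Var ''be'')) ;;
  For ''a'' (Var ''m'') (Write ''r'' (Var ''a'') (Add (Mul (Var ''al'') (Read ''r'' (Var ''a'')))
     (Mul (Var ''be'') (Sub (Read ''w'' (Var ''a'')) (Read ''bb'' (Var ''a''))))))"

text \<open>\<open>j\<close> runs down from \<open>q\<close> to \<open>s + 1\<close>; the remaining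
  rounds idle, so that the trip count is always \<open>m\<close>. The moved greedy vectors are not
  stored but recomputed when they are inserted.\<close>

definition exchange_com :: com where "exchange_com =
  For ''a'' (Var ''m'') (Write ''r'' (Var ''a'') (Const 0)) ;;
  For ''a'' (Var ''m'') (Write ''kap'' (Var ''a'') (Const 0)) ;;
  For ''c'' (Var ''m'') (
    Assign ''j'' (Sub (Var ''q'') (Var ''c'')) ;;
    Cond (Less (Var ''s'') (Var ''j'')) (moved_com ;; exchange_update) Skip)"

text \<open>The step \<open>c1 / c0\<close> is the largest one that keeps the coefficient of the order \<open>b\<close> nonnegative
  and \<open>x(t)\<close> nonpositive.\<close>

definition rescale :: com where "rescale =
  Assign ''K'' (Const 0) ;;
  For ''a'' (Var ''m'') (Assign ''K'' (Add (Var ''K'') (Read ''kap'' (Var ''a'')))) ;;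
  Cond (Less (Mul (Sub (Const 0) (Read ''x'' (Var ''t''))) (Var ''K'')) (Mul (Read ''lam'' (Var ''b'')) (Read ''r'' (Var ''t''))))
    (Assign ''c0'' (Read ''r'' (Var ''t'')) ;; Assign ''c1'' (Sub (Const 0) (Read ''x'' (Var ''t''))))
    (Assign ''c0'' (Var ''K'') ;; Assign ''c1'' (Read ''lam'' (Var ''b''))) ;;
  For ''a'' (Var ''m'') (Write ''lam'' (Var ''a'') (Mul (Var ''c0'') (Read ''lam'' (Var ''a'')))) ;;
  Write ''lam'' (Var ''b'') (Sub (Read ''lam'' (Var ''b'')) (Mul (Var ''c1'') (Var ''K''))) ;;
  For ''a'' (Var ''m'') (Write ''kap'' (Var ''a'') (Mul (Var ''c1'') (Read ''kap'' (Var ''a''))))"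

definition coordinates :: com where "coordinates =
  For ''c'' (Var ''m'') (
    Assign ''y'' (Const 0) ;;
    For ''a'' (Var ''m'') (Assign ''y'' (Add (Var ''y'') (Mul (Read ''N'' (cell ''c'' (Var ''a''))) (Read ''w'' (Var ''a''))))) ;;
    Write ''Y'' (Var ''c'') (Var ''y''))"

text \<open>Idle columns with a positive coordinate also take part in the test (as degenerate pivots):
  they must not acquire a positive coefficient.\<close>

definition ratio_test :: com where "ratio_test =
  Assign ''p'' (Const (-1)) ;; Assign ''gb'' (Const 0) ;; Assign ''lb'' (Const 0) ;;
  For ''a'' (Var ''m'') (
    Cond (Less (Read ''Y'' (Var ''a'')) (Const 0)) (Assign ''ay'' (Sub (Const 0) (Read ''Y'' (Var ''a''))))
      (Cond (Less (Const 0) (Read ''lam'' (Var ''a''))) (Assign ''ay'' (Const 0)) (Assign ''ay'' (Read ''Y'' (Var ''a'')))) ;;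
    Cond (Conj (Less (Const 0) (Var ''ay'')) (Neg (Conj (Neg (Less (Var ''p'') (Const 0)))
           (Neg (Less (Mul (Read ''lam'' (Var ''a'')) (Var ''gb'')) (Mul (Var ''lb'') (Var ''ay'')))))))
      (Assign ''p'' (Var ''a'') ;; Assign ''gb'' (Var ''ay'') ;; Assign ''lb'' (Read ''lam'' (Var ''a''))) Skip)"

text \<open>The order of the writes matters: the other rows are eliminated while row
  \<open>p\<close> of \<open>N\<close> and the denominator \<open>D\<close> still hold their old
  values. \<open>kap\<close> is scaled along with \<open>lam\<close>, because the multipliers not
  yet inserted refer to the same scale.\<close>

definition pivot :: com where "pivot =
  For ''a'' (Var ''m'') (Write ''lam'' (Var ''a'')
    (Add (Mul (Read ''lam'' (Var ''a'')) (Var ''gb'')) (Mul (Var ''lb'') (Read ''Y'' (Var ''a''))))) ;;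
  Write ''lam'' (Var ''p'') (Sub (Mul (Var ''th'') (Var ''gb'')) (Mul (Var ''lb'') (Var ''D''))) ;;
  For ''a'' (Var ''m'') (Write ''kap'' (Var ''a'') (Mul (Var ''gb'') (Read ''kap'' (Var ''a'')))) ;;
  Assign ''yp'' (Read ''Y'' (Var ''p'')) ;;
  Cond (Less (Var ''yp'') (Const 0)) (Assign ''sg'' (Const (-1))) (Assign ''sg'' (Const 1)) ;;
  For ''c'' (Var ''m'') (Cond (Equal (Var ''c'') (Var ''p'')) Skip
    (For ''a'' (Var ''m'') (Write ''N'' (cell ''c'' (Var ''a'')) (Mul (Var ''sg'') (Div
       (Sub (Mul (Var ''yp'') (Read ''N'' (cell ''c'' (Var ''a''))))
          (Mul (Read ''Y'' (Var ''c'')) (Read ''N'' (cell ''p'' (Var ''a''))))) (Var ''D'')))))) ;;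
  For ''a'' (Var ''m'') (Write ''N'' (cell ''p'' (Var ''a'')) (Mul (Var ''sg'') (Read ''N'' (cell ''p'' (Var ''a''))))) ;;
  For ''a'' (Var ''m'') (Write ''B'' (cell ''p'' (Var ''a'')) (Read ''w'' (Var ''a''))) ;;
  For ''a'' (Var ''m'') (Write ''ord'' (cell ''p'' (Var ''a'')) (Read ''co'' (Var ''a''))) ;;
  Assign ''D'' (Var ''gb'')"

definition absorb :: com where "absorb =
  For ''a'' (Var ''m'') (Write ''lam'' (Var ''a'')
    (Add (Mul (Var ''D'') (Read ''lam'' (Var ''a''))) (Mul (Var ''th'') (Read ''Y'' (Var ''a''))))) ;;
  For ''a'' (Var ''m'') (Write ''kap'' (Var ''a'') (Mul (Var ''D'') (Read ''kap'' (Var ''a''))))"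

definition insert_com :: com where "insert_com =
  coordinates ;; ratio_test ;; Assign ''th'' (Read ''kap'' (Var ''j'')) ;;
  Cond (Conj (Neg (Less (Var ''p'') (Const 0))) (Less (Mul (Var ''lb'') (Var ''D'')) (Mul (Var ''th'') (Var ''gb''))))
    pivot absorb"

definition insert_all :: com where "insert_all =
  For ''j'' (Var ''m'') (Cond (Less (Const 0) (Read ''kap'' (Var ''j''))) (moved_com ;; insert_com) Skip)"

definition combine :: com where "combine =
  For ''c'' (Var ''m'') (
    Assign ''y'' (Const 0) ;;
    For ''a'' (Var ''m'') (Assign ''y'' (Add (Var ''y'') (Mul (Read ''lam'' (Var ''a'')) (Read ''B'' (cell ''a'' (Var ''c'')))))) ;;
    Write ''x'' (Var ''c'') (Var ''y''))"

text \<open>Without a candidate the round changes nothing of importance, so the loop around it may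
  run a fixed number of times.\<close>

definition iteration :: com where "iteration =
  select_element ;;
  Cond (Less (Var ''t'') (Const 0)) Skip (
    select_order ;;
    Cond (Less (Var ''b'') (Const 0)) (Write ''d'' (Var ''t'') (Add (Read ''d'' (Var ''t'')) (Const 1)))
      (locate ;; exchange_com ;; rescale ;; insert_all ;; combine))"

text \<open>The identity order is inserted like any later one, into a basis of unit vectors of
  weight zero; their rows of \<open>ord\<close> are placeholders, as only columns of positive weight
  have to stand for orders.\<close>

definition initialize :: com where "initialize =
  For ''a'' (Var ''m'') (Write ''d'' (Var ''a'') (Const 0)) ;;
  For ''a'' (Var ''m'') (Write ''co'' (Var ''a'') (Var ''a'')) ;;
  For ''a'' (Var ''m'') (Write ''lam'' (Var ''a'') (Const 0)) ;;
  For ''a'' (Var ''m'') (Write ''kap'' (Var ''a'') (Const 1)) ;;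
  For ''c'' (Var ''m'') (
    For ''a'' (Var ''m'') (Write ''B'' (cell ''c'' (Var ''a'')) (Const 0)) ;;
    Write ''B'' (cell ''c'' (Var ''c'')) (Const 1)) ;;
  For ''c'' (Var ''m'') (
    For ''a'' (Var ''m'') (Write ''N'' (cell ''c'' (Var ''a'')) (Const 0)) ;;
    Write ''N'' (cell ''c'' (Var ''c'')) (Const 1)) ;;
  For ''c'' (Var ''m'') (For ''a'' (Var ''m'') (Write ''ord'' (cell ''c'' (Var ''a'')) (Const 0))) ;;
  Assign ''D'' (Const 1) ;; Assign ''j'' (Const 0) ;;
  greedy_com ;; insert_com ;; combine"

definition level_sets :: com where "level_sets =
  For ''l'' (Add (Var ''m'') (Const 1)) (
    For ''a'' (Var ''m'') (Write ''mask'' (Var ''a'') (Const 0)) ;;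
    Assign ''cnt'' (Const 0) ;; Assign ''dummy'' (Const 0) ;;
    For ''a'' (Var ''m'') (Cond (Less (Var ''l'') (Read ''d'' (Var ''a''))) (
      Write ''mask'' (Var ''a'') (Read ''T'' (Var ''a'')) ;;
      Assign ''cnt'' (Add (Var ''cnt'') (Read ''T'' (Var ''a''))) ;;
      Cond (Less (Var ''a'') (Var ''n'')) Skip (Assign ''dummy'' (Const 1))) Skip) ;;
    eval_prefix ;;
    Cond (Conj (Less (Const 0) (Var ''l'')) (Neg (Less (Var ''cur'') (Var ''best'')))) Skip
      (Assign ''best'' (Var ''cur'')))"

definition minimize :: com where "minimize =
  initialize ;; For ''it'' (Var ''R'') iteration ;; level_sets"

text \<open>The number \<open>R\<close> of rounds is the bound \<open>(m + 1) ^ 8\<close> for the initial value of \<open>progress\<close>. The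
  first run uses \<open>T = V\<close>, the second one \<open>T = V - S\<close>.\<close>

definition main :: com where "main =
  Assign ''m'' (Add (Var ''n'') (Const 1)) ;;
  Assign ''e'' (Add (Var ''m'') (Const 1)) ;;
  Assign ''e'' (Mul (Var ''e'') (Var ''e'')) ;;
  Assign ''e'' (Mul (Var ''e'') (Var ''e'')) ;;
  Assign ''R'' (Mul (Var ''e'') (Var ''e'')) ;;
  For ''a'' (Var ''n'') (Write ''T'' (Var ''a'') (Const 1)) ;;
  minimize ;;
  Assign ''all'' (Var ''best'') ;;
  For ''a'' (Var ''n'') (Write ''T'' (Var ''a'') (Sub (Const 1) (Read ''S'' (Var ''a'')))) ;;
  minimize ;;
  Assign ''out_num'' (Sub (Var ''best'') (Var ''all'')) ;;
  Assign ''out_den'' (Var ''rho_den'')"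

lemma wvars_greedy [simp]: "wvars greedy_com = {''a'', ''mask'', ''prev'', ''cnt'', ''dummy'', ''u'', ''ans'', ''cur'', ''w''}"
  by (auto simp: greedy_com_def eval_prefix_def)

lemma wvars_moved [simp]: "wvars moved_com = insert ''co'' (wvars greedy_com)"
  by (auto simp: moved_com_def)

lemma wvars_insert [simp]: "wvars insert_com =
  {''c'', ''a'', ''y'', ''Y'', ''p'', ''gb'', ''lb'', ''ay'', ''th'', ''lam'', ''kap'', ''yp'', ''sg'', ''N'', ''B'', ''ord'', ''D''}"
  by (auto simp: insert_com_def coordinates_def ratio_test_def pivot_def absorb_def)

lemma wvars_combine [simp]: "wvars combine = {''c'', ''a'', ''y'', ''x''}"
  by (auto simp: combine_def)

section \<open>Loops that fill an array or accumulate a sum\<close>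

context machine begin

text \<open>The evaluation hypothesis sees the cells still to be written at their old values, which
  permits updating an array in place.\<close>

lemma wp_fill:
  assumes "v \<noteq> x" "v \<notin> avars hi" "x \<notin> avars hi" and N: "aval hi s0 = int N" "N \<le> H" "int N \<le> Z"
    and ev: "\<And>k s. k < N \<Longrightarrow> s v 0 = int k \<Longrightarrow> (\<And>y. y \<noteq> v \<Longrightarrow> y \<noteq> x \<Longrightarrow> s y = s0 y) \<Longrightarrow>
      (\<And>i. i < off \<or> off + int k \<le> i \<Longrightarrow> s x i = s0 x i) \<Longrightarrow> aval ie s = off + int k \<and> aval e s = f k \<and> \<bar>f k\<bar> \<le> Z"
    and post: "\<And>s. (\<And>y. y \<noteq> v \<Longrightarrow> y \<noteq> x \<Longrightarrow> s y = s0 y) \<Longrightarrow> (\<And>k. k < N \<Longrightarrow> s x (off + int k) = f k) \<Longrightarrow>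
      (\<And>i. i < off \<or> off + int N \<le> i \<Longrightarrow> s x i = s0 x i) \<Longrightarrow> Q s"
  shows "wp (For v hi (Write x ie e)) Q s0"
proof (rule wp_For[where N = N and I = "\<lambda>k s. (\<forall>l<k. s x (off + int l) = f l) \<and> (\<forall>i. i < off \<or> off + int k \<le> i \<longrightarrow> s x i = s0 x i)"])
  fix k s assume k: "k < N" and I: "(\<forall>l<k. s x (off + int l) = f l) \<and> (\<forall>i. i < off \<or> off + int k \<le> i \<longrightarrow> s x i = s0 x i)"
    and v: "s v 0 = int k" and f: "\<And>y. y \<notin> insert v (wvars (Write x ie e)) \<Longrightarrow> s y = s0 y"
  have *: "aval ie s = off + int k \<and> aval e s = f k \<and> \<bar>f k\<bar> \<le> Z"
    by (rule ev) (use k v f I in auto)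
  show "wp (Write x ie e) (\<lambda>s'. (\<forall>l<Suc k. (s'(v := (s' v)(0 := int k + 1))) x (off + int l) = f l) \<and>
      (\<forall>i. i < off \<or> off + int (Suc k) \<le> i \<longrightarrow> (s'(v := (s' v)(0 := int k + 1))) x i = s0 x i)) s"
    by (rule wp_Write) (use * assms(1) I in \<open>auto simp: less_Suc_eq\<close>)
next
  fix s assume "(\<forall>l<N. s x (off + int l) = f l) \<and> (\<forall>i. i < off \<or> off + int N \<le> i \<longrightarrow> s x i = s0 x i)"
    "\<And>y. y \<notin> insert v (wvars (Write x ie e)) \<Longrightarrow> s y = s0 y"
  then show "Q s" by (intro post) auto
qed (use assms in auto)

lemma wp_sum:
  assumes "v \<noteq> x" "v \<notin> avars hi" "x \<notin> avars hi" and N: "aval hi s0 = int N" "N \<le> H" "int N \<le> Z"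
    and ev: "\<And>k s. k < N \<Longrightarrow> s v 0 = int k \<Longrightarrow> (\<And>y. y \<noteq> v \<Longrightarrow> y \<noteq> x \<Longrightarrow> s y = s0 y) \<Longrightarrow> aval e s = f k"
    and bound: "\<And>k. k \<le> N \<Longrightarrow> \<bar>\<Sum>i<k. f i\<bar> \<le> Z" and init: "s0 x 0 = 0"
    and post: "\<And>s. (\<And>y. y \<noteq> v \<Longrightarrow> y \<noteq> x \<Longrightarrow> s y = s0 y) \<Longrightarrow> s x 0 = (\<Sum>k<N. f k) \<Longrightarrow> Q s"
  shows "wp (For v hi (Assign x (Add (Var x) e))) Q s0"
proof (rule wp_For[where N = N and I = "\<lambda>k s. s x 0 = (\<Sum>i<k. f i)"])
  fix k s assume k: "k < N" and I: "s x 0 = (\<Sum>i<k. f i)"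
    and v: "s v 0 = int k" and f: "\<And>y. y \<notin> insert v (wvars (Assign x (Add (Var x) e))) \<Longrightarrow> s y = s0 y"
  have *: "aval e s = f k" by (rule ev) (use k v f in auto)
  show "wp (Assign x (Add (Var x) e)) (\<lambda>s'. (s'(v := (s' v)(0 := int k + 1))) x 0 = (\<Sum>i<Suc k. f i)) s"
    by (rule wp_Write) (use * assms(1) I bound[of "Suc k"] k in auto)
next
  fix s assume "s x 0 = (\<Sum>i<N. f i)"
    "\<And>y. y \<notin> insert v (wvars (Assign x (Add (Var x) e))) \<Longrightarrow> s y = s0 y"
  then show "Q s" by (intro post) auto
qed (use assms in auto)

end

section \<open>Correctness of the program\<close>

text \<open>All intermediate values are estimated by powers of \<open>U\<close>; the exponent \<open>E\<close> bounds them.\<close>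

locale minimizer = machine n orc Z B H + submodular_dummy m F n
  for n :: nat and orc :: "nat set \<Rightarrow> int" and Z :: int and B H :: nat and m :: nat and F :: "nat set \<Rightarrow> int" +
  fixes T :: "nat set" and rn rd U :: int and E :: nat
  assumes m: "m = Suc n" and T: "T \<subseteq> {..<n}"
    and Z: "Z = U ^ E" and U: "U \<ge> 2" "int m < U" and mH: "m < H"
    and E: "E \<ge> 10"
    and orc_bound: "\<And>X. X \<subseteq> T \<Longrightarrow> \<bar>orc X\<bar> \<le> U"
    and F_bound: "\<And>X. X \<subseteq> {..<m} \<Longrightarrow> 2 * \<bar>F X\<bar> \<le> U"
    and F: "\<And>X. X \<subseteq> {..<m} \<Longrightarrow>
      F X = rn * int (card (X \<inter> T)) - rd * orc (X \<inter> T) + (if n \<in> X then 1 else 0)"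
begin

definition env :: "state \<Rightarrow> bool" where
  "env s \<longleftrightarrow> s ''n'' 0 = int n \<and> s ''m'' 0 = int m \<and> s ''rho_num'' 0 = rn \<and> s ''rho_den'' 0 = rd \<and>
     (\<forall>v<m. s ''T'' (int v) = (if v \<in> T then 1 else 0))"

definition vec :: "state \<Rightarrow> vname \<Rightarrow> (nat \<Rightarrow> int) \<Rightarrow> bool" where
  "vec s x f \<longleftrightarrow> (\<forall>v<m. s x (int v) = f v)"

definition matr :: "state \<Rightarrow> vname \<Rightarrow> (nat \<Rightarrow> nat \<Rightarrow> int) \<Rightarrow> bool" where
  "matr s x f \<longleftrightarrow> (\<forall>j<m. \<forall>v<m. s x (int j * int m + int v) = f j v)"

lemma env_cong:
  "(\<And>y. y \<in> {''n'', ''m'', ''rho_num'', ''rho_den'', ''T''} \<Longrightarrow> s' y = s y) \<Longrightarrow> env s \<Longrightarrow> env s'"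
  by (simp add: env_def)

lemma envD: "env s \<Longrightarrow> s ''m'' 0 = int m" "env s \<Longrightarrow> s ''n'' 0 = int n"
  "env s \<Longrightarrow> v < m \<Longrightarrow> s ''T'' (int v) = (if v \<in> T then 1 else 0)"
  by (auto simp: env_def)

lemma vecD: "vec s x f \<Longrightarrow> v < m \<Longrightarrow> s x (int v) = f v"
  by (simp add: vec_def)

lemma matrD: "matr s x f \<Longrightarrow> j < m \<Longrightarrow> v < m \<Longrightarrow> s x (int j * int m + int v) = f j v"
  by (simp add: matr_def)

lemma power_le: "i \<le> k \<Longrightarrow> U ^ i \<le> U ^ k"
  using U by (intro power_increasing) auto

lemma le_Z: "\<bar>a\<bar> \<le> U ^ i \<Longrightarrow> i \<le> E \<Longrightarrow> \<bar>a\<bar> \<le> Z"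
  using power_le[of i E] by (simp add: Z)

lemma U_le_Z: "\<bar>a\<bar> \<le> U \<Longrightarrow> \<bar>a\<bar> \<le> Z"
  using le_Z[of a 1] E by simp

lemma small: "\<bar>a\<bar> \<le> int m \<Longrightarrow> \<bar>a\<bar> \<le> Z"
  using U_le_Z[of a] U by simp

lemma nat_Z: "k \<le> m \<Longrightarrow> int k \<le> Z" using small[of "int k"] by simp

lemma m_Z: "int m \<le> Z" using small[of "int m"] by simp

lemma m_H: "m \<le> H" using mH by simp

lemma m_pos: "0 < m" by (simp add: m)

lemma one_Z: "1 \<le> Z" by (rule Z_pos)

text \<open>The factor 2 in \<open>F_bound\<close> is spent here: an entry is a difference of two
  values of \<open>F\<close>.\<close>

lemma greedy_bound: "ordering_on m \<pi> \<Longrightarrow> v < m \<Longrightarrow> \<bar>greedy F m \<pi> v\<bar> \<le> U"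
proof -
  assume \<pi>: "ordering_on m \<pi>" and "v < m"
  then obtain p where p: "p < m" "v = \<pi> p" using ordering_on_surj by blast
  have "2 * \<bar>F (\<pi> ` {..<Suc p})\<bar> \<le> U" "2 * \<bar>F (\<pi> ` {..<p})\<bar> \<le> U"
    by (intro F_bound image_sub[OF \<pi>]; use p in simp)+
  then show ?thesis using greedy_at[OF \<pi> p(1), of F] p by simp
qed

section \<open>Evaluation of greedy vectors\<close>

lemma wp_eval_prefix:
  assumes env: "env s" and X: "X \<subseteq> {..<m}" and mask: "vec s ''mask'' (\<lambda>v. if v \<in> X \<inter> T then 1 else 0)"
    and cnt: "s ''cnt'' 0 = int (card (X \<inter> T))" and dummy: "s ''dummy'' 0 = (if n \<in> X then 1 else 0)"
    and post: "\<And>s'. (\<And>y. y \<notin> {''ans'', ''cur''} \<Longrightarrow> s' y = s y) \<Longrightarrow> s' ''cur'' 0 = F X \<Longrightarrow> Q s'"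
  shows "wp eval_prefix Q s"
proof -
  \<comment> \<open>The oracle reads the first \<open>n\<close> cells only, and \<open>T\<close>
    does not contain the dummy \<open>n\<close>.\<close>
  have dec: "decode_set n (s ''mask'') = X \<inter> T"
  proof -
    have "s ''mask'' (int i) = (if i \<in> X \<inter> T then 1 else 0)" if "i < n" for i
    proof -
      have "i < m" using that m by simp
      from vecD[OF mask this] show ?thesis .
    qed
    then show ?thesis using T by (auto simp: decode_set_def split: if_splits)
  qed
  have 1: "\<bar>orc (X \<inter> T)\<bar> \<le> Z" by (rule U_le_Z[OF orc_bound]) simp
  have "2 * \<bar>F X\<bar> \<le> U" by (rule F_bound[OF X])
  then have 2: "\<bar>F X\<bar> \<le> Z" by (intro U_le_Z) simp
  have 3: "rn * int (card (X \<inter> T)) - rd * orc (X \<inter> T) + (if n \<in> X then 1 else 0) = F X"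
    using F[OF X] by simp
  show ?thesis unfolding eval_prefix_def
    by (rule wp_Seq, rule wp_Query, simp add: dec 1, rule wp_Write)
      (use env cnt dummy 2 3 in \<open>auto simp: dec env_def intro!: post\<close>)
qed

lemma wp_greedy:
  assumes env: "env s" and \<pi>: "ordering_on m \<pi>" and co: "vec s ''co'' (\<lambda>p. int (\<pi> p))"
    and post: "\<And>s'. (\<And>y. y \<notin> wvars greedy_com \<Longrightarrow> s' y = s y) \<Longrightarrow> vec s' ''w'' (greedy F m \<pi>) \<Longrightarrow> Q s'"
  shows "wp greedy_com Q s"
proof -
  define W where "W = wvars greedy_com"
  define P where "P k s' \<longleftrightarrow> vec s' ''mask'' (\<lambda>v. if v \<in> \<pi> ` {..<k} \<inter> T then 1 else 0) \<and>
    s' ''prev'' 0 = F (\<pi> ` {..<k}) \<and> s' ''cnt'' 0 = int (card (\<pi> ` {..<k} \<inter> T)) \<and>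
    s' ''dummy'' 0 = (if n \<in> \<pi> ` {..<k} then 1 else 0) \<and>
    (\<forall>p<k. s' ''w'' (int (\<pi> p)) = greedy F m \<pi> (\<pi> p))" for k s'
  have card_le: "card (\<pi> ` {..<k} \<inter> T) \<le> m" for k
  proof -
    have "card (\<pi> ` {..<k} \<inter> T) \<le> card {..<n}" by (rule card_mono) (use T in auto)
    then show ?thesis by (simp add: m)
  qed
  \<comment> \<open>The frame condition is taken as a premise inside the postcondition;
    \<open>wp_frame\<close> supplies it at the end.\<close>
  have "wp greedy_com (\<lambda>s'. (\<forall>x. x \<notin> W \<longrightarrow> s' x = s x) \<longrightarrow> Q s') s"
    unfolding greedy_com_def
  proof (intro wp_Seq, rule wp_fill[where N = m and f = "\<lambda>_. 0" and off = 0])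
    fix s1 assume f1: "\<And>y. y \<noteq> ''a'' \<Longrightarrow> y \<noteq> ''mask'' \<Longrightarrow> s1 y = s y"
      and m1: "\<And>k. k < m \<Longrightarrow> s1 ''mask'' (0 + int k) = 0"
    let ?s = "s1(''prev'' := (s1 ''prev'')(0 := 0), ''cnt'' := (s1 ''cnt'')(0 := 0), ''dummy'' := (s1 ''dummy'')(0 := 0))"
    have "wp (For ''a'' (Var ''m'')
            (Assign ''u'' (Read ''co'' (Var ''a'')) ;; Write ''mask'' (Var ''u'') (Read ''T'' (Var ''u'')) ;;
             Assign ''cnt'' (Add (Var ''cnt'') (Read ''T'' (Var ''u''))) ;;
             Cond (Less (Var ''u'') (Var ''n'')) Skip (Assign ''dummy'' (Const 1)) ;;
             eval_prefix ;; Write ''w'' (Var ''u'') (Sub (Var ''cur'') (Var ''prev'')) ;; Assign ''prev'' (Var ''cur'')))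
       (\<lambda>s'. (\<forall>x. x \<notin> W \<longrightarrow> s' x = s x) \<longrightarrow> Q s') ?s"
    proof (rule wp_For[where I = P and N = m], goal_cases)
      case (8 k s2)
      have fr: "s2 y = s y" if "y \<notin> W" for y
        using 8(4)[of y] f1[of y] that by (simp add: eval_prefix_def W_def)
      have km: "k < m" by fact
      have \<pi>k: "\<pi> k < m" using ordering_on_less[OF \<pi> km] .
      have co2: "s2 ''co'' (int k) = int (\<pi> k)"
      proof -
        have "s2 ''co'' = s ''co''" by (rule fr) (simp add: W_def)
        then show ?thesis using vecD[OF co km] by simp
      qed
      have env2: "env s2" by (rule env_cong[OF _ env]) (auto simp: fr W_def)
      have notin: "\<pi> k \<notin> \<pi> ` {..<k}" using ordering_on_inj[OF \<pi>] km by fastforce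
      have Suc_img: "\<pi> ` {..<Suc k} = insert (\<pi> k) (\<pi> ` {..<k})" by (simp add: lessThan_Suc)
      have Tk: "s2 ''T'' (int (\<pi> k)) = (if \<pi> k \<in> T then 1 else 0)" using envD(3)[OF env2 \<pi>k] .
      have cardS: "card (\<pi> ` {..<Suc k} \<inter> T) = card (\<pi> ` {..<k} \<inter> T) + (if \<pi> k \<in> T then 1 else 0)"
        unfolding Suc_img using notin by (simp add: Int_insert_left)
      have nlt: "\<pi> k < n \<longleftrightarrow> \<pi> k \<noteq> n" using \<pi>k m by auto
      let ?d = "if n \<in> \<pi> ` {..<Suc k} then 1 else 0 :: int"
      let ?s3 = "s2(''u'' := (s2 ''u'')(0 := int (\<pi> k)),
        ''mask'' := (s2 ''mask'')(int (\<pi> k) := if \<pi> k \<in> T then 1 else 0),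
        ''cnt'' := (s2 ''cnt'')(0 := int (card (\<pi> ` {..<Suc k} \<inter> T))))"
      let ?rest = "eval_prefix ;; Write ''w'' (Var ''u'') (Sub (Var ''cur'') (Var ''prev'')) ;; Assign ''prev'' (Var ''cur'')"
      let ?Q = "\<lambda>s'. P (Suc k) (s'(''a'' := (s' ''a'')(0 := int k + 1)))"
      have rest: "wp ?rest ?Q s4"
        if s4: "\<And>y. y \<noteq> ''dummy'' \<Longrightarrow> s4 y = ?s3 y" "s4 ''dummy'' 0 = ?d" for s4
      proof (rule wp_Seq, rule wp_eval_prefix[where X = "\<pi> ` {..<Suc k}"])
        show "env s4" by (rule env_cong[OF _ env2]) (auto simp: s4)
        show "\<pi> ` {..<Suc k} \<subseteq> {..<m}" by (rule image_sub[OF \<pi>]) (use km in simp)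
        show "vec s4 ''mask'' (\<lambda>v. if v \<in> \<pi> ` {..<Suc k} \<inter> T then 1 else 0)"
          using 8(2) s4(1)[of "''mask''"] unfolding P_def vec_def Suc_img by auto
        show "s4 ''cnt'' 0 = int (card (\<pi> ` {..<Suc k} \<inter> T))" using s4(1)[of "''cnt''"] by simp
        show "s4 ''dummy'' 0 = (if n \<in> \<pi> ` {..<Suc k} then 1 else 0)" by (rule s4(2))
        fix s5 assume s5: "\<And>y. y \<notin> {''ans'', ''cur''} \<Longrightarrow> s5 y = s4 y" "s5 ''cur'' 0 = F (\<pi> ` {..<Suc k})"
        have b: "2 * \<bar>F (\<pi> ` {..<Suc k})\<bar> \<le> U" "2 * \<bar>F (\<pi> ` {..<k})\<bar> \<le> U"
          by (intro F_bound image_sub[OF \<pi>]; use km in simp)+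
        have b1: "\<bar>F (\<pi> ` {..<Suc k}) - F (\<pi> ` {..<k})\<bar> \<le> Z" "\<bar>F (\<pi> ` {..<Suc k})\<bar> \<le> Z"
          using b by (intro U_le_Z; simp)+
        have e: "s5 ''prev'' 0 = F (\<pi> ` {..<k})" "s5 ''u'' 0 = int (\<pi> k)" "s5 ''w'' = s2 ''w''"
          using s5(1)[of "''prev''"] s4(1)[of "''prev''"] s5(1)[of "''u''"] s4(1)[of "''u''"]
            s5(1)[of "''w''"] s4(1)[of "''w''"] 8(2) by (simp_all add: P_def)
        have e2: "s5 ''mask'' = ?s3 ''mask''" "s5 ''cnt'' = ?s3 ''cnt''" "s5 ''dummy'' 0 = ?d"
          using s5(1)[of "''mask''"] s4(1)[of "''mask''"] s5(1)[of "''cnt''"] s4(1)[of "''cnt''"]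
            s5(1)[of "''dummy''"] s4(2) by simp_all
        have w: "s2 ''w'' (int (\<pi> p)) = greedy F m \<pi> (\<pi> p)" "\<pi> p \<noteq> \<pi> k" if "p < k" for p
          using 8(2) that ordering_on_inj[OF \<pi>, of p k] km by (auto simp: P_def)
        have gk: "greedy F m \<pi> (\<pi> k) = F (\<pi> ` {..<Suc k}) - F (\<pi> ` {..<k})"
          by (rule greedy_at[OF \<pi> km])
        show "wp (Write ''w'' (Var ''u'') (Sub (Var ''cur'') (Var ''prev'')) ;; Assign ''prev'' (Var ''cur'')) ?Q s5"
        proof (rule wp_Seq, rule wp_Write)
          show "\<bar>aval (Sub (Var ''cur'') (Var ''prev'')) s5\<bar> \<le> Z" using b1(1) by (simp add: e(1) s5(2))
        qed (rule wp_Write, use b1 8(2) w in \<open>auto simp: P_def vec_def Suc_img less_Suc_eq e e2 s5(2) gk\<close>)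
      qed
      show ?case
      proof (rule wp_Seq, rule wp_Write)
        show "\<bar>aval (Read ''co'' (Var ''a'')) s2\<bar> \<le> Z" using co2 8(3) \<pi>k by (simp add: nat_Z)
        have "wp (Cond (Less (Var ''u'') (Var ''n'')) Skip (Assign ''dummy'' (Const 1)) ;; ?rest) ?Q ?s3"
        proof (rule wp_Seq, rule wp_Cond)
          assume b: "bval (Less (Var ''u'') (Var ''n'')) ?s3"
          then have "\<pi> k \<noteq> n" using envD(2)[OF env2] nlt by simp
          then show "wp Skip (wp ?rest ?Q) ?s3"
            by (intro wp_Skip rest) (use 8(2) in \<open>simp_all add: P_def Suc_img\<close>)
        next
          assume b: "\<not> bval (Less (Var ''u'') (Var ''n'')) ?s3"
          then have "\<pi> k = n" using envD(2)[OF env2] nlt by simp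
          then show "wp (Assign ''dummy'' (Const 1)) (wp ?rest ?Q) ?s3"
            by (intro wp_Write rest) (use one_Z in \<open>simp_all add: Suc_img\<close>)
        qed
        then have nxt: "wp (Cond (Less (Var ''u'') (Var ''n'')) Skip (Assign ''dummy'' (Const 1)) ;; ?rest) ?Q s3"
          if "s3 = ?s3" for s3 using that by simp
        have "int (card (\<pi> ` {..<k} \<inter> T)) + (if \<pi> k \<in> T then 1 else 0) = int (card (\<pi> ` {..<Suc k} \<inter> T))"
          by (simp add: cardS)
        moreover have "s2 ''cnt'' 0 = int (card (\<pi> ` {..<k} \<inter> T))" using 8(2) by (simp add: P_def)
        ultimately have cnt2: "s2 ''cnt'' 0 + (if \<pi> k \<in> T then 1 else 0) = int (card (\<pi> ` {..<Suc k} \<inter> T))"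
          by simp
        show "wp (Write ''mask'' (Var ''u'') (Read ''T'' (Var ''u'')) ;;
           Assign ''cnt'' (Add (Var ''cnt'') (Read ''T'' (Var ''u''))) ;;
           Cond (Less (Var ''u'') (Var ''n'')) Skip (Assign ''dummy'' (Const 1)) ;; ?rest) ?Q
           (s2(''u'' := (s2 ''u'')(aval (Const 0) s2 := aval (Read ''co'' (Var ''a'')) s2)))"
        proof (rule wp_Seq, rule wp_Write, goal_cases)
          case 1
          show ?case using one_Z by (simp add: co2 8(3) Tk)
        next
          case 2
          show ?case
          proof (rule wp_Seq, rule wp_Write, goal_cases)
            case 1
            show ?case using card_le[of "Suc k"] cnt2 by (simp add: co2 8(3) Tk nat_Z)
          next
            case 2
            show ?case by (rule nxt) (use cnt2 in \<open>simp add: co2 8(3) Tk\<close>)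
          qed
        qed
      qed
    next
      case (9 s2)
      have "vec s2 ''w'' (greedy F m \<pi>)" unfolding vec_def
        using 9(1) ordering_on_surj[OF \<pi>] by (auto simp: P_def)
      then show ?case
        by (intro impI post) (simp_all add: W_def)
    qed (use m1 in \<open>simp_all add: P_def vec_def eval_prefix_def F_empty m_H m_Z f1 envD[OF env]\<close>)
    then show "wp (Assign ''prev'' (Const 0) ;; Assign ''cnt'' (Const 0) ;; Assign ''dummy'' (Const 0) ;;
      For ''a'' (Var ''m'')
            (Assign ''u'' (Read ''co'' (Var ''a'')) ;; Write ''mask'' (Var ''u'') (Read ''T'' (Var ''u'')) ;;
             Assign ''cnt'' (Add (Var ''cnt'') (Read ''T'' (Var ''u''))) ;;
             Cond (Less (Var ''u'') (Var ''n'')) Skip (Assign ''dummy'' (Const 1)) ;;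
             eval_prefix ;; Write ''w'' (Var ''u'') (Sub (Var ''cur'') (Var ''prev'')) ;; Assign ''prev'' (Var ''cur'')))
       (\<lambda>s'. (\<forall>x. x \<notin> W \<longrightarrow> s' x = s x) \<longrightarrow> Q s') s1"
      using one_Z by (intro wp_Seq wp_Write) auto
  qed (use envD[OF env] m_H m_Z in auto)
  then show ?thesis unfolding W_def by (rule wp_frame)
qed

end

context machine begin

lemma wp_SeqWrite:
  assumes "\<bar>aval b s\<bar> \<le> Z" and "wp c Q (s(x := (s x)(aval a s := aval b s)))"
  shows "wp (Write x a b ;; c) Q s"
  using assms by (intro wp_Seq wp_Write)

end

context minimizer begin

lemma wp_moved:
  assumes env: "env s" and \<pi>: "ordering_on m \<pi>" and oo: "vec s ''oo'' (\<lambda>p. int (\<pi> p))"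
    and s: "s ''s'' 0 = int sp" and j: "s ''j'' 0 = int j" "sp \<le> j" "j < m"
    and post: "\<And>s'. (\<And>y. y \<notin> wvars moved_com \<Longrightarrow> s' y = s y) \<Longrightarrow> vec s' ''w'' (greedy F m (move_to \<pi> sp j)) \<Longrightarrow>
       vec s' ''co'' (\<lambda>p. int (move_to \<pi> sp j p)) \<Longrightarrow> Q s'"
  shows "wp moved_com Q s"
  unfolding moved_com_def
proof (rule wp_Seq, rule wp_For[where N = m and I = "\<lambda>k s'. \<forall>p<k. s' ''co'' (int p) = int (move_to \<pi> sp j p)"], goal_cases)
  case (8 k s1)
  have fr: "s1 y = s y" if "y \<notin> {''a'', ''co''}" for y using 8(4)[of y] that by simp
  have km: "k < m" by fact
  have \<pi>m: "int (\<pi> p) \<le> Z" if "p < m" for p using ordering_on_less[OF \<pi> that] by (simp add: nat_Z)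
  have oo1: "s1 ''oo'' (int p) = int (\<pi> p)" if "p < m" for p using vecD[OF oo that] by (simp add: fr)
  have sj: "s1 ''s'' 0 = int sp" "s1 ''j'' 0 = int j" using s j by (simp_all add: fr)
  \<comment> \<open>Position \<open>k - 1\<close> is read only behind \<open>sp\<close>, hence for
    \<open>k > 0\<close>.\<close>
  have oo2: "s1 ''oo'' (int k - 1) = int (\<pi> (k - 1))" if "k > 0" using oo1[of "k - 1"] km that
    by (simp add: of_nat_diff)
  show ?case
    by (intro wp_Cond wp_Write)
      (use 8(2,3) km j(2,3) in \<open>auto simp: sj oo1 oo2 \<pi>m move_to_def less_Suc_eq\<close>)
next
  case (9 s1)
  have fr: "s1 y = s y" if "y \<notin> {''a'', ''co''}" for y using 9(3)[of y] that by simp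
  have co: "vec s1 ''co'' (\<lambda>p. int (move_to \<pi> sp j p))" using 9(1) by (simp add: vec_def)
  show ?case
  proof (rule wp_greedy[OF _ ordering_on_move_to[OF \<pi> j(2,3)] co], goal_cases)
    case 1
    show ?case by (rule env_cong[OF _ env]) (auto simp: fr)
  next
    case (2 s2)
    show ?case by (rule post[OF _ 2(2)]) (use co in \<open>simp_all add: 2(1) fr vec_def\<close>)
  qed
qed (use envD[OF env] m_H m_Z in auto)

section \<open>Choice of the element and of the order\<close>

lemma wp_select_element:
  assumes env: "env s" and x: "vec s ''x'' xv" and d: "vec s ''d'' (\<lambda>v. int (dv v))"
    and post: "\<And>s'. (\<And>y. y \<notin> {''a'', ''t'', ''kt''} \<Longrightarrow> s' y = s y) \<Longrightarrow>
       s' ''t'' 0 = -1 \<and> candidates m xv dv = {} \<or> (\<exists>t. s' ''t'' 0 = int t \<and> selected m xv dv t) \<Longrightarrow> Q s'"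
  shows "wp select_element Q s"
  unfolding select_element_def
proof (rule wp_SeqWrite, goal_cases)
  case 2
  let ?C = "candidates m xv dv"
  \<comment> \<open>The initial \<open>-1\<close> in \<open>kt\<close> lies below every label, so
    the first candidate is always accepted.\<close>
  define P where "P k s' \<longleftrightarrow> s' ''t'' 0 = -1 \<and> s' ''kt'' 0 = -1 \<and> (\<forall>v<k. v \<notin> ?C) \<or>
    (\<exists>t<k. s' ''t'' 0 = int t \<and> s' ''kt'' 0 = int (dv t) \<and> t \<in> ?C \<and> (\<forall>v<k. v \<in> ?C \<longrightarrow> dv v < dv t \<or> dv v = dv t \<and> v \<le> t))" for k and s' :: state
  show ?case
  proof (rule wp_SeqWrite, goal_cases)
    case 2
    show ?case
    proof (rule wp_For[where N = m and I = P], goal_cases)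
      case (8 k s1)
      have fr: "s1 y = s y" if "y \<notin> {''a'', ''t'', ''kt''}" for y using 8(4)[of y] that by simp
      have km: "k < m" by fact
      have xd: "s1 ''x'' (int k) = xv k" "s1 ''d'' (int k) = int (dv k)" "s1 ''m'' 0 = int m"
        using vecD[OF x km] vecD[OF d km] envD(1)[OF env] by (simp_all add: fr)
      have cand: "k \<in> ?C \<longleftrightarrow> xv k < 0 \<and> dv k < m" using km by (simp add: candidates_def)
      show ?case
      proof (rule wp_Cond, goal_cases)
        case 1
        then have k: "k \<in> ?C" "int (dv k) \<ge> s1 ''kt'' 0" using xd 8(3) by (auto simp: cand)
        have dk: "int (dv k) \<le> Z" using k(1) by (simp add: nat_Z cand)
        have "\<forall>v<Suc k. v \<in> ?C \<longrightarrow> dv v < dv k \<or> dv v = dv k \<and> v \<le> k"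
          using 8(2) k(2) unfolding P_def by (fastforce simp: less_Suc_eq)
        then have "P (Suc k) (s1(''t'' := (s1 ''t'')(0 := int k), ''kt'' := (s1 ''kt'')(0 := int (dv k)), ''a'' := (s1 ''a'')(0 := int k + 1)))"
          unfolding P_def using k(1) by (intro disjI2 exI[of _ k]) simp
        then show ?case using km dk xd(2)
          by (intro wp_SeqWrite wp_Write) (simp_all add: 8(3) nat_Z)
      next
        case 2
        then have k: "k \<in> ?C \<Longrightarrow> int (dv k) < s1 ''kt'' 0" using xd 8(3) by (auto simp: cand)
        show ?case
          by (rule wp_Skip) (use 8(2) k in \<open>fastforce simp: P_def less_Suc_eq\<close>)
      qed
    next
      case (9 s1)
      have fr: "s1 y = s y" if "y \<notin> {''a'', ''t'', ''kt''}" for y using 9(3)[of y] that by simp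
      have "?C \<subseteq> {..<m}" by (auto simp: candidates_def)
      then have "s1 ''t'' 0 = -1 \<and> ?C = {} \<or> (\<exists>t. s1 ''t'' 0 = int t \<and> selected m xv dv t)"
        using 9(1) unfolding P_def selected_def by blast
      with fr show ?case by (rule post)
    qed (use envD[OF env] m_H m_Z in \<open>auto simp: P_def\<close>)
  qed (use one_Z in simp)
qed (use one_Z in simp)

lemma cell_eq [simp]:
  "a < m \<Longrightarrow> a' < m \<Longrightarrow> int j * int m + int a = int j' * int m + int a' \<longleftrightarrow> j = j' \<and> a = a'"
proof -
  assume a: "a < m" "a' < m"
  have "int j * int m + int a = int (j * m + a)" "int j' * int m + int a' = int (j' * m + a')" by simp_all
  moreover have "j * m + a = j' * m + a' \<longleftrightarrow> j = j' \<and> a = a'"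
  proof
    assume eq: "j * m + a = j' * m + a'"
    have "(j * m + a) div m = j" "(j * m + a) mod m = a" "(j' * m + a') div m = j'" "(j' * m + a') mod m = a'"
      using a by simp_all
    then show "j = j' \<and> a = a'" using eq by metis
  qed auto
  ultimately show ?thesis by (simp del: of_nat_add of_nat_mult)
qed

lemma wp_select_order:
  assumes env: "env s" and d: "vec s ''d'' (\<lambda>v. int (dv v))" and lam: "vec s ''lam'' lamv"
    and ord: "matr s ''ord'' (\<lambda>j p. int (ordv j p))" and t: "s ''t'' 0 = int t" "t < m"
    and orders: "\<And>j. j < m \<Longrightarrow> lamv j > 0 \<Longrightarrow> ordering_on m (ordv j)"
    and dm: "\<And>v. v < m \<Longrightarrow> dv v \<le> m"
    and post: "\<And>s'. (\<And>y. y \<notin> {''a'', ''b'', ''c'', ''phib'', ''phi'', ''bad'', ''seen'', ''u''} \<Longrightarrow> s' y = s y) \<Longrightarrow>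
       s' ''b'' 0 = -1 \<and> bad_orders m dv t ordv lamv = {} \<or>
       (\<exists>i. s' ''b'' 0 = int i \<and> i \<in> bad_orders m dv t ordv lamv \<and>
          (\<forall>j \<in> bad_orders m dv t ordv lamv. disorder m dv (ordv j) \<le> disorder m dv (ordv i))) \<Longrightarrow> Q s'"
  shows "wp select_order Q s"
proof -
  define W where "W = {''a'', ''b'', ''c'', ''phib'', ''phi'', ''bad'', ''seen'', ''u''}"
  let ?C = "bad_orders m dv t ordv lamv"
  let ?\<phi> = "\<lambda>j. disorder m dv (ordv j)"
  define P where "P k s' \<longleftrightarrow> s' ''b'' 0 = -1 \<and> s' ''phib'' 0 = -1 \<and> (\<forall>v<k. v \<notin> ?C) \<or>
    (\<exists>t<k. s' ''b'' 0 = int t \<and> s' ''phib'' 0 = int (?\<phi> t) \<and> t \<in> ?C \<and> (\<forall>v<k. v \<in> ?C \<longrightarrow> ?\<phi> v \<le> ?\<phi> t))" for k and s' :: state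
  show ?thesis unfolding select_order_def
  proof (rule wp_SeqWrite, goal_cases)
    case 2
    show ?case
    proof (rule wp_SeqWrite, goal_cases)
      case 2
      show ?case
      proof (rule wp_For[where N = m and I = P], goal_cases)
        case (8 k s1)
        have fr: "s1 y = s y" if "y \<notin> W" for y using 8(4)[of y] that by (simp add: W_def)
        have km: "k < m" by fact
        have lamk: "s1 ''lam'' (int k) = lamv k" using vecD[OF lam km] by (simp add: fr W_def)
        show ?case
        proof (rule wp_Cond, goal_cases)
          case 2
          then have "k \<notin> ?C" using lamk 8(3) by (simp add: bad_orders_def)
          then show ?case
            by (intro wp_Skip) (use 8(2) in \<open>fastforce simp: P_def less_Suc_eq\<close>)
        next
          case 1
          then have lamk: "lamv k > 0" using lamk 8(3) by simp
          let ?\<pi> = "ordv k"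
          have \<pi>: "ordering_on m ?\<pi>" by (rule orders[OF km lamk])
          obtain q where q: "q < m" "t = ?\<pi> q" using ordering_on_surj[OF \<pi> t(2)] by blast
          have kC: "k \<in> ?C \<longleftrightarrow> (\<exists>p<q. dv (?\<pi> p) + 1 = dv t)"
          proof -
            have "out_of_place m dv t ?\<pi> \<longleftrightarrow> (\<exists>p<q. dv (?\<pi> p) + 1 = dv t)"
              unfolding out_of_place_def using q ordering_on_inj[OF \<pi>] by metis
            then show ?thesis using km lamk by (simp add: bad_orders_def)
          qed
          \<comment> \<open>Positions behind \<open>q\<close>, the place of \<open>t\<close>, must
            not count; \<open>seen\<close> realizes the condition \<open>p < q\<close> in the
            program.\<close>
          define bd where "bd i \<longleftrightarrow> (\<exists>p<i. p < q \<and> dv (?\<pi> p) + 1 = dv t)" for i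
          have bdS: "bd (Suc i) \<longleftrightarrow> bd i \<or> i < q \<and> dv (?\<pi> i) + 1 = dv t" for i
            unfolding bd_def less_Suc_eq by blast
          define R where "R i s' \<longleftrightarrow> s' ''phi'' 0 = int (\<Sum>p<i. p * dv (?\<pi> p)) \<and>
            s' ''seen'' 0 = (if q < i then 1 else 0) \<and>
            s' ''bad'' 0 = (if bd i then 1 else 0)" for i and s' :: state
          \<comment> \<open>The terms are nonnegative, so a partial sum never exceeds the full
            disorder, which is at most \<open>m ^ 3\<close>.\<close>
          have part: "int (\<Sum>p<i. p * dv (?\<pi> p)) \<le> Z" if "i \<le> m" for i
          proof -
            have "(\<Sum>p<i. p * dv (?\<pi> p)) \<le> disorder m dv ?\<pi>"
              unfolding disorder_def by (rule sum_mono2) (use that in auto)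
            also have "\<dots> \<le> m ^ 3" by (rule disorder_le[OF \<pi> dm])
            finally have "int (\<Sum>p<i. p * dv (?\<pi> p)) \<le> int (m ^ 3)" by (simp only: of_nat_le_iff)
            also have "\<dots> \<le> U ^ 3" unfolding of_nat_power by (rule power_mono) (use U in auto)
            finally have "\<bar>int (\<Sum>p<i. p * dv (?\<pi> p))\<bar> \<le> U ^ 3" by (simp only: abs_of_nat)
            then have "\<bar>int (\<Sum>p<i. p * dv (?\<pi> p))\<bar> \<le> Z" by (rule le_Z) (use E in simp)
            then show ?thesis by (simp only: abs_of_nat)
          qed
          show ?case
          proof (rule wp_SeqWrite, goal_cases)
            case 2
            show ?case
            proof (rule wp_SeqWrite, goal_cases)
              case 2
              show ?case
              proof (rule wp_SeqWrite, goal_cases)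
                case 2
                show ?case
                proof (rule wp_Seq, rule wp_For[where N = m and I = R], goal_cases)
                  case (8 i s2)
                  have fr2: "s2 y = s y" if "y \<notin> W" for y using 8(4)[of y] that by (simp add: W_def fr)
                  have c: "s2 ''c'' 0 = int k" using 8(4)[of "''c''"] \<open>s1 ''c'' 0 = int k\<close> by simp
                  have im: "i < m" by fact
                  have \<pi>i: "?\<pi> i < m" using ordering_on_less[OF \<pi> im] .
                  have e: "s2 ''ord'' (int k * int m + int i) = int (?\<pi> i)" "s2 ''m'' 0 = int m"
                    "s2 ''d'' (int (?\<pi> i)) = int (dv (?\<pi> i))" "s2 ''t'' 0 = int t" "s2 ''d'' (int t) = int (dv t)"
                    using matrD[OF ord km im] envD(1)[OF env] vecD[OF d \<pi>i] t vecD[OF d t(2)] by (simp_all add: fr2 W_def)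
                  have phi: "s2 ''phi'' 0 + int i * int (dv (?\<pi> i)) = int (\<Sum>p<Suc i. p * dv (?\<pi> p))"
                    using 8(2) by (simp add: R_def)
                  have qi: "?\<pi> i = t \<longleftrightarrow> i = q" using q ordering_on_inj[OF \<pi> im q(1)] by simp
                  show ?case
                  proof (rule wp_SeqWrite, goal_cases)
                    case 1
                    show ?case using \<pi>i by (simp add: c e 8(3) nat_Z)
                  next
                    case 2
                    show ?case
                    proof (rule wp_SeqWrite, goal_cases)
                      case 1
                      show ?case using part[of "Suc i"] im by (simp add: c e 8(3) phi del: of_nat_sum)
                    next
                      case 2
                      have sb: "s2 ''seen'' 0 = (if q < i then 1 else 0)" "s2 ''bad'' 0 = (if bd i then 1 else 0)"
                        using 8(2) by (simp_all add: R_def)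
                      have eqd: "int (dv (?\<pi> i)) + 1 = int (dv t) \<longleftrightarrow> dv (?\<pi> i) + 1 = dv t" by linarith
                      show ?case
                      proof (rule wp_Cond, goal_cases)
                        case 1
                        then have "i = q" using qi by (simp add: c e 8(3))
                        then have lt: "q < Suc i" "\<not> i < q" "\<not> q < i" by auto
                        show ?case using one_Z phi
                          by (intro wp_Write) (simp_all add: c e 8(3) R_def sb bdS lt)
                      next
                        case 2
                        then have "i \<noteq> q" using qi by (simp add: c e 8(3))
                        then have lt: "i < Suc q \<longleftrightarrow> i < q" "q < Suc i \<longleftrightarrow> \<not> i < q" "q < i \<longleftrightarrow> \<not> i < q" by auto
                        show ?case
                          by (rule wp_Cond; rule wp_Write wp_Skip)
                            (use one_Z phi in \<open>simp_all add: c e 8(3) R_def sb bdS lt eqd split: if_splits\<close>)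
                      qed
                    qed
                  qed
                next
                  case (9 s2)
                  have c: "s2 ''c'' 0 = int k" using 9(3)[of "''c''"] \<open>s1 ''c'' 0 = int k\<close> by simp
                  have b: "s2 ''b'' = s1 ''b''" "s2 ''phib'' = s1 ''phib''" using 9(3) by simp_all
                  have phi: "s2 ''phi'' 0 = int (?\<phi> k)" using 9(1) by (simp add: R_def disorder_def)
                  have bad: "s2 ''bad'' 0 = (if k \<in> ?C then 1 else 0)"
                    using 9(1) q(1) unfolding R_def kC bd_def by (auto intro: less_trans)
                  have phiZ: "int (?\<phi> k) \<le> Z" using part[of m] by (simp add: disorder_def)
                  show ?case
                  proof (rule wp_Cond, goal_cases)
                    case 1
                    then have k: "k \<in> ?C" "s1 ''phib'' 0 < int (?\<phi> k)" using bad phi b by (auto split: if_splits)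
                    then have "\<forall>v<Suc k. v \<in> ?C \<longrightarrow> ?\<phi> v \<le> ?\<phi> k"
                      using 8(2) unfolding P_def by (fastforce simp: less_Suc_eq)
                    then have "P (Suc k) (s2(''b'' := (s2 ''b'')(0 := int k), ''phib'' := (s2 ''phib'')(0 := int (?\<phi> k)), ''c'' := (s2 ''c'')(0 := int k + 1)))"
                      unfolding P_def using k(1) by (intro disjI2 exI[of _ k]) simp
                    then show ?case using km phiZ
                      by (intro wp_SeqWrite wp_Write) (simp_all add: c phi nat_Z)
                  next
                    case 2
                    then have "k \<in> ?C \<Longrightarrow> int (?\<phi> k) \<le> s1 ''phib'' 0" using bad phi b by (auto split: if_splits)
                    then show ?case
                      by (intro wp_Skip) (use 8(2) in \<open>fastforce simp: P_def less_Suc_eq b\<close>)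
                  qed
                qed (use m_H m_Z envD(1)[OF env] in \<open>simp_all add: R_def bd_def fr W_def\<close>)
              qed (use one_Z in simp)
            qed (use one_Z in simp)
          qed (use one_Z in simp)
        qed
      next
        case (9 s1)
        have fr: "s1 y = s y" if "y \<notin> W" for y using 9(3)[of y] that by (simp add: W_def)
        have "?C \<subseteq> {..<m}" by (auto simp: bad_orders_def)
        then have "s1 ''b'' 0 = -1 \<and> ?C = {} \<or> (\<exists>i. s1 ''b'' 0 = int i \<and> i \<in> ?C \<and> (\<forall>j\<in>?C. ?\<phi> j \<le> ?\<phi> i))"
          using 9(1) unfolding P_def by blast
        with fr show ?case unfolding W_def by (rule post)
      qed (use envD[OF env] m_H m_Z in \<open>auto simp: P_def\<close>)
    qed (use one_Z in simp)
  qed (use one_Z in simp)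
qed

lemma wp_locate:
  assumes env: "env s" and d: "vec s ''d'' (\<lambda>v. int (dv v))"
    and ord: "matr s ''ord'' (\<lambda>j p. int (ordv j p))" and B: "matr s ''B'' Bv"
    and t: "s ''t'' 0 = int t" and i: "s ''b'' 0 = int i" "i < m"
    and \<pi>: "ordering_on m (ordv i)" and Bv: "\<And>v. v < m \<Longrightarrow> \<bar>Bv i v\<bar> \<le> U"
    and bad: "out_of_place m dv t (ordv i)"
    and post: "\<And>s' sp q. (\<And>y. y \<notin> {''a'', ''oo'', ''bb'', ''seen'', ''u'', ''q'', ''s''} \<Longrightarrow> s' y = s y) \<Longrightarrow>
       vec s' ''oo'' (\<lambda>p. int (ordv i p)) \<Longrightarrow> vec s' ''bb'' (Bv i) \<Longrightarrow>
       s' ''s'' 0 = int sp \<Longrightarrow> s' ''q'' 0 = int q \<Longrightarrow> sp < q \<Longrightarrow> q < m \<Longrightarrow> ordv i q = t \<Longrightarrow>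
       dv (ordv i sp) + 1 = dv t \<Longrightarrow> (\<And>p. sp < p \<Longrightarrow> p < q \<Longrightarrow> dv (ordv i p) + 1 \<noteq> dv t) \<Longrightarrow> Q s'"
  shows "wp locate Q s"
  unfolding locate_def
proof (rule wp_Seq, rule wp_fill[where N = m and f = "\<lambda>p. int (ordv i p)" and off = 0], goal_cases)
  case (7 k s1)
  have fr: "s1 y = s y" if "y \<noteq> ''a''" "y \<noteq> ''oo''" for y using 7(3)[of y] that by simp
  show ?case using ordering_on_less[OF \<pi> 7(1)]
    by (simp add: fr i envD(1)[OF env] 7(2) matrD[OF ord i(2) 7(1)] nat_Z)
next
  case (8 s1)
  note fr1 = 8(1)
  note oo1 = 8(2)
  show ?case
  proof (rule wp_Seq, rule wp_fill[where N = m and f = "Bv i" and off = 0], goal_cases)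
    case (7 k s2)
    have fr: "s2 y = s y" if "y \<noteq> ''a''" "y \<noteq> ''oo''" "y \<noteq> ''bb''" for y using 7(3)[of y] fr1[of y] that by simp
    show ?case
      by (simp add: fr i envD(1)[OF env] 7(2) matrD[OF B i(2) 7(1)] U_le_Z Bv 7(1))
  next
    case (8 s2)
    have fr2: "s2 y = s y" if "y \<notin> {''a'', ''oo'', ''bb''}" for y using 8(1)[of y] fr1[of y] that by simp
    have oo2: "s2 ''oo'' (int p) = int (ordv i p)" if "p < m" for p using oo1[OF that] 8(1)[of "''oo''"] by simp
    have bb2: "s2 ''bb'' (int p) = Bv i p" if "p < m" for p using 8(2)[OF that] by simp
    obtain q where q: "q < m" "ordv i q = t" "\<exists>p<q. dv (ordv i p) + 1 = dv t"
      using bad unfolding out_of_place_def by blast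
    have tm: "t < m" using ordering_on_less[OF \<pi> q(1)] q by simp
    define gd where "gd p \<longleftrightarrow> p < q \<and> dv (ordv i p) + 1 = dv t" for p
    \<comment> \<open>The scan keeps overwriting \<open>s\<close>, so at the end it holds the last
      suitable position before \<open>q\<close>, as \<open>exchange_progress\<close>
      requires.\<close>
    define R where "R k s' \<longleftrightarrow> s' ''seen'' 0 = (if q < k then 1 else 0) \<and> (q < k \<longrightarrow> s' ''q'' 0 = int q) \<and>
      ((\<forall>p<k. \<not> gd p) \<or> (\<exists>sp<k. s' ''s'' 0 = int sp \<and> gd sp \<and> (\<forall>p<k. sp < p \<longrightarrow> \<not> gd p)))" for k and s' :: state
    show ?case
    proof (rule wp_SeqWrite, goal_cases)
      case 2
      show ?case
      proof (rule wp_For[where N = m and I = R], goal_cases)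
        case (8 k s3)
        have fr: "s3 y = s2 y" if "y \<notin> {''a'', ''u'', ''seen'', ''q'', ''s''}" for y
          using 8(4)[of y] that by simp
        have km: "k < m" by fact
        have \<pi>k: "ordv i k < m" using ordering_on_less[OF \<pi> km] .
        have e: "s3 ''oo'' (int k) = int (ordv i k)" "s3 ''t'' 0 = int t"
            "s3 ''d'' (int (ordv i k)) = int (dv (ordv i k))" "s3 ''d'' (int t) = int (dv t)"
          using oo2[OF km] t vecD[OF d \<pi>k] vecD[OF d tm] by (simp_all add: fr fr2)
        have qk: "ordv i k = t \<longleftrightarrow> k = q" using q ordering_on_inj[OF \<pi> km q(1)] by simp
        have sb: "s3 ''seen'' 0 = (if q < k then 1 else 0)" "q < k \<Longrightarrow> s3 ''q'' 0 = int q"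
          "(\<forall>p<k. \<not> gd p) \<or> (\<exists>sp<k. s3 ''s'' 0 = int sp \<and> gd sp \<and> (\<forall>p<k. sp < p \<longrightarrow> \<not> gd p))"
          using 8(2) by (simp_all add: R_def)
        have eqd: "int (dv (ordv i k)) + 1 = int (dv t) \<longleftrightarrow> dv (ordv i k) + 1 = dv t" by linarith
        have keep: "(\<forall>p<Suc k. \<not> gd p) \<or> (\<exists>sp<Suc k. s3 ''s'' 0 = int sp \<and> gd sp \<and> (\<forall>p<Suc k. sp < p \<longrightarrow> \<not> gd p))"
          if "\<not> gd k" using sb(3) that by (metis less_Suc_eq)
        show ?case
        proof (rule wp_SeqWrite, goal_cases)
          case 1
          show ?case using \<pi>k by (simp add: e 8(3) nat_Z)
        next
          case 2
          show ?case
          proof (rule wp_Cond, goal_cases)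
            case 1
            then have "k = q" using qk by (simp add: e 8(3))
            then have lt: "q < Suc k" "\<not> gd k" by (auto simp: gd_def)
            have kq: "int k = int q" using \<open>k = q\<close> by simp
            show ?case using one_Z keep[OF lt(2)] nat_Z[of k] km lt(1) kq
              by (intro wp_SeqWrite wp_Write) (simp_all add: e 8(3) R_def)
          next
            case 2
            then have "k \<noteq> q" using qk by (simp add: e 8(3))
            then have lt: "q < Suc k \<longleftrightarrow> q < k" by auto
            show ?case
            proof (rule wp_Cond, goal_cases)
              case 1
              then have gdk: "gd k" using \<open>k \<noteq> q\<close> unfolding gd_def
                by (auto simp: e 8(3) sb eqd split: if_splits)
              then have "\<exists>sp<Suc k. int k = int sp \<and> gd sp \<and> (\<forall>p<Suc k. sp < p \<longrightarrow> \<not> gd p)"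
                by (intro exI[of _ k]) auto
              moreover have "\<not> q < k" using gdk by (simp add: gd_def)
              ultimately show ?case using nat_Z[of k] km
                by (intro wp_Write) (simp_all add: e 8(3) R_def lt sb)
            next
              case 2
              then have "\<not> gd k" unfolding gd_def
                by (auto simp: e 8(3) sb eqd split: if_splits)
              from keep[OF this] show ?case using sb(2)
                by (intro wp_Skip) (simp add: e 8(3) R_def lt sb(1))
            qed
          qed
        qed
      next
        case (9 s3)
        have fr: "s3 y = s2 y" if "y \<notin> {''a'', ''u'', ''seen'', ''q'', ''s''}" for y
          using 9(3)[of y] that by simp
        have q3: "s3 ''q'' 0 = int q" using 9(1) q(1) by (simp add: R_def)
        have "\<exists>p<m. gd p" using q unfolding gd_def by (metis less_trans)
        then obtain sp where sp: "s3 ''s'' 0 = int sp" "gd sp" "\<And>p. p < m \<Longrightarrow> sp < p \<Longrightarrow> \<not> gd p"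
          using 9(1) unfolding R_def by blast
        show ?case
        proof (rule post[where sp = sp and q = q])
          show "vec s3 ''oo'' (\<lambda>p. int (ordv i p))" "vec s3 ''bb'' (Bv i)"
            using oo2 bb2 by (simp_all add: vec_def fr)
          show "dv (ordv i p) + 1 \<noteq> dv t" if "sp < p" "p < q" for p
            using sp(3)[of p] that q(1) by (simp add: gd_def)
        qed (use q3 sp q in \<open>simp_all add: fr fr2 gd_def\<close>)
      qed (use m_H m_Z envD(1)[OF env] in \<open>simp_all add: R_def fr2\<close>)
    qed (use one_Z in simp)
  qed (use envD[OF env] m_H m_Z in \<open>simp_all add: fr1\<close>)
qed (use envD[OF env] m_H m_Z in simp_all)

end

lemma wvars_exchange_update [simp]: "wvars exchange_update = {''u'', ''al'', ''be'', ''a'', ''kap'', ''r''}"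
  by (auto simp: exchange_update_def)

context minimizer begin

section \<open>Exponent arithmetic\<close>

lemma power_mult_le: "\<bar>a\<bar> \<le> U ^ i \<Longrightarrow> \<bar>b\<bar> \<le> U ^ j \<Longrightarrow> \<bar>a * b\<bar> \<le> U ^ (i + j)"
  unfolding abs_mult power_add using U by (intro mult_mono) auto

text \<open>A sum of two costs one exponent because \<open>U \<ge> 2\<close>; a sum of up to
  \<open>m\<close> terms costs one as well because \<open>m < U\<close>.\<close>

lemma power_add_le: "\<bar>a\<bar> \<le> U ^ i \<Longrightarrow> \<bar>b\<bar> \<le> U ^ i \<Longrightarrow> \<bar>a + b\<bar> \<le> U ^ Suc i"
proof -
  assume "\<bar>a\<bar> \<le> U ^ i" "\<bar>b\<bar> \<le> U ^ i"
  then have "\<bar>a + b\<bar> \<le> 2 * U ^ i" by simp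
  also have "\<dots> \<le> U * U ^ i" using U by (intro mult_right_mono) auto
  finally show ?thesis by simp
qed

lemma power_diff_le: "\<bar>a\<bar> \<le> U ^ i \<Longrightarrow> \<bar>b\<bar> \<le> U ^ i \<Longrightarrow> \<bar>a - b\<bar> \<le> U ^ Suc i"
  using power_add_le[of a i "- b"] by simp

lemma power_mono_le: "\<bar>a\<bar> \<le> U ^ i \<Longrightarrow> i \<le> j \<Longrightarrow> \<bar>a\<bar> \<le> U ^ j"
  using power_le[of i j] by simp

lemma power_sum_le:
  assumes "\<And>k. k < N \<Longrightarrow> \<bar>f k\<bar> \<le> U ^ i" "N \<le> m"
  shows "\<bar>\<Sum>k<N. f k\<bar> \<le> U ^ Suc i"
proof -
  have "\<bar>\<Sum>k<N. f k\<bar> \<le> (\<Sum>k<N. \<bar>f k\<bar>)" by (rule sum_abs)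
  also have "\<dots> \<le> (\<Sum>k<N. U ^ i)" by (rule sum_mono) (use assms in auto)
  also have "\<dots> = int N * U ^ i" by simp
  also have "\<dots> \<le> U * U ^ i" using U assms(2) by (intro mult_right_mono) auto
  finally show ?thesis by simp
qed

lemma one_le_power: "\<bar>1\<bar> \<le> U ^ i"
  using power_le[of 0 i] by simp

section \<open>Back substitution and step length\<close>

lemma wp_exchange_update:
  assumes env: "env s" and oo: "vec s ''oo'' (\<lambda>p. int (\<pi> p))" and bb: "vec s ''bb'' bv"
    and w: "vec s ''w'' wv" and kap: "vec s ''kap'' kv" and r: "vec s ''r'' rv"
    and j: "s ''j'' 0 = int j" "j < m" and c: "s ''c'' 0 = int k" and \<pi>: "ordering_on m \<pi>"
    and bv: "\<And>v. v < m \<Longrightarrow> \<bar>bv v\<bar> \<le> U" and wv: "\<And>v. v < m \<Longrightarrow> \<bar>wv v\<bar> \<le> U"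
    and kv: "\<And>v. v < m \<Longrightarrow> \<bar>kv v\<bar> \<le> U ^ l" and rv: "\<And>v. v < m \<Longrightarrow> \<bar>rv v\<bar> \<le> U ^ l" and l: "l + 3 \<le> E"
    and ab: "(al, be) = (if 0 < wv (\<pi> j) - bv (\<pi> j) \<and> 0 < k then (wv (\<pi> j) - bv (\<pi> j), - rv (\<pi> j)) else (0, 1))"
    and post: "\<And>s'. (\<And>y. y \<notin> wvars exchange_update \<Longrightarrow> s' y = s y) \<Longrightarrow>
       vec s' ''kap'' (\<lambda>i. al * kv i + (if i = j then be else 0)) \<Longrightarrow>
       vec s' ''r'' (\<lambda>v. al * rv v + be * (wv v - bv v)) \<Longrightarrow>
       (\<And>v. v < m \<Longrightarrow> \<bar>al * kv v + (if v = j then be else 0)\<bar> \<le> U ^ (l + 3)) \<Longrightarrow>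
       (\<And>v. v < m \<Longrightarrow> \<bar>al * rv v + be * (wv v - bv v)\<bar> \<le> U ^ (l + 3)) \<Longrightarrow> Q s'"
  shows "wp exchange_update Q s"
proof -
  let ?u = "\<pi> j"
  have u: "?u < m" using ordering_on_less[OF \<pi> j(2)] .
  \<comment> \<open>Entries of the vectors are at most \<open>U\<close>, so pivots are at most
    \<open>U ^ 2\<close>; multiplying by them adds two to the exponent and the final addition one
    more, three in all.\<close>
  have diff: "\<bar>wv v - bv v\<bar> \<le> U ^ 2" if "v < m" for v
    using power_diff_le[of "wv v" 1 "bv v"] wv[OF that] bv[OF that] by (simp add: numeral_2_eq_2)
  have al: "\<bar>al\<bar> \<le> U ^ 2" using ab diff[OF u] by (auto split: if_splits)
  have be: "\<bar>be\<bar> \<le> U ^ l" using ab rv[OF u] one_le_power[of l] by (auto split: if_splits)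
  have alk: "\<bar>al * kv v\<bar> \<le> U ^ (2 + l)" "\<bar>al * rv v\<bar> \<le> U ^ (2 + l)" if "v < m" for v
    using power_mult_le[OF al kv[OF that]] power_mult_le[OF al rv[OF that]] by auto
  have be': "\<bar>be * (wv v - bv v)\<bar> \<le> U ^ (2 + l)" if "v < m" for v
    using power_mult_le[OF be diff[OF that]] by (simp add: add.commute)
  have kb: "\<bar>al * kv v + (if v = j then be else 0)\<bar> \<le> U ^ (l + 3)" if "v < m" for v
  proof -
    have "\<bar>if v = j then be else 0\<bar> \<le> U ^ (2 + l)" using power_mono_le[OF be, of "2 + l"] U by simp
    from power_add_le[OF alk(1)[OF that] this] show ?thesis by (simp add: numeral_3_eq_3 add.commute)
  qed
  have rb: "\<bar>al * rv v + be * (wv v - bv v)\<bar> \<le> U ^ (l + 3)" if "v < m" for v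
    using power_add_le[OF alk(2)[OF that] be'[OF that]] by (simp add: numeral_3_eq_3 add.commute)
  have Zb: "\<bar>a\<bar> \<le> Z" if "\<bar>a\<bar> \<le> U ^ i" "i \<le> l + 3" for a i
    by (rule le_Z[OF that(1)]) (use that(2) l in simp)
  let ?pv = "wv ?u - bv ?u"
  have e: "s ''oo'' (int j) = int ?u" "s ''w'' (int ?u) = wv ?u" "s ''bb'' (int ?u) = bv ?u" "s ''r'' (int ?u) = rv ?u"
    using vecD[OF oo j(2)] vecD[OF w u] vecD[OF bb u] vecD[OF r u] by auto
  show ?thesis unfolding exchange_update_def
  proof (rule wp_SeqWrite, goal_cases)
    case 1
    show ?case using u by (simp add: j e nat_Z)
  next
    case 2
    show ?case
    proof (rule wp_SeqWrite, goal_cases)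
      case 1
      have "\<bar>?pv\<bar> \<le> Z" by (rule Zb[OF diff[OF u]]) simp
      then show ?case by (simp add: j e)
    next
      case 2
      show ?case
      proof (rule wp_SeqWrite, goal_cases)
        case 1
        have "\<bar>rv ?u\<bar> \<le> Z" by (rule Zb[OF rv[OF u]]) simp
        then show ?case by (simp add: j e)
      next
        case 2
        let ?s = "s(''u'' := (s ''u'')(0 := int ?u), ''al'' := (s ''al'')(0 := ?pv), ''be'' := (s ''be'')(0 := - rv ?u))"
        let ?rest = "For ''a'' (Var ''m'') (Write ''kap'' (Var ''a'') (Mul (Var ''al'') (Read ''kap'' (Var ''a'')))) ;;
          Write ''kap'' (Var ''j'') (Add (Read ''kap'' (Var ''j'')) (Var ''be'')) ;;
          For ''a'' (Var ''m'') (Write ''r'' (Var ''a'') (Add (Mul (Var ''al'') (Read ''r'' (Var ''a'')))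
             (Mul (Var ''be'') (Sub (Read ''w'' (Var ''a'')) (Read ''bb'' (Var ''a''))))))"
        have rest: "wp ?rest Q s1" if s1: "\<And>y. y \<notin> {''u'', ''al'', ''be''} \<Longrightarrow> s1 y = s y"
           "s1 ''al'' 0 = al" "s1 ''be'' 0 = be" for s1
        proof (rule wp_Seq, rule wp_fill[where N = m and f = "\<lambda>i. al * kv i" and off = 0], goal_cases)
          case (7 k' s2)
          have "s2 ''kap'' (int k') = kv k'" using 7(4)[of "int k'"] vecD[OF kap 7(1)] by (simp add: s1)
          then show ?case using Zb[OF alk(1)[OF 7(1)]] by (simp add: 7(2,3) s1)
        next
          case (8 s2)
          note f2 = 8(1)
          have kap2: "s2 ''kap'' (int i) = al * kv i" if "i < m" for i using 8(2)[OF that] by simp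
          show ?case
          proof (rule wp_SeqWrite, goal_cases)
            case 1
            show ?case using Zb[OF kb[OF j(2)]] by (simp add: f2 s1 j kap2)
          next
            case 2
            show ?case
            proof (rule wp_fill[where N = m and f = "\<lambda>v. al * rv v + be * (wv v - bv v)" and off = 0], goal_cases)
              case (7 v s3)
              have "s3 ''r'' (int v) = rv v" using 7(4)[of "int v"] vecD[OF r 7(1)] by (simp add: f2 s1)
              moreover have "s3 ''w'' (int v) = wv v" "s3 ''bb'' (int v) = bv v"
                using vecD[OF w 7(1)] vecD[OF bb 7(1)] by (simp_all add: 7(3) f2 s1)
              ultimately show ?case using Zb[OF rb[OF 7(1)]] by (simp add: 7(2,3) f2 s1)
            next
              case (8 s3)
              show ?case
              proof (rule post)
                show "s3 y = s y" if "y \<notin> wvars exchange_update" for y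
                  using that by (simp add: 8(1) f2 s1)
                show "vec s3 ''kap'' (\<lambda>i. al * kv i + (if i = j then be else 0))"
                  unfolding vec_def using j(2) by (simp add: 8(1) f2 s1 kap2 j)
                show "vec s3 ''r'' (\<lambda>v. al * rv v + be * (wv v - bv v))"
                  unfolding vec_def using 8(2) by simp
              qed (fact kb rb)+
            qed (use m_H m_Z envD(1)[OF env] in \<open>simp_all add: f2 s1\<close>)
          qed
        qed (use m_H m_Z envD(1)[OF env] in \<open>simp_all add: s1\<close>)
        have "wp (Cond (Conj (Less (Const 0) (Var ''al'')) (Less (Const 0) (Var ''c''))) Skip
             (Assign ''al'' (Const 0) ;; Assign ''be'' (Const 1)) ;; ?rest) Q ?s"
        proof (rule wp_Seq, rule wp_Cond, goal_cases)
          case 1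
          then have "(al, be) = (?pv, - rv ?u)" using ab by (simp add: c)
          then show ?case by (intro wp_Skip rest) simp_all
        next
          case 2
          then have "(al, be) = (0, 1)" using ab by (auto simp: c)
          then show ?case using one_Z by (intro wp_SeqWrite wp_Write rest) simp_all
        qed
        then show ?case by (simp add: j e)
      qed
    qed
  qed
qed

lemma wp_exchange:
  assumes env: "env s" and oo: "vec s ''oo'' (\<lambda>p. int (\<pi> p))" and bb: "vec s ''bb'' (greedy F m \<pi>)"
    and \<pi>: "ordering_on m \<pi>" and sp: "s ''s'' 0 = int sp" and q: "s ''q'' 0 = int q" "sp < q" "q < m"
    and E': "3 * m + 2 \<le> E"
    and post: "\<And>s' kv rv. (\<And>y. y \<notin> wvars exchange_com \<Longrightarrow> s' y = s y) \<Longrightarrow>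
       vec s' ''kap'' kv \<Longrightarrow> vec s' ''r'' rv \<Longrightarrow> exchange \<pi> sp q (Suc sp) kv rv \<Longrightarrow>
       (\<And>v. v < m \<Longrightarrow> \<bar>kv v\<bar> \<le> U ^ (3 * m + 2)) \<Longrightarrow> (\<And>v. v < m \<Longrightarrow> \<bar>rv v\<bar> \<le> U ^ (3 * m + 2)) \<Longrightarrow> Q s'"
  shows "wp exchange_com Q s"
proof -
  define W where "W = wvars exchange_com"
  have W: "W = {''a'', ''c'', ''j'', ''kap'', ''r'', ''al'', ''be'', ''u'', ''co'', ''mask'', ''prev'', ''cnt'', ''dummy'', ''ans'', ''cur'', ''w''}"
    by (auto simp: W_def exchange_com_def)
  \<comment> \<open>After \<open>k\<close> rounds the positions from \<open>q - k + 1\<close> on are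
    settled, but never below \<open>sp + 1\<close>. At \<open>k = 0\<close> all multipliers are
    zero, which \<open>exchange\<close> excludes, so nothing is claimed yet.\<close>
  define P where "P k s' \<longleftrightarrow> (\<exists>kv rv. vec s' ''kap'' kv \<and> vec s' ''r'' rv \<and>
      (\<forall>v<m. \<bar>kv v\<bar> \<le> U ^ (3 * k + 2) \<and> \<bar>rv v\<bar> \<le> U ^ (3 * k + 2)) \<and>
      (k > 0 \<longrightarrow> exchange \<pi> sp q (max (Suc sp) (Suc q - k)) kv rv))" for k and s' :: state
  show ?thesis unfolding exchange_com_def
  proof (rule wp_Seq, rule wp_fill[where N = m and f = "\<lambda>_. 0" and off = 0], goal_cases)
    case (8 s1)
    note f1 = 8(1)
    have r1: "vec s1 ''r'' (\<lambda>_. 0)" using 8(2) by (simp add: vec_def)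
    show ?case
    proof (rule wp_Seq, rule wp_fill[where N = m and f = "\<lambda>_. 0" and off = 0], goal_cases)
      case (8 s2)
      note f2 = 8(1)
      have k2: "vec s2 ''kap'' (\<lambda>_. 0)" using 8(2) by (simp add: vec_def)
      have r2: "vec s2 ''r'' (\<lambda>_. 0)" using r1 by (simp add: vec_def f2)
      show ?case
      proof (rule wp_For[where N = m and I = P], goal_cases)
        case (7)
        have "P 0 s2" unfolding P_def using k2 r2 U by (intro exI[of _ "\<lambda>_. 0"]) simp
        then show ?case by (simp add: P_def vec_def)
      next
        case (8 k s3)
        have fr: "s3 y = s y" if "y \<notin> W" for y using 8(4)[of y] that by (simp add: W f2 f1)
        have km: "k < m" by fact
        obtain kv rv where P3: "vec s3 ''kap'' kv" "vec s3 ''r'' rv"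
          "\<And>v. v < m \<Longrightarrow> \<bar>kv v\<bar> \<le> U ^ (3 * k + 2)" "\<And>v. v < m \<Longrightarrow> \<bar>rv v\<bar> \<le> U ^ (3 * k + 2)"
          "k > 0 \<Longrightarrow> exchange \<pi> sp q (max (Suc sp) (Suc q - k)) kv rv"
          using 8(2) unfolding P_def by blast
        have sq: "s3 ''s'' 0 = int sp" "s3 ''q'' 0 = int q" by (simp_all add: fr W sp q)
        show ?case
        proof (rule wp_SeqWrite, goal_cases)
          case 1
          show ?case using km q(3) by (simp add: sq 8(3)) (intro small, simp)
        next
          case 2
          show ?case
          proof (rule wp_Cond, goal_cases)
            case 2
            then have le: "q \<le> sp + k" by (simp add: sq 8(3))
            then have k0: "k > 0" using q(2) by simp
            have "exchange \<pi> sp q (max (Suc sp) (Suc q - Suc k)) kv rv"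

            proof -
              have "max (Suc sp) (Suc q - Suc k) = Suc sp" "max (Suc sp) (Suc q - k) = Suc sp"
                by (intro max_absorb1; use le in simp)+
              then show ?thesis using P3(5)[OF k0] by simp
            qed
            then have "P (Suc k) s3" unfolding P_def
              using P3(1,2) power_mono_le[OF P3(3), of _ "3 * Suc k + 2"] power_mono_le[OF P3(4), of _ "3 * Suc k + 2"]
              by (intro exI[of _ kv] exI[of _ rv]) simp
            then show ?case by (intro wp_Skip) (simp add: P_def vec_def)
          next
            case 1
            then have lt: "sp + k < q" by (simp add: sq 8(3))
            define j where "j = q - k"
            have j: "int q - int k = int j" "sp < j" "j \<le> q" "j < m" using lt q by (auto simp: j_def)
            let ?s4 = "s3(''j'' := (s3 ''j'')(0 := int j))"
            have fr4: "?s4 y = s y" if "y \<notin> W" for y using that by (simp add: fr W)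
            have "wp (moved_com ;; exchange_update) (\<lambda>s'. P (Suc k) (s'(''c'' := (s' ''c'')(0 := int k + 1)))) ?s4"
            proof (rule wp_Seq, rule wp_moved[OF _ \<pi>, where sp = sp and j = j], goal_cases)
              case 1
              show ?case by (rule env_cong[OF _ env]) (auto simp: fr W)
            next
              case 2
              show ?case using vecD[OF oo] by (simp add: vec_def fr W)
            next
              case (7 s5)
              note f5 = 7(1)
              let ?w = "greedy F m (move_to \<pi> sp j)"
              have \<pi>j: "ordering_on m (move_to \<pi> sp j)" by (rule ordering_on_move_to[OF \<pi>]) (use j in auto)
              have diff: "?w v - greedy F m \<pi> v = swap_gain \<pi> sp j v" for v by (simp add: swap_gain_def)
              define al be where "al = (if 0 < swap_gain \<pi> sp j (\<pi> j) \<and> 0 < k then swap_gain \<pi> sp j (\<pi> j) else 0)"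
                and "be = (if 0 < swap_gain \<pi> sp j (\<pi> j) \<and> 0 < k then - rv (\<pi> j) else 1)"
              show ?case
              proof (rule wp_exchange_update[where \<pi> = \<pi> and bv = "greedy F m \<pi>" and wv = ?w and kv = kv and rv = rv and j = j and k = k and l = "3 * k + 2" and al = al and be = be], goal_cases)
                case 1
                show ?case by (rule env_cong[OF _ env]) (auto simp: f5 fr W)
              next
                case 2
                show ?case using vecD[OF oo] by (simp add: vec_def f5 fr W)
              next
                case 3
                show ?case using vecD[OF bb] by (simp add: vec_def f5 fr W)
              next
                case 4
                show ?case by fact
              next
                case 5
                show ?case using P3(1) by (simp add: vec_def f5)
              next
                case 6
                show ?case using P3(2) by (simp add: vec_def f5)
              next
                case 15
                show ?case using km E' by simp
              next
                case (17 s6)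
                let ?kv = "\<lambda>i. al * kv i + (if i = j then be else 0)"
                let ?rv = "\<lambda>v. al * rv v + be * (?w v - greedy F m \<pi> v)"
                have "exchange \<pi> sp q j ?kv ?rv"
                proof (cases "0 < swap_gain \<pi> sp j (\<pi> j) \<and> 0 < k")
                  case True
                  have "max (Suc sp) (Suc q - k) = Suc j" using lt by (simp add: j_def)
                  then have ex: "exchange \<pi> sp q (Suc j) kv rv" and jq: "j < q"
                    using P3(5) True lt by (auto simp: j_def)
                  show ?thesis
                  proof (rule exchange_step[OF \<pi> j(2) jq q(3) ex])
                    have alb: "al = swap_gain \<pi> sp j (\<pi> j)" "be = - rv (\<pi> j)"
                      using True by (simp_all add: al_def be_def)
                    show "?kv i = swap_gain \<pi> sp j (\<pi> j) * kv i + (if i = j then - rv (\<pi> j) else 0)" for i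
                      unfolding alb by (rule refl)
                    show "?rv v = swap_gain \<pi> sp j (\<pi> j) * rv v + - rv (\<pi> j) * swap_gain \<pi> sp j v" for v
                      unfolding alb diff by (rule refl)
                  qed (use True in auto)
                next
                  case False
                  \<comment> \<open>Either this is round zero, where \<open>j = q\<close>, or the
                    pivot vanishes; in both cases the system restarts from a single column.\<close>
                  have "swap_gain \<pi> sp j (\<pi> j) \<ge> 0" by (rule swap_gain_moved[OF \<pi>]) (use j in auto)
                  with False have "j = q \<or> swap_gain \<pi> sp j (\<pi> j) = 0" by (auto simp: j_def)
                  then show ?thesis
                    by (intro exchange_single[OF \<pi> j(2,3) q(3)]) (use False in \<open>auto simp: al_def be_def diff\<close>)
                qed
                moreover have "max (Suc sp) (Suc q - Suc k) = j" using lt by (simp add: j_def)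
                moreover have "3 * k + 2 + 3 = 3 * Suc k + 2" by simp
                ultimately have "P (Suc k) s6" unfolding P_def using 17(2-5)
                  by (intro exI[of _ ?kv] exI[of _ ?rv]) simp
                then show ?case by (simp add: P_def vec_def)
              qed (use j 8(3) greedy_bound[OF \<pi>] greedy_bound[OF \<pi>j] P3(3,4) \<pi> in \<open>simp_all add: f5 al_def be_def diff\<close>)
            qed (use j in \<open>simp_all add: sq\<close>)
            then show ?case by (simp add: sq 8(3) j)
          qed
        qed
      next
        case (9 s3)
        have fr: "s3 y = s y" if "y \<notin> W" for y using 9(3)[of y] that by (simp add: W f2 f1)
        obtain kv rv where P3: "vec s3 ''kap'' kv" "vec s3 ''r'' rv"
          "\<And>v. v < m \<Longrightarrow> \<bar>kv v\<bar> \<le> U ^ (3 * m + 2)" "\<And>v. v < m \<Longrightarrow> \<bar>rv v\<bar> \<le> U ^ (3 * m + 2)"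
          "exchange \<pi> sp q (max (Suc sp) (Suc q - m)) kv rv"
          using 9(1) m_pos unfolding P_def by blast
        have "max (Suc sp) (Suc q - m) = Suc sp" using q(3) by simp
        then show ?case using post[of s3 kv rv] P3 fr unfolding W_def by simp
      qed (use m_H m_Z envD(1)[OF env] in \<open>simp_all add: f1 f2\<close>)
    qed (use m_H m_Z Z_pos envD(1)[OF env] in \<open>simp_all add: f1\<close>)
  qed (use m_H m_Z Z_pos envD(1)[OF env] in simp_all)
qed

lemma wp_rescale:
  assumes env: "env s" and kap: "vec s ''kap'' kv" and r: "vec s ''r'' rv" and lam: "vec s ''lam'' lv"
    and x: "vec s ''x'' xv" and t: "s ''t'' 0 = int t" "t < m" and i: "s ''b'' 0 = int i" "i < m"
    and kv: "\<And>v. v < m \<Longrightarrow> \<bar>kv v\<bar> \<le> U ^ (3 * m + 2)" and rv: "\<And>v. v < m \<Longrightarrow> \<bar>rv v\<bar> \<le> U ^ (3 * m + 2)"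
    and lv: "\<And>v. v < m \<Longrightarrow> \<bar>lv v\<bar> \<le> U ^ l" and xv: "\<And>v. v < m \<Longrightarrow> \<bar>xv v\<bar> \<le> U ^ (l + 2)"
    and l: "l + 3 * m + 6 \<le> E"
    and cc: "(c0, c1) = (if - xv t * (\<Sum>j<m. kv j) < lv i * rv t then (rv t, - xv t) else (\<Sum>j<m. kv j, lv i))"
    and post: "\<And>s'. (\<And>y. y \<notin> {''K'', ''a'', ''c0'', ''c1'', ''lam'', ''kap''} \<Longrightarrow> s' y = s y) \<Longrightarrow>
       vec s' ''lam'' (\<lambda>j. c0 * lv j - (if j = i then c1 * (\<Sum>j<m. kv j) else 0)) \<Longrightarrow>
       vec s' ''kap'' (\<lambda>j. c1 * kv j) \<Longrightarrow>
       (\<And>v. v < m \<Longrightarrow> \<bar>c0 * lv v - (if v = i then c1 * (\<Sum>j<m. kv j) else 0)\<bar> \<le> U ^ (l + 3 * m + 6)) \<Longrightarrow>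
       (\<And>v. v < m \<Longrightarrow> \<bar>c1 * kv v\<bar> \<le> U ^ (l + 3 * m + 6)) \<Longrightarrow> Q s'"
  shows "wp rescale Q s"
proof -
  let ?K = "\<Sum>j<m. kv j"
  have K: "\<bar>\<Sum>j<k. kv j\<bar> \<le> U ^ (3 * m + 3)" if "k \<le> m" for k
    by (rule power_mono_le[OF power_sum_le[of k kv "3 * m + 2"]]) (use kv that in auto)
  \<comment> \<open>In either branch \<open>c0\<close> has the size of the multipliers and
    \<open>c1\<close> that of the old coefficients, up to two exponents for \<open>x\<close>; so all
    products stay linear in the old coefficients.\<close>
  have c0: "\<bar>c0\<bar> \<le> U ^ (3 * m + 3)" using cc K[of m] power_mono_le[OF rv[OF t(2)], of "3 * m + 3"]
    by (auto split: if_splits)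
  have c1: "\<bar>c1\<bar> \<le> U ^ (l + 2)" using cc xv[OF t(2)] power_mono_le[OF lv[OF i(2)], of "l + 2"]
    by (auto split: if_splits)
  have a: "\<bar>c0 * lv v\<bar> \<le> U ^ (l + 3 * m + 5)" if "v < m" for v
    by (rule power_mono_le[OF power_mult_le[OF c0 lv[OF that]]]) simp
  have b: "\<bar>c1 * ?K\<bar> \<le> U ^ (l + 3 * m + 5)"
    by (rule power_mono_le[OF power_mult_le[OF c1 K[OF order_refl]]]) simp
  have lb: "\<bar>c0 * lv v - (if v = i then c1 * ?K else 0)\<bar> \<le> U ^ (l + 3 * m + 6)" if "v < m" for v
  proof -
    have c: "\<bar>if v = i then c1 * ?K else 0\<bar> \<le> U ^ (l + 3 * m + 5)" using b U by simp
    show ?thesis by (rule power_mono_le[OF power_diff_le[OF a[OF that] c]]) simp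
  qed
  have kb: "\<bar>c1 * kv v\<bar> \<le> U ^ (l + 3 * m + 6)" if "v < m" for v
    by (rule power_mono_le[OF power_mult_le[OF c1 kv[OF that]]]) simp
  have Zb: "\<bar>a\<bar> \<le> Z" if "\<bar>a\<bar> \<le> U ^ k" "k \<le> l + 3 * m + 6" for a k
    by (rule le_Z[OF that(1)]) (use that(2) l in simp)
  show ?thesis unfolding rescale_def
  proof (rule wp_SeqWrite, goal_cases)
    case 2
    show ?case
    proof (rule wp_Seq, rule wp_sum[where N = m and f = kv], goal_cases)
      case (7 k s1)
      then show ?case using vecD[OF kap] by simp
    next
      case (8 k)
      show ?case by (rule Zb[OF K[OF 8]]) simp
    next
      case (10 s1)
      have f1: "s1 y = s y" if "y \<notin> {''K'', ''a''}" for y using 10(1)[of y] that by simp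
      note K1 = 10(2)
      let ?rest = "For ''a'' (Var ''m'') (Write ''lam'' (Var ''a'') (Mul (Var ''c0'') (Read ''lam'' (Var ''a'')))) ;;
        Write ''lam'' (Var ''b'') (Sub (Read ''lam'' (Var ''b'')) (Mul (Var ''c1'') (Var ''K''))) ;;
        For ''a'' (Var ''m'') (Write ''kap'' (Var ''a'') (Mul (Var ''c1'') (Read ''kap'' (Var ''a''))))"
      have e: "s1 ''x'' (int t) = xv t" "s1 ''lam'' (int i) = lv i" "s1 ''r'' (int t) = rv t" "s1 ''t'' 0 = int t" "s1 ''b'' 0 = int i"
        using vecD[OF x t(2)] vecD[OF lam i(2)] vecD[OF r t(2)] by (simp_all add: f1 t i)
      have rest: "wp ?rest Q s2" if s2: "\<And>y. y \<notin> {''c0'', ''c1''} \<Longrightarrow> s2 y = s1 y" "s2 ''c0'' 0 = c0" "s2 ''c1'' 0 = c1" for s2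
      proof (rule wp_Seq, rule wp_fill[where N = m and f = "\<lambda>j. c0 * lv j" and off = 0], goal_cases)
        case (7 k s3)
        have "s3 ''lam'' (int k) = lv k" using 7(4)[of "int k"] vecD[OF lam 7(1)] by (simp add: s2 f1)
        then show ?case using Zb[OF a[OF 7(1)]] by (simp add: 7(2,3) s2)
      next
        case (8 s3)
        note f3 = 8(1)
        have lam3: "s3 ''lam'' (int j) = c0 * lv j" if "j < m" for j using 8(2)[OF that] by simp
        show ?case
        proof (rule wp_SeqWrite, goal_cases)
          case 1
          show ?case using Zb[OF lb[OF i(2)]] by (simp add: f3 s2 e lam3 i K1)
        next
          case 2
          show ?case
          proof (rule wp_fill[where N = m and f = "\<lambda>j. c1 * kv j" and off = 0], goal_cases)
            case (7 k s4)
            have "s4 ''kap'' (int k) = kv k" using 7(4)[of "int k"] vecD[OF kap 7(1)] by (simp add: f3 s2 f1)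
            then show ?case using Zb[OF kb[OF 7(1)]] by (simp add: 7(2,3) f3 s2)
          next
            case (8 s4)
            show ?case
            proof (rule post)
              show "s4 y = s y" if "y \<notin> {''K'', ''a'', ''c0'', ''c1'', ''lam'', ''kap''}" for y
                using that by (simp add: 8(1) f3 s2 f1)
              show "vec s4 ''lam'' (\<lambda>j. c0 * lv j - (if j = i then c1 * ?K else 0))"
                unfolding vec_def using i(2) by (simp add: 8(1) f3 s2 e lam3 K1)
              show "vec s4 ''kap'' (\<lambda>j. c1 * kv j)"
                unfolding vec_def using 8(2) by simp
            qed (fact lb kb)+
          qed (use m_H m_Z envD(1)[OF env] in \<open>simp_all add: f3 s2 f1\<close>)
        qed
      qed (use m_H m_Z envD(1)[OF env] in \<open>simp_all add: s2 f1\<close>)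
      show ?case
      proof (rule wp_Seq, rule wp_Cond, goal_cases)
        case 1
        then have "(c0, c1) = (rv t, - xv t)" using cc by (simp add: e K1)
        then show ?case using Zb[OF rv[OF t(2)]] Zb[OF xv[OF t(2)]]
          by (intro wp_SeqWrite wp_Write rest) (simp_all add: e)
      next
        case 2
        then have "(c0, c1) = (?K, lv i)" using cc by (simp add: e K1)
        then show ?case using Zb[OF K[of m]] Zb[OF lv[OF i(2)]]
          by (intro wp_SeqWrite wp_Write rest) (simp_all add: e K1)
      qed
    qed (use m_H m_Z envD(1)[OF env] in simp_all)
  qed (use one_Z in simp)
qed

section \<open>Insertion of an order into the basis\<close>

lemma cell_neq:
  assumes "j \<noteq> c" "v < m"
  shows "int j * int m + int v < int c * int m \<or> int c * int m + int m \<le> int j * int m + int v"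
proof (cases "j < c")
  case True
  then have "Suc j * m \<le> c * m" by (intro mult_right_mono) auto
  then have "j * m + v < c * m" using assms(2) by simp
  then have "int (j * m + v) < int (c * m)" by (simp only: of_nat_less_iff)
  then show ?thesis by simp
next
  case False
  then have "Suc c * m \<le> j * m" using assms(1) by (intro mult_right_mono) auto
  then have "c * m + m \<le> j * m + v" by simp
  then have "int (c * m + m) \<le> int (j * m + v)" by (simp only: of_nat_le_iff)
  then show ?thesis by simp
qed

lemma wp_fill_row:
  assumes vars: "cv \<noteq> ''a''" "cv \<noteq> x" "x \<noteq> ''a''" "x \<noteq> ''m''" and s0: "s0 ''m'' 0 = int m" "s0 cv 0 = int j" "j < m"
    and f: "matr s0 x f"
    and ev: "\<And>k s. k < m \<Longrightarrow> s ''a'' 0 = int k \<Longrightarrow> (\<And>y. y \<noteq> ''a'' \<Longrightarrow> y \<noteq> x \<Longrightarrow> s y = s0 y) \<Longrightarrow>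
      (\<And>j' v. j' < m \<Longrightarrow> v < m \<Longrightarrow> j' \<noteq> j \<or> k \<le> v \<Longrightarrow> s x (int j' * int m + int v) = f j' v) \<Longrightarrow>
      aval e s = g k \<and> \<bar>g k\<bar> \<le> Z"
    and post: "\<And>s. (\<And>y. y \<noteq> ''a'' \<Longrightarrow> y \<noteq> x \<Longrightarrow> s y = s0 y) \<Longrightarrow>
      matr s x (\<lambda>j' v. if j' = j then g v else f j' v) \<Longrightarrow> Q s"
  shows "wp (For ''a'' (Var ''m'') (Write x (cell cv (Var ''a'')) e)) Q s0"
proof (rule wp_fill[where N = m and f = g and off = "int j * int m"], goal_cases)
  case (7 k s)
  have "aval e s = g k \<and> \<bar>g k\<bar> \<le> Z"
  proof (rule ev[OF 7(1,2,3)])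
    fix j' v assume v: "j' < m" "v < m" "j' \<noteq> j \<or> k \<le> v"
    have "int j' * int m + int v < int j * int m \<or> int j * int m + int k \<le> int j' * int m + int v"
      using cell_neq[of j' j v] v 7(1) by (cases "j' = j") auto
    from 7(4)[OF this] show "s x (int j' * int m + int v) = f j' v" using matrD[OF f v(1,2)] by simp
  qed
  then show ?case using 7(2,3) vars s0 by simp
next
  case (8 s)
  show ?case
  proof (rule post[OF 8(1)])
    show "matr s x (\<lambda>j' v. if j' = j then g v else f j' v)"
      unfolding matr_def
    proof (intro allI impI)
      fix j' v assume v: "j' < m" "v < m"
      have "s x (int j' * int m + int v) = s0 x (int j' * int m + int v)" if "j' \<noteq> j"
        by (rule 8(3)) (rule cell_neq[OF that v(2)])
      then show "s x (int j' * int m + int v) = (if j' = j then g v else f j' v)"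
        using 8(2)[OF v(2)] matrD[OF f v] by simp
    qed
  qed
qed (use vars s0 m_H m_Z in auto)

lemma wp_coordinates:
  assumes env: "env s" and N: "matr s ''N'' Nv" and w: "vec s ''w'' wv"
    and Nv: "\<And>r c. r < m \<Longrightarrow> c < m \<Longrightarrow> \<bar>Nv r c\<bar> \<le> U ^ (2 * m)" and wv: "\<And>v. v < m \<Longrightarrow> \<bar>wv v\<bar> \<le> U"
    and E': "2 * m + 2 \<le> E"
    and post: "\<And>s'. (\<And>y. y \<notin> {''c'', ''a'', ''y'', ''Y''} \<Longrightarrow> s' y = s y) \<Longrightarrow>
       vec s' ''Y'' (\<lambda>r. \<Sum>c<m. Nv r c * wv c) \<Longrightarrow> Q s'"
  shows "wp coordinates Q s"
  unfolding coordinates_def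
proof (rule wp_For[where N = m and I = "\<lambda>k s'. \<forall>r<k. s' ''Y'' (int r) = (\<Sum>c<m. Nv r c * wv c)"], goal_cases)
  case (8 k s1)
  have fr: "s1 y = s y" if "y \<notin> {''c'', ''a'', ''y'', ''Y''}" for y using 8(4)[of y] that by simp
  have km: "k < m" by fact
  have bound: "\<bar>\<Sum>c<i. Nv k c * wv c\<bar> \<le> Z" if "i \<le> m" for i
  proof (rule le_Z[OF power_sum_le[OF _ that]])
    fix c assume c: "c < i"
    show "\<bar>Nv k c * wv c\<bar> \<le> U ^ (2 * m + 1)"
      by (rule power_mult_le) (use Nv[OF km, of c] wv[of c] c that in auto)
  qed (use E' in simp)
  show ?case
  proof (rule wp_SeqWrite, goal_cases)
    case 2
    show ?case
    proof (rule wp_Seq, rule wp_sum[where N = m and f = "\<lambda>c. Nv k c * wv c"], goal_cases)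
      case (7 c s2)
      show ?case using 7(3) by (simp add: 7(2) fr 8(3) envD(1)[OF env] matrD[OF N km 7(1)] vecD[OF w 7(1)])
    next
      case (8 i)
      then show ?case by (rule bound)
    next
      case (10 s2)
      show ?case
        by (rule wp_Write) (use bound[of m] 8(2) in \<open>simp_all add: 10 8(3) less_Suc_eq\<close>)
    qed (use m_H m_Z envD(1)[OF env] in \<open>simp_all add: fr\<close>)
  qed (use one_Z in simp)
next
  case (9 s1)
  show ?case by (rule post) (use 9 in \<open>simp_all add: vec_def\<close>)
qed (use m_H m_Z envD(1)[OF env] in simp_all)

lemma wp_ratio_test:
  assumes env: "env s" and Y: "vec s ''Y'' Yv" and lam: "vec s ''lam'' lv"
    and lv: "\<And>j. j < m \<Longrightarrow> 0 \<le> lv j"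
    and bY: "\<And>v. v < m \<Longrightarrow> \<bar>Yv v\<bar> \<le> Z" and bl: "\<And>v. v < m \<Longrightarrow> \<bar>lv v\<bar> \<le> Z"
    and post: "\<And>s'. (\<And>y. y \<notin> {''a'', ''p'', ''gb'', ''lb'', ''ay''} \<Longrightarrow> s' y = s y) \<Longrightarrow>
       s' ''p'' 0 = -1 \<and> (\<forall>r<m. \<not> (Yv r < 0 \<or> Yv r > 0 \<and> lv r = 0)) \<or>
       (\<exists>p<m. s' ''p'' 0 = int p \<and> (Yv p < 0 \<or> Yv p > 0 \<and> lv p = 0) \<and> s' ''gb'' 0 = \<bar>Yv p\<bar> \<and> s' ''lb'' 0 = lv p \<and>
          (\<forall>r<m. Yv r < 0 \<or> Yv r > 0 \<and> lv r = 0 \<longrightarrow> lv p * \<bar>Yv r\<bar> \<le> lv r * \<bar>Yv p\<bar>)) \<Longrightarrow> Q s'"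
  shows "wp ratio_test Q s"
proof -
  define cd where "cd r \<longleftrightarrow> Yv r < 0 \<or> Yv r > 0 \<and> lv r = 0" for r
  define P where "P k s' \<longleftrightarrow> s' ''p'' 0 = -1 \<and> (\<forall>r<k. \<not> cd r) \<or>
     (\<exists>p<m. s' ''p'' 0 = int p \<and> cd p \<and> s' ''gb'' 0 = \<bar>Yv p\<bar> \<and> s' ''lb'' 0 = lv p \<and>
          (\<forall>r<k. cd r \<longrightarrow> lv p * \<bar>Yv r\<bar> \<le> lv r * \<bar>Yv p\<bar>))" for k and s' :: state
  show ?thesis unfolding ratio_test_def
  proof (rule wp_SeqWrite, goal_cases)
    case 2
    show ?case
    proof (rule wp_SeqWrite, goal_cases)
      case 2
      show ?case
      proof (rule wp_SeqWrite, goal_cases)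
        case 2
        show ?case
        proof (rule wp_For[where N = m and I = P], goal_cases)
          case (8 k s1)
          have fr: "s1 y = s y" if "y \<notin> {''a'', ''p'', ''gb'', ''lb'', ''ay''}" for y using 8(4)[of y] that by simp
          have km: "k < m" by fact
          have e: "s1 ''Y'' (int k) = Yv k" "s1 ''lam'' (int k) = lv k"
            using vecD[OF Y km] vecD[OF lam km] by (simp_all add: fr)
          define ay where "ay = (if cd k then \<bar>Yv k\<bar> else 0)"
          let ?Q = "\<lambda>s'. P (Suc k) (s'(''a'' := (s' ''a'')(0 := int k + 1)))"
          let ?c = "Cond (Conj (Less (Const 0) (Var ''ay'')) (Neg (Conj (Neg (Less (Var ''p'') (Const 0)))
           (Neg (Less (Mul (Read ''lam'' (Var ''a'')) (Var ''gb'')) (Mul (Var ''lb'') (Var ''ay'')))))))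
      (Assign ''p'' (Var ''a'') ;; Assign ''gb'' (Var ''ay'') ;; Assign ''lb'' (Read ''lam'' (Var ''a''))) Skip"
          have rest: "wp ?c ?Q s2" if s2: "\<And>y. y \<noteq> ''ay'' \<Longrightarrow> s2 y = s1 y" "s2 ''ay'' 0 = ay \<or> s2 ''ay'' 0 \<le> 0 \<and> ay = 0" for s2
          proof (rule wp_Cond, goal_cases)
            case 1
            then have cdk: "cd k" "s2 ''ay'' 0 = \<bar>Yv k\<bar>" using s2(2) by (auto simp: ay_def split: if_splits)
            have "lv k * \<bar>Yv r\<bar> \<le> lv r * \<bar>Yv k\<bar>" if r: "r < Suc k" "cd r" for r
            proof (cases "r = k")
              case False
              then have rk: "r < k" using r by simp
              then obtain p where p: "p < m" "s1 ''p'' 0 = int p" "cd p" "s1 ''gb'' 0 = \<bar>Yv p\<bar>" "s1 ''lb'' 0 = lv p"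
                "lv p * \<bar>Yv r\<bar> \<le> lv r * \<bar>Yv p\<bar>" using 8(2) r(2) unfolding P_def by blast
              have lt: "lv k * \<bar>Yv p\<bar> < lv p * \<bar>Yv k\<bar>"
                using 1 p cdk by (simp add: s2(1) e 8(3))
              have Yp: "\<bar>Yv p\<bar> > 0" using p(3) by (auto simp: cd_def)
              \<comment> \<open>Transitivity of the comparison of ratios without dividing: multiply
                by \<open>|Yv p|\<close>, pass through \<open>p\<close>, and cancel.\<close>
              have "\<bar>Yv p\<bar> * (lv k * \<bar>Yv r\<bar>) = (lv k * \<bar>Yv p\<bar>) * \<bar>Yv r\<bar>" by simp
              also have "\<dots> \<le> (lv p * \<bar>Yv k\<bar>) * \<bar>Yv r\<bar>" using lt by (intro mult_right_mono) auto
              also have "\<dots> = (lv p * \<bar>Yv r\<bar>) * \<bar>Yv k\<bar>" by simp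
              also have "\<dots> \<le> (lv r * \<bar>Yv p\<bar>) * \<bar>Yv k\<bar>" using p(6) by (intro mult_right_mono) auto
              also have "\<dots> = \<bar>Yv p\<bar> * (lv r * \<bar>Yv k\<bar>)" by simp
              finally show ?thesis using Yp by simp
            qed simp
            then have "P (Suc k) (s2(''p'' := (s2 ''p'')(0 := int k), ''gb'' := (s2 ''gb'')(0 := \<bar>Yv k\<bar>), ''lb'' := (s2 ''lb'')(0 := lv k), ''a'' := (s2 ''a'')(0 := int k + 1)))"
              unfolding P_def using km cdk by (intro disjI2 exI[of _ k]) simp
            then show ?case using km bY[OF km] bl[OF km]
              by (intro wp_SeqWrite wp_Write) (simp_all add: s2(1) 8(3) e cdk(2) nat_Z)
          next
            case 2
            have "P (Suc k) s1"
            proof (cases "cd k")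
              case True
              then have ay: "s2 ''ay'' 0 = \<bar>Yv k\<bar>" "\<bar>Yv k\<bar> > 0" using s2(2) by (auto simp: ay_def cd_def)
              then have "\<not> s1 ''p'' 0 < 0" "\<not> lv k * s1 ''gb'' 0 < s1 ''lb'' 0 * \<bar>Yv k\<bar>"
                using 2 by (auto simp: s2(1) e 8(3))
              then show ?thesis using 8(2) unfolding P_def by (auto simp: less_Suc_eq)
            next
              case False
              then show ?thesis using 8(2) unfolding P_def by (auto simp: less_Suc_eq)
            qed
            then have P: "P (Suc k) (s2(''a'' := (s2 ''a'')(0 := int k + 1)))" by (simp add: P_def s2(1))
            show ?case by (rule wp_Skip) (rule P)
          qed
          show ?case
          proof (rule wp_Seq, rule wp_Cond, goal_cases)
            case 1
            then show ?case using bY[OF km]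
              by (intro wp_Write rest) (simp_all add: e 8(3) ay_def cd_def)
          next
            case 2
            then have n: "\<not> Yv k < 0" by (simp add: e 8(3))
            show ?case
            proof (rule wp_Cond, goal_cases)
              case 1
              then show ?case using n one_Z
                by (intro wp_Write rest) (simp_all add: e 8(3) ay_def cd_def)
            next
              case 2
              then have "lv k = 0" using lv[OF km] by (simp add: e 8(3))
              then show ?case using n bY[OF km]
                by (intro wp_Write rest) (simp_all add: e 8(3) ay_def cd_def)
            qed
          qed
        next
          case (9 s1)
          show ?case
          proof (rule post)
            show "s1 y = s y" if "y \<notin> {''a'', ''p'', ''gb'', ''lb'', ''ay''}" for y using 9(3)[of y] that by simp
            show "s1 ''p'' 0 = -1 \<and> (\<forall>r<m. \<not> (Yv r < 0 \<or> Yv r > 0 \<and> lv r = 0)) \<or>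
               (\<exists>p<m. s1 ''p'' 0 = int p \<and> (Yv p < 0 \<or> Yv p > 0 \<and> lv p = 0) \<and> s1 ''gb'' 0 = \<bar>Yv p\<bar> \<and> s1 ''lb'' 0 = lv p \<and>
                (\<forall>r<m. Yv r < 0 \<or> Yv r > 0 \<and> lv r = 0 \<longrightarrow> lv p * \<bar>Yv r\<bar> \<le> lv r * \<bar>Yv p\<bar>))"
              using 9(1) unfolding P_def cd_def .
          qed
        qed (use m_H m_Z envD(1)[OF env] in \<open>simp_all add: P_def\<close>)
      qed (use one_Z in simp)
    qed (use one_Z in simp)
  qed (use one_Z in simp)
qed

lemma wp_pivot:
  assumes env: "env s" and lam: "vec s ''lam'' lv" and kap: "vec s ''kap'' kv" and Y: "vec s ''Y'' Yv"
    and w: "vec s ''w'' wv" and co: "vec s ''co'' (\<lambda>r. int (\<pi> r))"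
    and N: "matr s ''N'' Nv" and B: "matr s ''B'' Bv" and ord: "matr s ''ord'' (\<lambda>j r. int (ordv j r))"
    and p: "s ''p'' 0 = int p" "p < m" and sc: "s ''gb'' 0 = \<bar>Yv p\<bar>" "s ''lb'' 0 = lv p" "s ''th'' 0 = \<theta>" "s ''D'' 0 = D"
    and N': "\<And>r c. r < m \<Longrightarrow> c < m \<Longrightarrow> N' r c =
      (if r = p then sgn (Yv p) * Nv p c else sgn (Yv p) * ((Yv p * Nv r c - Yv r * Nv p c) div D))"
    and Yp: "Yv p \<noteq> 0"
    and b: "\<And>j. j < m \<Longrightarrow> \<bar>lv j * \<bar>Yv p\<bar> + lv p * Yv j\<bar> \<le> Z" "\<bar>\<theta> * \<bar>Yv p\<bar> - lv p * D\<bar> \<le> Z"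
       "\<And>j. j < m \<Longrightarrow> \<bar>\<bar>Yv p\<bar> * kv j\<bar> \<le> Z" "\<And>r c. r < m \<Longrightarrow> c < m \<Longrightarrow> \<bar>N' r c\<bar> \<le> Z"
       "\<bar>Yv p\<bar> \<le> Z" "\<And>j. j < m \<Longrightarrow> \<bar>wv j\<bar> \<le> Z" "\<And>j. j < m \<Longrightarrow> \<pi> j < m"
    and post: "\<And>s'. (\<And>y. y \<notin> {''a'', ''c'', ''lam'', ''kap'', ''yp'', ''sg'', ''N'', ''B'', ''ord'', ''D''} \<Longrightarrow> s' y = s y) \<Longrightarrow>
       vec s' ''lam'' (\<lambda>j. if j = p then \<theta> * \<bar>Yv p\<bar> - lv p * D else lv j * \<bar>Yv p\<bar> + lv p * Yv j) \<Longrightarrow>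
       vec s' ''kap'' (\<lambda>j. \<bar>Yv p\<bar> * kv j) \<Longrightarrow> matr s' ''N'' N' \<Longrightarrow>
       matr s' ''B'' (\<lambda>j v. if j = p then wv v else Bv j v) \<Longrightarrow>
       matr s' ''ord'' (\<lambda>j v. int (if j = p then \<pi> v else ordv j v)) \<Longrightarrow> s' ''D'' 0 = \<bar>Yv p\<bar> \<Longrightarrow> Q s'"
  shows "wp pivot Q s"
proof -
  let ?lv = "\<lambda>j. if j = p then \<theta> * \<bar>Yv p\<bar> - lv p * D else lv j * \<bar>Yv p\<bar> + lv p * Yv j"
  show ?thesis unfolding pivot_def
  proof (rule wp_Seq, rule wp_fill[where N = m and f = "\<lambda>j. lv j * \<bar>Yv p\<bar> + lv p * Yv j" and off = 0], goal_cases)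
    case (7 k s1)
    have "s1 ''lam'' (int k) = lv k" using 7(4)[of "int k"] vecD[OF lam 7(1)] by simp
    then show ?case using b(1)[OF 7(1)] vecD[OF Y 7(1)] by (simp add: 7(2,3) sc)
  next
    case (8 s1)
    note f1 = 8(1)
    have lam1: "s1 ''lam'' (int j) = lv j * \<bar>Yv p\<bar> + lv p * Yv j" if "j < m" for j using 8(2)[OF that] by simp
    show ?case
    proof (rule wp_SeqWrite, goal_cases)
      case 1
      show ?case using b(2) by (simp add: f1 sc)
    next
      case 2
      let ?s2 = "s1(''lam'' := (s1 ''lam'')(aval (Var ''p'') s1 := aval (Sub (Mul (Var ''th'') (Var ''gb'')) (Mul (Var ''lb'') (Var ''D''))) s1))"
      have f2: "?s2 y = s y" if "y \<notin> {''a'', ''lam''}" for y using that by (simp add: f1)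
      have lam2: "?s2 ''lam'' (int j) = ?lv j" if "j < m" for j
        using lam1[OF that] by (simp add: f1 p sc)
      show ?case
      proof (rule wp_Seq, rule wp_fill[where N = m and f = "\<lambda>j. \<bar>Yv p\<bar> * kv j" and off = 0], goal_cases)
        case (7 k s3)
        have "s3 ''kap'' (int k) = kv k" using 7(4)[of "int k"] vecD[OF kap 7(1)] by (simp add: f1)
        then show ?case using b(3)[OF 7(1)] by (simp add: 7(2,3) f1 sc)
      next
        case (8 s3)
        have f3: "s3 y = s y" if "y \<notin> {''a'', ''lam'', ''kap''}" for y using 8(1)[of y] f2[of y] that by simp
        have kap3: "s3 ''kap'' (int j) = \<bar>Yv p\<bar> * kv j" if "j < m" for j using 8(2)[OF that] by simp
        have lam3: "s3 ''lam'' (int j) = ?lv j" if "j < m" for j using lam2[OF that] 8(1)[of "''lam''"] by simp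
        have Yp3: "s ''Y'' (int p) = Yv p" by (rule vecD[OF Y p(2)])
        let ?rest = "For ''c'' (Var ''m'') (Cond (Equal (Var ''c'') (Var ''p'')) Skip
          (For ''a'' (Var ''m'') (Write ''N'' (cell ''c'' (Var ''a'')) (Mul (Var ''sg'') (Div
             (Sub (Mul (Var ''yp'') (Read ''N'' (cell ''c'' (Var ''a''))))
                (Mul (Read ''Y'' (Var ''c'')) (Read ''N'' (cell ''p'' (Var ''a''))))) (Var ''D'')))))) ;;
        For ''a'' (Var ''m'') (Write ''N'' (cell ''p'' (Var ''a'')) (Mul (Var ''sg'') (Read ''N'' (cell ''p'' (Var ''a''))))) ;;
        For ''a'' (Var ''m'') (Write ''B'' (cell ''p'' (Var ''a'')) (Read ''w'' (Var ''a''))) ;;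
        For ''a'' (Var ''m'') (Write ''ord'' (cell ''p'' (Var ''a'')) (Read ''co'' (Var ''a''))) ;;
        Assign ''D'' (Var ''gb'')"
        have rest: "wp ?rest Q s4" if s4: "\<And>y. y \<notin> {''yp'', ''sg''} \<Longrightarrow> s4 y = s3 y" "s4 ''yp'' 0 = Yv p" "s4 ''sg'' 0 = sgn (Yv p)" for s4
        proof (rule wp_Seq, rule wp_For[where N = m and I = "\<lambda>k s'. matr s' ''N'' (\<lambda>r c. if r < k \<and> r \<noteq> p then N' r c else Nv r c)"], goal_cases)
          case 7
          show ?case using N by (simp add: matr_def s4 f3)
        next
          \<comment> \<open>Rows below \<open>k\<close> are already new except row \<open>p\<close>,
            whose old entries the elimination of the others still reads.\<close>
          case (8 k s5)
          have fr: "s5 y = s4 y" if "y \<notin> {''c'', ''a'', ''N''}" for y using 8(4)[of y] that by simp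
          have km: "k < m" by fact
          show ?case
          proof (rule wp_Cond, goal_cases)
            case 1
            then have "k = p" by (simp add: 8(3) fr s4 f3 p)
            show ?case
              by (rule wp_Skip) (use 8(2) \<open>k = p\<close> in \<open>auto simp: matr_def less_Suc_eq\<close>)
          next
            case 2
            then have kp: "k \<noteq> p" by (simp add: 8(3) fr s4 f3 p)
            show ?case
            proof (rule wp_fill_row[where j = k and g = "N' k" and f = "\<lambda>r c. if r < k \<and> r \<noteq> p then N' r c else Nv r c"], goal_cases)
              case (9 i s6)
              have e: "s6 ''N'' (int k * int m + int i) = Nv k i" "s6 ''N'' (int p * int m + int i) = Nv p i"
                using 9(4)[OF km 9(1)] 9(4)[OF p(2) 9(1)] kp by simp_all
              have "s ''Y'' (int k) = Yv k" by (rule vecD[OF Y km])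
              then show ?case using b(4)[OF km 9(1)] N'[OF km 9(1)] kp
                by (simp add: 9(2,3) 8(3) fr s4 f3 p sc e envD(1)[OF env])
            next
              case (10 s6)
              show ?case using 10(2) kp by (auto simp: matr_def less_Suc_eq)
            qed (use km 8(2,3) envD(1)[OF env] in \<open>simp_all add: fr s4 f3\<close>)
          qed
        next
          case (9 s5)
          have f5: "s5 y = s4 y" if "y \<notin> {''c'', ''a'', ''N''}" for y using 9(3)[of y] that by simp
          have N5: "matr s5 ''N'' (\<lambda>r c. if r < m \<and> r \<noteq> p then N' r c else Nv r c)" using 9(1) .
          show ?case
          proof (rule wp_Seq, rule wp_fill_row[OF _ _ _ _ _ _ p(2) N5, where g = "N' p"], goal_cases)
            case (7 i s6)
            have "s6 ''N'' (int p * int m + int i) = Nv p i" using 7(4)[OF p(2) 7(1)] by simp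
            then show ?case using b(4)[OF p(2) 7(1)] N'[OF p(2) 7(1)]
              by (simp add: 7(2,3) f5 s4 f3 p envD(1)[OF env])
          next
            case (8 s6)
            have f6: "s6 y = s4 y" if "y \<notin> {''c'', ''a'', ''N''}" for y using 8(1)[of y] f5[of y] that by simp
            have N6: "matr s6 ''N'' N'" using 8(2) by (simp add: matr_def)
            have B6: "matr s6 ''B'' Bv" using B by (simp add: matr_def f6 s4 f3)
            show ?case
            proof (rule wp_Seq, rule wp_fill_row[OF _ _ _ _ _ _ p(2) B6, where g = wv], goal_cases)
              case (7 i s7)
              show ?case using b(6)[OF 7(1)] vecD[OF w 7(1)] by (simp add: 7(2,3) f6 s4 f3)
            next
              case (8 s7)
              have f7: "s7 y = s4 y" if "y \<notin> {''c'', ''a'', ''N'', ''B''}" for y using 8(1)[of y] f6[of y] that by simp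
              have N7: "matr s7 ''N'' N'" using N6 by (simp add: matr_def 8(1))
              note B7 = 8(2)
              have ord7: "matr s7 ''ord'' (\<lambda>j r. int (ordv j r))" using ord by (simp add: matr_def f7 s4 f3)
              show ?case
              proof (rule wp_Seq, rule wp_fill_row[OF _ _ _ _ _ _ p(2) ord7, where g = "\<lambda>r. int (\<pi> r)"], goal_cases)
                case (7 i s8)
                show ?case using b(7)[OF 7(1)] vecD[OF co 7(1)] by (simp add: 7(2,3) f7 s4 f3 nat_Z)
              next
                case (8 s8)
                have f8: "s8 y = s4 y" if "y \<notin> {''c'', ''a'', ''N'', ''B'', ''ord''}" for y using 8(1)[of y] f7[of y] that by simp
                let ?s9 = "s8(''D'' := (s8 ''D'')(0 := \<bar>Yv p\<bar>))"
                have "Q ?s9"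
                proof (rule post)
                  show "?s9 y = s y" if "y \<notin> {''a'', ''c'', ''lam'', ''kap'', ''yp'', ''sg'', ''N'', ''B'', ''ord'', ''D''}" for y
                    using that by (simp add: f8 s4 f3)
                  show "vec ?s9 ''lam'' ?lv" using lam3 by (simp add: vec_def f8 s4)
                  show "vec ?s9 ''kap'' (\<lambda>j. \<bar>Yv p\<bar> * kv j)" using kap3 by (simp add: vec_def f8 s4)
                  show "matr ?s9 ''N'' N'" using N7 by (simp add: matr_def 8(1))
                  show "matr ?s9 ''B'' (\<lambda>j v. if j = p then wv v else Bv j v)" using B7 by (simp add: matr_def 8(1))
                  show "matr ?s9 ''ord'' (\<lambda>j v. int (if j = p then \<pi> v else ordv j v))" using 8(2) by (simp add: matr_def)
                  show "?s9 ''D'' 0 = \<bar>Yv p\<bar>" by simp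
                qed
                then show ?case using b(5) by (intro wp_Write) (simp_all add: f8 s4 f3 sc)
              qed (simp_all add: f7 s4 f3 p envD(1)[OF env])
            qed (simp_all add: f6 s4 f3 p envD(1)[OF env])
          qed (simp_all add: f5 s4 f3 p envD(1)[OF env])
        qed (use m_H m_Z envD(1)[OF env] in \<open>simp_all add: s4 f3\<close>)
        show ?case
        proof (rule wp_SeqWrite, goal_cases)
          case 1
          show ?case using b(5) by (simp add: f3 p Yp3)
        next
          case 2
          show ?case
          proof (rule wp_Seq, rule wp_Cond, goal_cases)
            case 1
            then show ?case using one_Z
              by (intro wp_Write rest) (simp_all add: f3 p Yp3)
          next
            case 2
            then show ?case using one_Z Yp
              by (intro wp_Write rest) (simp_all add: f3 p Yp3)
          qed
        qed
      qed (use m_H m_Z envD(1)[OF env] in \<open>simp_all add: f1\<close>)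
    qed
  qed (use m_H m_Z envD(1)[OF env] in simp_all)
qed

lemma wp_absorb:
  assumes env: "env s" and lam: "vec s ''lam'' lv" and kap: "vec s ''kap'' kv" and Y: "vec s ''Y'' Yv"
    and sc: "s ''th'' 0 = \<theta>" "s ''D'' 0 = D"
    and b: "\<And>j. j < m \<Longrightarrow> \<bar>D * lv j + \<theta> * Yv j\<bar> \<le> Z" "\<And>j. j < m \<Longrightarrow> \<bar>D * kv j\<bar> \<le> Z"
    and post: "\<And>s'. (\<And>y. y \<notin> {''a'', ''lam'', ''kap''} \<Longrightarrow> s' y = s y) \<Longrightarrow>
       vec s' ''lam'' (\<lambda>j. D * lv j + \<theta> * Yv j) \<Longrightarrow> vec s' ''kap'' (\<lambda>j. D * kv j) \<Longrightarrow> Q s'"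
  shows "wp absorb Q s"
  unfolding absorb_def
proof (rule wp_Seq, rule wp_fill[where N = m and f = "\<lambda>j. D * lv j + \<theta> * Yv j" and off = 0], goal_cases)
  case (7 k s1)
  have "s1 ''lam'' (int k) = lv k" using 7(4)[of "int k"] vecD[OF lam 7(1)] by simp
  then show ?case using b(1)[OF 7(1)] vecD[OF Y 7(1)] by (simp add: 7(2,3) sc)
next
  case (8 s1)
  note f1 = 8(1)
  have lam1: "s1 ''lam'' (int j) = D * lv j + \<theta> * Yv j" if "j < m" for j using 8(2)[OF that] by simp
  show ?case
  proof (rule wp_fill[where N = m and f = "\<lambda>j. D * kv j" and off = 0], goal_cases)
    case (7 k s3)
    have "s3 ''kap'' (int k) = kv k" using 7(4)[of "int k"] vecD[OF kap 7(1)] by (simp add: f1)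
    then show ?case using b(2)[OF 7(1)] by (simp add: 7(2,3) f1 sc)
  next
    case (8 s3)
    show ?case
    proof (rule post)
      show "vec s3 ''lam'' (\<lambda>j. D * lv j + \<theta> * Yv j)" using lam1 by (simp add: vec_def 8(1))
      show "vec s3 ''kap'' (\<lambda>j. D * kv j)" using 8(2) by (simp add: vec_def)
    qed (simp add: 8(1) f1)
  qed (use m_H m_Z envD(1)[OF env] in \<open>simp_all add: f1\<close>)
qed (use m_H m_Z envD(1)[OF env] in simp_all)

end

lemma wvars_insert_all [simp]: "wvars insert_all = insert ''j'' (wvars moved_com \<union> wvars insert_com)"
  unfolding insert_all_def by (simp only: wvars_For wvars.simps Un_empty_right)

context minimizer begin

text \<open>Columns of weight zero may be unit vectors or discarded orders; apart from their size
  all that counts is that they keep the matrix invertible.\<close>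

definition tableau :: "state \<Rightarrow> (nat \<Rightarrow> nat \<Rightarrow> nat) \<Rightarrow> (nat \<Rightarrow> int) \<Rightarrow> (nat \<Rightarrow> nat \<Rightarrow> int) \<Rightarrow> (nat \<Rightarrow> nat \<Rightarrow> int) \<Rightarrow> int \<Rightarrow> bool" where
  "tableau s ordv lv Bv Nv D \<longleftrightarrow> matr s ''ord'' (\<lambda>j p. int (ordv j p)) \<and> vec s ''lam'' lv \<and>
     matr s ''B'' Bv \<and> matr s ''N'' Nv \<and> s ''D'' 0 = D \<and> basis_adjugate m Bv Nv D \<and>
     (\<forall>j<m. \<forall>v<m. \<bar>Bv j v\<bar> \<le> U) \<and> (\<forall>j<m. 0 \<le> lv j)"

lemma tableauD:
  assumes "tableau s ordv lv Bv Nv D"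
  shows "matr s ''ord'' (\<lambda>j p. int (ordv j p))" "vec s ''lam'' lv" "matr s ''B'' Bv" "matr s ''N'' Nv"
    "s ''D'' 0 = D" "basis_adjugate m Bv Nv D" "\<And>j v. j < m \<Longrightarrow> v < m \<Longrightarrow> \<bar>Bv j v\<bar> \<le> U" "\<And>j. j < m \<Longrightarrow> 0 \<le> lv j"
  using assms by (auto simp: tableau_def)

lemma tableau_cong:
  assumes "tableau s ordv lv Bv Nv D" "\<And>y. y \<in> {''ord'', ''lam'', ''B'', ''N'', ''D''} \<Longrightarrow> s' y = s y"
  shows "tableau s' ordv lv Bv Nv D"
  using assms(1) by (simp add: tableau_def matr_def vec_def assms(2))

text \<open>Each factor of \<open>m!\<close> is below \<open>U\<close>, so determinants of basis
  columns have exponent \<open>2 * m\<close>.\<close>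

lemma fact_power_le: "fact m * U ^ m \<le> U ^ (2 * m)"
proof -
  have "fact m \<le> int m ^ m" using fact_le_power[of m, where ?'a = int] by simp
  also have "\<dots> \<le> U ^ m" by (rule power_mono) (use U in auto)
  finally have "fact m * U ^ m \<le> U ^ m * U ^ m" by (rule mult_right_mono) (use U in auto)
  then show ?thesis by (simp add: mult_2 power_add)
qed

lemma basis_bounds:
  assumes ba: "basis_adjugate m Bv Nv D" and B: "\<forall>j<m. \<forall>v<m. \<bar>Bv j v\<bar> \<le> U"
  shows "D > 0" "\<bar>D\<bar> \<le> U ^ (2 * m)" "r < m \<Longrightarrow> c < m \<Longrightarrow> \<bar>Nv r c\<bar> \<le> U ^ (2 * m)"
proof -
  show D: "D > 0" using ba by (simp add: basis_adjugate_def)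
  have U1: "U \<ge> 1" using U by simp
  have "D \<le> fact m * U ^ m" by (rule basis_adjugate_bound(1)[OF ba]) (use B U1 in auto)
  then show "\<bar>D\<bar> \<le> U ^ (2 * m)" using fact_power_le D by simp
  assume rc: "r < m" "c < m"
  have "\<bar>Nv r c\<bar> \<le> fact m * U ^ m" by (rule basis_adjugate_bound(2)[OF ba _ _ rc]) (use B U1 in auto)
  then show "\<bar>Nv r c\<bar> \<le> U ^ (2 * m)" using fact_power_le by linarith
qed

text \<open>The factor \<open>g\<close> is \<open>|Y p|\<close> or \<open>D\<close>, according to
  the branch; callers learn only that it is positive and what it does to the sizes. The exponent
  rises by \<open>2 * m + 3\<close>: \<open>2 * m\<close> for an entry of \<open>N\<close>, one for
  an entry of \<open>w\<close>, one for summing to a coordinate and one for the final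
  addition.\<close>

lemma wp_insert:
  assumes env: "env s" and tab: "tableau s ordv lv Bv Nv D" and kap: "vec s ''kap'' kv"
    and w: "vec s ''w'' wv" and co: "vec s ''co'' (\<lambda>r. int (\<pi> r))" and j: "s ''j'' 0 = int j" "j < m" "kv j > 0"
    and wv: "\<And>v. v < m \<Longrightarrow> \<bar>wv v\<bar> \<le> U" and \<pi>: "\<And>r. r < m \<Longrightarrow> \<pi> r < m"
    and lv: "\<And>v. v < m \<Longrightarrow> \<bar>lv v\<bar> \<le> U ^ l" and kv: "\<And>v. v < m \<Longrightarrow> \<bar>kv v\<bar> \<le> U ^ l" and l: "l + 2 * m + 4 \<le> E"
    and post: "\<And>s' g ordv' lv' Bv' Nv' D'. (\<And>y. y \<notin> wvars insert_com \<Longrightarrow> s' y = s y) \<Longrightarrow>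
       tableau s' ordv' lv' Bv' Nv' D' \<Longrightarrow> vec s' ''kap'' (\<lambda>v. g * kv v) \<Longrightarrow> g > 0 \<Longrightarrow>
       (\<And>v. v < m \<Longrightarrow> \<bar>lv' v\<bar> \<le> U ^ (l + 2 * m + 3)) \<Longrightarrow> (\<And>v. v < m \<Longrightarrow> \<bar>g * kv v\<bar> \<le> U ^ (l + 2 * m + 3)) \<Longrightarrow>
       (\<And>v. v < m \<Longrightarrow> (\<Sum>i<m. lv' i * Bv' i v) = g * ((\<Sum>i<m. lv i * Bv i v) + kv j * wv v)) \<Longrightarrow>
       (\<And>i. i < m \<Longrightarrow> lv' i > 0 \<Longrightarrow>
          lv i > 0 \<and> (\<forall>r<m. ordv' i r = ordv i r) \<and> (\<forall>v<m. Bv' i v = Bv i v) \<or>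
          (\<forall>r<m. ordv' i r = \<pi> r) \<and> (\<forall>v<m. Bv' i v = wv v)) \<Longrightarrow> Q s'"
  shows "wp insert_com Q s"
proof -
  note tab = tableauD[OF tab]
  define Yv where "Yv r = (\<Sum>c<m. Nv r c * wv c)" for r
  have "\<forall>j<m. \<forall>v<m. \<bar>Bv j v\<bar> \<le> U" using tab(7) by blast
  note bb = basis_bounds[OF tab(6) this]
  have Yb: "\<bar>Yv v\<bar> \<le> U ^ (2 * m + 2)" if "v < m" for v unfolding Yv_def
  proof (rule power_mono_le[OF power_sum_le[where i = "2 * m + 1"]])
    fix c assume c: "c < m"
    show "\<bar>Nv v c * wv c\<bar> \<le> U ^ (2 * m + 1)"
      by (rule power_mult_le) (use bb(3)[OF that c] wv[OF c] in auto)
  qed simp_all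
  have Zb: "\<bar>a\<bar> \<le> Z" if "\<bar>a\<bar> \<le> U ^ k" "k \<le> l + 2 * m + 4" for a k
    by (rule le_Z[OF that(1)]) (use that(2) l in simp)
  define W where "W = wvars insert_com"
  have W: "W = {''c'', ''a'', ''y'', ''Y'', ''p'', ''gb'', ''lb'', ''ay'', ''th'', ''lam'', ''kap'', ''yp'', ''sg'', ''N'', ''B'', ''ord'', ''D''}"
    by (simp add: W_def)
  show ?thesis unfolding insert_com_def
  proof (rule wp_Seq, rule wp_coordinates[OF env tab(4) w], goal_cases)
    case (1 r c) then show ?case by (rule bb(3))
  next
    case (2 v) then show ?case by (rule wv)
  next
    case (4 s1)
    have f1: "s1 y = s y" if "y \<notin> {''c'', ''a'', ''y'', ''Y''}" for y using 4(1) that by simp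
    have Y1: "vec s1 ''Y'' Yv" using 4(2) unfolding Yv_def .
    have lam1: "vec s1 ''lam'' lv" using tab(2) by (simp add: vec_def f1)
    have env1: "env s1" by (rule env_cong[OF _ env]) (auto simp: f1)
    show ?case
    proof (rule wp_Seq, rule wp_ratio_test[OF env1 Y1 lam1 tab(8)], goal_cases)
      case (2 v)
      show ?case by (rule Zb[OF Yb[OF 2]]) simp
    next
      case (3 v)
      show ?case by (rule Zb[OF lv[OF 3]]) simp
    next
      case (4 s2)
      have f2: "s2 y = s y" if "y \<notin> {''c'', ''a'', ''y'', ''Y'', ''p'', ''gb'', ''lb'', ''ay''}" for y
        using 4(1)[of y] f1[of y] that by simp
      have Y2: "vec s2 ''Y'' Yv" using Y1 4(1) by (simp add: vec_def)
      let ?s3 = "s2(''th'' := (s2 ''th'')(0 := kv j))"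
      have kj: "s ''kap'' (int j) = kv j" by (rule vecD[OF kap j(2)])
      have env3: "env ?s3" by (rule env_cong[OF _ env]) (auto simp: f2)
      have v3: "vec ?s3 ''lam'' lv" "vec ?s3 ''kap'' kv" "vec ?s3 ''Y'' Yv" "vec ?s3 ''w'' wv" "vec ?s3 ''co'' (\<lambda>r. int (\<pi> r))"
        using tab(2) kap Y2 w co by (simp_all add: vec_def f2)
      have m3: "matr ?s3 ''N'' Nv" "matr ?s3 ''B'' Bv" "matr ?s3 ''ord'' (\<lambda>j p. int (ordv j p))"
        using tab(1,3,4) by (simp_all add: matr_def f2)
      have D3: "?s3 ''D'' 0 = D" using tab(5) by (simp add: f2)
      have "wp (Cond (Conj (Neg (Less (Var ''p'') (Const 0))) (Less (Mul (Var ''lb'') (Var ''D'')) (Mul (Var ''th'') (Var ''gb'')))) pivot absorb) Q ?s3"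
      proof (rule wp_Cond, goal_cases)
        case 1
        then have "s2 ''p'' 0 \<noteq> -1" by auto
        then obtain p where p: "p < m" "s2 ''p'' 0 = int p" "Yv p < 0 \<or> Yv p > 0 \<and> lv p = 0" "s2 ''gb'' 0 = \<bar>Yv p\<bar>" "s2 ''lb'' 0 = lv p"
          "\<And>r. r < m \<Longrightarrow> Yv r < 0 \<or> Yv r > 0 \<and> lv r = 0 \<Longrightarrow> lv p * \<bar>Yv r\<bar> \<le> lv r * \<bar>Yv p\<bar>"
          using 4(2) by blast
        have lt: "lv p * D < kv j * \<bar>Yv p\<bar>" using 1 p D3 by simp
        have Yp: "Yv p \<noteq> 0" using p(3) by auto
        define lv' where "lv' i = (if i = p then kv j * \<bar>Yv p\<bar> - lv p * D else lv i * \<bar>Yv p\<bar> + lv p * Yv i)" for i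
        define N' where "N' r c = (if r = p then sgn (Yv p) * Nv p c else sgn (Yv p) * ((Yv p * Nv r c - Yv r * Nv p c) div D))" for r c
        define B' where "B' i v = (if i = p then wv v else Bv i v)" for i v
        define ordv' where "ordv' i v = (if i = p then \<pi> v else ordv i v)" for i v
        have ba: "basis_adjugate m B' N' \<bar>Yv p\<bar>"
          by (rule basis_adjugate_replace[OF tab(6) p(1), where Y = Yv and w = wv])
            (use Yp in \<open>simp_all add: B'_def N'_def Yv_def[symmetric]\<close>)
        have Bb: "\<forall>i<m. \<forall>v<m. \<bar>B' i v\<bar> \<le> U" using tab(7) wv by (simp add: B'_def)
        note bb' = basis_bounds[OF ba Bb]
        have ip: "i < m \<Longrightarrow> lv' i \<ge> 0" "i < m \<Longrightarrow> i \<noteq> p \<Longrightarrow> lv i = 0 \<Longrightarrow> lv' i = 0"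
          "v < m \<Longrightarrow> (\<Sum>i<m. lv' i * B' i v) = \<bar>Yv p\<bar> * ((\<Sum>i<m. lv i * Bv i v) + kv j * wv v)" for i v
          by (rule insert_pivot[OF tab(6), where Y = Yv and p = p and lam = lv and w = wv and \<theta> = "kv j"],
              (assumption | rule tab(8) p lt Yv_def B'_def lv'_def)+)+
        have t1: "\<bar>lv i * \<bar>Yv p\<bar>\<bar> \<le> U ^ (l + 2 * m + 2)" if "i < m" for i
          using power_mult_le[OF lv[OF that], of "\<bar>Yv p\<bar>" "2 * m + 2"] Yb[OF p(1)] by (simp add: add.assoc)
        have t2: "\<bar>lv p * Yv i\<bar> \<le> U ^ (l + 2 * m + 2)" if "i < m" for i
          using power_mult_le[OF lv[OF p(1)] Yb[OF that]] by (simp add: add.assoc)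
        have t3: "\<bar>kv j * \<bar>Yv p\<bar>\<bar> \<le> U ^ (l + 2 * m + 2)"
          using power_mult_le[OF kv[OF j(2)], of "\<bar>Yv p\<bar>" "2 * m + 2"] Yb[OF p(1)] by (simp add: add.assoc)
        have t4: "\<bar>lv p * D\<bar> \<le> U ^ (l + 2 * m + 2)"
          by (rule power_mono_le[OF power_mult_le[OF lv[OF p(1)] bb(2)]]) simp
        have s: "Suc (l + 2 * m + 2) = l + 2 * m + 3" by simp
        have lvb0: "\<bar>lv i * \<bar>Yv p\<bar> + lv p * Yv i\<bar> \<le> U ^ (l + 2 * m + 3)" if "i < m" for i
          using power_add_le[OF t1[OF that] t2[OF that]] unfolding s .
        have lvb1: "\<bar>kv j * \<bar>Yv p\<bar> - lv p * D\<bar> \<le> U ^ (l + 2 * m + 3)"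
          using power_diff_le[OF t3 t4] unfolding s .
        have lvb: "\<bar>lv' i\<bar> \<le> U ^ (l + 2 * m + 3)" if "i < m" for i
          using lvb0[OF that] lvb1 by (simp add: lv'_def)
        have kb: "\<bar>\<bar>Yv p\<bar> * kv i\<bar> \<le> U ^ (l + 2 * m + 3)" if "i < m" for i
          by (rule power_mono_le[OF power_mult_le[of "\<bar>Yv p\<bar>" "2 * m + 2", OF _ kv[OF that]]]) (use Yb[OF p(1)] in simp_all)
        show ?case
        proof (rule wp_pivot[OF env3 v3 m3, where p = p and \<theta> = "kv j" and D = D and N' = N'], goal_cases)
          case 7
          show ?case using N'_def .
        next
          case (8 ) show ?case by (rule Yp)
        next
          case (9 i) show ?case by (rule Zb[OF lvb0[OF 9]]) simp
        next
          case 10 show ?case by (rule Zb[OF lvb1]) simp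
        next
          case (11 i) show ?case by (rule Zb[OF kb[OF 11]]) simp
        next
          case (12 r c) show ?case by (rule Zb[OF bb'(3)[OF 12]]) simp
        next
          case 13 show ?case by (rule Zb[of _ "2 * m + 2"]) (use Yb[OF p(1)] in simp_all)
        next
          case (14 i) show ?case by (rule U_le_Z[OF wv[OF 14]])
        next
          case (15 i) then show ?case by (rule \<pi>)
        next
          case (16 s4)
          have f4: "s4 y = s y" if "y \<notin> W" for y using that 16(1)[of y] f2[of y] by (simp add: W)
          have lam4: "vec s4 ''lam'' lv'" using 16(2) unfolding lv'_def .
          have B4: "matr s4 ''B'' B'" using 16(5) unfolding B'_def .
          have ord4: "matr s4 ''ord'' (\<lambda>i v. int (ordv' i v))" using 16(6) unfolding ordv'_def .
          have tab': "tableau s4 ordv' lv' B' N' \<bar>Yv p\<bar>"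
            unfolding tableau_def using lam4 B4 ord4 16(4,7) ba Bb ip(1) by blast
          show ?case
          proof (rule post[OF _ tab' 16(3) _ lvb kb ip(3)], goal_cases)
            case (1 y) then show ?case using f4 unfolding W_def by blast
          next
            case 2 show ?case using Yp by simp
          next
            case (6 i)
            show ?case
            proof (cases "i = p")
              case False
              have "lv i \<noteq> 0" using ip(2)[OF 6(1) False] 6(2) by auto
              then have "lv i > 0" using tab(8)[OF 6(1)] by simp
              then show ?thesis using False by (simp add: ordv'_def B'_def)
            qed (simp add: ordv'_def B'_def)
          qed
        qed (use p D3 in simp_all)
      next
        case 2
        \<comment> \<open>The pivot test failed for the column of least ratio, hence would fail for
          every blocking column; if the ratio test found none, there is nothing to show.\<close>
        have min: "kv j * \<bar>Yv r\<bar> \<le> lv r * D" if r: "r < m" "Yv r < 0 \<or> Yv r > 0 \<and> lv r = 0" for r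
        proof -
          obtain p where p: "p < m" "s2 ''p'' 0 = int p" "Yv p < 0 \<or> Yv p > 0 \<and> lv p = 0" "s2 ''gb'' 0 = \<bar>Yv p\<bar>" "s2 ''lb'' 0 = lv p"
            "lv p * \<bar>Yv r\<bar> \<le> lv r * \<bar>Yv p\<bar>"
            using 4(2) r by blast
          have ge: "kv j * \<bar>Yv p\<bar> \<le> lv p * D" using 2 p D3 by simp
          have Yp: "\<bar>Yv p\<bar> > 0" using p(3) by auto
          have "\<bar>Yv p\<bar> * (kv j * \<bar>Yv r\<bar>) = (kv j * \<bar>Yv p\<bar>) * \<bar>Yv r\<bar>" by simp
          also have "\<dots> \<le> (lv p * D) * \<bar>Yv r\<bar>" using ge by (intro mult_right_mono) auto
          also have "\<dots> = (lv p * \<bar>Yv r\<bar>) * D" by simp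
          also have "\<dots> \<le> (lv r * \<bar>Yv p\<bar>) * D" using p(6) bb(1) by (intro mult_right_mono) auto
          also have "\<dots> = \<bar>Yv p\<bar> * (lv r * D)" by simp
          finally show ?thesis using Yp by simp
        qed
        define lv' where "lv' i = D * lv i + kv j * Yv i" for i
        have ia: "i < m \<Longrightarrow> lv' i \<ge> 0" "i < m \<Longrightarrow> lv i = 0 \<Longrightarrow> lv' i = 0"
          "v < m \<Longrightarrow> (\<Sum>i<m. lv' i * Bv i v) = D * ((\<Sum>i<m. lv i * Bv i v) + kv j * wv v)" for i v
          by (rule insert_absorb_vector[OF tab(6), where Y = Yv and lam = lv and w = wv and \<theta> = "kv j"],
              (assumption | rule tab(8) min j Yv_def lv'_def)+)+
        have t1: "\<bar>D * lv i\<bar> \<le> U ^ (l + 2 * m + 2)" "\<bar>D * kv i\<bar> \<le> U ^ (l + 2 * m + 2)" if "i < m" for i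
          by (rule power_mono_le[OF power_mult_le[OF bb(2) lv[OF that]]], simp)
            (rule power_mono_le[OF power_mult_le[OF bb(2) kv[OF that]]], simp)
        have t2: "\<bar>kv j * Yv i\<bar> \<le> U ^ (l + 2 * m + 2)" if "i < m" for i
          using power_mult_le[OF kv[OF j(2)] Yb[OF that]] by (simp add: add.assoc)
        have s: "Suc (l + 2 * m + 2) = l + 2 * m + 3" by simp
        have lvb: "\<bar>lv' i\<bar> \<le> U ^ (l + 2 * m + 3)" if "i < m" for i
          using power_add_le[OF t1(1)[OF that] t2[OF that]] unfolding s lv'_def .
        have kb: "\<bar>D * kv i\<bar> \<le> U ^ (l + 2 * m + 3)" if "i < m" for i
          by (rule power_mono_le[OF t1(2)[OF that]]) simp
        show ?case
        proof (rule wp_absorb[OF env3 v3(1-3), where \<theta> = "kv j" and D = D], goal_cases)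
          case (3 i) show ?case using Zb[OF lvb[OF 3]] by (simp add: lv'_def)
        next
          case (4 i) show ?case by (rule Zb[OF kb[OF 4]]) simp
        next
          case (5 s4)
          have f4: "s4 y = s y" if "y \<notin> W" for y using that 5(1)[of y] f2[of y] by (simp add: W)
          have lam4: "vec s4 ''lam'' lv'" using 5(2) unfolding lv'_def .
          have m4: "matr s4 ''N'' Nv" "matr s4 ''B'' Bv" "matr s4 ''ord'' (\<lambda>j p. int (ordv j p))" "s4 ''D'' 0 = D"
            using tab(1,3,4,5) by (simp_all add: matr_def 5(1) f2)
          have tab': "tableau s4 ordv lv' Bv Nv D"
            unfolding tableau_def using lam4 m4 tab(6,7) ia(1) by blast
          show ?case
          proof (rule post[OF _ tab' 5(3) _ lvb kb ia(3)], goal_cases)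
            case (1 y) then show ?case using f4 unfolding W_def by blast
          next
            case 2 show ?case by (rule bb(1))
          next
            case (6 i)
            have "lv i \<noteq> 0" using ia(2)[OF 6(1)] 6(2) by auto
            then have "lv i > 0" using tab(8)[OF 6(1)] by simp
            then show ?case by simp
          qed
        qed (use D3 in simp_all)
      qed
      then show ?case using Zb[OF kv[OF j(2)]]
        by (intro wp_SeqWrite) (simp_all add: j kj f2)
    qed simp
  qed (use l in simp_all)
qed

lemma wp_insert_all:
  assumes env: "env s" and tab: "tableau s ordv lv Bv Nv D" and kap: "vec s ''kap'' kv"
    and oo: "vec s ''oo'' (\<lambda>p. int (\<pi> p))" and \<pi>: "ordering_on m \<pi>"
    and sp: "s ''s'' 0 = int sp" and kv0: "\<And>j. j < m \<Longrightarrow> kv j \<ge> 0" "\<And>j. j < m \<Longrightarrow> kv j > 0 \<Longrightarrow> sp < j \<and> j \<le> q"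
    and lv: "\<And>v. v < m \<Longrightarrow> \<bar>lv v\<bar> \<le> U ^ l" and kv: "\<And>v. v < m \<Longrightarrow> \<bar>kv v\<bar> \<le> U ^ l"
    and l: "l + m * (2 * m + 3) + 1 \<le> E"
    and post: "\<And>s' g ordv' lv' Bv' Nv' D'. (\<And>y. y \<notin> wvars insert_all \<Longrightarrow> s' y = s y) \<Longrightarrow>
       tableau s' ordv' lv' Bv' Nv' D' \<Longrightarrow> g > 0 \<Longrightarrow>
       (\<And>v. v < m \<Longrightarrow> \<bar>lv' v\<bar> \<le> U ^ (l + m * (2 * m + 3))) \<Longrightarrow>
       (\<And>v. v < m \<Longrightarrow> (\<Sum>i<m. lv' i * Bv' i v) =
          g * ((\<Sum>i<m. lv i * Bv i v) + (\<Sum>p<m. kv p * greedy F m (move_to \<pi> sp p) v))) \<Longrightarrow>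
       (\<And>i. i < m \<Longrightarrow> lv' i > 0 \<Longrightarrow>
          lv i > 0 \<and> (\<forall>r<m. ordv' i r = ordv i r) \<and> (\<forall>v<m. Bv' i v = Bv i v) \<or>
          (\<exists>p. sp < p \<and> p \<le> q \<and> (\<forall>r<m. ordv' i r = move_to \<pi> sp p r) \<and>
             (\<forall>v<m. Bv' i v = greedy F m (move_to \<pi> sp p) v))) \<Longrightarrow> Q s'"
  shows "wp insert_all Q s"
proof -
  define W where "W = wvars insert_all"
  have W: "W = insert ''j'' (wvars moved_com \<union> wvars insert_com)" by (simp add: W_def)
  let ?w = "\<lambda>p. greedy F m (move_to \<pi> sp p)"
  define rel where "rel ordv' lv' Bv' i \<longleftrightarrow> lv i > 0 \<and> (\<forall>r<m. ordv' i r = ordv i r) \<and> (\<forall>v<m. Bv' i v = Bv i v) \<or>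
          (\<exists>p. sp < p \<and> p \<le> q \<and> (\<forall>r<m. ordv' i r = move_to \<pi> sp p r) \<and> (\<forall>v<m. Bv' i v = ?w p v))"
    for ordv' :: "nat \<Rightarrow> nat \<Rightarrow> nat" and lv' :: "nat \<Rightarrow> int" and Bv' :: "nat \<Rightarrow> nat \<Rightarrow> int" and i
  \<comment> \<open>Each insertion scales what has been inserted and what is still to come by the
    same factor; \<open>g\<close> is the product of these factors.\<close>
  define P where "P k s' \<longleftrightarrow> (\<exists>g ordv' lv' Bv' Nv' D'. tableau s' ordv' lv' Bv' Nv' D' \<and> g > 0 \<and> vec s' ''kap'' (\<lambda>v. g * kv v) \<and>
      (\<forall>v<m. \<bar>lv' v\<bar> \<le> U ^ (l + k * (2 * m + 3)) \<and> \<bar>g * kv v\<bar> \<le> U ^ (l + k * (2 * m + 3))) \<and>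
      (\<forall>v<m. (\<Sum>i<m. lv' i * Bv' i v) = g * ((\<Sum>i<m. lv i * Bv i v) + (\<Sum>p<k. kv p * ?w p v))) \<and>
      (\<forall>i<m. lv' i > 0 \<longrightarrow> rel ordv' lv' Bv' i))" for k and s' :: state
  have Pcong: "P k s'" if "P k s''" "\<And>y. y \<in> {''ord'', ''lam'', ''B'', ''N'', ''D'', ''kap''} \<Longrightarrow> s' y = s'' y" for k s' s''
  proof -
    have "tableau s'' o' l' b' n' d' \<Longrightarrow> tableau s' o' l' b' n' d'" for o' l' b' n' d'
      by (erule tableau_cong, rule that(2)) auto
    moreover have "vec s'' ''kap'' f \<Longrightarrow> vec s' ''kap'' f" for f by (simp add: vec_def that(2))
    ultimately show ?thesis using that(1) unfolding P_def by meson
  qed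
  show ?thesis unfolding insert_all_def
  proof (rule wp_For[where N = m and I = P], goal_cases)
    case 7
    have "P 0 s" unfolding P_def
      by (rule exI[of _ 1], rule exI[of _ ordv], rule exI[of _ lv], rule exI[of _ Bv], rule exI[of _ Nv], rule exI[of _ D])
        (use tab kap lv kv in \<open>simp add: rel_def\<close>)
    then show ?case by (rule Pcong) auto
  next
    case (8 k s1)
    have fr: "s1 y = s y" if "y \<notin> W" for y
    proof (rule 8(4))
      show "y \<notin> insert ''j'' (wvars (Cond (Less (Const 0) (Read ''kap'' (Var ''j''))) (moved_com ;; insert_com) Skip))"
        using that unfolding W by (simp only: wvars.simps Un_empty_right not_False_eq_True)
    qed
    have km: "k < m" by fact
    obtain g ordv' lv' Bv' Nv' D' where P1: "tableau s1 ordv' lv' Bv' Nv' D'" "g > 0" "vec s1 ''kap'' (\<lambda>v. g * kv v)"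
      "\<And>v. v < m \<Longrightarrow> \<bar>lv' v\<bar> \<le> U ^ (l + k * (2 * m + 3))" "\<And>v. v < m \<Longrightarrow> \<bar>g * kv v\<bar> \<le> U ^ (l + k * (2 * m + 3))"
      "\<And>v. v < m \<Longrightarrow> (\<Sum>i<m. lv' i * Bv' i v) = g * ((\<Sum>i<m. lv i * Bv i v) + (\<Sum>p<k. kv p * ?w p v))"
      "\<And>i. i < m \<Longrightarrow> lv' i > 0 \<Longrightarrow> rel ordv' lv' Bv' i"
      using 8(2) unfolding P_def by blast
    have env1: "env s1" by (rule env_cong[OF _ env]) (auto simp: fr W)
    have oo1: "vec s1 ''oo'' (\<lambda>p. int (\<pi> p))" using oo by (simp add: vec_def fr W)
    have sp1: "s1 ''s'' 0 = int sp" using sp by (simp add: fr W)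
    show ?case
    proof (rule wp_Cond, goal_cases)
      case 2
      then have kk: "kv k = 0" using vecD[OF P1(3) km] kv0(1)[OF km] P1(2) 8(3) by (simp add: zero_less_mult_iff)
      have le: "l + k * (2 * m + 3) \<le> l + Suc k * (2 * m + 3)" by simp
      have "P (Suc k) s1" unfolding P_def
        by (rule exI[of _ g], rule exI[of _ ordv'], rule exI[of _ lv'], rule exI[of _ Bv'], rule exI[of _ Nv'], rule exI[of _ D'],
            intro conjI allI impI)
          (use P1 power_mono_le[OF P1(4) le] power_mono_le[OF P1(5) le] kk in \<open>auto simp: lessThan_Suc\<close>)
      then show ?case by (intro wp_Skip) (erule Pcong, auto)
    next
      case 1
      then have kk: "kv k > 0" using vecD[OF P1(3) km] P1(2) 8(3) by (simp add: zero_less_mult_iff)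
      then have gk: "g * kv k > 0" using P1(2) by simp
      have sk: "sp < k" "k \<le> q" using kv0(2)[OF km kk] by auto
      have \<pi>k: "ordering_on m (move_to \<pi> sp k)" by (rule ordering_on_move_to[OF \<pi>]) (use sk km in auto)
      show ?case
      proof (rule wp_Seq, rule wp_moved[OF env1 \<pi> oo1 sp1 8(3) _ km], goal_cases)
        case 1 show ?case using sk by simp
      next
        case (2 s2)
        have f2: "s2 y = s y" if "y \<notin> W" for y using that 2(1)[of y] fr[of y] by (simp add: W)
        have env2: "env s2" by (rule env_cong[OF _ env]) (auto simp: f2 W)
        have tab2: "tableau s2 ordv' lv' Bv' Nv' D'" by (rule tableau_cong[OF P1(1)]) (auto simp: 2(1))
        have kap2: "vec s2 ''kap'' (\<lambda>v. g * kv v)" using P1(3) by (simp add: vec_def 2(1))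
        have j2: "s2 ''j'' 0 = int k" using 8(3) by (simp add: 2(1))
        have "(k + 1) * (2 * m + 3) \<le> m * (2 * m + 3)" using km by (intro mult_right_mono) auto
        then have le: "l + k * (2 * m + 3) + 2 * m + 4 \<le> E" using l by simp
        have Suck: "l + k * (2 * m + 3) + 2 * m + 3 = l + Suc k * (2 * m + 3)" by simp
        show ?case
        proof (rule wp_insert[OF env2 tab2 kap2 2(2,3) j2 km gk greedy_bound[OF \<pi>k] ordering_on_less[OF \<pi>k] P1(4,5) le], goal_cases)
          case (5 s3 g' ordv'' lv'' Bv'' Nv'' D'')
          have "P (Suc k) s3" unfolding P_def
          proof (rule exI[of _ "g' * g"], rule exI[of _ ordv''], rule exI[of _ lv''], rule exI[of _ Bv''], rule exI[of _ Nv''], rule exI[of _ D''],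
            intro conjI allI impI)
            show "tableau s3 ordv'' lv'' Bv'' Nv'' D''" by fact
            show "g' * g > 0" using 5(4) P1(2) by simp
            show "vec s3 ''kap'' (\<lambda>v. g' * g * kv v)" using 5(3) by (simp add: mult.assoc)
            show "\<bar>lv'' v\<bar> \<le> U ^ (l + Suc k * (2 * m + 3))" if "v < m" for v using 5(5)[OF that] unfolding Suck .
            show "\<bar>g' * g * kv v\<bar> \<le> U ^ (l + Suc k * (2 * m + 3))" if "v < m" for v
              using 5(6)[OF that] unfolding Suck mult.assoc .
            show "(\<Sum>i<m. lv'' i * Bv'' i v) = g' * g * ((\<Sum>i<m. lv i * Bv i v) + (\<Sum>p<Suc k. kv p * ?w p v))" if "v < m" for v
              using 5(7)[OF that] P1(6)[OF that] by (simp add: algebra_simps)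
            show "rel ordv'' lv'' Bv'' i" if i: "i < m" "lv'' i > 0" for i
              using 5(8)[OF i]
            proof
              assume a: "0 < lv' i \<and> (\<forall>r<m. ordv'' i r = ordv' i r) \<and> (\<forall>v<m. Bv'' i v = Bv' i v)"
              then have "rel ordv' lv' Bv' i" using P1(7) i by simp
              with a show ?thesis unfolding rel_def by auto
            next
              assume "(\<forall>r<m. ordv'' i r = move_to \<pi> sp k r) \<and> (\<forall>v<m. Bv'' i v = ?w k v)"
              then show ?thesis unfolding rel_def using sk by blast
            qed
          qed
          then show ?case by (rule Pcong) auto
        qed simp_all
      qed
    qed
  next
    case (9 s1)
    have fr: "s1 y = s y" if "y \<notin> W" for y
    proof (rule 9(3))
      show "y \<notin> insert ''j'' (wvars (Cond (Less (Const 0) (Read ''kap'' (Var ''j''))) (moved_com ;; insert_com) Skip))"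
        using that unfolding W by (simp only: wvars.simps Un_empty_right not_False_eq_True)
    qed
    obtain g ordv' lv' Bv' Nv' D' where P1: "tableau s1 ordv' lv' Bv' Nv' D'" "g > 0"
      "\<And>v. v < m \<Longrightarrow> \<bar>lv' v\<bar> \<le> U ^ (l + m * (2 * m + 3))"
      "\<And>v. v < m \<Longrightarrow> (\<Sum>i<m. lv' i * Bv' i v) = g * ((\<Sum>i<m. lv i * Bv i v) + (\<Sum>p<m. kv p * ?w p v))"
      "\<And>i. i < m \<Longrightarrow> lv' i > 0 \<Longrightarrow> rel ordv' lv' Bv' i"
      using 9(1) unfolding P_def by blast
    show ?case by (rule post[OF _ P1(1,2,3,4) P1(5)[unfolded rel_def]]) (use fr in \<open>simp_all add: W_def\<close>)
  qed (use m_H m_Z envD(1)[OF env] in simp_all)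
qed

lemma wp_combine:
  assumes env: "env s" and tab: "tableau s ordv lv Bv Nv D"
    and lv: "\<And>v. v < m \<Longrightarrow> \<bar>lv v\<bar> \<le> U ^ l" and l: "l + 2 \<le> E"
    and post: "\<And>s'. (\<And>y. y \<notin> {''c'', ''a'', ''y'', ''x''} \<Longrightarrow> s' y = s y) \<Longrightarrow>
       vec s' ''x'' (\<lambda>v. \<Sum>j<m. lv j * Bv j v) \<Longrightarrow> (\<And>v. v < m \<Longrightarrow> \<bar>\<Sum>j<m. lv j * Bv j v\<bar> \<le> U ^ (l + 2)) \<Longrightarrow> Q s'"
  shows "wp combine Q s"
proof -
  note tab = tableauD[OF tab]
  have bound: "\<bar>\<Sum>j<i. lv j * Bv j v\<bar> \<le> U ^ (l + 2)" if "i \<le> m" "v < m" for i v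
  proof (rule power_mono_le[OF power_sum_le[where i = "l + 1", OF _ that(1)]])
    fix j assume j: "j < i"
    show "\<bar>lv j * Bv j v\<bar> \<le> U ^ (l + 1)"
      by (rule power_mult_le) (use lv[of j] tab(7)[of j v] that j in auto)
  qed simp
  have Zb: "\<bar>\<Sum>j<i. lv j * Bv j v\<bar> \<le> Z" if "i \<le> m" "v < m" for i v
    by (rule le_Z[OF bound[OF that] l])
  show ?thesis unfolding combine_def
  proof (rule wp_For[where N = m and I = "\<lambda>k s'. \<forall>v<k. s' ''x'' (int v) = (\<Sum>j<m. lv j * Bv j v)"], goal_cases)
    case (8 k s1)
    have fr: "s1 y = s y" if "y \<notin> {''c'', ''a'', ''y'', ''x''}" for y using 8(4)[of y] that by simp
    have km: "k < m" by fact
    show ?case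
    proof (rule wp_SeqWrite, goal_cases)
      case 2
      show ?case
      proof (rule wp_Seq, rule wp_sum[where N = m and f = "\<lambda>j. lv j * Bv j k"], goal_cases)
        case (7 c s2)
        show ?case by (simp add: 7(2,3) fr 8(3) envD(1)[OF env] matrD[OF tab(3) 7(1) km] vecD[OF tab(2) 7(1)])
      next
        case (8 i)
        then show ?case by (rule Zb[OF _ km])
      next
        case (10 s2)
        show ?case
          by (rule wp_Write) (use Zb[OF order_refl km] 8(2) in \<open>simp_all add: 10 8(3) less_Suc_eq\<close>)
      qed (use m_H m_Z envD(1)[OF env] in \<open>simp_all add: fr\<close>)
    qed (use one_Z in simp)
  next
    case (9 s1)
    show ?case by (rule post) (use 9 bound in \<open>simp_all add: vec_def\<close>)
  qed (use m_H m_Z envD(1)[OF env] in simp_all)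
qed

end

section \<open>One round and its invariant\<close>

lemma wvars_select_element [simp]: "wvars select_element = {''t'', ''kt'', ''a''}"
  by (auto simp: select_element_def)

lemma wvars_select_order [simp]: "wvars select_order = {''b'', ''phib'', ''c'', ''phi'', ''bad'', ''seen'', ''a'', ''u''}"
  by (auto simp: select_order_def)

lemma wvars_locate [simp]: "wvars locate = {''a'', ''oo'', ''bb'', ''seen'', ''u'', ''q'', ''s''}"
  by (auto simp: locate_def)

lemma wvars_exchange [simp]: "wvars exchange_com = {''a'', ''c'', ''j'', ''kap'', ''r'', ''al'', ''be'', ''u'', ''co'', ''mask'', ''prev'', ''cnt'', ''dummy'', ''ans'', ''cur'', ''w''}"
  by (auto simp: exchange_com_def)

lemma wvars_rescale [simp]: "wvars rescale = {''K'', ''a'', ''c0'', ''c1'', ''lam'', ''kap''}"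
  by (auto simp: rescale_def)

lemma wvars_iteration:
  "x \<in> {''n'', ''m'', ''rho_num'', ''rho_den'', ''T'', ''S'', ''R'', ''it'', ''all'', ''best'', ''l''} \<Longrightarrow> x \<notin> wvars iteration"
  by (auto simp: iteration_def)

context minimizer begin

text \<open>\<open>l\<close> bounds the sizes and \<open>k\<close> the remaining progress; with the
  witnesses hidden, a round is a transition between two pairs of numbers.\<close>

definition status :: "nat \<Rightarrow> nat \<Rightarrow> state \<Rightarrow> bool" where
  "status l k s \<longleftrightarrow> (\<exists>ordv lv Bv Nv D xv dv. env s \<and> tableau s ordv lv Bv Nv D \<and> vec s ''x'' xv \<and>
     vec s ''d'' (\<lambda>v. int (dv v)) \<and> combination ordv lv Bv xv \<and> labelling dv ordv lv xv \<and>
     (\<forall>v<m. \<bar>lv v\<bar> \<le> U ^ l) \<and> (\<forall>v<m. \<bar>xv v\<bar> \<le> U ^ (l + 2)) \<and> progress m xv dv ordv lv \<le> k)"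

lemma status_cong:
  assumes "status l k s" "\<And>y. y \<in> {''n'', ''m'', ''rho_num'', ''rho_den'', ''T'', ''ord'', ''lam'', ''B'', ''N'', ''D'', ''x'', ''d''} \<Longrightarrow> s' y = s y"
  shows "status l k s'"
proof -
  have "env s \<Longrightarrow> env s'" by (erule env_cong[rotated], rule assms(2)) auto
  moreover have "tableau s o' l' b' n' d' \<Longrightarrow> tableau s' o' l' b' n' d'" for o' l' b' n' d'
    by (erule tableau_cong, rule assms(2)) auto
  moreover have "vec s ''x'' f \<Longrightarrow> vec s' ''x'' f" "vec s ''d'' f \<Longrightarrow> vec s' ''d'' f" for f
    by (simp_all add: vec_def assms(2))
  ultimately show ?thesis using assms(1) unfolding status_def by meson
qed

text \<open>Increase, per round, of the exponent of \<open>U\<close> that bounds the coefficients.\<close>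

definition growth :: nat where "growth = 3 * m + 6 + m * (2 * m + 3)"

text \<open>Matches the scalings of the program with the hypotheses of
  \<open>exchange_progress\<close>: \<open>c0\<close> and \<open>c1\<close> come from the step
  length, \<open>g\<close> from the insertions.\<close>

lemma wp_exchange_step:
  assumes env: "env s" and tab: "tableau s ordv lv Bv Nv D" and x: "vec s ''x'' xv" and d: "vec s ''d'' (\<lambda>v. int (dv v))"
    and com: "combination ordv lv Bv xv" and lab: "labelling dv ordv lv xv"
    and lb: "\<And>v. v < m \<Longrightarrow> \<bar>lv v\<bar> \<le> U ^ l" and xb: "\<And>v. v < m \<Longrightarrow> \<bar>xv v\<bar> \<le> U ^ (l + 2)"
    and l: "l + growth + 2 \<le> E" and t: "s ''t'' 0 = int t" "selected m xv dv t"
    and b: "s ''b'' 0 = int i" "i \<in> bad_orders m dv t ordv lv"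
    and imax: "\<forall>j \<in> bad_orders m dv t ordv lv. disorder m dv (ordv j) \<le> disorder m dv (ordv i)"
  shows "wp (locate ;; exchange_com ;; rescale ;; insert_all ;; combine)
    (\<lambda>s'. status (l + growth) (progress m xv dv ordv lv - 1) s') s"
proof -
  note tb = tableauD[OF tab]
  have im: "i < m" "lv i > 0" "out_of_place m dv t (ordv i)" using b(2) by (auto simp: bad_orders_def)
  have tm: "t < m" "xv t < 0" using t(2) by (auto simp: selected_def candidates_def)
  have act: "ordering_on m (ordv j)" "\<And>v. v < m \<Longrightarrow> Bv j v = greedy F m (ordv j) v" if "j < m" "lv j > 0" for j
    using com that by (auto simp: combination_def)
  let ?\<pi> = "ordv i"
  have \<pi>: "ordering_on m ?\<pi>" by (rule act(1)[OF im(1,2)])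
  have lv0: "lv j \<ge> 0" if "j < m" for j by (rule tb(8)[OF that])
  have xsum: "xv v = (\<Sum>j<m. lv j * Bv j v)" if "v < m" for v using com that by (simp add: combination_def)
  show ?thesis
  proof (rule wp_Seq, rule wp_locate[OF env d tb(1,3) t(1) b(1) im(1) \<pi> _ im(3)], goal_cases)
    case (1 v) then show ?case by (intro tb(7) im)
  next
    case (2 s1 sp q)
    note f1 = 2(1)
    note sq = 2(6,8,9)
    have qm: "q < m" by fact
    have last: "\<And>p. sp < p \<Longrightarrow> p < q \<Longrightarrow> dv (?\<pi> p) + 1 \<noteq> dv t" by (rule 2(10))
    have sm: "?\<pi> sp < m" using ordering_on_less[OF \<pi>, of sp] 2(6,7) by simp
    have env1: "env s1" by (rule env_cong[OF _ env]) (auto simp: f1)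
    have Bg: "vec s1 ''bb'' (greedy F m ?\<pi>)" using 2(3) act(2)[OF im(1,2)] by (simp add: vec_def)
    show ?case
    proof (rule wp_Seq, rule wp_exchange[OF env1 2(2) Bg \<pi> 2(4,5,6,7)], goal_cases)
      case 1 show ?case using l by (simp add: growth_def)
    next
      case (2 s2 kv rv)
      have f2: "s2 y = s y" if "y \<notin> {''oo'', ''bb'', ''seen'', ''q'', ''s''} \<union> wvars exchange_com" for y
        using 2(1)[of y] f1[of y] that by simp
      note ex = 2(4)
      have rvb: "\<bar>rv v\<bar> \<le> U ^ (3 * m + 2)" if "v < m" for v by (rule 2(6)[OF that])
      have kvb: "\<bar>kv v\<bar> \<le> U ^ (3 * m + 2)" if "v < m" for v by (rule 2(5)[OF that])
      have env2: "env s2" by (rule env_cong[OF _ env]) (auto simp: f2)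
      have oo2: "vec s2 ''oo'' (\<lambda>p. int (?\<pi> p))" using \<open>vec s1 ''oo'' _\<close> by (simp add: vec_def 2(1))
      have sp2: "s2 ''s'' 0 = int sp" using \<open>s1 ''s'' 0 = int sp\<close> by (simp add: 2(1))
      have x2: "vec s2 ''x'' xv" "vec s2 ''lam'' lv" "s2 ''t'' 0 = int t" "s2 ''b'' 0 = int i"
        using x tb(2) t b by (simp_all add: vec_def f2)
      let ?K = "\<Sum>j<m. kv j"
      have exD: "\<And>j. j < m \<Longrightarrow> kv j \<ge> 0" "\<And>j. j < m \<Longrightarrow> j \<le> sp \<or> q < j \<Longrightarrow> kv j = 0" "?K > 0" "rv t \<ge> 0"
        using ex \<open>?\<pi> q = t\<close> by (auto simp: exchange_def)
      define c0 c1 where "c0 = (if - xv t * ?K < lv i * rv t then rv t else ?K)"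
        and "c1 = (if - xv t * ?K < lv i * rv t then - xv t else lv i)"
      have cc: "(c0, c1) = (if - xv t * ?K < lv i * rv t then (rv t, - xv t) else (?K, lv i))"
        by (simp add: c0_def c1_def)
      \<comment> \<open>If the branch with \<open>rv t\<close> is taken, its condition forces
        \<open>rv t > 0\<close>, since the left hand side is already positive.\<close>
      have c0: "c0 > 0"
      proof (cases "- xv t * ?K < lv i * rv t")
        case True
        have "- xv t * ?K > 0" using tm exD(3) by (simp add: mult_neg_pos)
        then have "lv i * rv t > 0" using True by linarith
        then have "rv t > 0" using im(2) by (simp add: zero_less_mult_iff)
        then show ?thesis using True by (simp add: c0_def)
      qed (use exD(3) in \<open>simp add: c0_def\<close>)
      have c1: "c1 \<ge> 0" using tm im(2) by (simp add: c1_def)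
      define lam1 where "lam1 j = c0 * lv j - (if j = i then c1 * ?K else 0)" for j
      \<comment> \<open>The step is the smaller of the two limits, so at least one of the weight of
        \<open>i\<close> and the value at \<open>t\<close> becomes zero while the other keeps its
        sign or vanishes too.\<close>
      have lam1i: "lam1 i \<ge> 0" "lam1 i = 0 \<or> c0 * xv t + c1 * rv t = 0" "c0 * xv t + c1 * rv t \<le> 0"
        unfolding lam1_def c0_def c1_def by (auto simp: mult.commute)
      have lam1_0: "lam1 j \<ge> 0" if "j < m" for j
        using lam1i(1) lv0[OF that] c0 by (cases "j = i") (simp_all add: lam1_def)
      show ?case
      proof (rule wp_Seq, rule wp_rescale[OF env2 2(2,3) x2(2,1,3) tm(1) x2(4) im(1) _ _ _ _ _ cc, where l = l], goal_cases)
        case (1 v) then show ?case by (rule kvb)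
      next
        case (2 v) then show ?case by (rule rvb)
      next
        case (3 v) then show ?case by (rule lb)
      next
        case (4 v) then show ?case by (rule xb)
      next
        case 5 show ?case using l by (simp add: growth_def)
      next
        case (6 s3)
        have f3: "s3 y = s y" if "y \<notin> {''oo'', ''bb'', ''seen'', ''q'', ''s''} \<union> wvars exchange_com \<union> wvars rescale" for y
          using 6(1)[of y] f2[of y] that by simp
        have env3: "env s3" by (rule env_cong[OF _ env]) (auto simp: f3)
        have oo3: "vec s3 ''oo'' (\<lambda>p. int (?\<pi> p))" using oo2 by (simp add: vec_def 6(1))
        have sp3: "s3 ''s'' 0 = int sp" using sp2 by (simp add: 6(1))
        have lam3: "vec s3 ''lam'' lam1" using 6(2) unfolding lam1_def .
        have tab3: "tableau s3 ordv lam1 Bv Nv D"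
          using tb(1,3-7) lam3 lam1_0 by (simp add: tableau_def matr_def f3)
        have lam1b: "\<bar>lam1 v\<bar> \<le> U ^ (l + 3 * m + 6)" if "v < m" for v using 6(4)[OF that] unfolding lam1_def .
        show ?case
        proof (rule wp_Seq, rule wp_insert_all[OF env3 tab3 6(3) oo3 \<pi> sp3, where q = q and l = "l + 3 * m + 6"], goal_cases)
          case (1 j) then show ?case using exD(1) c1 by simp
        next
          case (2 j)
          then have "kv j \<noteq> 0" by auto
          then show ?case using exD(2)[OF 2(1)] by (cases "sp < j \<and> j \<le> q") auto
        next
          case (3 v) then show ?case by (rule lam1b)
        next
          case (4 v) then show ?case by (rule 6(5))
        next
          case 5 show ?case using l by (simp add: growth_def)
        next
          case (6 s4 g ordv' lv' Bv' Nv' D')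
          have f4: "s4 y = s y" if "y \<notin> {''oo'', ''bb'', ''seen'', ''q'', ''s''} \<union> wvars exchange_com \<union> wvars rescale \<union> wvars insert_all" for y
            using 6(1)[of y] f3[of y] that by simp
          have env4: "env s4" by (rule env_cong[OF _ env]) (auto simp: f4)
          have lg: "l + 3 * m + 6 + m * (2 * m + 3) = l + growth" by (simp add: growth_def)
          have lv': "\<bar>lv' v\<bar> \<le> U ^ (l + growth)" if "v < m" for v using 6(4)[OF that] unfolding lg .
          show ?case
          proof (rule wp_combine[OF env4 6(2), where l = "l + growth"], goal_cases)
            case (1 v) then show ?case by (rule lv')
          next
            case 2 show ?case by (rule l)
          next
            case (3 s5)
            have f5: "s5 y = s y" if "y \<notin> {''oo'', ''bb'', ''seen'', ''q'', ''s''} \<union> wvars exchange_com \<union> wvars rescale \<union> wvars insert_all \<union> wvars combine" for y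
              using 3(1)[of y] f4[of y] that by simp
            have env5: "env s5" by (rule env_cong[OF _ env]) (auto simp: f5)
            have tab5: "tableau s5 ordv' lv' Bv' Nv' D'" by (rule tableau_cong[OF 6(2)]) (auto simp: 3(1))
            have d5: "vec s5 ''d'' (\<lambda>v. int (dv v))" using d by (simp add: vec_def f5)
            let ?x' = "\<lambda>v. \<Sum>j<m. lv' j * Bv' j v"
            let ?w = "\<lambda>p. greedy F m (move_to ?\<pi> sp p)"
            \<comment> \<open>The vector after the exchange, before the factor \<open>g\<close>
              collected by the insertions.\<close>
            define x1 where "x1 v = (\<Sum>j<m. lam1 j * Bv j v) + (\<Sum>p<m. c1 * kv p * ?w p v)" for v
            have x1: "x1 v = c0 * xv v + c1 * (if v = t then rv t else if v = ?\<pi> sp then - rv t else 0)" if v: "v < m" for v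
            proof -
              have "(\<Sum>j<m. lam1 j * Bv j v) = (\<Sum>j<m. c0 * (lv j * Bv j v) - (if j = i then c1 * ?K * Bv i v else 0))"
                by (intro sum.cong) (auto simp: lam1_def algebra_simps)
              also have "\<dots> = c0 * xv v - c1 * ?K * Bv i v"
                using im(1) by (simp add: sum_subtractf xsum[OF v] sum_distrib_left)
              finally have 1: "(\<Sum>j<m. lam1 j * Bv j v) = c0 * xv v - c1 * (?K * Bv i v)" by simp
              have "(\<Sum>p<m. c1 * kv p * ?w p v) = c1 * (\<Sum>p<m. kv p * ?w p v)"
                by (simp add: sum_distrib_left mult.assoc)
              also have "(\<Sum>p<m. kv p * ?w p v) = ?K * greedy F m ?\<pi> v + (if v = t then rv t else if v = ?\<pi> sp then - rv t else 0)"
                using exchange_final[OF \<pi> sq(1) qm ex v] \<open>?\<pi> q = t\<close> by simp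
              finally show ?thesis unfolding x1_def 1 act(2)[OF im(1,2) v] by (simp add: algebra_simps)
            qed
            have x'g: "?x' v = g * x1 v" if "v < m" for v using 6(5)[OF that] unfolding x1_def by simp
            have lv'0: "lv' j \<ge> 0" if "j < m" for j using tableauD(8)[OF 6(2) that] .
            have spq: "sp < q" by fact
            have rel: "lam1 j > 0 \<and> (\<forall>p<m. ordv' j p = ordv j p) \<and> (\<forall>v<m. Bv' j v = Bv j v) \<or>
               (\<exists>p. sp < p \<and> p \<le> q \<and> (\<forall>r<m. ordv' j r = move_to ?\<pi> sp p r) \<and> (\<forall>v<m. Bv' j v = ?w p v))"
              if "j < m" "lv' j > 0" for j by (rule 6(6)[OF that])
            have lam1_pos: "lv j > 0" if "j < m" "lam1 j > 0" for j
              using that im(2) c0 by (cases "j = i") (simp_all add: lam1_def zero_less_mult_iff)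
            \<comment> \<open>The total weight is read off at the dummy coordinate, where every
              greedy vector is one.\<close>
            have tot: "(\<Sum>j<m. lv' j) > 0"
            proof -
              have act': "ordering_on m (ordv' j) \<and> (\<forall>v<m. Bv' j v = greedy F m (ordv' j) v)" if j: "j < m" "lv' j > 0" for j
                using rel[OF j]
              proof
                assume a: "lam1 j > 0 \<and> (\<forall>p<m. ordv' j p = ordv j p) \<and> (\<forall>v<m. Bv' j v = Bv j v)"
                then have "lv j > 0" using lam1_pos j by simp
                from act[OF j(1) this] a show ?thesis
                  using ordering_on_cong[of m "ordv' j" "ordv j"] greedy_cong[of m "ordv j" "ordv' j"] by simp
              next
                assume "\<exists>p. sp < p \<and> p \<le> q \<and> (\<forall>r<m. ordv' j r = move_to ?\<pi> sp p r) \<and> (\<forall>v<m. Bv' j v = ?w p v)"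
                then obtain p where p: "sp < p" "p \<le> q" "\<forall>r<m. ordv' j r = move_to ?\<pi> sp p r" "\<forall>v<m. Bv' j v = ?w p v" by blast
                have "ordering_on m (move_to ?\<pi> sp p)" by (rule ordering_on_move_to[OF \<pi>]) (use p qm in auto)
                then show ?thesis using p ordering_on_cong[of m "ordv' j" "move_to ?\<pi> sp p"]
                    greedy_cong[of m "move_to ?\<pi> sp p" "ordv' j"] by simp
              qed
              have "?x' n = (\<Sum>j<m. lv' j)" by (rule total_weight[OF lv'0 act'])
              moreover have "xv n = (\<Sum>j<m. lv j)"
                using total_weight[of lv ordv Bv] lv0 act xsum[OF z] by simp
              then have "xv n > 0" using com by (simp add: combination_def)
              \<comment> \<open>The exchange leaves the dummy coordinate alone: all moved orders
                have value one there, so the amount transferred at \<open>n\<close> is zero.\<close>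
              moreover have "(if n = t then rv t else if n = ?\<pi> sp then - rv t else 0) = 0"
              proof -
                have "kv p * ?w p n = kv p" if "p < m" for p
                proof (cases "p \<le> sp")
                  case False
                  then have "ordering_on m (move_to ?\<pi> sp p)" by (intro ordering_on_move_to[OF \<pi>]) (use that in auto)
                  then show ?thesis by (simp add: greedy_dummy)
                qed (use exD(2)[OF that] in simp)
                then have S: "(\<Sum>p<m. kv p * ?w p n) = ?K" by (intro sum.cong) simp_all
                have "?K = ?K * 1 + (if n = t then rv t else if n = ?\<pi> sp then - rv t else 0)"
                  using exchange_final[OF \<pi> spq qm ex z] unfolding \<open>?\<pi> q = t\<close> S greedy_dummy[OF \<pi>] .
                then show ?thesis by linarith
              qed
              ultimately have eq: "(\<Sum>j<m. lv' j) = g * (c0 * xv n)" and pos: "xv n > 0"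
                using x'g[OF z] x1[OF z] by simp_all
              show ?thesis unfolding eq by (intro mult_pos_pos 6(3) c0 pos)
            qed
            have full: "lam1 i = 0 \<or> x1 t = 0" "x1 t \<le> 0" using lam1i x1[OF tm(1)] by simp_all
            have bmax: "disorder m dv (ordv j) \<le> disorder m dv ?\<pi>" if "j \<in> bad_orders m dv t ordv lv" for j
              using imax that by blast
            have step: "combination ordv' lv' Bv' ?x'" "labelling dv ordv' lv' ?x'"
              "progress m ?x' dv ordv' lv' < progress m xv dv ordv lv"
              by (rule exchange_progress[OF com lab t(2) b(2) bmax spq qm sq(2,3) last c0 c1 exD(4) x1 full(2,1)
                    lam1_pos 6(3) x'g lv'0 refl tot rel]; assumption)+
            show ?case unfolding status_def
              by (rule exI[of _ ordv'], rule exI[of _ lv'], rule exI[of _ Bv'], rule exI[of _ Nv'], rule exI[of _ D'],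
                  rule exI[of _ ?x'], rule exI[of _ dv])
                (use env5 tab5 3(2,3) d5 step lv' in auto)
          qed
        qed
      qed
    qed
  qed
qed

lemma statusI:
  assumes "env s" "tableau s ordv lv Bv Nv D" "vec s ''x'' xv" "vec s ''d'' (\<lambda>v. int (dv v))"
    "combination ordv lv Bv xv" "labelling dv ordv lv xv" "\<And>v. v < m \<Longrightarrow> \<bar>lv v\<bar> \<le> U ^ l"
    "\<And>v. v < m \<Longrightarrow> \<bar>xv v\<bar> \<le> U ^ (l + 2)" "progress m xv dv ordv lv \<le> k"
  shows "status l k s"
  unfolding status_def using assms by blast

lemma wp_iteration:
  assumes st: "status l k s" and l: "l + growth + 2 \<le> E"
  shows "wp iteration (status (l + growth) (k - 1)) s"
proof -
  from st obtain ordv lv Bv Nv D xv dv where env: "env s" and tab: "tableau s ordv lv Bv Nv D"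
    and x: "vec s ''x'' xv" and d: "vec s ''d'' (\<lambda>v. int (dv v))" and com: "combination ordv lv Bv xv"
    and lab: "labelling dv ordv lv xv" and lb: "\<And>v. v < m \<Longrightarrow> \<bar>lv v\<bar> \<le> U ^ l"
    and xb: "\<And>v. v < m \<Longrightarrow> \<bar>xv v\<bar> \<le> U ^ (l + 2)" and pr: "progress m xv dv ordv lv \<le> k"
    unfolding status_def by blast
  have lb': "\<bar>lv v\<bar> \<le> U ^ (l + growth)" if "v < m" for v by (rule power_mono_le[OF lb[OF that]]) simp
  have xb': "\<bar>xv v\<bar> \<le> U ^ (l + growth + 2)" if "v < m" for v by (rule power_mono_le[OF xb[OF that]]) simp
  note tb = tableauD[OF tab]
  show ?thesis unfolding iteration_def
  proof (rule wp_Seq, rule wp_select_element[OF env x d], goal_cases)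
    case (1 s1)
    note f1 = 1(1)
    have env1: "env s1" by (rule env_cong[OF _ env]) (auto simp: f1)
    have tab1: "tableau s1 ordv lv Bv Nv D" by (rule tableau_cong[OF tab]) (auto simp: f1)
    note tb1 = tableauD[OF tab1]
    have x1: "vec s1 ''x'' xv" using x by (simp add: vec_def f1)
    have d1: "vec s1 ''d'' (\<lambda>v. int (dv v))" using d by (simp add: vec_def f1)
    show ?case
    proof (rule wp_Cond, goal_cases)
      case 1
      then have "candidates m xv dv = {}" using \<open>_ \<or> _\<close> by auto
      \<comment> \<open>With the measure at zero, subtracting one from its bound is harmless on
        natural numbers.\<close>
      then have "progress m xv dv ordv lv = 0" by (simp add: progress_def)
      then have "progress m xv dv ordv lv \<le> k - 1" by simp
      from statusI[OF env1 tab1 x1 d1 com lab lb' xb' this]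
      have st1: "status (l + growth) (k - 1) s1" by simp
      show ?case by (rule wp_Skip) (rule st1)
    next
      case 2
      then obtain t where t: "s1 ''t'' 0 = int t" "selected m xv dv t" using \<open>_ \<or> _\<close> by auto
      have tm: "t < m" "dv t < m" using t(2) by (auto simp: selected_def candidates_def)
      have ords: "ordering_on m (ordv j)" if "j < m" "lv j > 0" for j using com that by (auto simp: combination_def)
      have dm: "dv v \<le> m" if "v < m" for v using lab that by (auto simp: labelling_def)
      show ?case
      proof (rule wp_Seq, rule wp_select_order[OF env1 d1 tb1(2,1) t(1) tm(1) ords dm], goal_cases)
        case (4 s2)
        note f2 = 4(1)
        have env2: "env s2" by (rule env_cong[OF _ env1]) (auto simp: f2)
        have tab2: "tableau s2 ordv lv Bv Nv D" by (rule tableau_cong[OF tab1]) (auto simp: f2)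
        have x2: "vec s2 ''x'' xv" using x1 by (simp add: vec_def f2)
        have d2: "vec s2 ''d'' (\<lambda>v. int (dv v))" using d1 by (simp add: vec_def f2)
        have t2: "s2 ''t'' 0 = int t" using t(1) by (simp add: f2)
        show ?case
        proof (rule wp_Cond, goal_cases)
          case 1
          then have none: "bad_orders m dv t ordv lv = {}" using 4(2) by auto
          note rl = labelling_relabel[OF lab com t(2) none]
          let ?dv = "dv(t := dv t + 1)"
          let ?s3 = "s2(''d'' := (s2 ''d'')(int t := int (dv t) + 1))"
          have "status (l + growth) (k - 1) ?s3"
          proof (rule statusI[where dv = ?dv])
            show "env ?s3" by (rule env_cong[OF _ env2]) auto
            show "tableau ?s3 ordv lv Bv Nv D" by (rule tableau_cong[OF tab2]) auto
            show "vec ?s3 ''x'' xv" using x2 by (simp add: vec_def)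
            show "vec ?s3 ''d'' (\<lambda>v. int (?dv v))" using d2 by (simp add: vec_def)
            show "progress m xv ?dv ordv lv \<le> k - 1" using rl(2) pr by simp
          qed (fact com rl(1) | erule lb' xb')+
          moreover have "int (dv t) + 1 \<le> Z" using nat_Z[of "dv t + 1"] tm(2) by simp
          ultimately show ?case using vecD[OF d2 tm(1)]
            by (intro wp_Write) (simp_all add: t2)
        next
          case 2
          then obtain i where i: "s2 ''b'' 0 = int i" "i \<in> bad_orders m dv t ordv lv"
            "\<forall>j\<in>bad_orders m dv t ordv lv. disorder m dv (ordv j) \<le> disorder m dv (ordv i)" using 4(2) by auto
          show ?case
          proof (rule wp_weaken, rule wp_exchange_step[OF env2 tab2 x2 d2 com lab lb xb l t2 t(2) i], goal_cases)
            case (3 s3)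
            then show ?case using pr unfolding status_def by (meson diff_le_mono le_trans)
          qed
        qed
      qed
    qed
  qed
qed

section \<open>Initialization and comparison of the level sets\<close>

lemma wp_unit_matrix:
  assumes env: "env s" and x: "x \<notin> {''a'', ''c'', ''m''}" and e: "e = Const 0 \<or> e = Const 1"
    and post: "\<And>s'. (\<And>y. y \<notin> {''a'', ''c'', x} \<Longrightarrow> s' y = s y) \<Longrightarrow>
      matr s' x (\<lambda>j v. if j = v then aval e s else 0) \<Longrightarrow> Q s'"
  shows "wp (For ''c'' (Var ''m'') (
    For ''a'' (Var ''m'') (Write x (cell ''c'' (Var ''a'')) (Const 0)) ;;
    Write x (cell ''c'' (Var ''c'')) e)) Q s"
proof (rule wp_For[where N = m and I = "\<lambda>k s'. \<forall>j<k. \<forall>v<m. s' x (int j * int m + int v) = (if j = v then aval e s else 0)"], goal_cases)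
  case (8 k s1)
  have fr: "s1 y = s y" if "y \<notin> {''a'', ''c'', x}" for y using 8(4)[of y] that by simp
  have m1: "s1 ''m'' 0 = int m" using fr[of "''m''"] x envD(1)[OF env] by auto
  have km: "k < m" by fact
  have ev: "aval e s' = aval e s" "\<bar>aval e s\<bar> \<le> Z" for s' using e one_Z by auto
  have M: "matr s1 x (\<lambda>j v. s1 x (int j * int m + int v))" by (simp add: matr_def)
  show ?case
  proof (rule wp_Seq, rule wp_fill_row[OF _ _ _ _ m1 8(3) km M, where g = "\<lambda>_. 0"], goal_cases)
    case (5 i s2)
    then show ?case using one_Z by simp
  next
    case (6 s2)
    have c2: "s2 ''c'' = s1 ''c''" "s2 ''m'' = s1 ''m''" using x by (auto intro!: 6(1))
    have e2: "aval e s2 = aval e s" by (rule ev)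
    have M2: "s2 x (int j * int m + int v) = (if j = k then 0 else s1 x (int j * int m + int v))" if "j < m" "v < m" for j v
      using matrD[OF 6(2) that] .
    show ?case
      by (rule wp_Write) (use ev(2) 8(2) km x in \<open>auto simp: e2 c2 8(3) m1 less_Suc_eq M2\<close>)
  qed (use x in auto)
next
  case (9 s1)
  show ?case by (rule post) (use 9 in \<open>simp_all add: matr_def\<close>)
qed (use x m_H m_Z envD(1)[OF env] in auto)

lemma wp_initialize:
  assumes env: "env s" and l: "2 * m + 5 \<le> E"
    and post: "\<And>s'. (\<And>y. y \<notin> wvars initialize \<Longrightarrow> s' y = s y) \<Longrightarrow> status (2 * m + 3) ((m + 1) ^ 8) s' \<Longrightarrow> Q s'"
  shows "wp initialize Q s"
proof -
  define W where "W = wvars initialize"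
  have W: "W = {''d'', ''co'', ''lam'', ''kap'', ''B'', ''N'', ''ord'', ''D'', ''j'', ''x''} \<union> wvars greedy_com \<union> wvars insert_com"
    unfolding W_def by (auto simp: initialize_def)
  show ?thesis unfolding initialize_def
  proof (rule wp_Seq, rule wp_fill[where N = m and f = "\<lambda>_. 0" and off = 0], goal_cases)
    case (8 s1)
    have d1: "s1 ''d'' (int v) = 0" if "v < m" for v using 8(2)[OF that] by simp
    note f1 = 8(1)
    show ?case
    proof (rule wp_Seq, rule wp_fill[where N = m and f = int and off = 0], goal_cases)
      case (7 k s) then show ?case by (simp add: nat_Z)
    next
      case (8 s2)
      have co2: "s2 ''co'' (int v) = int v" if "v < m" for v using 8(2)[OF that] by simp
      have f2: "s2 y = s y" if "y \<notin> {''a'', ''d'', ''co''}" for y using 8(1)[of y] f1[of y] that by simp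
      have d2: "s2 ''d'' = s1 ''d''" using 8(1) by simp
      show ?case
      proof (rule wp_Seq, rule wp_fill[where N = m and f = "\<lambda>_. 0" and off = 0], goal_cases)
        case (8 s3)
        have lam3: "s3 ''lam'' (int v) = 0" if "v < m" for v using 8(2)[OF that] by simp
        have f3: "s3 y = s2 y" if "y \<notin> {''a'', ''lam''}" for y using 8(1)[of y] that by simp
        show ?case
        proof (rule wp_Seq, rule wp_fill[where N = m and f = "\<lambda>_. 1" and off = 0], goal_cases)
          case (8 s4)
          have kap4: "s4 ''kap'' (int v) = 1" if "v < m" for v using 8(2)[OF that] by simp
          have f4: "s4 y = s3 y" if "y \<notin> {''a'', ''kap''}" for y using 8(1)[of y] that by simp
          have env4: "env s4" by (rule env_cong[OF _ env]) (auto simp: f4 f3 f2)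
          show ?case
          proof (rule wp_Seq, rule wp_unit_matrix[OF env4], goal_cases)
            case (3 s5)
            note f5 = 3(1) and B5 = 3(2)
            have env5: "env s5" by (rule env_cong[OF _ env4]) (auto simp: f5)
            show ?case
            proof (rule wp_Seq, rule wp_unit_matrix[OF env5], goal_cases)
              case (3 s6)
              note f6 = 3(1) and N6 = 3(2)
              have env6: "env s6" by (rule env_cong[OF _ env5]) (auto simp: f6)
              show ?case
              proof (rule wp_Seq, rule wp_For[where N = m and I = "\<lambda>k s'. \<forall>j<k. \<forall>v<m. s' ''ord'' (int j * int m + int v) = 0"], goal_cases)
                case (8 k s7)
                have m7: "s7 ''m'' 0 = int m" using 8(4)[of "''m''"] envD(1)[OF env6] by simp
                have M: "matr s7 ''ord'' (\<lambda>j v. s7 ''ord'' (int j * int m + int v))" by (simp add: matr_def)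
                show ?case
                proof (rule wp_fill_row[OF _ _ _ _ m7 8(3,1) M, where g = "\<lambda>_. 0"], goal_cases)
                  case (5 i s8) then show ?case using one_Z by simp
                next
                  case (6 s8)
                  show ?case using 8(1,2) by (auto simp: less_Suc_eq matrD[OF 6(2)])
                qed simp_all
              next
                case (9 s7)
                have f7: "s7 y = s6 y" if "y \<notin> {''a'', ''c'', ''ord''}" for y using 9(3)[of y] that by simp
                let ?s = "s7(''D'' := (s7 ''D'')(0 := 1), ''j'' := (s7 ''j'')(0 := 0))"
                have fs: "?s y = s y" if "y \<notin> W" for y
                  using that by (simp add: W f7 f6 f5 f4 f3 f2)
                have envs: "env ?s" by (rule env_cong[OF _ env]) (auto simp: f7 f6 f5 f4 f3 f2)
                let ?one = "\<lambda>j v. if j = v then 1 else 0 :: int"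
                have tabs: "tableau ?s (\<lambda>_ _. 0) (\<lambda>_. 0) ?one ?one 1"
                  unfolding tableau_def
                proof (intro conjI allI impI)
                  show "matr ?s ''ord'' (\<lambda>j p. int 0)" using 9(1) by (simp add: matr_def)
                  show "vec ?s ''lam'' (\<lambda>_. 0)" using lam3 by (simp add: vec_def f7 f6 f5 f4)
                  show "matr ?s ''B'' ?one" using B5 by (simp add: matr_def f7 f6)
                  show "matr ?s ''N'' ?one" using N6 by (simp add: matr_def f7)
                  show "basis_adjugate m ?one ?one 1" by (rule basis_adjugate_unit)
                qed (use U in auto)
                have kaps: "vec ?s ''kap'' (\<lambda>_. 1)" using kap4 by (simp add: vec_def f7 f6 f5)
                have cos: "vec ?s ''co'' (\<lambda>p. int p)" using co2 by (simp add: vec_def f7 f6 f5 f4 f3)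
                have ds: "vec ?s ''d'' (\<lambda>_. int 0)" using d1 by (simp add: vec_def f7 f6 f5 f4 f3 d2)
                have \<pi>: "ordering_on m (\<lambda>p. p)" by (simp add: ordering_on_def bij_betw_def)
                have "wp (greedy_com ;; insert_com ;; combine) Q ?s"
                proof (rule wp_Seq, rule wp_greedy[OF envs \<pi> cos], goal_cases)
                  case (1 s8)
                  note f8 = 1(1)
                  have env8: "env s8" by (rule env_cong[OF _ envs]) (auto simp: f8)
                  have tab8: "tableau s8 (\<lambda>_ _. 0) (\<lambda>_. 0) ?one ?one 1" by (rule tableau_cong[OF tabs]) (auto simp: f8)
                  have kap8: "vec s8 ''kap'' (\<lambda>_. 1)" using kaps by (simp add: vec_def f8)
                  have co8: "vec s8 ''co'' (\<lambda>p. int p)" using cos by (simp add: vec_def f8)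
                  show ?case
                  proof (rule wp_Seq, rule wp_insert[OF env8 tab8 kap8 1(2) co8, where j = 0 and l = 0], goal_cases)
                    case 1 show ?case by (simp add: f8)
                  next
                    case (4 v) then show ?case by (rule greedy_bound[OF \<pi>])
                  next
                    case 8 show ?case using l by simp
                  next
                    case (9 s9 g ordv' lv' Bv' Nv' D')
                    note f9 = 9(1) and tab9 = 9(2)
                    have env9: "env s9" by (rule env_cong[OF _ env8]) (auto simp: f9)
                    have lb: "\<bar>lv' v\<bar> \<le> U ^ (2 * m + 3)" if "v < m" for v using 9(5)[OF that] by simp
                    show ?case
                    proof (rule wp_combine[OF env9 tab9, where l = "2 * m + 3"], goal_cases)
                      case (1 v) then show ?case by (rule lb)
                    next
                      case 2 show ?case using l by simp
                    next
                      case (3 s10)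
                      note f10 = 3(1)
                      let ?x = "\<lambda>v. \<Sum>j<m. lv' j * Bv' j v"
                      have lv0: "lv' j \<ge> 0" if "j < m" for j by (rule tableauD(8)[OF tab9 that])
                      have act: "ordering_on m (ordv' j) \<and> (\<forall>v<m. Bv' j v = greedy F m (ordv' j) v)" if j: "j < m" "lv' j > 0" for j
                      proof -
                        have a: "\<forall>r<m. ordv' j r = r" "\<forall>v<m. Bv' j v = greedy F m (\<lambda>p. p) v" using 9(8)[OF j] by auto
                        then show ?thesis using \<pi> ordering_on_cong[of m "ordv' j" "\<lambda>p. p"] greedy_cong[of m "\<lambda>p. p" "ordv' j"] by simp
                      qed
                      \<comment> \<open>The dummy coordinate shows again that the total weight is
                        positive; here it equals \<open>g\<close>.\<close>
                      have "?x n = (\<Sum>j<m. lv' j)" by (rule total_weight[OF lv0 act])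
                      moreover have "?x n = g * greedy F m (\<lambda>p. p) n" using 9(7)[OF z] by simp
                      ultimately have tot: "(\<Sum>j<m. lv' j) > 0" using 9(4) greedy_dummy[OF \<pi>] by simp
                      have com: "combination ordv' lv' Bv' ?x"
                        unfolding combination_def using lv0 act tot by blast
                      have lab: "labelling (\<lambda>_. 0) ordv' lv' ?x" by (simp add: labelling_def)
                      have "status (2 * m + 3) ((m + 1) ^ 8) s10"
                      proof (rule statusI[where xv = ?x and dv = "\<lambda>_. 0"])
                        show "env s10" by (rule env_cong[OF _ env9]) (auto simp: f10)
                        show "tableau s10 ordv' lv' Bv' Nv' D'" by (rule tableau_cong[OF tab9]) (auto simp: f10)
                        show "vec s10 ''x'' ?x" by (rule 3(2))
                        show "vec s10 ''d'' (\<lambda>v. int 0)" using ds by (simp add: vec_def f10 f9 f8)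
                        show "progress m ?x (\<lambda>_. 0) ordv' lv' \<le> (m + 1) ^ 8" by (rule progress_bound[OF com lab m_pos])
                        show "\<bar>?x v\<bar> \<le> U ^ (2 * m + 3 + 2)" if "v < m" for v by (rule 3(3)[OF that])
                      qed (fact com lab | erule lb)+
                      then show ?case
                      proof (rule post[rotated])
                        fix y assume "y \<notin> wvars initialize"
                        then have y: "y \<notin> W" by (simp add: W_def)
                        have "s10 y = ?s y" using y by (simp add: W f10 f9 f8)
                        then show "s10 y = s y" using fs[OF y] by simp
                      qed
                    qed
                  qed (use U m_pos in auto)
                qed
                then show ?case using one_Z by (intro wp_SeqWrite) simp_all
              qed (use m_H m_Z envD(1)[OF env6] in simp_all)
            qed auto
          qed auto
        qed (use m_H m_Z one_Z envD(1)[OF env] in \<open>simp_all add: f3 f2\<close>)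
      qed (use m_H m_Z one_Z envD(1)[OF env] in \<open>simp_all add: f2\<close>)
    qed (use m_H m_Z one_Z envD(1)[OF env] in \<open>simp_all add: f1\<close>)
  qed (use m_H m_Z one_Z envD(1)[OF env] in simp_all)
qed

end

lemma wvars_level_sets [simp]: "wvars level_sets = {''l'', ''a'', ''mask'', ''cnt'', ''dummy'', ''ans'', ''cur'', ''best''}"
  by (auto simp: level_sets_def eval_prefix_def)

lemma wvars_initialize:
  "x \<in> {''n'', ''m'', ''rho_num'', ''rho_den'', ''T'', ''S'', ''R'', ''all''} \<Longrightarrow> x \<notin> wvars initialize"
  by (auto simp: initialize_def)

context minimizer begin

lemma wp_level_sets:
  assumes env: "env s" and d: "vec s ''d'' (\<lambda>v. int (dv v))"
    and post: "\<And>s' l. (\<And>y. y \<notin> wvars level_sets \<Longrightarrow> s' y = s y) \<Longrightarrow>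
       s' ''best'' 0 = F {v. v < m \<and> l < dv v} \<Longrightarrow>
       (\<And>l'. l' \<le> m \<Longrightarrow> F {v. v < m \<and> l < dv v} \<le> F {v. v < m \<and> l' < dv v}) \<Longrightarrow> Q s'"
  shows "wp level_sets Q s"
proof -
  let ?L = "\<lambda>k l. {v. v < k \<and> l < dv v}"
  define W where "W = wvars level_sets"
  have W: "W = {''l'', ''a'', ''mask'', ''cnt'', ''dummy'', ''ans'', ''cur'', ''best''}" by (simp add: W_def)
  \<comment> \<open>\<open>best\<close> carries no information before the first threshold has been
    evaluated, hence the case \<open>k = 0\<close>.\<close>
  define P where "P k s' \<longleftrightarrow> k = 0 \<or> (\<exists>l<k. s' ''best'' 0 = F (?L m l) \<and> (\<forall>l'<k. F (?L m l) \<le> F (?L m l')))" for k and s' :: state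
  have FZ: "\<bar>F (?L m l)\<bar> \<le> Z" for l
  proof -
    have "2 * \<bar>F (?L m l)\<bar> \<le> U" by (rule F_bound) auto
    then show ?thesis by (intro U_le_Z) simp
  qed
  have cardm: "card (?L k l \<inter> T) \<le> m" for k l
  proof -
    have "card (?L k l \<inter> T) \<le> card {..<n}" by (rule card_mono) (use T in auto)
    then show ?thesis by (simp add: m)
  qed
  show ?thesis unfolding level_sets_def
  proof (rule wp_For[where N = "m + 1" and I = P], goal_cases)
    case (8 k s1)
    have fr: "s1 y = s y" if "y \<notin> W" for y using 8(4)[of y] that by (simp add: W eval_prefix_def)
    have env1: "env s1" by (rule env_cong[OF _ env]) (auto simp: fr W)
    show ?case
    proof (rule wp_Seq, rule wp_fill[where N = m and f = "\<lambda>_. 0" and off = 0], goal_cases)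
      case (8 s2)
      have mask2: "s2 ''mask'' (int v) = 0" if "v < m" for v using 8(2)[OF that] by simp
      have f2: "s2 y = s1 y" if "y \<notin> {''a'', ''mask''}" for y using 8(1)[of y] that by simp
      let ?s = "s2(''cnt'' := (s2 ''cnt'')(0 := 0), ''dummy'' := (s2 ''dummy'')(0 := 0))"
      define R where "R i s' \<longleftrightarrow> vec s' ''mask'' (\<lambda>v. if v \<in> ?L i k \<inter> T then 1 else 0) \<and>
         s' ''cnt'' 0 = int (card (?L i k \<inter> T)) \<and> s' ''dummy'' 0 = (if n \<in> ?L i k then 1 else 0)" for i and s' :: state
      have L0: "?L 0 k = {}" by simp
      have "wp (For ''a'' (Var ''m'') (Cond (Less (Var ''l'') (Read ''d'' (Var ''a''))) (
          Write ''mask'' (Var ''a'') (Read ''T'' (Var ''a'')) ;;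
          Assign ''cnt'' (Add (Var ''cnt'') (Read ''T'' (Var ''a''))) ;;
          Cond (Less (Var ''a'') (Var ''n'')) Skip (Assign ''dummy'' (Const 1))) Skip) ;;
        eval_prefix ;;
        Cond (Conj (Less (Const 0) (Var ''l'')) (Neg (Less (Var ''cur'') (Var ''best'')))) Skip
          (Assign ''best'' (Var ''cur''))) (\<lambda>s'. P (Suc k) (s'(''l'' := (s' ''l'')(0 := int k + 1)))) ?s"
      proof (rule wp_Seq, rule wp_For[where N = m and I = R], goal_cases)
        case (8 i s3)
        have im: "i < m" by fact
        have f3: "s3 y = s y" if "y \<notin> W" for y using 8(4)[of y] f2[of y] fr[of y] that by (simp add: W)
        have l3: "s3 ''l'' 0 = int k" using 8(4)[of "''l''"] f2[of "''l''"] \<open>s1 ''l'' 0 = int k\<close> by simp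
        have e: "s3 ''d'' (int i) = int (dv i)" "s3 ''n'' 0 = int n" "s3 ''T'' (int i) = (if i \<in> T then 1 else 0)"
          using vecD[OF d im] envD(2)[OF env] envD(3)[OF env im] by (simp_all add: f3 W)
        have R3: "vec s3 ''mask'' (\<lambda>v. if v \<in> ?L i k \<inter> T then 1 else 0)"
          "s3 ''cnt'' 0 = int (card (?L i k \<inter> T))" "s3 ''dummy'' 0 = (if n \<in> ?L i k then 1 else 0)"
          using 8(2) by (simp_all add: R_def)
        show ?case
        proof (rule wp_Cond, goal_cases)
          case 1
          then have lt: "k < dv i" by (simp add: l3 8(3) e)
          then have L: "?L (Suc i) k = insert i (?L i k)" by (auto simp: less_Suc_eq)
          have cardS: "card (?L (Suc i) k \<inter> T) = card (?L i k \<inter> T) + (if i \<in> T then 1 else 0)"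
            unfolding L by (simp add: Int_insert_left)
          have cnt: "s3 ''cnt'' 0 + (if i \<in> T then 1 else 0) = int (card (?L (Suc i) k \<inter> T))"
            unfolding cardS using R3(2) by simp
          have mask: "vec (s3(''mask'' := (s3 ''mask'')(int i := if i \<in> T then 1 else 0))) ''mask'' (\<lambda>v. if v \<in> ?L (Suc i) k \<inter> T then 1 else 0)"
            using R3(1) unfolding L by (auto simp: vec_def)
          let ?s4 = "s3(''mask'' := (s3 ''mask'')(int i := if i \<in> T then 1 else 0), ''cnt'' := (s3 ''cnt'')(0 := int (card (?L (Suc i) k \<inter> T))))"
          let ?Q = "\<lambda>s'. R (Suc i) (s'(''a'' := (s' ''a'')(0 := int i + 1)))"
          have "wp (Cond (Less (Var ''a'') (Var ''n'')) Skip (Assign ''dummy'' (Const 1))) ?Q ?s4"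
          proof (rule wp_Cond, goal_cases)
            case 1
            then have "i \<noteq> n" by (simp add: 8(3) e)
            then have "(n \<in> ?L (Suc i) k) = (n \<in> ?L i k)" by auto
            then show ?case using mask R3(3) by (intro wp_Skip) (simp add: R_def vec_def)
          next
            case 2
            then have "i = n" using im m by (simp add: 8(3) e)
            then have "n \<in> ?L (Suc i) k" using lt by auto
            then show ?case using mask one_Z by (intro wp_Write) (simp_all add: R_def vec_def)
          qed
          then show ?case using cnt one_Z cardm[of "Suc i" k]
            by (intro wp_SeqWrite) (simp_all add: e 8(3) nat_Z)
        next
          case 2
          then have "\<not> k < dv i" by (simp add: l3 8(3) e)
          then have "?L (Suc i) k = ?L i k" by (auto simp: less_Suc_eq)
          then show ?case using R3 by (intro wp_Skip) (simp add: R_def vec_def)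
        qed
      next
        case (9 s3)
        have f3: "s3 y = s y" if "y \<notin> W" for y using 9(3)[of y] f2[of y] fr[of y] that by (simp add: W)
        have l3: "s3 ''l'' 0 = int k" using 9(3)[of "''l''"] f2[of "''l''"] \<open>s1 ''l'' 0 = int k\<close> by simp
        have best3: "s3 ''best'' = s1 ''best''" using 9(3)[of "''best''"] f2[of "''best''"] by simp
        have env3: "env s3" by (rule env_cong[OF _ env]) (auto simp: f3 W)
        show ?case
        proof (rule wp_Seq, rule wp_eval_prefix[OF env3, where X = "?L m k"], goal_cases)
          case (5 s4)
          have e4: "s4 ''l'' 0 = int k" "s4 ''best'' = s1 ''best''" using 5(1) l3 best3 by simp_all
          show ?case
          proof (rule wp_Cond, goal_cases)
            case 1
            then have k: "k > 0" "s1 ''best'' 0 \<le> F (?L m k)" by (simp_all add: e4 5(2))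
            then obtain l where l: "l < k" "s1 ''best'' 0 = F (?L m l)" "\<forall>l'<k. F (?L m l) \<le> F (?L m l')"
              using \<open>P k s1\<close> unfolding P_def by auto
            have "P (Suc k) s4" unfolding P_def
              using l k(2) by (intro disjI2 exI[of _ l]) (auto simp: e4 less_Suc_eq)
            then show ?case by (intro wp_Skip) (simp add: P_def)
          next
            case 2
            then have k: "k = 0 \<or> F (?L m k) < s1 ''best'' 0" by (auto simp: e4 5(2))
            have "\<forall>l'<Suc k. F (?L m k) \<le> F (?L m l')"
              using \<open>P k s1\<close> k unfolding P_def by (force simp: less_Suc_eq)
            then have "P (Suc k) (s4(''best'' := (s4 ''best'')(0 := F (?L m k))))"
              unfolding P_def by (intro disjI2 exI[of _ k]) auto
            then show ?case using FZ[of k] by (intro wp_Write) (simp_all add: 5(2) P_def)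
          qed
        qed (use 9(1) in \<open>auto simp: R_def\<close>)
      qed (use m_H m_Z envD(1)[OF env1] mask2 in \<open>simp_all add: R_def vec_def f2\<close>)
      then show ?case using one_Z by (intro wp_SeqWrite) simp_all
    qed (use m_H m_Z one_Z envD(1)[OF env1] in simp_all)
  next
    case (9 s1)
    have fr: "s1 y = s y" if "y \<notin> W" for y using 9(3)[of y] that by (simp add: W eval_prefix_def)
    obtain l where l: "s1 ''best'' 0 = F (?L m l)" "\<And>l'. l' < m + 1 \<Longrightarrow> F (?L m l) \<le> F (?L m l')"
      using 9(1) unfolding P_def by auto
    show ?case by (rule post[of s1 l]) (use l in \<open>simp_all add: fr W_def del: wvars_level_sets\<close>)
  qed (use mH U U_le_Z[of "int m + 1"] envD(1)[OF env] in \<open>simp_all add: P_def eval_prefix_def\<close>)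
qed

text \<open>The start contributes the exponent \<open>2 * m + 3\<close>, each of the
  \<open>(m + 1) ^ 8\<close> rounds \<open>growth\<close>, and the vector \<open>x\<close> two more.
  When all rounds are done, the bound on \<open>progress\<close> has come down to zero, so no
  candidate is left.\<close>

lemma wp_minimize:
  assumes env: "env s" and R: "s ''R'' 0 = int ((m + 1) ^ 8)" "(m + 1) ^ 8 \<le> H" "int ((m + 1) ^ 8) \<le> Z"
    and E': "2 * m + 5 + ((m + 1) ^ 8 + 1) * growth \<le> E"
    and post: "\<And>s' X. (\<And>y. y \<in> {''n'', ''m'', ''rho_num'', ''rho_den'', ''T'', ''S'', ''R'', ''all''} \<Longrightarrow> s' y = s y) \<Longrightarrow>
       X \<subseteq> {..<m} \<Longrightarrow> s' ''best'' 0 = F X \<Longrightarrow> (\<And>Y. Y \<subseteq> {..<m} \<Longrightarrow> F X \<le> F Y) \<Longrightarrow> Q s'"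
  shows "wp minimize Q s"
proof -
  let ?R = "(m + 1) ^ 8"
  let ?K = "{''n'', ''m'', ''rho_num'', ''rho_den'', ''T'', ''S'', ''R'', ''all''}"
  have keep: "y \<notin> wvars initialize" "y \<notin> insert ''it'' (wvars iteration)" "y \<notin> wvars level_sets" if "y \<in> ?K" for y
  proof -
    show "y \<notin> wvars initialize" by (rule wvars_initialize[OF that])
    have "y \<notin> wvars iteration" by (rule wvars_iteration) (use that in auto)
    moreover have "y \<noteq> ''it''" using that by auto
    ultimately show "y \<notin> insert ''it'' (wvars iteration)" by simp
    show "y \<notin> wvars level_sets" using that by auto
  qed
  show ?thesis unfolding minimize_def
  proof (rule wp_Seq, rule wp_initialize[OF env], goal_cases)
    case 1 show ?case using E' by simp
  next
    case (2 s1)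
    have f1: "s1 y = s y" if "y \<in> ?K" for y using 2(1)[of y] keep[OF that] by simp
    have R1: "s1 ''R'' 0 = int ?R" using R(1) by (simp add: f1)
    let ?I = "\<lambda>k. status (2 * m + 3 + k * growth) (?R - k)"
    have Iit: "?I k (s'(''it'' := f))" if "?I k s'" for k s' f
      by (rule status_cong[OF that]) auto
    show ?case
    proof (rule wp_Seq, rule wp_For[where N = ?R and I = ?I], goal_cases)
      case 1 show ?case using wvars_iteration[of "''it''"] by simp
    next
      case 3 show ?case using wvars_iteration[of "''R''"] by simp
    next
      case 7 show ?case by (rule Iit[of 0]) (use 2(2) in simp)
    next
      case (8 k s2)
      have "(k + 2) * growth \<le> (?R + 1) * growth" using 8(1) by (intro mult_right_mono) auto
      then have l: "2 * m + 3 + k * growth + growth + 2 \<le> E" using E' by simp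
      show ?case
      proof (rule wp_weaken[OF wp_iteration[OF 8(2) l]])
        fix s' assume "status (2 * m + 3 + k * growth + growth) (?R - k - 1) s'"
        then have "?I (Suc k) s'" by (simp add: add.assoc add.commute)
        then show "?I (Suc k) (s'(''it'' := (s' ''it'')(0 := int k + 1)))" by (rule Iit)
      qed
    next
      case (9 s2)
      have f2: "s2 y = s y" if "y \<in> ?K" for y using 9(3)[of y] keep[OF that] f1[OF that] by simp
      obtain ordv lv Bv Nv D xv dv where st: "env s2" "tableau s2 ordv lv Bv Nv D" "vec s2 ''x'' xv"
        "vec s2 ''d'' (\<lambda>v. int (dv v))" "combination ordv lv Bv xv" "labelling dv ordv lv xv" "progress m xv dv ordv lv = 0"
        using 9(1) unfolding status_def by auto
      have "candidates m xv dv = {}"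
        using st(7) by (cases "candidates m xv dv = {}") (simp_all add: progress_def Let_def)
      from minimum_level_set[OF st(5,6) this] obtain l0 where l0: "l0 \<le> m" "\<And>Y. Y \<subseteq> {..<m} \<Longrightarrow> F {v. v < m \<and> l0 < dv v} \<le> F Y"
        by blast
      show ?case
      proof (rule wp_level_sets[OF st(1,4)], goal_cases)
        case (1 s3 l)
        show ?case
        proof (rule post[of s3 "{v. v < m \<and> l < dv v}"])
          fix y assume y: "y \<in> ?K"
          show "s3 y = s y" using 1(1)[of y] keep[OF y] f2[OF y] by simp
        next
          fix Y assume "Y \<subseteq> {..<m}"
          then show "F {v. v < m \<and> l < dv v} \<le> F Y" using 1(3)[OF l0(1)] l0(2)[of Y] by linarith
        qed (use 1(2) in auto)
      qed
    qed (use R R1 in simp_all)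
  qed
qed

end

section \<open>The excess function\<close>

definition excess :: "('a set \<Rightarrow> int) \<Rightarrow> rat \<Rightarrow> 'a set \<Rightarrow> real" where
  "excess f \<rho> X = of_int (f X) - of_rat \<rho> * real (card X)"

definition max_excess :: "('a set \<Rightarrow> int) \<Rightarrow> rat \<Rightarrow> 'a set \<Rightarrow> real" where
  "max_excess f \<rho> T = Max (excess f \<rho> ` Pow T)"

definition excess_drop :: "'a set \<Rightarrow> ('a set \<Rightarrow> int) \<Rightarrow> rat \<Rightarrow> 'a set \<Rightarrow> real" where
  "excess_drop V f \<rho> S = max_excess f \<rho> V - max_excess f \<rho> (V - S)"

lemma supermodular_onD:
  fixes f :: "'a set \<Rightarrow> int"
  assumes "supermodular_on V f" "A \<subseteq> V" "B \<subseteq> V"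
  shows "f A + f B \<le> f (A \<inter> B) + f (A \<union> B)"
proof -
  have "- f (A \<inter> B) + - f (A \<union> B) \<le> - f A + - f B"
    using assms unfolding supermodular_on_def submodular_on_def by blast
  then show ?thesis by linarith
qed

lemma max_excess_le_iff: "finite T \<Longrightarrow> max_excess f \<rho> T \<le> c \<longleftrightarrow> (\<forall>X \<subseteq> T. excess f \<rho> X \<le> c)"
  unfolding max_excess_def by (subst Max_le_iff) auto

lemma excess_le_max: "finite T \<Longrightarrow> X \<subseteq> T \<Longrightarrow> excess f \<rho> X \<le> max_excess f \<rho> T"
  using max_excess_le_iff by blast

lemma max_excess_attained: "finite T \<Longrightarrow> \<exists>X \<subseteq> T. max_excess f \<rho> T = excess f \<rho> X"
proof -
  assume "finite T"
  then have "max_excess f \<rho> T \<in> excess f \<rho> ` Pow T" unfolding max_excess_def by (intro Max_in) auto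
  then show ?thesis by auto
qed

lemma max_excess_mono: "finite T \<Longrightarrow> T' \<subseteq> T \<Longrightarrow> max_excess f \<rho> T' \<le> max_excess f \<rho> T"
  by (subst max_excess_le_iff) (auto intro: excess_le_max finite_subset)

lemma excess_supermodular:
  assumes "finite V" "supermodular_on V f" "A \<subseteq> V" "B \<subseteq> V"
  shows "excess f \<rho> A + excess f \<rho> B \<le> excess f \<rho> (A \<inter> B) + excess f \<rho> (A \<union> B)"
proof -
  have "f A + f B \<le> f (A \<inter> B) + f (A \<union> B)" by (rule supermodular_onD[OF assms(2-4)])
  then have "real_of_int (f A) + real_of_int (f B) \<le> real_of_int (f (A \<inter> B)) + real_of_int (f (A \<union> B))"
    by (metis of_int_add of_int_le_iff)
  moreover have "card A + card B = card (A \<union> B) + card (A \<inter> B)"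
    using assms finite_subset by (intro card_Un_Int) auto
  then have "real (card A) + real (card B) = real (card (A \<inter> B)) + real (card (A \<union> B))"
    by (metis add.commute of_nat_add)
  then have "of_rat \<rho> * real (card A) + of_rat \<rho> * real (card B) =
      of_rat \<rho> * real (card (A \<inter> B)) + of_rat \<rho> * real (card (A \<union> B))"
    by (metis distrib_left)
  ultimately show ?thesis unfolding excess_def by linarith
qed

text \<open>Intersection and union of maximizers for \<open>A\<close> and \<open>B\<close> compete
  for \<open>A \<inter> B\<close> and \<open>A \<union> B\<close>.\<close>

lemma max_excess_supermodular:
  assumes "finite V" "supermodular_on V f" "A \<subseteq> V" "B \<subseteq> V"
  shows "max_excess f \<rho> A + max_excess f \<rho> B \<le> max_excess f \<rho> (A \<inter> B) + max_excess f \<rho> (A \<union> B)"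
proof -
  have fin: "finite A" "finite B" using assms finite_subset by auto
  obtain X where X: "X \<subseteq> A" "max_excess f \<rho> A = excess f \<rho> X" using max_excess_attained[OF fin(1)] by blast
  obtain Y where Y: "Y \<subseteq> B" "max_excess f \<rho> B = excess f \<rho> Y" using max_excess_attained[OF fin(2)] by blast
  have "excess f \<rho> X + excess f \<rho> Y \<le> excess f \<rho> (X \<inter> Y) + excess f \<rho> (X \<union> Y)"
    by (rule excess_supermodular[OF assms(1,2)]) (use X Y assms in auto)
  also have "\<dots> \<le> max_excess f \<rho> (A \<inter> B) + max_excess f \<rho> (A \<union> B)"
    by (intro add_mono excess_le_max) (use X Y fin in auto)
  finally show ?thesis using X Y by simp
qed

lemma excess_drop_submodular:
  assumes "finite V" "supermodular_on V f"
  shows "submodular_on V (excess_drop V f \<rho>)"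
  unfolding submodular_on_def
proof (intro allI impI)
  fix A B assume "A \<subseteq> V" "B \<subseteq> V"
  have "(V - A) \<inter> (V - B) = V - (A \<union> B)" "(V - A) \<union> (V - B) = V - (A \<inter> B)" by auto
  then show "excess_drop V f \<rho> (A \<inter> B) + excess_drop V f \<rho> (A \<union> B) \<le> excess_drop V f \<rho> A + excess_drop V f \<rho> B"
    using max_excess_supermodular[OF assms, of "V - A" "V - B" \<rho>] by (simp add: excess_drop_def)
qed

lemma excess_drop_mono: "finite V \<Longrightarrow> mono_on (Pow V) (excess_drop V f \<rho>)"
  unfolding excess_drop_def by (intro mono_onI diff_left_mono max_excess_mono) auto

lemma excess_drop_empty: "excess_drop V f \<rho> {} = 0"
  by (simp add: excess_drop_def)

lemma excess_drop_nonneg: "finite V \<Longrightarrow> excess_drop V f \<rho> S \<ge> 0"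
  by (simp add: excess_drop_def max_excess_mono)

lemma excess_drop_Ints:
  assumes "finite V" "\<rho> \<in> \<int>"
  shows "excess_drop V f \<rho> S \<in> \<int>"
proof -
  obtain k where k: "\<rho> = of_int k" using assms(2) by (elim Ints_cases)
  have "excess f \<rho> X \<in> \<int>" for X by (simp add: excess_def k)
  moreover have "finite (V - S)" using assms(1) by simp
  ultimately show ?thesis
    unfolding excess_drop_def using max_excess_attained[OF assms(1)] max_excess_attained[of "V - S"] by (metis Ints_diff)
qed

lemma density_le_iff:
  assumes "finite W" "f {} = 0"
  shows "density_le W (\<lambda>S. of_int (f S)) (of_rat \<rho>) \<longleftrightarrow> max_excess f \<rho> W \<le> 0"
proof (cases "W = {}")
  case True
  then show ?thesis using assms(2) by (simp add: density_le_def max_excess_def excess_def)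
next
  case False
  let ?D = "{real_of_int (f S) / real (card S) | S. S \<noteq> {} \<and> S \<subseteq> W}"
  have D: "?D = (\<lambda>S. real_of_int (f S) / real (card S)) ` (Pow W - {{}})" by auto
  have ne: "Pow W - {{}} \<noteq> {}" using False by auto
  have "density W (\<lambda>S. of_int (f S)) \<le> of_rat \<rho> \<longleftrightarrow>
    (\<forall>S \<in> Pow W - {{}}. real_of_int (f S) / real (card S) \<le> of_rat \<rho>)"
    unfolding density_def D using assms(1) ne by (subst Max_le_iff) auto
  also have "\<dots> \<longleftrightarrow> (\<forall>S \<in> Pow W - {{}}. excess f \<rho> S \<le> 0)"
  proof (intro ball_cong refl)
    fix S assume S: "S \<in> Pow W - {{}}"
    then have "finite S" using assms(1) finite_subset by auto
    with S have "real (card S) > 0" by (auto simp: card_gt_0_iff)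
    then show "(real_of_int (f S) / real (card S) \<le> of_rat \<rho>) = (excess f \<rho> S \<le> 0)"
      by (simp add: excess_def divide_le_eq)
  qed
  also have "\<dots> \<longleftrightarrow> (\<forall>S \<subseteq> W. excess f \<rho> S \<le> 0)"
    using assms(2) by (auto simp: excess_def)
  finally show ?thesis using False assms(1) by (simp add: density_le_def max_excess_le_iff)
qed

text \<open>The maximal excess over the empty ground set is zero, so the value at \<open>V\<close>
  minus the value at \<open>S\<close> is the maximal excess over \<open>V - S\<close>.\<close>

lemma excess_drop_ge_iff:
  assumes "finite V" "f {} = 0" "S \<subseteq> V"
  shows "density_le (V - S) (\<lambda>X. of_int (f X)) (of_rat \<rho>) \<longleftrightarrow> excess_drop V f \<rho> S \<ge> excess_drop V f \<rho> V"
proof -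
  have "max_excess f \<rho> {} = 0" using assms(2) by (simp add: max_excess_def excess_def)
  moreover have "finite (V - S)" using assms(1) by simp
  ultimately show ?thesis using density_le_iff[of "V - S" f \<rho>] assms(2) by (simp add: excess_drop_def)
qed

text \<open>If a maximizer avoids \<open>v\<close>, nothing is lost by removing \<open>v\<close>.
  Otherwise supermodularity compares the marginal of \<open>v\<close> at the maximizer with the
  larger one at \<open>V - {v}\<close>.\<close>

lemma excess_drop_singleton:
  assumes "finite V" "supermodular_on V f" "v \<in> V"
  shows "excess_drop V f \<rho> {v} \<le> max 0 (of_int (marginal f v (V - {v})) - of_rat \<rho>)"
proof -
  obtain X where X: "X \<subseteq> V" "max_excess f \<rho> V = excess f \<rho> X" using max_excess_attained[OF assms(1)] by blast
  have fin: "finite (V - {v})" using assms(1) by simp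
  show ?thesis
  proof (cases "v \<in> X")
    case False
    then have "excess f \<rho> X \<le> max_excess f \<rho> (V - {v})" using X by (intro excess_le_max[OF fin]) auto
    then show ?thesis using X by (simp add: excess_drop_def)
  next
    case True
    have "excess f \<rho> X + excess f \<rho> (V - {v}) \<le> excess f \<rho> (X \<inter> (V - {v})) + excess f \<rho> (X \<union> (V - {v}))"
      by (rule excess_supermodular[OF assms(1,2) X(1)]) auto
    moreover have "X \<union> (V - {v}) = V" using True X assms(3) by auto
    moreover have "excess f \<rho> (X \<inter> (V - {v})) \<le> max_excess f \<rho> (V - {v})" by (rule excess_le_max[OF fin]) auto
    moreover have "excess f \<rho> V - excess f \<rho> (V - {v}) = of_int (marginal f v (V - {v})) - of_rat \<rho>"
    proof -
      have "V - {v} \<union> {v} = V" using assms(3) by auto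
      moreover have "card V = Suc (card (V - {v}))" by (rule card.remove) (use assms in auto)
      ultimately show ?thesis by (simp add: excess_def marginal_def algebra_simps)
    qed
    ultimately show ?thesis using X by (simp add: excess_drop_def)
  qed
qed

text \<open>The function minimized by the program: up to the factor \<open>- rd\<close> and the dummy element \<open>n\<close>,
  it is the excess with respect to \<open>\<rho> = rn / rd\<close> of subsets of \<open>T\<close>.\<close>

definition objective :: "nat \<Rightarrow> (nat set \<Rightarrow> int) \<Rightarrow> int \<Rightarrow> int \<Rightarrow> nat set \<Rightarrow> nat set \<Rightarrow> int" where
  "objective n orc rn rd T X = rn * int (card (X \<inter> T)) - rd * orc (X \<inter> T) + (if n \<in> X then 1 else 0)"

text \<open>The cardinality term is modular, and the factor \<open>- rd\<close> turns the
  supermodular oracle into a submodular function.\<close>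

lemma objective_submodular_dummy:
  assumes orc: "orc {} = 0" "\<And>A B. A \<subseteq> {..<n} \<Longrightarrow> B \<subseteq> {..<n} \<Longrightarrow> orc A + orc B \<le> orc (A \<inter> B) + orc (A \<union> B)"
    and T: "T \<subseteq> {..<n}" and rd: "rd \<ge> 0"
  shows "submodular_dummy (Suc n) (objective n orc rn rd T) n"
proof unfold_locales
  fix A B assume "A \<subseteq> {..<Suc n}" "B \<subseteq> {..<Suc n}"
  let ?A = "A \<inter> T" and ?B = "B \<inter> T"
  have fin: "finite T" using T finite_subset by blast
  have eq: "(A \<inter> B) \<inter> T = ?A \<inter> ?B" "(A \<union> B) \<inter> T = ?A \<union> ?B" by auto
  have "orc ?A + orc ?B \<le> orc (?A \<inter> ?B) + orc (?A \<union> ?B)" by (rule orc(2)) (use T in auto)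
  then have "rd * (orc ?A + orc ?B) \<le> rd * (orc (?A \<inter> ?B) + orc (?A \<union> ?B))" using rd by (rule mult_left_mono)
  moreover have "card ?A + card ?B = card (?A \<union> ?B) + card (?A \<inter> ?B)"
    using fin by (intro card_Un_Int) auto
  then have "rn * int (card ?A) + rn * int (card ?B) = rn * int (card (?A \<inter> ?B)) + rn * int (card (?A \<union> ?B))"
    by (metis add.commute distrib_left of_nat_add)
  ultimately show "objective n orc rn rd T (A \<inter> B) + objective n orc rn rd T (A \<union> B)
      \<le> objective n orc rn rd T A + objective n orc rn rd T B"
    unfolding objective_def eq by (auto simp: distrib_left)
next
  show "objective n orc rn rd T {} = 0" using orc(1) by (simp add: objective_def)
next
  fix A assume "A \<subseteq> {..<Suc n}" "n \<notin> A"
  moreover have "insert n A \<inter> T = A \<inter> T" using T by auto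
  ultimately show "objective n orc rn rd T (insert n A) = objective n orc rn rd T A + 1"
    by (simp add: objective_def)
qed simp

text \<open>Dropping the dummy and the elements outside \<open>T\<close> never increases the
  objective, so its minimum is attained on a subset of \<open>T\<close>, where it is
  \<open>- rd\<close> times the excess.\<close>

lemma minimum_objective:
  assumes xs: "distinct xs" and T: "T \<subseteq> {..<length xs}" and \<rho>: "quotient_of \<rho> = (rn, rd)"
    and X: "X \<subseteq> {..<Suc (length xs)}"
      "\<And>Y. Y \<subseteq> {..<Suc (length xs)} \<Longrightarrow> objective (length xs) (eval_oracle f xs) rn rd T X
         \<le> objective (length xs) (eval_oracle f xs) rn rd T Y"
  shows "of_int (objective (length xs) (eval_oracle f xs) rn rd T X) = - of_int rd * max_excess f \<rho> ((\<lambda>i. xs ! i) ` T)"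
proof -
  let ?i = "\<lambda>I. (\<lambda>i. xs ! i) ` I"
  let ?F = "objective (length xs) (eval_oracle f xs) rn rd T"
  have rd: "rd > 0" using quotient_of_denom_pos[OF \<rho>] .
  have r: "of_rat \<rho> = (of_int rn / of_int rd :: real)" using quotient_of_div[OF \<rho>] by (simp add: of_rat_divide)
  have fin: "finite T" using T finite_subset by blast
  have inj: "inj_on (\<lambda>i. xs ! i) {..<length xs}" using xs by (auto simp: inj_on_def nth_eq_iff_index_eq)
  have val: "real_of_int (rn * int (card I) - rd * eval_oracle f xs I) = - of_int rd * excess f \<rho> (?i I)" if "I \<subseteq> T" for I
  proof -
    have "card (?i I) = card I" by (rule card_image, rule inj_on_subset[OF inj]) (use that T in auto)
    then show ?thesis using rd by (simp add: excess_def eval_oracle_def r field_simps)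
  qed
  have fin': "finite (?i T)" using fin by simp
  obtain A where A: "A \<subseteq> ?i T" "max_excess f \<rho> (?i T) = excess f \<rho> A" using max_excess_attained[OF fin'] by blast
  from A(1) obtain I where I: "I \<subseteq> T" "A = ?i I" by (auto simp: subset_image_iff)
  have "?F I = rn * int (card I) - rd * eval_oracle f xs I"
  proof -
    have "I \<inter> T = I" "length xs \<notin> I" using I T by auto
    then show ?thesis by (simp add: objective_def)
  qed
  then have "real_of_int (?F I) = - of_int rd * max_excess f \<rho> (?i T)" using val[OF I(1)] A I by simp
  moreover have "?F X \<le> ?F I" by (rule X(2)) (use I T in auto)
  ultimately have le: "real_of_int (?F X) \<le> - of_int rd * max_excess f \<rho> (?i T)" by (metis of_int_le_iff)
  have "- of_int rd * max_excess f \<rho> (?i T) \<le> - of_int rd * excess f \<rho> (?i (X \<inter> T))"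
    using rd by (simp add: excess_le_max[OF fin'] image_mono)
  also have "\<dots> = real_of_int (rn * int (card (X \<inter> T)) - rd * eval_oracle f xs (X \<inter> T))" by (rule val[symmetric]) simp
  also have "\<dots> \<le> real_of_int (?F X)" unfolding of_int_le_iff by (simp add: objective_def)
  finally show ?thesis using le by simp
qed

text \<open>With \<open>m = k + 1\<close> this covers the requirement of \<open>wp_minimize\<close>;
  the constant 15 also ensures \<open>10 \<le> E\<close>, and the last summand makes the round
  counter fit, because \<open>R \<le> 2 ^ R \<le> U ^ R\<close>.\<close>

definition exponent_bound :: "nat \<Rightarrow> nat" where
  "exponent_bound k = 2 * (k + 1) + 15 + ((k + 2) ^ 8 + 1) * (3 * (k + 1) + 6 + (k + 1) * (2 * (k + 1) + 3)) + (k + 2) ^ 8"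

text \<open>Values reach \<open>U ^ E\<close> with \<open>U = 2 ^ (2 * k + 3)\<close>; one more bit
  is for the sign and one because the bound may be attained.\<close>

definition bits_bound :: "nat \<Rightarrow> nat" where
  "bits_bound k = (2 * k + 3) * exponent_bound k + 2"

text \<open>The number of rounds dominates all other trip counts. It is used with the size of the
  ground set, not with the input size; this makes the query count a polynomial in
  \<open>card V\<close>.\<close>

definition trips_bound :: "nat \<Rightarrow> nat" where
  "trips_bound k = (k + 2) ^ 8 + 1"

lemma exponent_bound_mono: "j \<le> k \<Longrightarrow> exponent_bound j \<le> exponent_bound k"
  unfolding exponent_bound_def by (intro add_mono mult_mono power_mono) auto

lemma trips_bound_mono: "j \<le> k \<Longrightarrow> trips_bound j \<le> trips_bound k"
  unfolding trips_bound_def by (intro add_mono power_mono) auto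

text \<open>The two arguments \<open>n \<le> k\<close> keep ground set and input size apart: trip
  counts come from \<open>n\<close> and the cell width from \<open>k\<close>, so time is bounded in
  \<open>k\<close> but queries in \<open>n\<close>.\<close>

lemma polynomial_bounds:
  "\<exists>p q :: nat poly. (\<forall>n k. n \<le> k \<longrightarrow> ctime (bits_bound k) (trips_bound n) c \<le> poly p k) \<and>
     (\<forall>n. cqueries (trips_bound n) c \<le> poly q n)"
proof -
  obtain C D where CD: "\<And>B H. ctime B H c \<le> C * (B + 1) * (H + 1) ^ D" using ctime_poly by blast
  obtain C' D' where CD': "\<And>H. cqueries H c \<le> C' * (H + 1) ^ D'" using cqueries_poly by blast
  define X1 X2 pH pE pB :: "nat poly" where "X1 = [:1, 1:]" and "X2 = [:2, 1:]" and "pH = X2 ^ 8 + 1"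
    and "pE = 2 * X1 + 15 + (X2 ^ 8 + 1) * (3 * X1 + 6 + X1 * (2 * X1 + 3)) + X2 ^ 8"
    and "pB = [:3, 2:] * pE + 2"
  have X: "poly X1 k = k + 1" "poly X2 k = k + 2" for k by (simp_all add: X1_def X2_def)
  have H: "poly pH k = trips_bound k" for k by (simp add: pH_def X trips_bound_def)
  have E: "poly pE k = exponent_bound k" for k by (simp add: pE_def X exponent_bound_def)
  have B: "poly pB k = bits_bound k" for k by (simp add: pB_def E bits_bound_def algebra_simps)
  have "ctime (bits_bound k) (trips_bound n) c \<le> poly ([:C:] * (pB + 1) * (pH + 1) ^ D) k" if "n \<le> k" for n k
  proof -
    have "ctime (bits_bound k) (trips_bound n) c \<le> C * (bits_bound k + 1) * (trips_bound n + 1) ^ D" by (rule CD)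
    also have "\<dots> \<le> C * (bits_bound k + 1) * (trips_bound k + 1) ^ D"
      using trips_bound_mono[OF that] by (intro mult_left_mono power_mono) auto
    finally show ?thesis by (simp add: H B algebra_simps)
  qed
  moreover have "cqueries (trips_bound n) c \<le> poly ([:C':] * (pH + 1) ^ D') n" for n
    using CD'[of "trips_bound n"] by (simp add: H)
  ultimately show ?thesis by blast
qed

lemma run_main:
  fixes f :: "'a set \<Rightarrow> int"
  assumes xs: "distinct xs" "set xs = V" and S: "S \<subseteq> V" and f: "f {} = 0" "supermodular_on V f"
    and len: "length xs \<le> k" and fb: "\<And>X. X \<subseteq> V \<Longrightarrow> bits (f X) \<le> k"
    and rb: "bits (fst (quotient_of \<rho>)) \<le> k" "bits (snd (quotient_of \<rho>)) \<le> k"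
  shows "\<exists>t q s. exec (length xs) (eval_oracle f xs) main (input_state xs \<rho> S) t q s \<and>
    outputs s (excess_drop V f \<rho> S) \<and> t \<le> ctime (bits_bound k) (trips_bound (length xs)) main \<and>
    q \<le> cqueries (trips_bound (length xs)) main"
proof -
  define n where "n = length xs"
  define m where "m = Suc n"
  define orc where "orc = eval_oracle f xs"
  obtain rn rd where \<rho>: "quotient_of \<rho> = (rn, rd)" by (cases "quotient_of \<rho>")
  have rd: "rd > 0" using quotient_of_denom_pos[OF \<rho>] .
  \<comment> \<open>Values of the objective are at most \<open>2 * 4 ^ k + 1\<close> in absolute
    value, so twice that stays below \<open>U\<close>, which is \<open>8 * 4 ^ k\<close>.\<close>
  define U :: int where "U = 2 ^ (2 * k + 3)"
  define E where "E = exponent_bound n"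
  define Z where "Z = U ^ E"
  let ?i = "\<lambda>I. (\<lambda>i. xs ! i) ` I"
  have im: "?i I \<subseteq> V" if "I \<subseteq> {..<n}" for I using that xs(2) by (auto simp: n_def)
  have pow: "\<bar>a\<bar> \<le> 2 ^ k" if "bits a \<le> k" for a
  proof -
    have "(2::int) ^ (bits a - 1) \<le> 2 ^ k" using that by (intro power_increasing) auto
    then show ?thesis using abs_less_pow_bits[of a] by linarith
  qed
  have orcb: "\<bar>orc I\<bar> \<le> 2 ^ k" if "I \<subseteq> {..<n}" for I
    unfolding orc_def eval_oracle_def by (rule pow[OF fb[OF im[OF that]]])
  have rnb: "\<bar>rn\<bar> \<le> 2 ^ k" "\<bar>rd\<bar> \<le> 2 ^ k" using rb \<rho> by (auto intro: pow)
  have nk: "int n \<le> 2 ^ k - 1"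
  proof -
    have "n < 2 ^ n" by (rule less_exp)
    also have "(2::nat) ^ n \<le> 2 ^ k" using len by (intro power_increasing) (auto simp: n_def)
    finally have "int n < int (2 ^ k)" by (simp only: of_nat_less_iff)
    then show ?thesis by simp
  qed
  have U8: "U = 8 * (2 ^ k * 2 ^ k)"
  proof -
    have "U = 2 ^ (k + k + 3)" unfolding U_def by (simp only: mult_2)
    then show ?thesis by (simp only: power_add) simp
  qed
  have two: "(1::int) \<le> 2 ^ k" by simp
  have k2: "(2::int) ^ k \<le> 2 ^ k * 2 ^ k" using mult_left_mono[OF two, of "2 ^ k"] by simp
  have U2: "U \<ge> 2" "int m < U" "(2::int) ^ k \<le> U"
    using U8 k2 two nk unfolding m_def by linarith+
  have U1: "U \<ge> 1" using U2 by simp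
  have E: "2 * m + 5 + ((m + 1) ^ 8 + 1) * (3 * m + 6 + m * (2 * m + 3)) \<le> E" "(m + 1) ^ 8 \<le> E" "10 \<le> E"
    by (simp_all add: E_def exponent_bound_def m_def)
  have UZ: "\<bar>a\<bar> \<le> Z" if "\<bar>a\<bar> \<le> U" for a
  proof -
    have "U ^ 1 \<le> Z" unfolding Z_def using U1 E(3) by (intro power_increasing) auto
    then show ?thesis using that by simp
  qed
  have RZ: "int ((m + 1) ^ 8) \<le> Z"
  proof -
    have "(m + 1) ^ 8 < 2 ^ ((m + 1) ^ 8)" by (rule less_exp)
    then have "int ((m + 1) ^ 8) \<le> int (2 ^ ((m + 1) ^ 8))" by (simp only: of_nat_le_iff less_imp_le)
    also have "\<dots> = 2 ^ ((m + 1) ^ 8)" by simp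
    also have "\<dots> \<le> U ^ ((m + 1) ^ 8)" using U2 by (intro power_mono) auto
    also have "\<dots> \<le> Z" unfolding Z_def using U1 E(2) by (intro power_increasing) auto
    finally show ?thesis .
  qed
  define H where "H = trips_bound n"
  have H: "(m + 1) ^ 8 \<le> H" "m < H" "n \<le> H"
  proof -
    show R: "(m + 1) ^ 8 \<le> H" by (simp add: H_def trips_bound_def m_def)
    have "m + 1 \<le> (m + 1) ^ 8" by (rule self_le_power) auto
    with R show "m < H" by simp
    then show "n \<le> H" by (simp add: m_def)
  qed
  interpret machine n orc Z "bits_bound k" H
  proof
    fix i :: int assume i: "\<bar>i\<bar> \<le> Z"
    have "E \<le> exponent_bound k" unfolding E_def using len by (intro exponent_bound_mono) (simp add: n_def)
    then have "(2 * k + 3) * E \<le> (2 * k + 3) * exponent_bound k" by (rule mult_left_mono) simp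
    then have le: "Suc (Suc ((2 * k + 3) * E)) \<le> bits_bound k" unfolding bits_bound_def by linarith
    have "Z = 2 ^ ((2 * k + 3) * E)" by (simp add: Z_def U_def power_mult)
    then have "\<bar>i\<bar> < 2 ^ Suc ((2 * k + 3) * E)" using i by (simp add: less_le_trans[of 0] order_le_less_trans)
    from bits_leI[OF this] le show "bits i \<le> bits_bound k" by (rule order_trans)
  next
    show "1 \<le> Z" using UZ[of 1] U1 by simp
  qed (rule H)
  let ?F = "objective n orc rn rd"
  have orc0: "orc {} = 0" using f(1) by (simp add: orc_def eval_oracle_def)
  have orc_super: "orc A + orc B \<le> orc (A \<inter> B) + orc (A \<union> B)" if "A \<subseteq> {..<n}" "B \<subseteq> {..<n}" for A B
  proof -
    have inj: "inj_on (\<lambda>i. xs ! i) {..<n}" using xs(1) by (auto simp: inj_on_def nth_eq_iff_index_eq n_def)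
    have "?i A \<inter> ?i B = ?i (A \<inter> B)" by (rule inj_on_image_Int[OF inj that, symmetric])
    moreover have "?i A \<union> ?i B = ?i (A \<union> B)" by (rule image_Un[symmetric])
    ultimately show ?thesis using supermodular_onD[OF f(2) im[OF that(1)] im[OF that(2)]]
      by (simp add: orc_def eval_oracle_def)
  qed
  have min: "minimizer n orc Z (bits_bound k) H m (?F T) T rn rd U E" if T: "T \<subseteq> {..<n}" for T
  proof -
    interpret submodular_dummy m "?F T" n
      unfolding m_def by (rule objective_submodular_dummy[OF orc0 orc_super T]) (use rd in auto)
    show ?thesis
    proof
      fix X assume "X \<subseteq> T" then show "\<bar>orc X\<bar> \<le> U" using orcb[of X] T U2(3) by (meson order_trans)
    next
      fix X assume "X \<subseteq> {..<m}"
      have "card (X \<inter> T) \<le> card {..<n}" by (rule card_mono) (use T in auto)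
      then have c: "\<bar>int (card (X \<inter> T))\<bar> \<le> 2 ^ k" using nk by simp
      have "\<bar>orc (X \<inter> T)\<bar> \<le> 2 ^ k" by (rule orcb) (use T in auto)
      then have "\<bar>rn * int (card (X \<inter> T))\<bar> \<le> 2 ^ k * 2 ^ k" "\<bar>rd * orc (X \<inter> T)\<bar> \<le> 2 ^ k * 2 ^ k"
        using c rnb unfolding abs_mult by (auto intro!: mult_mono)
      then have "\<bar>?F T X\<bar> \<le> 2 ^ k * 2 ^ k + 2 ^ k * 2 ^ k + 1" unfolding objective_def
        by (cases "n \<in> X"; simp only: if_True if_False; linarith)
      then show "2 * \<bar>?F T X\<bar> \<le> U" using U8 k2 two by linarith
    qed (use T U2 H E in \<open>simp_all add: m_def Z_def objective_def\<close>)
  qed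
  \<comment> \<open>Two instances of one locale for the two runs: the maximal excess over
    \<open>V\<close> and the one over \<open>V - S\<close>.\<close>
  define T1 where "T1 = {..<n}"
  define T2 where "T2 = {i. i < n \<and> xs ! i \<notin> S}"
  interpret A: minimizer n orc Z "bits_bound k" H m "?F T1" T1 rn rd U E by (rule min) (simp add: T1_def)
  interpret B: minimizer n orc Z "bits_bound k" H m "?F T2" T2 rn rd U E by (rule min) (auto simp: T2_def)
  have E': "2 * m + 5 + ((m + 1) ^ 8 + 1) * A.growth \<le> E" "2 * m + 5 + ((m + 1) ^ 8 + 1) * B.growth \<le> E"
    using E(1) unfolding A.growth_def B.growth_def by auto
  let ?s = "input_state xs \<rho> S"
  have s0: "?s ''n'' 0 = int n" "?s ''rho_num'' 0 = rn" "?s ''rho_den'' 0 = rd" "?s ''T'' i = 0"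
    "?s ''S'' (int v) = (if v < n \<and> xs ! v \<in> S then 1 else 0)" for i v
    using \<rho> by (auto simp: input_state_def n_def)
  have bs: "bounded_st ?s" unfolding bounded_st_def
  proof (intro allI)
    fix x i
    have "int (length xs) \<le> U" "\<bar>rn\<bar> \<le> U" "\<bar>rd\<bar> \<le> U" "0 \<le> U"
      using nk rnb U2 unfolding n_def by linarith+
    then have "\<bar>?s x i\<bar> \<le> U" using U1 by (simp add: input_state_def \<rho>)
    then show "\<bar>?s x i\<bar> \<le> Z" by (rule UZ)
  qed
  have mZ: "int m \<le> Z" "int m + 1 \<le> Z" using UZ[of "int m + 1"] U2(2) by simp_all
  define P :: "nat \<Rightarrow> int" where "P j = int ((m + 1) ^ j)" for j
  have mono8: "\<bar>P j\<bar> \<le> Z" if "j \<le> 8" for j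
  proof -
    have "(m + 1) ^ j \<le> (m + 1) ^ 8" using that by (intro power_increasing) auto
    then have "P j \<le> P 8" unfolding P_def by (simp only: of_nat_le_iff)
    moreover have "P j \<ge> 0" unfolding P_def by (rule of_nat_0_le_iff)
    ultimately show ?thesis using RZ by (simp add: P_def)
  qed
  \<comment> \<open>Three squarings of \<open>m + 1\<close> give the number of rounds.\<close>
  have e2: "(int m + 1) * (int m + 1) = P 2" "P 2 * P 2 = P 4" "P 4 * P 4 = P 8"
  proof -
    have pw: "P j = (int m + 1) ^ j" for j by (simp add: P_def add.commute)
    have "x * x = x ^ 2" "x ^ 2 * x ^ 2 = x ^ 4" "x ^ 4 * x ^ 4 = x ^ 8" for x :: int
      by (simp only: power2_eq_square) (simp_all flip: power_add)
    then show "(int m + 1) * (int m + 1) = P 2" "P 2 * P 2 = P 4" "P 4 * P 4 = P 8"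
      unfolding pw by blast+
  qed
  have "wp main (\<lambda>s'. outputs s' (excess_drop V f \<rho> S)) ?s"
    unfolding main_def
  proof (rule wp_SeqWrite, goal_cases)
    case 1 show ?case using mZ by (simp add: s0 m_def)
  next
    case 2
    let ?s1 = "?s(''m'' := (?s ''m'')(0 := int m))"
    have eq1: "?s(''m'' := (?s ''m'')(aval (Const 0) ?s := aval (Add (Var ''n'') (Const 1)) ?s)) = ?s1"
      by (simp add: s0 m_def add.commute)
    show ?case unfolding eq1
    proof (rule wp_SeqWrite, goal_cases)
      case 1 show ?case using mZ by simp
    next
      case 2
      show ?case
      proof (rule wp_SeqWrite, goal_cases)
        case 1 show ?case using mono8[of 2] by (simp add: e2)
      next
        case 2
        show ?case
        proof (rule wp_SeqWrite, goal_cases)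
          case 1 show ?case using mono8[of 4] by (simp add: e2)
        next
          case 2
          show ?case
          proof (rule wp_SeqWrite, goal_cases)
            case 1 show ?case using mono8[of 8] by (simp add: e2)
          next
            case 2
            let ?s2 = "?s1(''e'' := (?s1 ''e'')(0 := P 4), ''R'' := (?s1 ''R'')(0 := P 8))"
            let ?rest = "For ''a'' (Var ''n'') (Write ''T'' (Var ''a'') (Const 1)) ;;
              minimize ;;
              Assign ''all'' (Var ''best'') ;;
              For ''a'' (Var ''n'') (Write ''T'' (Var ''a'') (Sub (Const 1) (Read ''S'' (Var ''a'')))) ;;
              minimize ;;
              Assign ''out_num'' (Sub (Var ''best'') (Var ''all'')) ;;
              Assign ''out_den'' (Var ''rho_den'')"
            have "wp ?rest (\<lambda>s'. outputs s' (excess_drop V f \<rho> S)) ?s2"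
            proof (rule wp_Seq, rule wp_fill[where N = n and f = "\<lambda>_. 1" and off = 0], goal_cases)
              case (8 s3)
              note f3 = 8(1)
              have T3: "s3 ''T'' (int v) = (if v \<in> T1 then 1 else 0)" if "v < m" for v
              proof (cases "v < n")
                case True then show ?thesis using 8(2)[of v] by (simp add: T1_def)
              next
                case False then show ?thesis using 8(3)[of "int v"] by (simp add: T1_def s0)
              qed
              have env3: "A.env s3" unfolding A.env_def using T3 by (simp add: f3 s0)
              have R3: "s3 ''R'' 0 = int ((m + 1) ^ 8)" unfolding P_def[symmetric] by (simp add: f3)
              show ?case
              proof (rule wp_Seq, rule A.wp_minimize[OF env3 R3 H(1) RZ E'(1)], goal_cases)
                case (1 s4 X1)
                note f4 = 1(1)
                have F1: "\<bar>?F T1 X1\<bar> \<le> Z" "2 * \<bar>?F T1 X1\<bar> \<le> U" using A.F_bound[OF 1(2)] by (auto intro: UZ)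
                let ?s5 = "s4(''all'' := (s4 ''all'')(0 := ?F T1 X1))"
                let ?rest = "For ''a'' (Var ''n'') (Write ''T'' (Var ''a'') (Sub (Const 1) (Read ''S'' (Var ''a'')))) ;;
                  minimize ;;
                  Assign ''out_num'' (Sub (Var ''best'') (Var ''all'')) ;;
                  Assign ''out_den'' (Var ''rho_den'')"
                have "wp ?rest (\<lambda>s'. outputs s' (excess_drop V f \<rho> S)) ?s5"
                proof (rule wp_Seq, rule wp_fill[where N = n and f = "\<lambda>v. if v \<in> T2 then 1 else 0" and off = 0], goal_cases)
                  case (7 v s6)
                  then show ?case using Z_pos by (auto simp: f4 f3 s0 T2_def)
                next
                  case (8 s6)
                  note f6 = 8(1)
                  have f6': "s6 y = s4 y" if "y \<notin> {''a'', ''T'', ''all''}" for y using f6[of y] that by simp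
                  have T6: "s6 ''T'' (int v) = (if v \<in> T2 then 1 else 0)" if "v < m" for v
                  proof (cases "v < n")
                    case True then show ?thesis using 8(2)[of v] by simp
                  next
                    case False
                    then have "v \<notin> T1" "v \<notin> T2" by (auto simp: T1_def T2_def)
                    then show ?thesis using 8(3)[of "int v"] False T3[OF that] by (simp add: f4)
                  qed
                  have env6: "B.env s6" unfolding B.env_def using T6 by (simp add: f6' f4 f3 s0)
                  have R6: "s6 ''R'' 0 = int ((m + 1) ^ 8)" using R3 unfolding P_def[symmetric] by (simp add: f6' f4)
                  show ?case
                  proof (rule wp_Seq, rule B.wp_minimize[OF env6 R6 H(1) RZ E'(2)], goal_cases)
                    case (1 s7 X2)
                    note f7 = 1(1)
                    have F2: "2 * \<bar>?F T2 X2\<bar> \<le> U" using B.F_bound[OF 1(2)] .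
                    have all7: "s7 ''all'' 0 = ?F T1 X1" by (simp add: f7 f6)
                    have rd7: "s7 ''rho_den'' 0 = rd" by (simp add: f7 f6 f4 f3 s0)
                    have "\<bar>?F T2 X2 - ?F T1 X1\<bar> \<le> U" using F1 F2 by linarith
                    then have dZ: "\<bar>?F T2 X2 - ?F T1 X1\<bar> \<le> Z" by (rule UZ)
                    have rdZ: "\<bar>rd\<bar> \<le> Z" by (rule UZ) (use rnb U2 in linarith)
                    have T1V: "?i T1 = V" using xs(2) by (auto simp: T1_def n_def in_set_conv_nth)
                    have T2V: "?i T2 = V - S" using xs(2) by (auto simp: T2_def n_def in_set_conv_nth)
                    have m1: "of_int (?F T1 X1) = - of_int rd * max_excess f \<rho> V"
                      using minimum_objective[OF xs(1) _ \<rho>, of T1 X1 f] \<open>X1 \<subseteq> {..<m}\<close> \<open>\<And>Y. Y \<subseteq> {..<m} \<Longrightarrow> ?F T1 X1 \<le> ?F T1 Y\<close>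
                      unfolding T1V orc_def m_def n_def[symmetric] by (simp add: T1_def)
                    have m2: "of_int (?F T2 X2) = - of_int rd * max_excess f \<rho> (V - S)"
                      using minimum_objective[OF xs(1) _ \<rho>, of T2 X2 f] 1(2,4)
                      unfolding T2V orc_def m_def n_def[symmetric] by (auto simp: T2_def)
                    \<comment> \<open>The objective carries the factor \<open>- rd\<close>, so the
                      result for \<open>V - S\<close> comes first in the difference, and the
                      denominator of \<open>\<rho>\<close> is divided out.\<close>
                    have "excess_drop V f \<rho> S = of_int (?F T2 X2 - ?F T1 X1) / of_int rd"
                      using rd by (simp add: m1 m2 excess_drop_def field_simps)
                    then show ?case using dZ rdZ rd
                      by (intro wp_SeqWrite wp_Write) (simp_all add: 1(3) all7 rd7 outputs_def)
                  qed
                qed (use mZ in \<open>simp_all add: H f4 f3 s0 m_def\<close>)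
                then show ?case using F1(1) by (intro wp_SeqWrite) (simp_all add: 1(3))
              qed
            qed (use mZ Z_pos in \<open>simp_all add: H s0 m_def\<close>)
            then show ?case by (simp add: e2)
          qed
        qed
      qed
    qed
  qed
  then have "bounded_st ?s \<longrightarrow> (\<exists>t q s. exec n orc main ?s t q s \<and> outputs s (excess_drop V f \<rho> S) \<and> t \<le> ctime (bits_bound k) H main \<and> q \<le> cqueries H main)"
    unfolding wp_def by blast
  then show ?thesis using bs unfolding H_def n_def orc_def by blast
qed

theorem theorem1p1:
  shows "\<exists>(c :: com) (p :: nat poly) (q :: nat poly).
    \<forall>(V :: 'a set) (f :: 'a set \<Rightarrow> int) (\<rho> :: rat).
      finite V \<longrightarrow> (\<forall>S \<subseteq> V. f S \<ge> 0) \<longrightarrow> normalized f \<longrightarrow> supermodular_on V f \<longrightarrow>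
      (\<exists>h :: 'a set \<Rightarrow> real.
        (\<forall>S \<subseteq> V. h S \<ge> 0) \<and> normalized h \<and> mono_on (Pow V) h \<and> submodular_on V h \<and>
        (\<rho> \<in> \<int> \<longrightarrow> (\<forall>S \<subseteq> V. h S \<in> \<int>)) \<and>
        (\<forall>F \<subseteq> V. density_le (V - F) (\<lambda>S. of_int (f S)) (of_rat \<rho>) \<longleftrightarrow> h F \<ge> h V) \<and>
        (\<forall>v \<in> V. h {v} \<le> max 0 (of_int (marginal f v (V - {v})) - of_rat \<rho>)) \<and>
        answers_evaluation_queries c p q V f \<rho> h)"
proof -
  \<comment> \<open>The program and both polynomials are fixed before any instance is
    introduced.\<close>
  obtain p q :: "nat poly" where
    p: "\<And>n k. n \<le> k \<Longrightarrow> ctime (bits_bound k) (trips_bound n) main \<le> poly p k" and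
    q: "\<And>n. cqueries (trips_bound n) main \<le> poly q n"
    using polynomial_bounds[of main] by blast
  show ?thesis
  proof (intro exI allI impI)
    fix V :: "'a set" and f :: "'a set \<Rightarrow> int" and \<rho> :: rat
    assume V: "finite V" and f0: "normalized f" and sup: "supermodular_on V f"
    have f: "f {} = 0" using f0 by (simp add: normalized_def)
    have ans: "answers_evaluation_queries main p q V f \<rho> (excess_drop V f \<rho>)"
      unfolding answers_evaluation_queries_def
    proof (intro allI impI)
      fix xs S assume xs: "distinct xs" "set xs = V" and S: "S \<subseteq> V"
      let ?k = "input_size V f \<rho>"
      have card: "length xs = card V" using xs distinct_card by metis
      have len: "length xs \<le> ?k" by (simp add: input_size_def card)
      have fb: "bits (f X) \<le> ?k" if "X \<subseteq> V" for X
      proof -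
        have "bits (f X) \<le> Max ((\<lambda>S. bits (f S)) ` Pow V)" by (rule Max_ge) (use V that in auto)
        then show ?thesis by (simp add: input_size_def)
      qed
      have rb: "bits (fst (quotient_of \<rho>)) \<le> ?k" "bits (snd (quotient_of \<rho>)) \<le> ?k"
        by (simp_all add: input_size_def)
      from run_main[where f = f and \<rho> = \<rho> and S = S, OF xs S f sup len fb rb]
      obtain t k s where r: "exec (length xs) (eval_oracle f xs) main (input_state xs \<rho> S) t k s"
        "outputs s (excess_drop V f \<rho> S)" "t \<le> ctime (bits_bound ?k) (trips_bound (length xs)) main"
        "k \<le> cqueries (trips_bound (length xs)) main" by blast
      have "t \<le> poly p ?k" "k \<le> poly q (card V)"
        using r(3,4) p[OF len] q[of "length xs"] card by simp_all
      with r show "\<exists>t k s. exec (length xs) (eval_oracle f xs) main (input_state xs \<rho> S) t k s \<and>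
           outputs s (excess_drop V f \<rho> S) \<and> t \<le> poly p (input_size V f \<rho>) \<and> k \<le> poly q (card V)" by blast
    qed
    show "(\<forall>S \<subseteq> V. excess_drop V f \<rho> S \<ge> 0) \<and> normalized (excess_drop V f \<rho>) \<and> mono_on (Pow V) (excess_drop V f \<rho>) \<and>
        submodular_on V (excess_drop V f \<rho>) \<and>
        (\<rho> \<in> \<int> \<longrightarrow> (\<forall>S \<subseteq> V. excess_drop V f \<rho> S \<in> \<int>)) \<and>
        (\<forall>F \<subseteq> V. density_le (V - F) (\<lambda>S. of_int (f S)) (of_rat \<rho>) \<longleftrightarrow> excess_drop V f \<rho> F \<ge> excess_drop V f \<rho> V) \<and>
        (\<forall>v \<in> V. excess_drop V f \<rho> {v} \<le> max 0 (of_int (marginal f v (V - {v})) - of_rat \<rho>)) \<and>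
        answers_evaluation_queries main p q V f \<rho> (excess_drop V f \<rho>)"
      using V sup f ans
      by (simp add: excess_drop_nonneg normalized_def excess_drop_empty excess_drop_mono excess_drop_submodular
          excess_drop_Ints excess_drop_ge_iff excess_drop_singleton)
  qed
qed

end
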